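(* Assume that $1/2<\alpha<1$. Let $u_0=0$ and $f\in H^{1-\alpha}(0,T;L^2(\Omega))$, and let $u\in W$ be the weak solution of the time fractional diffusion problem with data $(u_0,f)$. Then there is a constant $C_{\alpha,T,\Omega}>0$ depending only on $\alpha,T,\Omega$ such that \[ \|u\|_{H^1(0,T;L^2(\Omega))}+\|u\|_{H^{1-\alpha/2}(0,T;\dot H^1(\Omega))}+\|u\|_{L^2(0,T;\dot H^2(\Omega))}\leqslant C_{\alpha,T,\Omega}\|f\|_{H^{1-\alpha}(0,T;L^2(\Omega))}. \]
   Context: Setting: $T>0$, $0<\alpha<1$, $\Omega\subset\mathbb R^d$ ($d=1,2,3$) is a convex polygonal domain (interval, polygon, polyhedron). The model problem is $\mathrm D_{0+}^\alpha(u-u_0)-\Delta u=f$ in $\Omega\times(0,T)$, $u=0$ on $\partial\Omega\times(0,T)$, $u(0)=u_0$ in $\Omega$. Fractional operators: on an interval $(a,b)$, for $\gamma>0$, $(\mathrm I_{a+}^\gamma v)(t)=\frac1{\Gamma(\gamma)}\int_a^t(t-s)^{\gamma-1}v(s)\,ds$ and $(\mathrm I_{b-}^\gamma v)(t)=\frac1{\Gamma(\gamma)}\int_t^b(s-t)^{\gamma-1}v(s)\,ds$; for $0<\gamma<1$, $\mathrm D_{a+}^\gamma=\mathrm D\,\mathrm I_{a+}^{1-\gamma}$ and $\mathrm D_{b-}^\gamma=-\mathrm D\,\mathrm I_{b-}^{1-\gamma}$, with $\mathrm D$ the distributional first derivative. Spaces: $\{\phi_i\}_{i\in\mathbb N}\subset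 H_0^1(\Omega)\cap H^2(\Omega)$ is an orthonormal basis of $L^2(\Omega)$ with $-\Delta\phi_i=\lambda_i\phi_i$, $\lambda_i>0$ non-decreasing. For $\gamma\geqslant0$, $\dot H^\gamma(\Omega)=\{v\in L^2(\Omega):\|v\|_{\dot H^\gamma(\Omega)}^2:=\sum_i\lambda_i^\gamma(v,\phi_i)_{L^2(\Omega)}^2<\infty\}$; $\dot H^1(\Omega)=H_0^1(\Omega)$. $H^\gamma(0,T;X)$ is the usual vector valued Sobolev space with its usual norm $\|\cdot\|_{H^\gamma(0,T;X)}$. For $0<\gamma<1/2$, $|w|_{H^\gamma(0,T)}^2:=\int_{\mathbb R}|\xi|^{2\gamma}|\mathcal F(w\chi_{(0,T)})(\xi)|^2\,d\xi$ with $\mathcal F$ the Fourier transform and $\chi_{(0,T)}$ the indicator function; for a separable Hilbert space $X$ with orthonormal basis $\{e_i\}$, $|v|_{H^\gamma(0,T;X)}^2:=\sum_i|(v,e_i)_X|_{H^\gamma(0,T)}^2$. Weak solution: $W:=H^{\alpha/2}(0,T;L^2(\Omega))\cap L^2(0,T;\dot H^1(\Omega))$ with norm $|\cdot|_{H^{\alpha/2}(0,T;L^2(\Omega))}+\|\cdot\|_{L^2(0,T;\dot H^1(\Omega))}$. The weak solution is the unique $u\in W$ with \[\langle\mathrm D_{0+}^\alpha u,v\rangle_{H^{\alpha/2}(0,T;L^2(\Omega))}+\int_0^T\!\!\int_\Omega\nabla u\cdot\nabla v=\langle\mathrm D_{0+}^\alpha u_0+f,v\rangle_W\quad\forall v\in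 W.\] Here $\langle\cdot,\cdot\rangle_X$ is the duality pairing between $X^*$ and $X$; $\langle\mathrm D_{0+}^\alpha u,v\rangle_{H^{\alpha/2}(0,T;L^2(\Omega))}=\int_0^T(\mathrm D_{0+}^{\alpha/2}u,\mathrm D_{T-}^{\alpha/2}v)_{L^2(\Omega)}dt$; for $u_0=0$ the right-hand side is $\int_0^T\int_\Omega fv$. *)

theory Defs
  imports "HOL-Analysis.Analysis"
begin

section \<open>The spatial domain\<close>

definition convex_polytopal_domain :: "'a::euclidean_space set \<Rightarrow> bool" where
  "convex_polytopal_domain \<Omega> \<longleftrightarrow> (\<exists>P. polytope P \<and> \<Omega> = interior P) \<and> \<Omega> \<noteq> {}"

abbreviation leb :: "'a::euclidean_space set \<Rightarrow> 'a measure" where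
  "leb U \<equiv> restrict_space lborel U"

section \<open>Test functions, weak derivatives and Sobolev spaces on an open set\<close>

definition partial :: "'a \<Rightarrow> ('a::euclidean_space \<Rightarrow> real) \<Rightarrow> 'a \<Rightarrow> real" where
  "partial b f x = frechet_derivative f (at x) b"

primrec C_k :: "nat \<Rightarrow> ('a::euclidean_space \<Rightarrow> real) \<Rightarrow> bool" where
  "C_k 0 f \<longleftrightarrow> continuous_on UNIV f"
| "C_k (Suc k) f \<longleftrightarrow> (\<forall>x. f differentiable (at x)) \<and> (\<forall>b\<in>Basis. C_k k (partial b f))"

text \<open>$C_c^\infty(U)$, each function being extended by zero to the whole space.\<close>

definition test_functions :: "'a::euclidean_space set \<Rightarrow> ('a \<Rightarrow> real) set" where
  "test_functions U = {\<psi>. (\<forall>k. C_k k \<psi>) \<and>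
     (\<exists>K. compact K \<and> K \<subseteq> U \<and> (\<forall>x. x \<notin> K \<longrightarrow> \<psi> x = 0))}"

text \<open>Elements of $L^2(U)$ are represented by square integrable functions; all notions below
  depend only on the almost everywhere equivalence class.\<close>

definition L2 :: "'a::euclidean_space set \<Rightarrow> ('a \<Rightarrow> real) set" where
  "L2 U = {v. v \<in> borel_measurable (leb U) \<and> integrable (leb U) (\<lambda>x. (v x)\<^sup>2)}"

definition L2_inner :: "'a::euclidean_space set \<Rightarrow> ('a \<Rightarrow> real) \<Rightarrow> ('a \<Rightarrow> real) \<Rightarrow> real" where
  "L2_inner U v w = (\<integral>x. v x * w x \<partial>leb U)"

definition L2_tendsto ::
  "'a::euclidean_space set \<Rightarrow> (nat \<Rightarrow> 'a \<Rightarrow> real) \<Rightarrow> ('a \<Rightarrow> real) \<Rightarrow> bool" where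
  "L2_tendsto U s v \<longleftrightarrow> (\<lambda>n. \<integral>x. (s n x - v x)\<^sup>2 \<partial>leb U) \<longlonglongrightarrow> 0"

definition has_weak_partial ::
  "'a::euclidean_space set \<Rightarrow> 'a \<Rightarrow> ('a \<Rightarrow> real) \<Rightarrow> ('a \<Rightarrow> real) \<Rightarrow> bool" where
  "has_weak_partial U b w g \<longleftrightarrow> g \<in> L2 U \<and>
     (\<forall>\<psi>\<in>test_functions U.
        (\<integral>x. w x * partial b \<psi> x \<partial>leb U) = - (\<integral>x. g x * \<psi> x \<partial>leb U))"

definition weak_partial :: "'a::euclidean_space set \<Rightarrow> 'a \<Rightarrow> ('a \<Rightarrow> real) \<Rightarrow> 'a \<Rightarrow> real" where
  "weak_partial U b w = (SOME g. has_weak_partial U b w g)"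

definition H1 :: "'a::euclidean_space set \<Rightarrow> ('a \<Rightarrow> real) set" where
  "H1 U = {w \<in> L2 U. \<forall>b\<in>Basis. \<exists>g. has_weak_partial U b w g}"

definition H2 :: "'a::euclidean_space set \<Rightarrow> ('a \<Rightarrow> real) set" where
  "H2 U = {w \<in> H1 U. \<forall>b\<in>Basis. weak_partial U b w \<in> H1 U}"

definition H10 :: "'a::euclidean_space set \<Rightarrow> ('a \<Rightarrow> real) set" where
  "H10 U = {w \<in> H1 U. \<exists>s. (\<forall>n. s n \<in> test_functions U) \<and> L2_tendsto U s w \<and>
     (\<forall>b\<in>Basis. L2_tendsto U (\<lambda>n. partial b (s n)) (weak_partial U b w))}"

definition weak_laplacian :: "'a::euclidean_space set \<Rightarrow> ('a \<Rightarrow> real) \<Rightarrow> 'a \<Rightarrow> real" where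
  "weak_laplacian U w x = (\<Sum>b\<in>Basis. weak_partial U b (weak_partial U b w) x)"

text \<open>The Dirichlet form $\int_U \nabla v \cdot \nabla w$.\<close>

definition grad_inner :: "'a::euclidean_space set \<Rightarrow> ('a \<Rightarrow> real) \<Rightarrow> ('a \<Rightarrow> real) \<Rightarrow> real" where
  "grad_inner U v w = (\<integral>x. (\<Sum>b\<in>Basis. weak_partial U b v x * weak_partial U b w x) \<partial>leb U)"

section \<open>Dirichlet eigenbasis and the spaces $\dot H^\gamma$\<close>

definition orthonormal_basis_L2 :: "'a::euclidean_space set \<Rightarrow> (nat \<Rightarrow> 'a \<Rightarrow> real) \<Rightarrow> bool" where
  "orthonormal_basis_L2 U \<phi> \<longleftrightarrow>
     (\<forall>i. \<phi> i \<in> L2 U) \<and>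
     (\<forall>i j. L2_inner U (\<phi> i) (\<phi> j) = (if i = j then 1 else 0)) \<and>
     (\<forall>v\<in>L2 U. L2_tendsto U (\<lambda>n x. \<Sum>i<n. L2_inner U v (\<phi> i) * \<phi> i x) v)"

definition dirichlet_eigenbasis ::
  "'a::euclidean_space set \<Rightarrow> (nat \<Rightarrow> 'a \<Rightarrow> real) \<Rightarrow> (nat \<Rightarrow> real) \<Rightarrow> bool" where
  "dirichlet_eigenbasis \<Omega> \<phi> lam \<longleftrightarrow>
     orthonormal_basis_L2 \<Omega> \<phi> \<and>
     (\<forall>i. \<phi> i \<in> H10 \<Omega> \<inter> H2 \<Omega>) \<and>
     (\<forall>i. AE x in leb \<Omega>. - weak_laplacian \<Omega> (\<phi> i) x = lam i * \<phi> i x) \<and>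
     (\<forall>i. 0 < lam i) \<and> mono lam"

text \<open>A Hilbert space \<open>X\<close> continuously embedded in $L^2(\Omega)$ is described by its squared norm,
  an \<open>ennreal\<close>-valued function on functions on \<open>\<Omega>\<close> that is infinite outside \<open>X\<close>.\<close>

definition L2_sq :: "'a::euclidean_space set \<Rightarrow> ('a \<Rightarrow> real) \<Rightarrow> ennreal" where
  "L2_sq \<Omega> v = (if v \<in> L2 \<Omega> then ennreal (L2_inner \<Omega> v v) else \<infinity>)"

definition hdot_sq ::
  "'a::euclidean_space set \<Rightarrow> (nat \<Rightarrow> 'a \<Rightarrow> real) \<Rightarrow> (nat \<Rightarrow> real) \<Rightarrow> real \<Rightarrow> ('a \<Rightarrow> real) \<Rightarrow> ennreal"
  where
  "hdot_sq \<Omega> \<phi> lam \<gamma> v =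
     (if v \<in> L2 \<Omega> then (\<Sum>i. ennreal (lam i powr \<gamma> * (L2_inner \<Omega> v (\<phi> i))\<^sup>2)) else \<infinity>)"

section \<open>Vector valued Sobolev spaces on $(0,T)$\<close>

text \<open>A function $(0,T) \to X \subseteq L^2(\Omega)$ is represented by a jointly measurable
  function \<open>u\<close> on $(0,T) \times \Omega$, with $u(t) = u(t,\cdot)$.  The parameter \<open>N\<close> is the squared
  norm of \<open>X\<close> in the above sense.\<close>

definition fields :: "real \<Rightarrow> 'a::euclidean_space set \<Rightarrow> (real \<Rightarrow> 'a \<Rightarrow> real) set" where
  "fields T \<Omega> = {u. case_prod u \<in> borel_measurable (leb {0<..<T} \<Otimes>\<^sub>M leb \<Omega>)}"

definition L2t_sq :: "real \<Rightarrow> (('a \<Rightarrow> real) \<Rightarrow> ennreal) \<Rightarrow> (real \<Rightarrow> 'a \<Rightarrow> real) \<Rightarrow> ennreal" where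
  "L2t_sq T N u = (\<integral>\<^sup>+t. N (u t) \<partial>leb {0<..<T})"

definition L2t ::
  "real \<Rightarrow> 'a::euclidean_space set \<Rightarrow> (('a \<Rightarrow> real) \<Rightarrow> ennreal) \<Rightarrow> (real \<Rightarrow> 'a \<Rightarrow> real) set" where
  "L2t T \<Omega> N = {u \<in> fields T \<Omega>. L2t_sq T N u < \<infinity>}"

definition L2t_norm :: "real \<Rightarrow> (('a \<Rightarrow> real) \<Rightarrow> ennreal) \<Rightarrow> (real \<Rightarrow> 'a \<Rightarrow> real) \<Rightarrow> real" where
  "L2t_norm T N u = sqrt (enn2real (L2t_sq T N u))"

text \<open>$H^\gamma(0,T;X)$ for $0 < \gamma < 1$, with the Sobolev--Slobodeckij norm.\<close>

definition Hgt_sq ::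
  "real \<Rightarrow> real \<Rightarrow> (('a \<Rightarrow> real) \<Rightarrow> ennreal) \<Rightarrow> (real \<Rightarrow> 'a \<Rightarrow> real) \<Rightarrow> ennreal" where
  "Hgt_sq \<gamma> T N u = L2t_sq T N u +
     (\<integral>\<^sup>+t. (\<integral>\<^sup>+s. N (\<lambda>x. u t x - u s x) * ennreal (\<bar>t - s\<bar> powr (- 1 - 2 * \<gamma>))
        \<partial>leb {0<..<T}) \<partial>leb {0<..<T})"

definition Hgt ::
  "real \<Rightarrow> real \<Rightarrow> 'a::euclidean_space set \<Rightarrow> (('a \<Rightarrow> real) \<Rightarrow> ennreal) \<Rightarrow>
   (real \<Rightarrow> 'a \<Rightarrow> real) set" where
  "Hgt \<gamma> T \<Omega> N = {u \<in> fields T \<Omega>. Hgt_sq \<gamma> T N u < \<infinity>}"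

definition Hgt_norm ::
  "real \<Rightarrow> real \<Rightarrow> (('a \<Rightarrow> real) \<Rightarrow> ennreal) \<Rightarrow> (real \<Rightarrow> 'a \<Rightarrow> real) \<Rightarrow> real" where
  "Hgt_norm \<gamma> T N u = sqrt (enn2real (Hgt_sq \<gamma> T N u))"

text \<open>Distributional time derivative in $L^2(0,T;L^2(\Omega))$.  The defining identity
  $\int_0^T w\psi' = -\int_0^T g\psi$ is one between elements of $L^2(\Omega)$, hence holds for almost
  every \<open>x\<close>.\<close>

definition has_time_deriv ::
  "real \<Rightarrow> 'a::euclidean_space set \<Rightarrow> (real \<Rightarrow> 'a \<Rightarrow> real) \<Rightarrow> (real \<Rightarrow> 'a \<Rightarrow> real) \<Rightarrow> bool" where
  "has_time_deriv T \<Omega> w g \<longleftrightarrow> g \<in> L2t T \<Omega> (L2_sq \<Omega>) \<and>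
     (\<forall>\<psi>\<in>test_functions {0<..<T}. AE x in leb \<Omega>.
        (\<integral>t. w t x * deriv \<psi> t \<partial>leb {0<..<T}) = - (\<integral>t. g t x * \<psi> t \<partial>leb {0<..<T}))"

definition time_deriv ::
  "real \<Rightarrow> 'a::euclidean_space set \<Rightarrow> (real \<Rightarrow> 'a \<Rightarrow> real) \<Rightarrow> real \<Rightarrow> 'a \<Rightarrow> real" where
  "time_deriv T \<Omega> w = (SOME g. has_time_deriv T \<Omega> w g)"

definition H1t ::
  "real \<Rightarrow> 'a::euclidean_space set \<Rightarrow> (('a \<Rightarrow> real) \<Rightarrow> ennreal) \<Rightarrow> (real \<Rightarrow> 'a \<Rightarrow> real) set" where
  "H1t T \<Omega> N = {u \<in> L2t T \<Omega> N. (\<exists>g. has_time_deriv T \<Omega> u g) \<and> time_deriv T \<Omega> u \<in> L2t T \<Omega> N}"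

definition H1t_norm ::
  "real \<Rightarrow> 'a::euclidean_space set \<Rightarrow> (('a \<Rightarrow> real) \<Rightarrow> ennreal) \<Rightarrow> (real \<Rightarrow> 'a \<Rightarrow> real) \<Rightarrow> real" where
  "H1t_norm T \<Omega> N u = sqrt (enn2real (L2t_sq T N u + L2t_sq T N (time_deriv T \<Omega> u)))"

section \<open>Fractional calculus operators\<close>

definition frac_int_left :: "real \<Rightarrow> real \<Rightarrow> (real \<Rightarrow> real) \<Rightarrow> real \<Rightarrow> real" where
  "frac_int_left a \<gamma> v t =
     1 / Gamma \<gamma> * (LINT s:{a<..<t}|lborel. (t - s) powr (\<gamma> - 1) * v s)"

definition frac_int_right :: "real \<Rightarrow> real \<Rightarrow> (real \<Rightarrow> real) \<Rightarrow> real \<Rightarrow> real" where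
  "frac_int_right b \<gamma> v t =
     1 / Gamma \<gamma> * (LINT s:{t<..<b}|lborel. (s - t) powr (\<gamma> - 1) * v s)"

text \<open>$\mathrm D_{0+}^\gamma$ and $\mathrm D_{T-}^\gamma$ on $(0,T)$ for $L^2(\Omega)$-valued functions
  whose derivative lies in $L^2(0,T;L^2(\Omega))$; the fractional integral is taken for each fixed \<open>x\<close>.\<close>

definition frac_deriv_left ::
  "real \<Rightarrow> 'a::euclidean_space set \<Rightarrow> real \<Rightarrow> (real \<Rightarrow> 'a \<Rightarrow> real) \<Rightarrow> real \<Rightarrow> 'a \<Rightarrow> real" where
  "frac_deriv_left T \<Omega> \<gamma> u =
     time_deriv T \<Omega> (\<lambda>t x. frac_int_left 0 (1 - \<gamma>) (\<lambda>s. u s x) t)"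

definition frac_deriv_right ::
  "real \<Rightarrow> 'a::euclidean_space set \<Rightarrow> real \<Rightarrow> (real \<Rightarrow> 'a \<Rightarrow> real) \<Rightarrow> real \<Rightarrow> 'a \<Rightarrow> real" where
  "frac_deriv_right T \<Omega> \<gamma> u = (\<lambda>t x.
     - time_deriv T \<Omega> (\<lambda>t x. frac_int_right T (1 - \<gamma>) (\<lambda>s. u s x) t) t x)"

section \<open>Weak solutions\<close>

definition W_space ::
  "real \<Rightarrow> real \<Rightarrow> 'a::euclidean_space set \<Rightarrow> (nat \<Rightarrow> 'a \<Rightarrow> real) \<Rightarrow> (nat \<Rightarrow> real) \<Rightarrow>
   (real \<Rightarrow> 'a \<Rightarrow> real) set" where
  "W_space \<alpha> T \<Omega> \<phi> lam =
     Hgt (\<alpha>/2) T \<Omega> (L2_sq \<Omega>) \<inter> L2t T \<Omega> (hdot_sq \<Omega> \<phi> lam 1)"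

text \<open>Weak solution for initial value $u_0 = 0$ and $f \in L^2(0,T;L^2(\Omega))$, for which the
  right-hand side functional is $v \mapsto \int_0^T \int_\Omega f v$.\<close>

definition weak_solution ::
  "real \<Rightarrow> real \<Rightarrow> 'a::euclidean_space set \<Rightarrow> (nat \<Rightarrow> 'a \<Rightarrow> real) \<Rightarrow> (nat \<Rightarrow> real) \<Rightarrow>
   (real \<Rightarrow> 'a \<Rightarrow> real) \<Rightarrow> (real \<Rightarrow> 'a \<Rightarrow> real) \<Rightarrow> bool" where
  "weak_solution \<alpha> T \<Omega> \<phi> lam f u \<longleftrightarrow> u \<in> W_space \<alpha> T \<Omega> \<phi> lam \<and>
     (\<forall>v\<in>W_space \<alpha> T \<Omega> \<phi> lam.
        (\<integral>t. L2_inner \<Omega> (frac_deriv_left T \<Omega> (\<alpha>/2) u t) (frac_deriv_right T \<Omega> (\<alpha>/2) v t)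
           \<partial>leb {0<..<T}) +
        (\<integral>t. grad_inner \<Omega> (u t) (v t) \<partial>leb {0<..<T})
        = (\<integral>t. L2_inner \<Omega> (f t) (v t) \<partial>leb {0<..<T}))"

end

theory Submission
  imports Defs
begin

text \<open>Testing the weak formulation with \<open>(c - t)\<^sub>+\<^sup>1\<^sup>+\<^sup>\<alpha>\<^sup>/\<^sup>2 \<phi>\<^sub>i(x)\<close>, whose right-sided derivative of order
  \<open>\<alpha>/2\<close> is explicit, shows that each coefficient \<open>y\<close> of the solution satisfies the Volterra equation
  \<open>y + \<lambda> I\<^sup>\<alpha> y = I\<^sup>\<alpha> f\<^sub>i\<close>. Since \<open>1 - \<alpha> < 1/2\<close>, \<open>f\<^sub>i\<close> has a square integrable derivative \<open>k\<close> of order \<open>1 - \<alpha>\<close>,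
  bounded by its Slobodeckij norm, by the fractional Hardy inequality; hence \<open>I\<^sup>\<alpha> f\<^sub>i = I\<^sup>1 k\<close>, and
  \<open>z = y'\<close> solves \<open>z + \<lambda> I\<^sup>\<alpha> z = k\<close>. Positivity of \<open>\<integral>z I\<^sup>\<alpha> z\<close> yields \<open>\<parallel>z\<parallel> \<le> \<parallel>k\<parallel>\<close>,
  \<open>\<lambda> \<integral>z I\<^sup>\<alpha> z \<le> \<parallel>k\<parallel>\<^sup>2\<close> and \<open>\<lambda>\<parallel>y\<parallel> \<le> c\<parallel>k\<parallel>\<close> uniformly in \<open>\<lambda>\<close>, where \<open>\<integral>z I\<^sup>\<alpha> z\<close> controls the seminorm of
  order \<open>1 - \<alpha>/2\<close> of \<open>y\<close>. The estimates are summed by Parseval's identity.\<close>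

section \<open>Square integrable functions\<close>

text \<open>All fractional derivatives that must be produced, of order \<alpha>/2 for the solution
  and of order 1 - \<alpha> for the data, have order below 1/2. Below this threshold the extension
  by zero across t = 0 and t = T stays in the space without a boundary condition, which is the
  content of the Hardy inequality; \<alpha> > 1/2 is what puts the data below it. The derivative of
  the solution has to be produced because \<open>time_deriv\<close> is a choice among witnesses: the
  weak formulation carries information only once a witness exists.

  The arguments stay on the time side. |a - b|^(\<alpha> - 1) is a superposition of products of
  indicators of windows containing a and b, so the quadratic form of I^\<alpha> is an integral of
  squares of window integrals, that is, of increments of the primitive. Positivity and the seminorm
  of order 1 - \<alpha>/2 come from this one identity.

  The constant must not depend on the eigenbasis. The scalar bounds therefore hold for all \<lambda>
  > 0 with constants in \<alpha> and T alone, and they are summed over the modes unchanged.\<close>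

definition sqi :: "'a measure \<Rightarrow> ('a \<Rightarrow> real) set" where
  "sqi M = {f \<in> borel_measurable M. integrable M (\<lambda>x. (f x)\<^sup>2)}"

lemma sqi_measurable: "f \<in> sqi M \<Longrightarrow> f \<in> borel_measurable M"
  by (simp add: sqi_def)

lemma sqi_integrable: "f \<in> sqi M \<Longrightarrow> integrable M (\<lambda>x. (f x)\<^sup>2)"
  by (simp add: sqi_def)

lemma L2_eq_sqi: "L2 U = sqi (leb U)"
  by (simp add: L2_def sqi_def)

lemma sqi_mult:
  assumes "f \<in> sqi M" "g \<in> sqi M"
  shows "integrable M (\<lambda>x. f x * g x)"
proof (rule Bochner_Integration.integrable_bound)
  show "integrable M (\<lambda>x. (f x)\<^sup>2 + (g x)\<^sup>2)"
    using assms by (simp add: sqi_def)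
  show "(\<lambda>x. f x * g x) \<in> borel_measurable M"
    using assms by (auto simp: sqi_def)
  have "norm (a * b) \<le> norm (a\<^sup>2 + b\<^sup>2)" for a b :: real
  proof -
    have "2 * \<bar>a * b\<bar> \<le> a\<^sup>2 + b\<^sup>2"
      using sum_squares_bound[of "\<bar>a\<bar>" "\<bar>b\<bar>"] by (simp add: abs_mult)
    then show ?thesis using abs_ge_zero[of "a * b"] by (simp only: real_norm_def)
  qed
  then show "AE x in M. norm (f x * g x) \<le> norm ((f x)\<^sup>2 + (g x)\<^sup>2)" by simp
qed

lemma sqi_cmult [intro]: "f \<in> sqi M \<Longrightarrow> (\<lambda>x. c * f x) \<in> sqi M"
  by (auto simp: sqi_def power_mult_distrib)

lemma sqi_uminus [intro]: "f \<in> sqi M \<Longrightarrow> (\<lambda>x. - f x) \<in> sqi M"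
  by (auto simp: sqi_def)

lemma sqi_zero [intro, simp]: "(\<lambda>x. 0) \<in> sqi M"
  by (auto simp: sqi_def)

lemma sqi_add [intro]:
  assumes "f \<in> sqi M" "g \<in> sqi M"
  shows "(\<lambda>x. f x + g x) \<in> sqi M"
proof -
  have "integrable M (\<lambda>x. (f x)\<^sup>2 + (g x)\<^sup>2 + 2 * (f x * g x))"
    using sqi_mult[OF assms] assms by (auto simp: sqi_def)
  then show ?thesis using assms by (auto simp: sqi_def power2_sum algebra_simps)
qed

lemma sqi_diff [intro]:
  assumes "f \<in> sqi M" "g \<in> sqi M"
  shows "(\<lambda>x. f x - g x) \<in> sqi M"
  using sqi_add[OF assms(1) sqi_uminus[OF assms(2)]] by simp

lemma sqi_sum [intro]:
  assumes "\<And>i. i \<in> I \<Longrightarrow> f i \<in> sqi M"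
  shows "(\<lambda>x. \<Sum>i\<in>I. f i x) \<in> sqi M"
  using assms by (induction I rule: infinite_finite_induct) auto

lemma sqi_iff_nn:
  "f \<in> sqi M \<longleftrightarrow> f \<in> borel_measurable M \<and> (\<integral>\<^sup>+x. ennreal ((f x)\<^sup>2) \<partial>M) < \<infinity>"
  unfolding sqi_def by (auto simp: integrable_iff_bounded)

lemma sqi_nn_integral:
  "f \<in> sqi M \<Longrightarrow> (\<integral>\<^sup>+x. ennreal ((f x)\<^sup>2) \<partial>M) = ennreal (\<integral>x. (f x)\<^sup>2 \<partial>M)"
  by (intro nn_integral_eq_integral) (auto simp: sqi_def)

lemma sqi_CS_sq:
  assumes "f \<in> sqi M" "g \<in> sqi M"
  shows "(\<integral>x. f x * g x \<partial>M)\<^sup>2 \<le> (\<integral>x. (f x)\<^sup>2 \<partial>M) * (\<integral>x. (g x)\<^sup>2 \<partial>M)"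
proof -
  have [measurable]: "f \<in> borel_measurable M" "g \<in> borel_measurable M"
    using assms by (auto simp: sqi_def)
  have i: "integrable M (\<lambda>x. \<bar>f x * g x\<bar>)" using sqi_mult[OF assms] by simp
  have "ennreal ((\<integral>x. \<bar>f x * g x\<bar> \<partial>M)\<^sup>2) = (\<integral>\<^sup>+x. ennreal \<bar>f x\<bar> * ennreal \<bar>g x\<bar> \<partial>M)\<^sup>2"
    using nn_integral_eq_integral[OF i] by (simp add: abs_mult ennreal_mult ennreal_power)
  also have "\<dots> \<le> (\<integral>\<^sup>+x. ennreal \<bar>f x\<bar> ^ 2 \<partial>M) * (\<integral>\<^sup>+x. ennreal \<bar>g x\<bar> ^ 2 \<partial>M)"
    by (rule Cauchy_Schwarz_nn_integral) auto
  also have "\<dots> = (\<integral>\<^sup>+x. ennreal ((f x)\<^sup>2) \<partial>M) * (\<integral>\<^sup>+x. ennreal ((g x)\<^sup>2) \<partial>M)"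
    by (simp add: ennreal_power)
  also have "\<dots> = ennreal ((\<integral>x. (f x)\<^sup>2 \<partial>M) * (\<integral>x. (g x)\<^sup>2 \<partial>M))"
    by (simp add: sqi_nn_integral assms ennreal_mult)
  finally have "(\<integral>x. \<bar>f x * g x\<bar> \<partial>M)\<^sup>2 \<le> (\<integral>x. (f x)\<^sup>2 \<partial>M) * (\<integral>x. (g x)\<^sup>2 \<partial>M)"
    by (subst (asm) ennreal_le_iff) auto
  moreover have "(\<integral>x. f x * g x \<partial>M)\<^sup>2 \<le> (\<integral>x. \<bar>f x * g x\<bar> \<partial>M)\<^sup>2"
    by (metis integral_abs_bound power2_abs abs_ge_zero power_mono)
  ultimately show ?thesis by linarith
qed

lemma sqi_CS:
  assumes "f \<in> sqi M" "g \<in> sqi M"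
  shows "\<bar>\<integral>x. f x * g x \<partial>M\<bar> \<le> sqrt (\<integral>x. (f x)\<^sup>2 \<partial>M) * sqrt (\<integral>x. (g x)\<^sup>2 \<partial>M)"
  using real_sqrt_le_mono[OF sqi_CS_sq[OF assms]] by (simp add: real_sqrt_mult)

lemma sqi_Minkowski:
  assumes "f \<in> sqi M" "g \<in> sqi M"
  shows "sqrt (\<integral>x. (f x + g x)\<^sup>2 \<partial>M) \<le> sqrt (\<integral>x. (f x)\<^sup>2 \<partial>M) + sqrt (\<integral>x. (g x)\<^sup>2 \<partial>M)"
proof (rule real_le_lsqrt)
  have "(\<integral>x. (f x + g x)\<^sup>2 \<partial>M) = (\<integral>x. (f x)\<^sup>2 + (g x)\<^sup>2 + 2 * (f x * g x) \<partial>M)"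
    by (simp add: power2_sum algebra_simps)
  also have "\<dots> = (\<integral>x. (f x)\<^sup>2 \<partial>M) + (\<integral>x. (g x)\<^sup>2 \<partial>M) + 2 * (\<integral>x. f x * g x \<partial>M)"
    using sqi_mult[OF assms] assms by (simp add: sqi_def)
  finally show "(\<integral>x. (f x + g x)\<^sup>2 \<partial>M) \<le> (sqrt (\<integral>x. (f x)\<^sup>2 \<partial>M) + sqrt (\<integral>x. (g x)\<^sup>2 \<partial>M))\<^sup>2"
    using sqi_CS[OF assms] by (simp add: power2_sum)
qed auto

lemma sqi_eq_AE:
  assumes "f \<in> sqi M" "g \<in> sqi M" "(\<integral>x. (f x - g x)\<^sup>2 \<partial>M) \<le> 0"
  shows "AE x in M. f x = g x"
proof -
  have "(\<integral>x. (f x - g x)\<^sup>2 \<partial>M) = 0"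
    using assms(3) by (simp add: antisym)
  then have "AE x in M. (f x - g x)\<^sup>2 = 0"
    using sqi_integrable[OF sqi_diff[OF assms(1,2)]]
    by (subst (asm) integral_nonneg_eq_0_iff_AE) auto
  then show ?thesis by simp
qed

lemma sqi_tendsto_inner:
  assumes "\<And>n. f n \<in> sqi M" "g \<in> sqi M" "h \<in> sqi M"
    and "(\<lambda>n. \<integral>x. (f n x - g x)\<^sup>2 \<partial>M) \<longlonglongrightarrow> 0"
  shows "(\<lambda>n. \<integral>x. f n x * h x \<partial>M) \<longlonglongrightarrow> (\<integral>x. g x * h x \<partial>M)"
proof (rule LIM_zero_cancel, rule Lim_null_comparison)
  show "\<forall>\<^sub>F n in sequentially. norm ((\<integral>x. f n x * h x \<partial>M) - (\<integral>x. g x * h x \<partial>M))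
     \<le> sqrt (\<integral>x. (f n x - g x)\<^sup>2 \<partial>M) * sqrt (\<integral>x. (h x)\<^sup>2 \<partial>M)"
  proof (intro always_eventually allI)
    fix n
    have "(\<integral>x. f n x * h x \<partial>M) - (\<integral>x. g x * h x \<partial>M) = (\<integral>x. (f n x - g x) * h x \<partial>M)"
      using sqi_mult[OF assms(1) assms(3)] sqi_mult[OF assms(2,3)] by (simp add: left_diff_distrib)
    then show "norm ((\<integral>x. f n x * h x \<partial>M) - (\<integral>x. g x * h x \<partial>M))
     \<le> sqrt (\<integral>x. (f n x - g x)\<^sup>2 \<partial>M) * sqrt (\<integral>x. (h x)\<^sup>2 \<partial>M)"
      using sqi_CS[OF sqi_diff[OF assms(1,2)] assms(3)] by simp
  qed
  show "(\<lambda>n. sqrt (\<integral>x. (f n x - g x)\<^sup>2 \<partial>M) * sqrt (\<integral>x. (h x)\<^sup>2 \<partial>M)) \<longlonglongrightarrow> 0"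
    using tendsto_mult_right[OF tendsto_real_sqrt[OF assms(4)], of "sqrt (\<integral>x. (h x)\<^sup>2 \<partial>M)"] by simp
qed

lemma sqi_tendsto_norm:
  assumes "\<And>n. f n \<in> sqi M" "g \<in> sqi M"
    and "(\<lambda>n. \<integral>x. (f n x - g x)\<^sup>2 \<partial>M) \<longlonglongrightarrow> 0"
  shows "(\<lambda>n. \<integral>x. (f n x)\<^sup>2 \<partial>M) \<longlonglongrightarrow> (\<integral>x. (g x)\<^sup>2 \<partial>M)"
proof -
  have "(\<lambda>n. (\<integral>x. (f n x - g x)\<^sup>2 \<partial>M) + 2 * (\<integral>x. f n x * g x \<partial>M) - (\<integral>x. (g x)\<^sup>2 \<partial>M))
     \<longlonglongrightarrow> 0 + 2 * (\<integral>x. g x * g x \<partial>M) - (\<integral>x. (g x)\<^sup>2 \<partial>M)"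
    by (intro tendsto_intros assms sqi_tendsto_inner)
  moreover have "(\<integral>x. (f n x - g x)\<^sup>2 \<partial>M) + 2 * (\<integral>x. f n x * g x \<partial>M) - (\<integral>x. (g x)\<^sup>2 \<partial>M)
     = (\<integral>x. (f n x)\<^sup>2 \<partial>M)" for n
  proof -
    have "(\<integral>x. (f n x - g x)\<^sup>2 \<partial>M) = (\<integral>x. (f n x)\<^sup>2 + (g x)\<^sup>2 - 2 * (f n x * g x) \<partial>M)"
      by (simp add: power2_diff algebra_simps)
    also have "\<dots> = (\<integral>x. (f n x)\<^sup>2 \<partial>M) + (\<integral>x. (g x)\<^sup>2 \<partial>M) - 2 * (\<integral>x. f n x * g x \<partial>M)"
      using sqi_mult[OF assms(1)[of n] assms(2)] assms(1)[of n] assms(2) by (simp add: sqi_def)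
    finally show ?thesis by simp
  qed
  ultimately show ?thesis by (simp add: power2_eq_square)
qed

text \<open>A subsequence whose increments satisfy \<open>\<integral>a\<^sub>k\<^sup>2 \<le> 8\<^sup>-\<^sup>k\<close> converges almost everywhere, because
  \<open>a\<^sub>k \<le> 2\<^sup>-\<^sup>k + 2\<^sup>k a\<^sub>k\<^sup>2\<close>.\<close>
lemma sqi_complete:
  fixes f :: "nat \<Rightarrow> 'a \<Rightarrow> real"
  assumes f: "\<And>n. f n \<in> sqi M"
    and C: "\<And>e. e > 0 \<Longrightarrow> \<exists>N. \<forall>m\<ge>N. \<forall>n\<ge>N. (\<integral>x. (f m x - f n x)\<^sup>2 \<partial>M) < e"
  obtains g where "g \<in> sqi M" "(\<lambda>n. \<integral>x. (f n x - g x)\<^sup>2 \<partial>M) \<longlonglongrightarrow> 0"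
proof -
  have [measurable]: "f n \<in> borel_measurable M" for n using f by (simp add: sqi_def)
  have "\<exists>r. \<forall>n. (\<forall>i\<ge>r n. \<forall>j\<ge>r n. (\<integral>x. (f i x - f j x)\<^sup>2 \<partial>M) < (1/8) ^ n) \<and> (r (Suc n) > r n)"
  proof (intro dependent_nat_choice, goal_cases)
    case 1
    show ?case using C[of "(1/8)^0"] by auto
  next
    case (2 x n)
    obtain N where N: "\<forall>m\<ge>N. \<forall>k\<ge>N. (\<integral>x. (f m x - f k x)\<^sup>2 \<partial>M) < (1/8) ^ Suc n"
      using C[of "(1/8)^Suc n"] by auto
    show ?case by (rule exI[of _ "max N (Suc x)"]) (use N in auto)
  qed
  then obtain r where r: "\<And>n i j. i \<ge> r n \<Longrightarrow> j \<ge> r n \<Longrightarrow> (\<integral>x. (f i x - f j x)\<^sup>2 \<partial>M) < (1/8) ^ n"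
    and mono: "\<And>n. r (Suc n) > r n" by blast
  have sm: "strict_mono r" using mono by (simp add: strict_mono_Suc_iff)
  define a where "a k x = f (r (Suc k)) x - f (r k) x" for k x
  have [measurable]: "a k \<in> borel_measurable M" for k unfolding a_def by measurable
  have "(\<integral>\<^sup>+x. (\<Sum>k. ennreal (2^k * (a k x)\<^sup>2)) \<partial>M) = (\<Sum>k. \<integral>\<^sup>+x. ennreal (2^k * (a k x)\<^sup>2) \<partial>M)"
    by (rule nn_integral_suminf) measurable
  also have "\<dots> \<le> (\<Sum>k. ennreal ((1/4)^k))"
  proof (rule suminf_le)
    fix k
    have ak: "a k \<in> sqi M" unfolding a_def by (intro sqi_diff f)
    have "(\<integral>\<^sup>+x. ennreal (2^k * (a k x)\<^sup>2) \<partial>M) = ennreal (2^k) * ennreal (\<integral>x. (a k x)\<^sup>2 \<partial>M)"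
      by (simp add: ennreal_mult nn_integral_cmult sqi_nn_integral[OF ak])
    also have "\<dots> \<le> ennreal (2^k) * ennreal ((1/8)^k)"
      unfolding a_def using r[of k "r (Suc k)" "r k"] mono[of k]
      by (intro mult_left_mono ennreal_leI) auto
    also have "\<dots> = ennreal ((1/4)^k)"
      by (simp add: ennreal_mult'[symmetric] power_mult_distrib[symmetric])
    finally show "(\<integral>\<^sup>+x. ennreal (2^k * (a k x)\<^sup>2) \<partial>M) \<le> ennreal ((1/4)^k)" .
  qed auto
  also have "\<dots> < \<infinity>"
    by (subst suminf_ennreal2) (auto intro!: summable_geometric)
  finally have "(\<integral>\<^sup>+x. (\<Sum>k. ennreal (2^k * (a k x)\<^sup>2)) \<partial>M) \<noteq> \<infinity>" by simp
  then have "AE x in M. (\<Sum>k. ennreal (2^k * (a k x)\<^sup>2)) \<noteq> \<infinity>"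
    by (intro nn_integral_PInf_AE) auto
  then have conv: "AE x in M. convergent (\<lambda>k. f (r k) x)"
  proof eventually_elim
    case (elim x)
    have s1: "summable (\<lambda>k. 2^k * (a k x)\<^sup>2)"
      using elim by (intro summable_suminf_not_top) auto
    have "summable (\<lambda>k. a k x)"
    proof (rule summable_comparison_test')
      show "summable (\<lambda>k. (1/2)^k + 2^k * (a k x)\<^sup>2)"
        by (intro summable_add s1) (auto intro!: summable_geometric)
      fix k
      have e: "(2::real)^k * (1/2)^k = 1" by (simp add: power_mult_distrib[symmetric])
      have "2 * (\<bar>a k x\<bar> * 2^k) \<le> 1 + (\<bar>a k x\<bar> * 2^k)\<^sup>2"
        using sum_squares_bound[of 1 "\<bar>a k x\<bar> * 2^k"] by simp
      then have "(1/2)^k * (2 * (\<bar>a k x\<bar> * 2^k)) \<le> (1/2)^k * (1 + (\<bar>a k x\<bar> * 2^k)\<^sup>2)"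
        by (intro mult_left_mono) auto
      also have "\<dots> = (1/2)^k + ((1/2)^k * 2^k) * (2^k * \<bar>a k x\<bar>\<^sup>2)" by (simp add: algebra_simps power2_eq_square)
      also have "(1/2)^k * (2 * (\<bar>a k x\<bar> * 2^k)) = 2 * \<bar>a k x\<bar> * ((1/2)^k * 2^k)" by simp
      finally show "norm (a k x) \<le> (1/2)^k + 2^k * (a k x)\<^sup>2" using e by (simp add: mult.commute)
    qed
    then have "convergent (\<lambda>n. (\<Sum>k<n. a k x))" by (simp add: summable_iff_convergent)
    moreover have "(\<Sum>k<n. a k x) = f (r n) x - f (r 0) x" for n
      unfolding a_def by (rule sum_lessThan_telescope)
    ultimately have "convergent (\<lambda>n. (f (r n) x - f (r 0) x) + f (r 0) x)"
      by (intro convergent_add convergent_const) simp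
    then show ?case by simp
  qed
  define g where "g x = lim (\<lambda>k. f (r k) x)" for x
  have [measurable]: "g \<in> borel_measurable M" unfolding g_def by measurable
  have lim: "AE x in M. (\<lambda>k. f (r k) x) \<longlonglongrightarrow> g x"
    using conv unfolding g_def by eventually_elim (simp add: convergent_LIMSEQ_iff)
  \<comment> \<open>Fatou's lemma along the subsequence bounds the distance from g to every late
    \<open>f n\<close>, not only to the members of the subsequence. The case m = 0 makes g square
    integrable, the other cases give the convergence.\<close>
  have est: "(\<integral>\<^sup>+x. ennreal ((f n x - g x)\<^sup>2) \<partial>M) \<le> ennreal ((1/8)^m)" if "n \<ge> r m" for n m
  proof -
    have "(\<integral>\<^sup>+x. ennreal ((f n x - g x)\<^sup>2) \<partial>M) = (\<integral>\<^sup>+x. liminf (\<lambda>k. ennreal ((f n x - f (r k) x)\<^sup>2)) \<partial>M)"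
      using lim
    proof (intro nn_integral_cong_AE, eventually_elim)
      case (elim x)
      have "(\<lambda>k. ennreal ((f n x - f (r k) x)\<^sup>2)) \<longlonglongrightarrow> ennreal ((f n x - g x)\<^sup>2)"
        by (intro tendsto_ennrealI tendsto_intros elim)
      then show ?case by (intro lim_imp_Liminf[symmetric]) auto
    qed
    also have "\<dots> \<le> liminf (\<lambda>k. \<integral>\<^sup>+x. ennreal ((f n x - f (r k) x)\<^sup>2) \<partial>M)"
      by (rule nn_integral_liminf) measurable
    also have "\<dots> \<le> ennreal ((1/8)^m)"
    proof (rule Liminf_le)
      show "\<forall>\<^sub>F k in sequentially. (\<integral>\<^sup>+x. ennreal ((f n x - f (r k) x)\<^sup>2) \<partial>M) \<le> ennreal ((1/8)^m)"
        using eventually_ge_at_top[of m]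
      proof eventually_elim
        case (elim k)
        have "(\<integral>\<^sup>+x. ennreal ((f n x - f (r k) x)\<^sup>2) \<partial>M) = ennreal (\<integral>x. (f n x - f (r k) x)\<^sup>2 \<partial>M)"
          by (intro sqi_nn_integral sqi_diff f)
        also have "\<dots> \<le> ennreal ((1/8)^m)"
          using r[of m n "r k"] that strict_mono_mono[OF sm] elim by (intro ennreal_leI less_imp_le) (auto simp: mono_def)
        finally show ?case .
      qed
    qed simp
    finally show ?thesis .
  qed
  have d: "(\<lambda>x. f n x - g x) \<in> sqi M" if "n \<ge> r 0" for n
    using est[of 0 n] that by (auto simp: sqi_iff_nn intro: le_less_trans)
  have gM: "g \<in> sqi M"
    using sqi_diff[OF f[of "r 0"] d[of "r 0"]] by simp
  have "(\<lambda>n. \<integral>x. (f n x - g x)\<^sup>2 \<partial>M) \<longlonglongrightarrow> 0"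
  proof (rule LIMSEQ_I)
    fix e :: real assume "e > 0"
    then obtain m where m: "(1/8::real)^m < e" using real_arch_pow_inv[of e "1/8"] by auto
    have "(\<integral>x. (f n x - g x)\<^sup>2 \<partial>M) < e" if "n \<ge> r m" for n
    proof -
      have "ennreal (\<integral>x. (f n x - g x)\<^sup>2 \<partial>M) \<le> ennreal ((1/8)^m)"
        using est[OF that] by (simp add: sqi_nn_integral[OF sqi_diff[OF f gM]])
      then show ?thesis using m by simp
    qed
    then show "\<exists>no. \<forall>n\<ge>no. norm ((\<integral>x. (f n x - g x)\<^sup>2 \<partial>M) - 0) < e"
      by (intro exI[of _ "r m"]) simp
  qed
  with gM show ?thesis using that by blast
qed

section \<open>Test functions\<close>

lemma C_k_const [simp]: "C_k k (\<lambda>x. c)"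
proof (induction k arbitrary: c)
  case (Suc k)
  have "partial b (\<lambda>x. c) = (\<lambda>x. 0)" for b :: 'a by (simp add: partial_def fun_eq_iff frechet_derivative_const)
  then show ?case using Suc by simp
qed simp

lemma C_k_Suc_imp: "C_k (Suc k) f \<Longrightarrow> C_k k f"
proof (induction k arbitrary: f)
  case 0
  then show ?case by (auto intro!: differentiable_imp_continuous_on simp: differentiable_on_def
        intro: differentiable_at_withinI)
qed auto

lemma C_k_add:
  "C_k k f \<Longrightarrow> C_k k g \<Longrightarrow> C_k k (\<lambda>x. f x + g x)"
proof (induction k arbitrary: f g)
  case 0
  then show ?case by (auto intro: continuous_intros)
next
  case (Suc k)
  have "partial b (\<lambda>x. f x + g x) = (\<lambda>x. partial b f x + partial b g x)" for b
  proof
    fix x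
    have "((\<lambda>x. f x + g x) has_derivative (\<lambda>h. frechet_derivative f (at x) h + frechet_derivative g (at x) h)) (at x)"
      using Suc.prems by (intro has_derivative_add) (auto simp: frechet_derivative_works)
    from frechet_derivative_at[OF this]
    show "partial b (\<lambda>x. f x + g x) x = partial b f x + partial b g x"
      unfolding partial_def by metis
  qed
  then show ?case using Suc by auto
qed

lemma C_k_mult:
  "C_k k f \<Longrightarrow> C_k k g \<Longrightarrow> C_k k (\<lambda>x. f x * g x)"
proof (induction k arbitrary: f g)
  case 0
  then show ?case by (auto intro: continuous_intros)
next
  case (Suc k)
  have eq: "partial b (\<lambda>x. f x * g x) = (\<lambda>x. f x * partial b g x + partial b f x * g x)" for b
  proof
    fix x
    have "((\<lambda>x. f x * g x) has_derivative
        (\<lambda>h. f x * frechet_derivative g (at x) h + frechet_derivative f (at x) h * g x)) (at x)"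
      using Suc.prems by (intro has_derivative_mult) (auto simp: frechet_derivative_works)
    from frechet_derivative_at[OF this]
    show "partial b (\<lambda>x. f x * g x) x = f x * partial b g x + partial b f x * g x"
      unfolding partial_def by metis
  qed
  have "C_k k (\<lambda>x. f x * partial b g x + partial b f x * g x)" if "b \<in> Basis" for b
    using Suc.prems C_k_Suc_imp[OF Suc.prems(1)] C_k_Suc_imp[OF Suc.prems(2)] that
    by (intro C_k_add Suc.IH) auto
  then show ?case using Suc.prems by (auto simp: eq)
qed

lemma C_k_prod: "(\<And>i. i \<in> I \<Longrightarrow> C_k k (f i)) \<Longrightarrow> C_k k (\<lambda>x. \<Prod>i\<in>I. f i x)"
  by (induction I rule: infinite_finite_induct) (auto intro: C_k_mult)

text \<open>The functions \<open>x \<mapsto> p(1/x) exp(-\<kappa>/x)\<close> form a class closed under differentiation.\<close>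

definition exp_bump :: "real poly \<Rightarrow> real \<Rightarrow> real \<Rightarrow> real" where
  "exp_bump p \<kappa> t = (if 0 < t then poly p (1 / t) * exp (- \<kappa> / t) else 0)"

lemma poly_times_exp_tendsto_0:
  fixes p :: "real poly"
  assumes "\<kappa> > 0"
  shows "((\<lambda>s. poly p s * exp (- \<kappa> * s)) \<longlongrightarrow> 0) at_top"
proof -
  have *: "((\<lambda>s. s ^ i * exp (- \<kappa> * s)) \<longlongrightarrow> 0) at_top" for i
  proof -
    have "((\<lambda>s. (\<kappa> * s) ^ i / exp (\<kappa> * s)) \<longlongrightarrow> 0) at_top"
      by (rule filterlim_compose[OF tendsto_power_div_exp_0])
         (use assms in \<open>auto intro!: filterlim_tendsto_pos_mult_at_top[OF tendsto_const _ filterlim_ident]\<close>)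
    then have "((\<lambda>s. (1 / \<kappa> ^ i) * ((\<kappa> * s) ^ i / exp (\<kappa> * s))) \<longlongrightarrow> 0) at_top"
      by (rule tendsto_mult_right_zero)
    moreover have "(1 / \<kappa> ^ i) * ((\<kappa> * s) ^ i / exp (\<kappa> * s)) = s ^ i * exp (- \<kappa> * s)" for s
      using assms by (simp add: power_mult_distrib exp_minus field_simps)
    ultimately show ?thesis by simp
  qed
  have "((\<lambda>s. \<Sum>i\<le>degree p. coeff p i * (s ^ i * exp (- \<kappa> * s))) \<longlongrightarrow> 0) at_top"
    by (intro tendsto_null_sum tendsto_mult_right_zero *)
  then show ?thesis by (simp add: poly_altdef sum_distrib_right mult.assoc)
qed

text \<open>With s = 1/t the chain rule multiplies the derivative of p(s) exp(-\<kappa> s) in s by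
  -s^2, which produces the new polynomial. At t = 0 the right difference quotient is s p(s)
  exp(-\<kappa> s), which vanishes as s grows.\<close>

lemma exp_bump_has_field_derivative:
  assumes "\<kappa> > 0"
  shows "(exp_bump p \<kappa> has_field_derivative
    exp_bump (monom 1 2 * (smult \<kappa> p - pderiv p)) \<kappa> t) (at t)"
proof -
  let ?q = "monom 1 2 * (smult \<kappa> p - pderiv p)"
  consider "t > 0" | "t < 0" | "t = 0" by linarith
  then show ?thesis
  proof cases
    case 1
    have "((\<lambda>t. poly p (1 / t) * exp (- \<kappa> / t)) has_field_derivative
        (poly (pderiv p) (1 / t) * (- (1 / t\<^sup>2))) * exp (- \<kappa> / t)
          + (exp (- \<kappa> / t) * (\<kappa> / t\<^sup>2)) * poly p (1 / t)) (at t)"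
      by (rule derivative_eq_intros poly_DERIV[THEN DERIV_chain2] refl | use 1 in force)+
         (use 1 in \<open>simp add: field_simps power2_eq_square\<close>)
    moreover have "(poly (pderiv p) (1 / t) * (- (1 / t\<^sup>2))) * exp (- \<kappa> / t)
          + (exp (- \<kappa> / t) * (\<kappa> / t\<^sup>2)) * poly p (1 / t) = exp_bump ?q \<kappa> t"
      using 1 by (simp add: exp_bump_def poly_monom field_simps)
    ultimately have "((\<lambda>t. poly p (1 / t) * exp (- \<kappa> / t)) has_field_derivative exp_bump ?q \<kappa> t) (at t)"
      by simp
    then show ?thesis
      by (rule has_field_derivative_transform_within_open[where S="{0<..}"])
         (use 1 in \<open>auto simp: exp_bump_def\<close>)
  next
    case 2
    have "((\<lambda>t. 0) has_field_derivative exp_bump ?q \<kappa> t) (at t)"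
      using 2 by (auto simp: exp_bump_def)
    then show ?thesis
      by (rule has_field_derivative_transform_within_open[where S="{..<0}"])
         (use 2 in \<open>auto simp: exp_bump_def\<close>)
  next
    case 3
    have "((\<lambda>h. poly (pCons 0 p) (inverse h) * exp (- \<kappa> * inverse h)) \<longlongrightarrow> 0) (at_right 0)"
      by (rule filterlim_compose[OF poly_times_exp_tendsto_0[OF assms] filterlim_inverse_at_top_right])
    then have r: "((\<lambda>h. (exp_bump p \<kappa> (0 + h) - exp_bump p \<kappa> 0) / h) \<longlongrightarrow> 0) (at_right 0)"
      by (rule Lim_transform_eventually)
         (auto simp: exp_bump_def eventually_at_filter field_simps)
    have l: "((\<lambda>h. (exp_bump p \<kappa> (0 + h) - exp_bump p \<kappa> 0) / h) \<longlongrightarrow> 0) (at_left 0)"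
      by (rule Lim_transform_eventually[OF tendsto_const])
         (auto simp: exp_bump_def eventually_at_filter)
    show ?thesis
      using filterlim_split_at[OF l r] 3 by (simp add: DERIV_def exp_bump_def)
  qed
qed

text \<open>A partial derivative in direction b multiplies c by s (b \<bullet> e) and replaces p by
  the next polynomial. With c and p arbitrary the class is closed under this, which is what the
  induction on k needs.\<close>

lemma C_k_exp_bump_affine:
  assumes "\<kappa> > 0"
  shows "C_k k (\<lambda>x::'a::euclidean_space. c * exp_bump p \<kappa> (s * (x \<bullet> e) + a))"
proof (induction k arbitrary: c p)
  case 0
  have "isCont (exp_bump p \<kappa>) t" for t
    using exp_bump_has_field_derivative[OF assms] by (rule DERIV_isCont)
  then have "continuous_on UNIV (exp_bump p \<kappa>)" by (simp add: continuous_on_eq_continuous_at)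
  then have "continuous_on UNIV (\<lambda>x::'a. exp_bump p \<kappa> (s * (x \<bullet> e) + a))"
    by (rule continuous_on_compose2) (auto intro!: continuous_on_add continuous_on_mult continuous_on_inner
        continuous_on_const continuous_on_id)
  then show ?case
    by (simp add: continuous_on_mult continuous_on_const)
next
  case (Suc k)
  let ?q = "monom 1 2 * (smult \<kappa> p - pderiv p)"
  have d: "((\<lambda>x. c * exp_bump p \<kappa> (s * (x \<bullet> e) + a)) has_derivative
      (\<lambda>h. c * ((s * (h \<bullet> e)) * exp_bump ?q \<kappa> (s * (x \<bullet> e) + a)))) (at x)" for x
  proof -
    have "((\<lambda>x. s * (x \<bullet> e) + a) has_derivative (\<lambda>h. s * (h \<bullet> e))) (at x)"
      by (auto intro!: derivative_eq_intros)
    from has_derivative_compose[OF this, of "exp_bump p \<kappa>"]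
      exp_bump_has_field_derivative[OF assms, of p "s * (x \<bullet> e) + a"]
    have "((\<lambda>x. exp_bump p \<kappa> (s * (x \<bullet> e) + a)) has_derivative
      (\<lambda>h. exp_bump ?q \<kappa> (s * (x \<bullet> e) + a) * (s * (h \<bullet> e)))) (at x)"
      by (simp add: has_field_derivative_def)
    from has_derivative_mult_right[OF this, of c] show ?thesis by (simp add: mult_ac)
  qed
  have "partial b (\<lambda>x. c * exp_bump p \<kappa> (s * (x \<bullet> e) + a))
      = (\<lambda>x. (c * (s * (b \<bullet> e))) * exp_bump ?q \<kappa> (s * (x \<bullet> e) + a))" for b
  proof
    fix x
    show "partial b (\<lambda>x. c * exp_bump p \<kappa> (s * (x \<bullet> e) + a)) x
      = (c * (s * (b \<bullet> e))) * exp_bump ?q \<kappa> (s * (x \<bullet> e) + a)"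
      unfolding partial_def frechet_derivative_at[OF d, symmetric] by (simp add: mult_ac)
  qed
  moreover have "(\<lambda>x. c * exp_bump p \<kappa> (s * (x \<bullet> e) + a)) differentiable (at x)" for x
    using d by (rule differentiableI)
  ultimately show ?case using Suc by simp
qed

text \<open>The parameter \<kappa> is kept because letting it tend to 0 turns the bump into the
  indicator of the open box, with 1 as a uniform bound.\<close>

definition box_bump :: "real \<Rightarrow> 'a::euclidean_space \<Rightarrow> 'a \<Rightarrow> 'a \<Rightarrow> real" where
  "box_bump \<kappa> a c x = (\<Prod>b\<in>Basis. exp_bump 1 \<kappa> (x \<bullet> b - a \<bullet> b) * exp_bump 1 \<kappa> (c \<bullet> b - x \<bullet> b))"

lemma box_bump_eq_0: "x \<notin> box a c \<Longrightarrow> box_bump \<kappa> a c x = 0"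
  by (auto simp: box_bump_def mem_box exp_bump_def)

lemma box_bump_bounds:
  assumes "\<kappa> > 0" shows "0 \<le> box_bump \<kappa> a c x" "box_bump \<kappa> a c x \<le> 1"
proof -
  have "0 \<le> exp_bump 1 \<kappa> t" "exp_bump 1 \<kappa> t \<le> 1" for t
    using assms by (auto simp: exp_bump_def)
  then show "0 \<le> box_bump \<kappa> a c x" "box_bump \<kappa> a c x \<le> 1"
    by (auto simp: box_bump_def intro!: prod_nonneg prod_le_1 mult_le_one)
qed

lemma box_bump_test:
  assumes "\<kappa> > 0" "cbox a c \<subseteq> U"
  shows "box_bump \<kappa> a c \<in> test_functions U"
proof -
  have "C_k k (box_bump \<kappa> a c)" for k
  proof -
    have "C_k k (\<lambda>x. \<Prod>b\<in>Basis. (1 * exp_bump 1 \<kappa> (1 * (x \<bullet> b) + (- (a \<bullet> b)))) *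
        (1 * exp_bump 1 \<kappa> ((-1) * (x \<bullet> b) + c \<bullet> b)))"
      by (intro C_k_prod C_k_mult C_k_exp_bump_affine assms)
    then show ?thesis by (simp add: box_bump_def[abs_def])
  qed
  moreover have "box_bump \<kappa> a c x = 0" if "x \<notin> cbox a c" for x
    using that by (intro box_bump_eq_0) (auto dest: box_subset_cbox[THEN subsetD])
  ultimately have "compact (cbox a c) \<and> cbox a c \<subseteq> U \<and> (\<forall>x. x \<notin> cbox a c \<longrightarrow> box_bump \<kappa> a c x = 0)"
    "\<forall>k. C_k k (box_bump \<kappa> a c)"
    using assms by auto
  then show ?thesis unfolding test_functions_def by blast
qed

lemma box_bump_tendsto:
  fixes x :: "'a::euclidean_space"
  shows "(\<lambda>n. box_bump (1 / Suc n) a c x) \<longlonglongrightarrow> indicator (box a c) x"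
proof (cases "x \<in> box a c")
  case True
  have *: "(\<lambda>n. exp_bump 1 (1 / Suc n) t) \<longlonglongrightarrow> 1" if "t > 0" for t
  proof -
    have "(\<lambda>n. exp (- (1 / real (Suc n)) / t)) \<longlonglongrightarrow> exp (- 0 / t)"
      by (intro tendsto_intros LIMSEQ_Suc[OF lim_1_over_n]) (use that in auto)
    then show ?thesis using that by (simp add: exp_bump_def)
  qed
  have "(\<lambda>n. box_bump (1 / Suc n) a c x) \<longlonglongrightarrow> (\<Prod>b\<in>(Basis::'a set). 1 * 1)"
    unfolding box_bump_def by (rule tendsto_prod, rule tendsto_mult) (rule *, use True in \<open>simp add: mem_box\<close>)+
  then show ?thesis using True by simp
qed (simp add: box_bump_eq_0)

lemma test_functions_continuous: "\<psi> \<in> test_functions U \<Longrightarrow> continuous_on UNIV \<psi>"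
  unfolding test_functions_def using C_k.simps(1)[of \<psi>] by blast

lemma test_functions_partial_continuous:
  assumes "\<psi> \<in> test_functions U" "b \<in> Basis" shows "continuous_on UNIV (partial b \<psi>)"
proof -
  have "C_k (Suc 0) \<psi>" using assms(1) unfolding test_functions_def by blast
  then show ?thesis using assms(2) by simp
qed

lemma sqi_compact_support:
  fixes f :: "'a::euclidean_space \<Rightarrow> real"
  assumes "continuous_on UNIV f" "compact K" "\<And>x. x \<notin> K \<Longrightarrow> f x = 0" "open U"
  shows "f \<in> sqi (leb U)"
proof -
  have [measurable]: "f \<in> borel_measurable borel"
    using assms(1) by (rule borel_measurable_continuous_onI)
  have "integrable lborel (\<lambda>x. indicator K x *\<^sub>R (f x)\<^sup>2)"
    using assms(1,2) by (intro borel_integrable_compact continuous_intros) (auto intro: continuous_on_subset)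
  moreover have "(\<lambda>x. indicator K x *\<^sub>R (f x)\<^sup>2) = (\<lambda>x. (f x)\<^sup>2)"
    using assms(3) by (auto simp: fun_eq_iff indicator_def)
  ultimately have "integrable lborel (\<lambda>x. (f x)\<^sup>2)" by simp
  then have "integrable (leb U) (\<lambda>x. (f x)\<^sup>2)"
    using assms(4) by (subst integrable_restrict_space) (auto intro!: integrable_mult_indicator simp del: real_scaleR_def)
  moreover have "f \<in> borel_measurable (leb U)" by (rule measurable_restrict_space1) simp
  ultimately show ?thesis by (simp add: sqi_def)
qed

lemma partial_eq_0_outside:
  assumes "closed K" "\<And>x. x \<notin> K \<Longrightarrow> f x = 0" "x \<notin> K"
  shows "partial b f x = 0"
proof -
  have "((\<lambda>x. 0) has_derivative (\<lambda>h. 0)) (at x)" by simp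
  then have "(f has_derivative (\<lambda>h. 0)) (at x)"
    by (rule has_derivative_transform_within_open[where s="-K"]) (use assms in auto)
  from frechet_derivative_at[OF this] show ?thesis unfolding partial_def by metis
qed

lemma test_functions_sqi:
  assumes "\<psi> \<in> test_functions U" "open U"
  shows "\<psi> \<in> sqi (leb U)" "b \<in> Basis \<Longrightarrow> partial b \<psi> \<in> sqi (leb U)"
proof -
  obtain K where K: "compact K" "\<And>x. x \<notin> K \<Longrightarrow> \<psi> x = 0"
    using assms(1) unfolding test_functions_def by blast
  show "\<psi> \<in> sqi (leb U)"
    by (rule sqi_compact_support[OF test_functions_continuous[OF assms(1)] K assms(2)])
  show "partial b \<psi> \<in> sqi (leb U)" if "b \<in> Basis"
    using partial_eq_0_outside[OF compact_imp_closed[OF K(1)] K(2)]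
    by (intro sqi_compact_support[OF test_functions_partial_continuous[OF assms(1) that] K(1) _ assms(2)]) auto
qed

section \<open>Functions annihilated by all test functions\<close>

text \<open>The positive and the negative part of e are densities of two measures that agree on open
  boxes. These form an intersection-stable generator of the Borel sets, so the measures coincide and
  with them their densities.\<close>

lemma AE_zero_if_box_integrals_zero:
  fixes e :: "'a::euclidean_space \<Rightarrow> real"
  assumes e: "integrable lborel e" and z: "\<And>a c. (\<integral>x. indicator (box a c) x * e x \<partial>lborel) = 0"
  shows "AE x in lborel. e x = 0"
proof -
  have [measurable]: "e \<in> borel_measurable borel" using e by simp
  let ?p = "\<lambda>x. max 0 (e x)" and ?n = "\<lambda>x. max 0 (- e x)"
  have ip: "integrable lborel ?p" and "integrable lborel ?n" using e by auto
  have ind: "integrable lborel (\<lambda>x. indicator A x * f x)" if "A \<in> sets borel" "integrable lborel f"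
    for A and f :: "'a \<Rightarrow> real"
    using integrable_mult_indicator[of A lborel f] that by simp
  have dens: "emeasure (density lborel (\<lambda>x. ennreal (f x))) A = ennreal (\<integral>x. indicator A x * f x \<partial>lborel)"
    if f: "integrable lborel f" "\<And>x. 0 \<le> f x" and [measurable]: "A \<in> sets borel" for f :: "'a \<Rightarrow> real" and A
  proof -
    have [measurable]: "f \<in> borel_measurable borel" using f by simp
    have "emeasure (density lborel (\<lambda>x. ennreal (f x))) A = (\<integral>\<^sup>+x. ennreal (indicator A x * f x) \<partial>lborel)"
      by (subst emeasure_density) (auto intro!: nn_integral_cong simp: indicator_def)
    also have "\<dots> = ennreal (\<integral>x. indicator A x * f x \<partial>lborel)"
      using f ind[of A f] by (intro nn_integral_eq_integral) auto
    finally show ?thesis .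
  qed
  have split: "(\<integral>x. indicator A x * ?p x \<partial>lborel) - (\<integral>x. indicator A x * ?n x \<partial>lborel)
    = (\<integral>x. indicator A x * e x \<partial>lborel)" if "A \<in> sets borel" for A
  proof -
    have "(\<integral>x. indicator A x * ?p x \<partial>lborel) - (\<integral>x. indicator A x * ?n x \<partial>lborel)
      = (\<integral>x. indicator A x * ?p x - indicator A x * ?n x \<partial>lborel)"
      by (intro Bochner_Integration.integral_diff[symmetric] ind that ip \<open>integrable lborel ?n\<close>)
    also have "\<dots> = (\<integral>x. indicator A x * e x \<partial>lborel)"
      by (intro Bochner_Integration.integral_cong) (auto simp: max_def indicator_def)
    finally show ?thesis .
  qed
  have eq: "density lborel (\<lambda>x. ennreal (?p x)) = density lborel (\<lambda>x. ennreal (?n x))"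
  proof (rule measure_eqI_generator_eq)
    show "Int_stable (range (\<lambda>(a, b). box a b :: 'a set))"
      by (auto simp: Int_stable_def box_Int_box)
    fix X assume "X \<in> range (\<lambda>(a, b). box a b :: 'a set)"
    then obtain a c where X: "X = box a c" by auto
    have "(\<integral>x. indicator X x * ?p x \<partial>lborel) = (\<integral>x. indicator X x * ?n x \<partial>lborel)"
      using split[of X] z[of a c] by (simp add: X)
    then show "emeasure (density lborel (\<lambda>x. ennreal (?p x))) X = emeasure (density lborel (\<lambda>x. ennreal (?n x))) X"
      using ip \<open>integrable lborel ?n\<close> by (subst (1 2) dens) (auto simp: X)
  next
    let ?A = "\<lambda>n::nat. box (- (real n *\<^sub>R One)) (real n *\<^sub>R One) :: 'a set"
    show "range ?A \<subseteq> range (\<lambda>(a, b). box a b :: 'a set)" by auto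
    show "(\<Union>i. ?A i) = UNIV" by (rule UN_box_eq_UNIV)
    show "emeasure (density lborel (\<lambda>x. ennreal (?p x))) (?A i) \<noteq> \<infinity>" for i
      using ip by (subst dens) auto
  qed (simp_all add: borel_eq_box)
  have "AE x in lborel. ?p x = ?n x"
  proof (rule density_unique_real[OF ip \<open>integrable lborel ?n\<close>])
    fix A :: "'a set" assume "A \<in> sets lborel"
    then have A: "A \<in> sets borel" by simp
    have "ennreal (\<integral>x. indicator A x * ?p x \<partial>lborel) = ennreal (\<integral>x. indicator A x * ?n x \<partial>lborel)"
      using arg_cong[OF eq, of "\<lambda>M. emeasure M A"] dens[OF ip _ A] dens[OF \<open>integrable lborel ?n\<close> _ A] by simp
    then have "(\<integral>x. indicator A x * ?p x \<partial>lborel) = (\<integral>x. indicator A x * ?n x \<partial>lborel)"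
      by (subst (asm) ennreal_inj) (auto intro!: Bochner_Integration.integral_nonneg)
    then show "(LINT x:A|lborel. ?p x) = (LINT x:A|lborel. ?n x)"
      by (simp add: set_lebesgue_integral_def)
  qed
  then show ?thesis by eventually_elim (auto simp: max_def split: if_splits)
qed

text \<open>On one box the global statement applies to d times the indicator of the box, because
  intersections of boxes are boxes. By Lindelof countably many such boxes cover U, so the
  exceptional sets add up to a null set.\<close>

lemma AE_zero_if_local_box_integrals_zero:
  fixes d :: "'a::euclidean_space \<Rightarrow> real"
  assumes U: "open U"
    and i: "\<And>a c. cbox a c \<subseteq> U \<Longrightarrow> integrable lborel (\<lambda>x. indicator (box a c) x * d x)"
    and z: "\<And>a c. cbox a c \<subseteq> U \<Longrightarrow> (\<integral>x. indicator (box a c) x * d x \<partial>lborel) = 0"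
  shows "AE x in lborel. x \<in> U \<longrightarrow> d x = 0"
proof -
  have loc: "AE x in lborel. x \<in> box a c \<longrightarrow> d x = 0" if ac: "cbox a c \<subseteq> U" for a c
  proof -
    have "AE x in lborel. indicator (box a c) x * d x = 0"
    proof (rule AE_zero_if_box_integrals_zero[OF i[OF ac]])
      fix a' c' :: 'a
      obtain p q where pq: "box a' c' \<inter> box a c = box p q" by (auto simp: box_Int_box)
      have eq: "(\<integral>x. indicator (box a' c') x * (indicator (box a c) x * d x) \<partial>lborel)
        = (\<integral>x. indicator (box p q) x * d x \<partial>lborel)"
        unfolding pq[symmetric] by (simp add: indicator_inter_arith mult.assoc)
      show "(\<integral>x. indicator (box a' c') x * (indicator (box a c) x * d x) \<partial>lborel) = 0"
      \<comment> \<open>For an empty open box the closed box \<open>cbox p q\<close> may be nonempty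
        and leave U, so the hypothesis \<open>z\<close> is available only when the open box is
        nonempty and \<open>cbox p q\<close> is its closure.\<close>
      proof (cases "box p q = {}")
        case False
        have "cbox p q = closure (box p q)" using False by (simp add: closure_box)
        also have "\<dots> \<subseteq> cbox a c"
          using pq box_subset_cbox[of a c] by (intro closure_minimal) auto
        finally show ?thesis unfolding eq using z[of p q] ac by simp
      qed (simp add: eq)
    qed
    then show ?thesis by eventually_elim (auto simp: indicator_def)
  qed
  obtain D where D: "D \<subseteq> {X. \<exists>a b. X = box a b \<and> cbox a b \<subseteq> U}" "countable D" "\<Union>D = U"
  proof -
    let ?F = "{X. \<exists>a b. X = box a b \<and> cbox a b \<subseteq> U}"
    have "\<exists>F'\<subseteq>?F. countable F' \<and> \<Union>F' = \<Union>?F"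
    proof -
      have "\<And>S. S \<in> ?F \<Longrightarrow> open S" using open_box by auto
      then obtain F' where "F' \<subseteq> ?F" "countable F'" "\<Union>F' = \<Union>?F" by (rule Lindelof)
      then show ?thesis by blast
    qed
    moreover have "\<Union>?F = U"
    proof
      show "U \<subseteq> \<Union>?F"
      proof
        fix x assume "x \<in> U"
        then obtain e where e: "e > 0" "ball x e \<subseteq> U" using U by (auto simp: open_contains_ball)
        define e' where "e' = e / 2"
        obtain a b where ab: "x \<in> box a b" "box a b \<subseteq> ball x e'"
          using rational_boxes[of e' x] e by (auto simp: e'_def)
        have "cbox a b = closure (box a b)" using ab by (subst closure_box) auto
        also have "\<dots> \<subseteq> cball x e'" using ab ball_subset_cball[of x e'] by (intro closure_minimal) auto
        also have "\<dots> \<subseteq> ball x e" using e by (auto simp: e'_def)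
        finally show "x \<in> \<Union>?F" using ab e by blast
      qed
    qed (use box_subset_cbox in blast)
    ultimately show ?thesis using that by auto
  qed
  have "AE x in lborel. \<forall>X\<in>D. x \<in> X \<longrightarrow> d x = 0"
    using D loc by (subst AE_ball_countable) auto
  then show ?thesis by eventually_elim (use D(3) in auto)
qed

lemma leb_indicator_integral:
  fixes f :: "'a::euclidean_space \<Rightarrow> real"
  assumes "open U" "B \<subseteq> U"
  shows "(\<integral>x. indicator B x * f x \<partial>leb U) = (\<integral>x. indicator B x * f x \<partial>lborel)"
    "integrable (leb U) (\<lambda>x. indicator B x * f x) \<longleftrightarrow> integrable lborel (\<lambda>x. indicator B x * f x)"
proof -
  have *: "(\<lambda>x. indicator U x *\<^sub>R (indicator B x * f x)) = (\<lambda>x. indicator B x * f x)"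
    using assms(2) by (auto simp: fun_eq_iff indicator_def)
  show "(\<integral>x. indicator B x * f x \<partial>leb U) = (\<integral>x. indicator B x * f x \<partial>lborel)"
    "integrable (leb U) (\<lambda>x. indicator B x * f x) \<longleftrightarrow> integrable lborel (\<lambda>x. indicator B x * f x)"
    using assms(1) by (simp_all add: integral_restrict_space integrable_restrict_space * del: real_scaleR_def)
qed

lemma sqi_indicator_box:
  assumes "open U" shows "(\<lambda>x. indicator (box a c) x) \<in> sqi (leb (U::'a::euclidean_space set))"
proof -
  have "integrable (leb U) (\<lambda>x. indicator (box a c) x :: real)"
    using assms by (subst integrable_restrict_space)
      (auto intro!: integrable_mult_indicator integrable_real_indicator
        simp: emeasure_lborel_box_finite[unfolded infinity_ennreal_def] simp del: real_scaleR_def)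
  moreover have "(\<lambda>x. (indicator (box a c) x :: real)\<^sup>2) = indicator (box a c)"
    by (auto simp: fun_eq_iff indicator_def)
  ultimately show ?thesis by (auto simp: sqi_def measurable_restrict_space1)
qed

lemma box_bump_integral_tendsto:
  fixes d :: "'a::euclidean_space \<Rightarrow> real"
  assumes "open U" "d \<in> sqi (leb U)"
  shows "(\<lambda>n. \<integral>x. d x * box_bump (1 / Suc n) a c x \<partial>leb U) \<longlonglongrightarrow> (\<integral>x. indicator (box a c) x * d x \<partial>leb U)"
proof (rule integral_dominated_convergence[where w="\<lambda>x. \<bar>d x * indicator (box a c) x\<bar>"])
  show [measurable]: "(\<lambda>x. indicator (box a c) x * d x) \<in> borel_measurable (leb U)"
    by (intro borel_measurable_times sqi_measurable[OF sqi_indicator_box] sqi_measurable assms)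
  have "continuous_on UNIV (box_bump (1 / Suc n) a c)" for n
    by (rule test_functions_continuous[OF box_bump_test[where U=UNIV]]) auto
  then have [measurable]: "box_bump (1 / Suc n) a c \<in> borel_measurable borel" for n
    by (rule borel_measurable_continuous_onI)
  show "(\<lambda>x. d x * box_bump (1 / Suc n) a c x) \<in> borel_measurable (leb U)" for n
    by (intro borel_measurable_times sqi_measurable[OF assms(2)] measurable_restrict_space1) measurable
  show "integrable (leb U) (\<lambda>x. \<bar>d x * indicator (box a c) x\<bar>)"
    using sqi_mult[OF assms(2) sqi_indicator_box[OF assms(1)]] by simp
  show "AE x in leb U. (\<lambda>n. d x * box_bump (1 / Suc n) a c x) \<longlonglongrightarrow> indicator (box a c) x * d x"
    using tendsto_mult_left[OF box_bump_tendsto[of a c]] by (intro AE_I2) (simp only: mult.commute[of "indicator _ _"])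
  show "AE x in leb U. norm (d x * box_bump (1 / Suc n) a c x) \<le> \<bar>d x * indicator (box a c) x\<bar>" for n
  proof (rule AE_I2)
    fix x
    show "norm (d x * box_bump (1 / Suc n) a c x) \<le> \<bar>d x * indicator (box a c) x\<bar>"
      using box_bump_bounds[of "1 / Suc n" a c x] box_bump_eq_0[of x a c "1 / Suc n"]
      by (cases "x \<in> box a c") (auto simp: abs_mult intro: mult_left_le)
  qed
qed

text \<open>The fundamental lemma of the calculus of variations. Smooth bumps converge boundedly to
  the indicators of boxes whose closure lies in U, so d has integral zero over all of these.\<close>

lemma AE_zero_if_orthogonal_to_test_functions:
  fixes d :: "'a::euclidean_space \<Rightarrow> real"
  assumes U: "open U" and d: "d \<in> sqi (leb U)"
    and z: "\<And>\<psi>. \<psi> \<in> test_functions U \<Longrightarrow> (\<integral>x. d x * \<psi> x \<partial>leb U) = 0"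
  shows "AE x in leb U. d x = 0"
proof -
  have "AE x in lborel. x \<in> U \<longrightarrow> d x = 0"
  proof (rule AE_zero_if_local_box_integrals_zero[OF U])
    fix a c :: 'a assume ac: "cbox a c \<subseteq> U"
    then have B: "box a c \<subseteq> U" using box_subset_cbox by blast
    show "integrable lborel (\<lambda>x. indicator (box a c) x * d x)"
      using sqi_mult[OF sqi_indicator_box[OF U] d] leb_indicator_integral[OF U B] by auto
    have "(\<lambda>n. \<integral>x. d x * box_bump (1 / Suc n) a c x \<partial>leb U) = (\<lambda>n. 0)"
      using z[OF box_bump_test[OF _ ac]] by auto
    then have "(\<integral>x. indicator (box a c) x * d x \<partial>leb U) = 0"
      using box_bump_integral_tendsto[OF U d, of a c] LIMSEQ_unique[OF _ tendsto_const] by metis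
    then show "(\<integral>x. indicator (box a c) x * d x \<partial>lborel) = 0"
      using leb_indicator_integral[OF U B] by simp
  qed
  then show ?thesis using U by (subst AE_restrict_space_iff) auto
qed

section \<open>Convolution on a bounded time interval\<close>

lemma nn_integral_shift:
  fixes f :: "real \<Rightarrow> ennreal"
  assumes "f \<in> borel_measurable borel"
  shows "(\<integral>\<^sup>+x. f (x - s) \<partial>lborel) = (\<integral>\<^sup>+x. f x \<partial>lborel)"
    "(\<integral>\<^sup>+x. f (s - x) \<partial>lborel) = (\<integral>\<^sup>+x. f x \<partial>lborel)"
  using nn_integral_real_affine[OF assms, of 1 "-s"] nn_integral_real_affine[OF assms, of "-1" s]
  by (simp_all add: algebra_simps)

lemma integral_shift:
  fixes f :: "real \<Rightarrow> real"
  shows "(\<integral>x. f (x - s) \<partial>lborel) = (\<integral>x. f x \<partial>lborel)"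
    "(\<integral>x. f (s - x) \<partial>lborel) = (\<integral>x. f x \<partial>lborel)"
  using lborel_integral_real_affine[of 1 f "-s"] lborel_integral_real_affine[of "-1" f s]
  by (simp_all add: algebra_simps)

lemma (in pair_sigma_finite) integrable_pair_nn:
  fixes f :: "_ \<Rightarrow> real"
  assumes [measurable]: "f \<in> borel_measurable (M1 \<Otimes>\<^sub>M M2)"
    and "(\<integral>\<^sup>+x. \<integral>\<^sup>+y. ennreal \<bar>f (x, y)\<bar> \<partial>M2 \<partial>M1) < \<infinity>"
  shows "integrable (M1 \<Otimes>\<^sub>M M2) f"
  unfolding integrable_iff_bounded using assms(2) by (simp add: M2.nn_integral_fst[symmetric])

definition conv :: "(real \<Rightarrow> real) \<Rightarrow> (real \<Rightarrow> real) \<Rightarrow> real \<Rightarrow> real" where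
  "conv p q t = (\<integral>s. p (t - s) * q s \<partial>lborel)"

lemma conv_commute: "conv p q t = conv q p t"
  unfolding conv_def using integral_shift(2)[of "\<lambda>s. p (t - s) * q s" t] by (simp add: mult.commute)

lemma conv_nn:
  fixes p q :: "real \<Rightarrow> real"
  assumes [measurable]: "p \<in> borel_measurable borel" "q \<in> borel_measurable borel"
  shows "(\<integral>\<^sup>+t. \<integral>\<^sup>+s. ennreal (\<bar>p (t - s) * q s\<bar>) \<partial>lborel \<partial>lborel)
    = (\<integral>\<^sup>+t. ennreal \<bar>p t\<bar> \<partial>lborel) * (\<integral>\<^sup>+t. ennreal \<bar>q t\<bar> \<partial>lborel)"
proof -
  have "(\<integral>\<^sup>+t. \<integral>\<^sup>+s. ennreal (\<bar>p (t - s) * q s\<bar>) \<partial>lborel \<partial>lborel)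
     = (\<integral>\<^sup>+s. \<integral>\<^sup>+t. ennreal \<bar>p (t - s)\<bar> * ennreal \<bar>q s\<bar> \<partial>lborel \<partial>lborel)"
    by (subst lborel_pair.Fubini') (auto simp: abs_mult ennreal_mult)
  also have "\<dots> = (\<integral>\<^sup>+s. (\<integral>\<^sup>+t. ennreal \<bar>p t\<bar> \<partial>lborel) * ennreal \<bar>q s\<bar> \<partial>lborel)"
    using nn_integral_shift(1)[of "\<lambda>t. ennreal \<bar>p t\<bar>"] by (simp add: nn_integral_multc)
  also have "\<dots> = (\<integral>\<^sup>+t. ennreal \<bar>p t\<bar> \<partial>lborel) * (\<integral>\<^sup>+t. ennreal \<bar>q t\<bar> \<partial>lborel)"
    by (simp add: nn_integral_cmult)
  finally show ?thesis .
qed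

lemma integrable_nn_finite:
  fixes p :: "'a \<Rightarrow> real"
  assumes "integrable M p" shows "(\<integral>\<^sup>+t. ennreal \<bar>p t\<bar> \<partial>M) < \<infinity>"
  using assms by (simp add: integrable_iff_bounded)

lemma conv_pair_integrable:
  fixes p q :: "real \<Rightarrow> real"
  assumes p: "integrable lborel p" and q: "integrable lborel q"
  shows "integrable (lborel \<Otimes>\<^sub>M lborel) (\<lambda>(t, s). p (t - s) * q s)"
proof (rule lborel_pair.integrable_pair_nn)
  have [measurable]: "p \<in> borel_measurable borel" "q \<in> borel_measurable borel" using p q by auto
  show "(\<lambda>(t, s). p (t - s) * q s) \<in> borel_measurable (lborel \<Otimes>\<^sub>M lborel)" by measurable
  show "(\<integral>\<^sup>+x. \<integral>\<^sup>+y. ennreal \<bar>case (x, y) of (t, s) \<Rightarrow> p (t - s) * q s\<bar> \<partial>lborel \<partial>lborel) < \<infinity>"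
    using conv_nn[of p q] integrable_nn_finite[OF p] integrable_nn_finite[OF q]
    by (simp add: ennreal_mult_less_top)
qed

lemma conv_AE_integrable:
  fixes p q :: "real \<Rightarrow> real"
  assumes "integrable lborel p" "integrable lborel q"
  shows "AE t in lborel. integrable lborel (\<lambda>s. p (t - s) * q s)"
  using lborel_pair.AE_integrable_fst'[OF conv_pair_integrable[OF assms]] by simp

lemma conv_integrable:
  assumes "integrable lborel p" "integrable lborel q"
  shows "integrable lborel (conv p q)"
  using lborel_pair.integrable_fst'[OF conv_pair_integrable[OF assms]]
  by (simp add: conv_def[abs_def])

text \<open>For fixed t this is Fubini in (s, w). Absolute integrability there means that |p|
  convolved with the convolution of |q| and |r| converges at t, which
  \<open>conv_AE_integrable\<close> provides for almost every t; elsewhere integrals may take the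
  default value 0.\<close>

lemma conv_assoc_AE:
  assumes p: "integrable lborel p" and q: "integrable lborel q" and r: "integrable lborel r"
  shows "AE t in lborel. conv p (conv q r) t = conv (conv p q) r t"
proof -
  have [measurable]: "p \<in> borel_measurable borel" "q \<in> borel_measurable borel" "r \<in> borel_measurable borel"
    using p q r by auto
  let ?p = "\<lambda>t. \<bar>p t\<bar>" and ?q = "\<lambda>t. \<bar>q t\<bar>" and ?r = "\<lambda>t. \<bar>r t\<bar>"
  let ?c = "conv ?q ?r"
  have c: "integrable lborel ?c" using q r by (intro conv_integrable) auto
  have ae: "AE s in lborel. integrable lborel (\<lambda>w. ?q (s - w) * ?r w)"
    using q r by (intro conv_AE_integrable) auto
  have "AE t in lborel. integrable lborel (\<lambda>s. ?p (t - s) * ?c s)"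
    using p c by (intro conv_AE_integrable) auto
  then show ?thesis
  proof eventually_elim
    case (elim t)
    have I: "integrable (lborel \<Otimes>\<^sub>M lborel) (\<lambda>(s, w). p (t - s) * (q (s - w) * r w))"
    proof (rule lborel_pair.integrable_pair_nn)
      have "(\<integral>\<^sup>+s. \<integral>\<^sup>+w. ennreal \<bar>p (t - s) * (q (s - w) * r w)\<bar> \<partial>lborel \<partial>lborel)
        = (\<integral>\<^sup>+s. ennreal (?p (t - s) * ?c s) \<partial>lborel)"
        using ae
      proof (intro nn_integral_cong_AE, eventually_elim)
        case (elim s)
        have "(\<integral>\<^sup>+w. ennreal \<bar>p (t - s) * (q (s - w) * r w)\<bar> \<partial>lborel)
          = (\<integral>\<^sup>+w. ennreal (?p (t - s) * (?q (s - w) * ?r w)) \<partial>lborel)"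
          by (simp add: abs_mult)
        also have "\<dots> = ennreal (\<integral>w. ?p (t - s) * (?q (s - w) * ?r w) \<partial>lborel)"
          using elim by (intro nn_integral_eq_integral integrable_mult_right) auto
        also have "\<dots> = ennreal (?p (t - s) * ?c s)" by (simp add: conv_def)
        finally show ?case .
      qed
      also have "\<dots> = ennreal (\<integral>s. ?p (t - s) * ?c s \<partial>lborel)"
        using elim by (intro nn_integral_eq_integral) (auto simp: conv_def intro!: AE_I2 mult_nonneg_nonneg Bochner_Integration.integral_nonneg)
      finally show "(\<integral>\<^sup>+s. \<integral>\<^sup>+w. ennreal \<bar>case (s, w) of (s, w) \<Rightarrow> p (t - s) * (q (s - w) * r w)\<bar> \<partial>lborel \<partial>lborel) < \<infinity>"
        by simp
    qed measurable
    have "conv p (conv q r) t = (\<integral>s. \<integral>w. p (t - s) * (q (s - w) * r w) \<partial>lborel \<partial>lborel)"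
      by (simp add: conv_def)
    also have "\<dots> = (\<integral>w. \<integral>s. p (t - s) * (q (s - w) * r w) \<partial>lborel \<partial>lborel)"
      using lborel_pair.Fubini_integral[OF I] by simp
    also have "\<dots> = (\<integral>w. conv p q (t - w) * r w \<partial>lborel)"
    proof (rule Bochner_Integration.integral_cong[OF refl])
      fix w
      have "(\<integral>s. p (t - s) * (q (s - w) * r w) \<partial>lborel) = (\<integral>s. p (t - s) * q (s - w) \<partial>lborel) * r w"
        by (simp add: mult.assoc[symmetric])
      also have "(\<integral>s. p (t - s) * q (s - w) \<partial>lborel) = conv p q (t - w)"
        unfolding conv_def using integral_shift(1)[of "\<lambda>s. p (t - w - s) * q s" w] by (simp add: algebra_simps)
      finally show "(\<integral>s. p (t - s) * (q (s - w) * r w) \<partial>lborel) = conv p q (t - w) * r w" .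
    qed
    finally show ?case by (simp add: conv_def)
  qed
qed

section \<open>Functions supported in (0, T) and causal convolution\<close>

definition L1s :: "real \<Rightarrow> (real \<Rightarrow> real) set" where
  "L1s T = {q. integrable lborel q \<and> (\<forall>t. t \<notin> {0<..<T} \<longrightarrow> q t = 0)}"

definition cv :: "real \<Rightarrow> (real \<Rightarrow> real) \<Rightarrow> (real \<Rightarrow> real) \<Rightarrow> real \<Rightarrow> real" where
  "cv T p q t = (if 0 < t \<and> t < T then conv p q t else 0)"

lemma L1s_integrable: "q \<in> L1s T \<Longrightarrow> integrable lborel q"
  and L1s_measurable: "q \<in> L1s T \<Longrightarrow> q \<in> borel_measurable borel"
  and L1s_zero: "q \<in> L1s T \<Longrightarrow> t \<notin> {0<..<T} \<Longrightarrow> q t = 0"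
  by (auto simp: L1s_def)

lemma L1s_add: "p \<in> L1s T \<Longrightarrow> q \<in> L1s T \<Longrightarrow> (\<lambda>t. p t + q t) \<in> L1s T"
  and L1s_diff: "p \<in> L1s T \<Longrightarrow> q \<in> L1s T \<Longrightarrow> (\<lambda>t. p t - q t) \<in> L1s T"
  and L1s_cmult: "p \<in> L1s T \<Longrightarrow> (\<lambda>t. c * p t) \<in> L1s T"
  by (auto simp: L1s_def)

lemma cv_L1s:
  assumes "p \<in> L1s T" "q \<in> L1s T" shows "cv T p q \<in> L1s T"
proof -
  have "integrable lborel (\<lambda>t. indicator {0<..<T} t *\<^sub>R conv p q t)"
    using assms by (intro integrable_mult_indicator conv_integrable) (auto dest: L1s_integrable)
  moreover have "(\<lambda>t. indicator {0<..<T} t *\<^sub>R conv p q t) = cv T p q"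
    by (auto simp: fun_eq_iff cv_def)
  ultimately show ?thesis by (simp add: L1s_def cv_def)
qed

lemma cv_commute: "cv T p q = cv T q p"
  by (auto simp: cv_def conv_commute fun_eq_iff)

text \<open>The conclusion is pointwise although the hypothesis holds only almost everywhere, since
  every value of a convolution is an integral. This allows rewriting inside nested
  convolutions.\<close>

lemma cv_cong_AE:
  assumes "q \<in> borel_measurable borel" "q' \<in> borel_measurable borel" "p \<in> borel_measurable borel"
    "AE t in lborel. q t = q' t"
  shows "cv T p q = cv T p q'"
proof -
  have "conv p q t = conv p q' t" for t
    unfolding conv_def using assms by (intro integral_cong_AE) auto
  then show ?thesis by (auto simp: cv_def fun_eq_iff)
qed

text \<open>By causality, truncating the inner convolution at time \<open>T\<close> does not change the outer one
  before time \<open>T\<close>.\<close>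
lemma conv_cv:
  assumes "p \<in> L1s T" "q \<in> L1s T" "r \<in> L1s T" "t < T"
  shows "conv p (cv T q r) t = conv p (conv q r) t"
  unfolding conv_def
proof (intro Bochner_Integration.integral_cong refl)
  fix s
  show "p (t - s) * cv T q r s = p (t - s) * (\<integral>w. q (s - w) * r w \<partial>lborel)"
  proof (cases "s < T")
    case False
    then show ?thesis using assms L1s_zero[OF assms(1), of "t - s"] by simp
  next
    case s: True
    show ?thesis
    proof (cases "0 < s")
      case False
      have "(\<lambda>w. q (s - w) * r w) = (\<lambda>w. 0)"
      proof
        show "q (s - w) * r w = 0" for w
          using L1s_zero[OF assms(2), of "s - w"] L1s_zero[OF assms(3), of w] False by (cases "w > 0") auto
      qed
      then show ?thesis using False by (simp only: cv_def) simp
    qed (use s in \<open>simp add: cv_def conv_def\<close>)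
  qed
qed

lemma cv_assoc_AE:
  assumes "p \<in> L1s T" "q \<in> L1s T" "r \<in> L1s T"
  shows "AE t in lborel. cv T p (cv T q r) t = cv T (cv T p q) r t"
  using conv_assoc_AE[OF assms[THEN L1s_integrable]]
proof eventually_elim
  case (elim t)
  show ?case
    using conv_cv[OF assms, of t] conv_cv[OF assms(3) assms(1,2), of t] elim
      conv_commute[of r "conv p q" t] conv_commute[of r "cv T p q" t]
    by (auto simp: cv_def[of T _ _ t])
qed

lemma cv_linear_AE:
  assumes "p \<in> L1s T" "q \<in> L1s T" "r \<in> L1s T"
  shows "AE t in lborel. cv T p (\<lambda>s. a * q s + b * r s) t = a * cv T p q t + b * cv T p r t"
  using conv_AE_integrable[OF assms(1,2)[THEN L1s_integrable]] conv_AE_integrable[OF assms(1,3)[THEN L1s_integrable]]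
proof eventually_elim
  case (elim t)
  have "conv p (\<lambda>s. a * q s + b * r s) t = (\<integral>s. a * (p (t - s) * q s) + b * (p (t - s) * r s) \<partial>lborel)"
    unfolding conv_def by (intro Bochner_Integration.integral_cong) (auto simp: algebra_simps)
  also have "\<dots> = a * conv p q t + b * conv p r t"
    using elim by (simp add: conv_def)
  finally show ?case by (simp add: cv_def)
qed

definition L2s :: "real \<Rightarrow> (real \<Rightarrow> real) set" where
  "L2s T = L1s T \<inter> sqi lborel"

lemma L2s_L1s: "q \<in> L2s T \<Longrightarrow> q \<in> L1s T" and L2s_sqi: "q \<in> L2s T \<Longrightarrow> q \<in> sqi lborel"
  by (auto simp: L2s_def)

lemma indicator_sqi: "(\<lambda>t. indicator {a<..<b} t) \<in> sqi (lborel :: real measure)"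
proof -
  have "(\<lambda>x. (indicator {a<..<b} x :: real)\<^sup>2) = indicator {a<..<b}"
    by (auto simp: fun_eq_iff indicator_def)
  moreover have "integrable lborel (indicator {a<..<b} :: real \<Rightarrow> real)"
    by (rule integrable_real_indicator) (auto simp: emeasure_lborel_box_finite[of a b, unfolded box_real infinity_ennreal_def])
  ultimately show ?thesis by (simp add: sqi_def)
qed

lemma L2s_I:
  assumes "q \<in> sqi lborel" "\<And>t. t \<notin> {0<..<T} \<Longrightarrow> q t = 0"
  shows "q \<in> L2s T"
proof -
  have "integrable lborel (\<lambda>t. indicator {0<..<T} t * q t)"
    by (intro sqi_mult indicator_sqi assms(1))
  moreover have "(\<lambda>t. indicator {0<..<T} t * q t) = q"
    using assms(2) by (auto simp: fun_eq_iff indicator_def)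
  ultimately show ?thesis using assms by (auto simp: L2s_def L1s_def)
qed

lemma L2s_add: "p \<in> L2s T \<Longrightarrow> q \<in> L2s T \<Longrightarrow> (\<lambda>t. p t + q t) \<in> L2s T"
  and L2s_diff: "p \<in> L2s T \<Longrightarrow> q \<in> L2s T \<Longrightarrow> (\<lambda>t. p t - q t) \<in> L2s T"
  and L2s_cmult: "p \<in> L2s T \<Longrightarrow> (\<lambda>t. c * p t) \<in> L2s T"
  by (auto simp: L2s_def L1s_add L1s_diff L1s_cmult)

text \<open>Young's inequality: Cauchy-Schwarz after splitting |p| into two factors sqrt |p|, then
  Tonelli. Where the convolution integral does not converge absolutely its value is 0 and the bound
  is trivial.\<close>

lemma cv_L2_nn:
  assumes p: "p \<in> L1s T" and q: "q \<in> L1s T"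
  shows "(\<integral>\<^sup>+t. ennreal ((cv T p q t)\<^sup>2) \<partial>lborel)
    \<le> ennreal ((\<integral>t. \<bar>p t\<bar> \<partial>lborel)\<^sup>2) * (\<integral>\<^sup>+t. ennreal ((q t)\<^sup>2) \<partial>lborel)"
proof -
  note [measurable] = L1s_measurable[OF p] L1s_measurable[OF q]
  let ?P = "\<integral>\<^sup>+t. ennreal \<bar>p t\<bar> \<partial>lborel"
  have P: "?P = ennreal (\<integral>t. \<bar>p t\<bar> \<partial>lborel)"
    using L1s_integrable[OF p] by (intro nn_integral_eq_integral) auto
  have "ennreal ((cv T p q t)\<^sup>2) \<le> ?P * (\<integral>\<^sup>+s. ennreal \<bar>p (t - s)\<bar> * ennreal ((q s)\<^sup>2) \<partial>lborel)" for t
  proof -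
    have "ennreal \<bar>cv T p q t\<bar> \<le> ennreal \<bar>conv p q t\<bar>" by (simp add: cv_def)
    also have "\<dots> \<le> (\<integral>\<^sup>+s. ennreal \<bar>p (t - s) * q s\<bar> \<partial>lborel)"
      unfolding conv_def using integral_norm_bound_ennreal[of lborel "\<lambda>s. p (t - s) * q s"]
      by (cases "integrable lborel (\<lambda>s. p (t - s) * q s)") (auto simp: not_integrable_integral_eq)
    also have "\<dots> = (\<integral>\<^sup>+s. ennreal (sqrt \<bar>p (t - s)\<bar>) * ennreal (sqrt \<bar>p (t - s)\<bar> * \<bar>q s\<bar>) \<partial>lborel)"
      by (auto simp: abs_mult ennreal_mult[symmetric] mult.assoc[symmetric] intro!: nn_integral_cong)
    finally have "(ennreal \<bar>cv T p q t\<bar>)\<^sup>2 \<le>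
      (\<integral>\<^sup>+s. ennreal (sqrt \<bar>p (t - s)\<bar>) * ennreal (sqrt \<bar>p (t - s)\<bar> * \<bar>q s\<bar>) \<partial>lborel)\<^sup>2"
      by (rule power_mono) simp
    also have "\<dots> \<le> (\<integral>\<^sup>+s. (ennreal (sqrt \<bar>p (t - s)\<bar>))\<^sup>2 \<partial>lborel) *
       (\<integral>\<^sup>+s. (ennreal (sqrt \<bar>p (t - s)\<bar> * \<bar>q s\<bar>))\<^sup>2 \<partial>lborel)"
      by (rule Cauchy_Schwarz_nn_integral) auto
    also have "\<dots> = ?P * (\<integral>\<^sup>+s. ennreal \<bar>p (t - s)\<bar> * ennreal ((q s)\<^sup>2) \<partial>lborel)"
      using nn_integral_shift(2)[of "\<lambda>s. ennreal \<bar>p s\<bar>" t]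
      by (simp add: ennreal_power power_mult_distrib ennreal_mult)
    finally show ?thesis by (simp add: ennreal_power)
  qed
  then have "(\<integral>\<^sup>+t. ennreal ((cv T p q t)\<^sup>2) \<partial>lborel) \<le>
    (\<integral>\<^sup>+t. ?P * (\<integral>\<^sup>+s. ennreal \<bar>p (t - s)\<bar> * ennreal ((q s)\<^sup>2) \<partial>lborel) \<partial>lborel)"
    by (intro nn_integral_mono) auto
  also have "\<dots> = ?P * (\<integral>\<^sup>+t. \<integral>\<^sup>+s. ennreal \<bar>p (t - s) * (q s)\<^sup>2\<bar> \<partial>lborel \<partial>lborel)"
    by (subst nn_integral_cmult) (auto simp: abs_mult ennreal_mult)
  also have "\<dots> = ?P * (?P * (\<integral>\<^sup>+t. ennreal ((q t)\<^sup>2) \<partial>lborel))"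
    by (subst conv_nn) auto
  finally show ?thesis
    by (simp add: P power2_eq_square ennreal_mult mult.assoc)
qed

lemma
  assumes p: "p \<in> L1s T" and q: "q \<in> L2s T"
  shows cv_L2s: "cv T p q \<in> L2s T"
    and cv_L2_le: "(\<integral>t. (cv T p q t)\<^sup>2 \<partial>lborel) \<le> (\<integral>t. \<bar>p t\<bar> \<partial>lborel)\<^sup>2 * (\<integral>t. (q t)\<^sup>2 \<partial>lborel)"
proof -
  have le: "(\<integral>\<^sup>+t. ennreal ((cv T p q t)\<^sup>2) \<partial>lborel)
     \<le> ennreal ((\<integral>t. \<bar>p t\<bar> \<partial>lborel)\<^sup>2 * (\<integral>t. (q t)\<^sup>2 \<partial>lborel))"
    using cv_L2_nn[OF p L2s_L1s[OF q]] sqi_nn_integral[OF L2s_sqi[OF q]] by (simp add: ennreal_mult)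
  have m: "cv T p q \<in> L1s T" by (intro cv_L1s p L2s_L1s q)
  have "cv T p q \<in> sqi lborel"
    using le L1s_measurable[OF m] unfolding sqi_iff_nn by (auto intro: le_less_trans)
  then show 1: "cv T p q \<in> L2s T" using m by (simp add: L2s_def)
  show "(\<integral>t. (cv T p q t)\<^sup>2 \<partial>lborel) \<le> (\<integral>t. \<bar>p t\<bar> \<partial>lborel)\<^sup>2 * (\<integral>t. (q t)\<^sup>2 \<partial>lborel)"
    using le sqi_nn_integral[OF L2s_sqi[OF 1]] by (simp add: ennreal_le_iff)
qed

section \<open>Riemann--Liouville kernels\<close>

text \<open>The kernel of the Riemann-Liouville integral: on (0, T), \<open>cv T (pw T a) q\<close>
  is I^a q with base point 0. Cutting the kernel off at T makes it integrable on the line and, by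
  causality, does not change I^a q before time T.\<close>

definition pw :: "real \<Rightarrow> real \<Rightarrow> real \<Rightarrow> real" where
  "pw T a t = (if 0 < t \<and> t < T then t powr (a - 1) / Gamma a else 0)"

lemma pw_nonneg: "0 < a \<Longrightarrow> 0 \<le> pw T a t"
  by (simp add: pw_def Gamma_real_nonneg)

lemma pw_measurable [measurable]: "pw T a \<in> borel_measurable borel"
  unfolding pw_def[abs_def] by measurable

lemma integrable_powr_Ioo:
  assumes "0 < a"
  shows "integrable lborel (\<lambda>t::real. indicator {0<..<T} t * t powr (a - 1))"
proof (cases "T > 0")
  case True
  have "(\<lambda>t. t powr (a - 1)) integrable_on {0..T}"
    by (rule integrable_on_powr_from_0) (use assms True in auto)
  then have "(\<lambda>t. t powr (a - 1)) absolutely_integrable_on {0..T}"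
    by (subst absolutely_integrable_on_iff_nonneg) auto
  then have "integrable lborel (\<lambda>t. indicator {0..T} t * t powr (a - 1))"
    by (simp add: set_integrable_def integrable_completion)
  then have "integrable lborel (\<lambda>t. indicator {0<..<T} t *\<^sub>R (indicator {0..T} t * t powr (a - 1)))"
    by (intro integrable_mult_indicator) auto
  moreover have "(\<lambda>t. indicator {0<..<T} t *\<^sub>R (indicator {0..T} t * t powr (a - 1)))
     = (\<lambda>t. indicator {0<..<T} t * t powr (a - 1))"
    by (auto simp: fun_eq_iff indicator_def)
  ultimately show ?thesis by simp
qed (simp add: greaterThanLessThan_empty)

lemma pw_L1s: "0 < a \<Longrightarrow> pw T a \<in> L1s T"
proof -
  assume a: "0 < a"
  have "integrable lborel (\<lambda>t. (indicator {0<..<T} t * t powr (a - 1)) * (1 / Gamma a))"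
    using integrable_powr_Ioo[OF a] by (rule integrable_mult_left)
  moreover have "(\<lambda>t. (indicator {0<..<T} t * t powr (a - 1)) * (1 / Gamma a)) = pw T a"
    by (auto simp: fun_eq_iff pw_def indicator_def)
  ultimately show ?thesis by (simp add: L1s_def pw_def)
qed

text \<open>The semigroup law I^a I^b = I^(a + b) on the level of kernels. The substitution s = t x
  turns the convolution into a power of t times the Beta integral B(b, a).\<close>

lemma cv_pw_pw:
  assumes a: "0 < a" and b: "0 < b"
  shows "cv T (pw T a) (pw T b) = pw T (a + b)"
proof
  fix t
  show "cv T (pw T a) (pw T b) t = pw T (a + b) t"
  proof (cases "0 < t \<and> t < T")
    case True
    then have t: "0 < t" "t < T" by auto
    let ?f = "\<lambda>s. pw T a (t - s) * pw T b s"
    have "conv (pw T a) (pw T b) t = t * (\<integral>x. ?f (t * x) \<partial>lborel)"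
      unfolding conv_def using lborel_integral_real_affine[of t ?f 0] t by simp
    also have "(\<lambda>x. ?f (t * x)) = (\<lambda>x. (t powr (a + b - 2) / (Gamma a * Gamma b)) *
        (indicator {0<..<1} x * (x powr (b - 1) * (1 - x) powr (a - 1))))"
    proof
      fix x
      have *: "0 < t * x \<longleftrightarrow> 0 < x" "0 < t - t * x \<longleftrightarrow> x < 1" "0 < t * (1 - x) \<longleftrightarrow> x < 1"
        using t by (auto simp: zero_less_mult_iff)
      have "t - t * x = t * (1 - x)" by (simp add: algebra_simps)
      moreover have "t powr (a + b - 2) = t powr (a - 1) * t powr (b - 1)"
        by (simp add: powr_add[symmetric])
      moreover have "t - t * x < T \<and> t * x < T" if "0 < x" "x < 1"
      proof -
        have "0 < t * x" "t * x < t * 1" using that t by (auto intro: mult_strict_left_mono)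
        then show ?thesis using t by linarith
      qed
      ultimately show "?f (t * x) = (t powr (a + b - 2) / (Gamma a * Gamma b)) *
        (indicator {0<..<1} x * (x powr (b - 1) * (1 - x) powr (a - 1)))"
        using t by (auto simp: pw_def indicator_def * powr_mult)
    qed
    also have "(\<integral>x. (t powr (a + b - 2) / (Gamma a * Gamma b)) *
        (indicator {0<..<1} x * (x powr (b - 1) * (1 - x) powr (a - 1))) \<partial>lborel)
      = (t powr (a + b - 2) / (Gamma a * Gamma b)) *
        (\<integral>x. indicator {0<..<1} x * (x powr (b - 1) * (1 - x) powr (a - 1)) \<partial>lborel)"
      by (rule integral_mult_right_zero)
    also have "(\<integral>x. indicator {0<..<1} x * (x powr (b - 1) * (1 - x) powr (a - 1)) \<partial>lborel) = Beta b a"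
    proof -
      have "(\<integral>x. indicator {0<..<1} x * (x powr (b - 1) * (1 - x) powr (a - 1)) \<partial>lborel)
        = (LINT x:{0..1}|lborel. x powr (b - 1) * (1 - x) powr (a - 1))"
        unfolding set_lebesgue_integral_def
        by (intro Bochner_Integration.integral_cong) (auto simp: indicator_def)
      also have "\<dots> = integral {0..1} (\<lambda>x. x powr (b - 1) * (1 - x) powr (a - 1))"
        by (rule set_borel_integral_eq_integral(2)[OF integrable_Beta[OF b a]])
      also have "\<dots> = Beta b a" using has_integral_Beta_real[OF b a] by (rule integral_unique)
      finally show ?thesis .
    qed
    also have "t * (t powr (a + b - 2) / (Gamma a * Gamma b) * Beta b a) = pw T (a + b) t"
    proof -
      have "Gamma a > 0" "Gamma b > 0" using a b by (auto intro: Gamma_real_pos)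
      moreover have "t * t powr (a + b - 2) = t powr (a + b - 1)"
        using t powr_mult_base[of t "a + b - 2"] by simp
      ultimately show ?thesis using t by (simp add: pw_def Beta_def add.commute field_simps)
    qed
    finally show ?thesis using True by (simp add: cv_def)
  qed (auto simp: cv_def pw_def)
qed

lemma conv_pw_1:
  assumes "q \<in> L1s T" "t \<le> T"
  shows "conv (pw T 1) q t = (\<integral>s. indicator {..<t} s * q s \<partial>lborel)"
  unfolding conv_def
  using L1s_zero[OF assms(1)] assms(2)
  by (intro Bochner_Integration.integral_cong) (auto simp: pw_def indicator_def)

lemma integrable_indicator_mult: 
  fixes q :: "'a \<Rightarrow> real"
  assumes "integrable M q" "A \<in> sets M" shows "integrable M (\<lambda>s. indicator A s * q s)"
  using integrable_mult_indicator[OF assms(2,1)] by simp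

lemma cv_pw_1_diff:
  assumes q: "q \<in> L1s T" and t: "0 < a" "a \<le> b" "b < T"
  shows "cv T (pw T 1) q b - cv T (pw T 1) q a = (\<integral>s. indicator {a..<b} s * q s \<partial>lborel)"
proof -
  have "cv T (pw T 1) q b - cv T (pw T 1) q a
    = (\<integral>s. indicator {..<b} s * q s \<partial>lborel) - (\<integral>s. indicator {..<a} s * q s \<partial>lborel)"
    using t by (simp add: cv_def conv_pw_1[OF q])
  also have "\<dots> = (\<integral>s. indicator {..<b} s * q s - indicator {..<a} s * q s \<partial>lborel)"
    by (intro Bochner_Integration.integral_diff[symmetric] integrable_indicator_mult L1s_integrable[OF q]) auto
  also have "\<dots> = (\<integral>s. indicator {a..<b} s * q s \<partial>lborel)"
    using t by (intro Bochner_Integration.integral_cong) (auto simp: indicator_def)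
  finally show ?thesis .
qed

lemma cv_pw_1_continuous:
  assumes q: "q \<in> L1s T"
  shows "continuous_on {0<..<T} (cv T (pw T 1) q)"
proof -
  have "continuous_on UNIV (\<lambda>t. \<integral>s. indicator {..<t} s * q s \<partial>lborel)"
    unfolding continuous_on_sequentially
  proof (safe)
    fix x :: "nat \<Rightarrow> real" and a assume x: "x \<longlonglongrightarrow> a"
    have [measurable]: "q \<in> borel_measurable borel" using q by (rule L1s_measurable)
    show "((\<lambda>t. \<integral>s. indicator {..<t} s * q s \<partial>lborel) \<circ> x) \<longlonglongrightarrow> (\<integral>s. indicator {..<a} s * q s \<partial>lborel)"
      unfolding o_def
    proof (rule integral_dominated_convergence[where w="\<lambda>s. \<bar>q s\<bar>"])
      show "AE s in lborel. (\<lambda>i. indicator {..<x i} s * q s) \<longlonglongrightarrow> indicator {..<a} s * q s"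
        using AE_lborel_singleton[of a]
      proof eventually_elim
        case (elim s)
        have "\<forall>\<^sub>F i in sequentially. indicator {..<x i} s * q s = indicator {..<a} s * q s"
        proof (cases "s < a")
          case True
          show ?thesis using order_tendstoD(1)[OF x True] by eventually_elim (use True in auto)
        next
          case False
          then have "a < s" using elim by auto
          show ?thesis using order_tendstoD(2)[OF x \<open>a < s\<close>] by eventually_elim (use False in \<open>auto simp: indicator_def\<close>)
        qed
        then show ?case by (rule tendsto_eventually)
      qed
    qed (use L1s_integrable[OF q] in \<open>auto simp: indicator_def\<close>)
  qed
  then have "continuous_on {0<..<T} (\<lambda>t. \<integral>s. indicator {..<t} s * q s \<partial>lborel)"
    by (rule continuous_on_subset) auto
  then show ?thesis
    by (rule continuous_on_eq) (auto simp: cv_def conv_pw_1[OF q])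
qed

lemma continuous_AE_zero:
  fixes f :: "real \<Rightarrow> real"
  assumes U: "open U" and f: "continuous_on U f" and z: "AE x in lborel. x \<in> U \<longrightarrow> f x = 0" and x: "x \<in> U"
  shows "f x = 0"
proof (rule ccontr)
  assume nz: "f x \<noteq> 0"
  let ?S = "U \<inter> f -` (- {0})"
  have o: "open ?S" by (rule continuous_open_preimage[OF f U]) auto
  have "AE x in lborel. x \<notin> ?S" using z by eventually_elim auto
  then have "?S \<in> null_sets lborel" using o by (subst AE_iff_null_sets) auto
  then have "negligible ?S" by (simp add: negligible_iff_null_sets null_sets_completionI)
  moreover have "?S \<noteq> {}" using x nz by auto
  ultimately show False using open_not_negligible[OF o] by blast
qed

text \<open>The primitive of q is continuous, so it vanishes at every point of (0, T) once it
  vanishes almost everywhere. Its increments are the integrals of q over intervals, which therefore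
  are all zero.\<close>

lemma cv_pw_1_injective:
  assumes q: "q \<in> L1s T" and z: "AE t in lborel. cv T (pw T 1) q t = 0"
  shows "AE t in lborel. q t = 0"
proof -
  have 0: "cv T (pw T 1) q t = 0" if "t \<in> {0<..<T}" for t
    by (rule continuous_AE_zero[OF _ cv_pw_1_continuous[OF q] _ that]) (use z in auto)
  have "AE t in lborel. t \<in> {0<..<T} \<longrightarrow> q t = 0"
  proof (rule AE_zero_if_local_box_integrals_zero)
    fix a c :: real assume ac: "cbox a c \<subseteq> {0<..<T}"
    show "integrable lborel (\<lambda>x. indicator (box a c) x * q x)"
      by (intro integrable_indicator_mult L1s_integrable[OF q]) auto
    show "(\<integral>x. indicator (box a c) x * q x \<partial>lborel) = 0"
    proof (cases "a < c")
      case True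
      then have t: "0 < a" "c < T" using ac by (auto simp: subset_iff)
      have "(\<integral>x. indicator (box a c) x * q x \<partial>lborel) = (\<integral>x. indicator {a..<c} x * q x \<partial>lborel)"
        using AE_lborel_singleton[of a] L1s_measurable[OF q]
        by (intro integral_cong_AE) (auto simp: indicator_def elim!: eventually_mono)
      also have "\<dots> = 0" using cv_pw_1_diff[OF q, of a c] t True 0[of a] 0[of c] by auto
      finally show ?thesis .
    qed (simp add: box_eq_empty)
  qed auto
  then show ?thesis by eventually_elim (use L1s_zero[OF q] in auto)
qed

lemma cv_pw_1_injective':
  assumes q: "q \<in> L1s T" and r: "r \<in> L1s T" and z: "AE t in lborel. cv T (pw T 1) q t = cv T (pw T 1) r t"
  shows "AE t in lborel. q t = r t"
proof -
  have "AE t in lborel. cv T (pw T 1) (\<lambda>s. 1 * q s + (-1) * r s) t = 0"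
    using cv_linear_AE[OF pw_L1s q r, of 1 1 "-1"] z by (auto elim: AE_mp)
  from cv_pw_1_injective[OF _ this] show ?thesis
    using L1s_diff[OF q r] by simp
qed

section \<open>The energy identity for the Riemann--Liouville kernel\<close>

text \<open>For two points at distance d, r - d measures the positions of a window of width r that
  contains both. The weight r^(\<alpha> - 3) is chosen so that integrating over all widths
  reproduces the singular kernel d^(\<alpha> - 1); the factor is 1/(1 - \<alpha>) - 1/(2 -
  \<alpha>).\<close>

lemma nn_integral_powr_kernel:
  fixes \<alpha> d :: real
  assumes "0 < \<alpha>" "\<alpha> < 1" "0 < d"
  shows "(\<integral>\<^sup>+r. ennreal (r powr (\<alpha> - 3) * (r - d)) * indicator {d..} r \<partial>lborel)
    = ennreal (d powr (\<alpha> - 1) / ((1 - \<alpha>) * (2 - \<alpha>)))"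
proof -
  let ?F = "\<lambda>r. r powr (\<alpha> - 1) / (\<alpha> - 1) - d * (r powr (\<alpha> - 2) / (\<alpha> - 2))"
  have "(\<integral>\<^sup>+r. ennreal (r powr (\<alpha> - 3) * (r - d)) * indicator {d..} r \<partial>lborel) = ennreal (0 - ?F d)"
  proof (rule nn_integral_FTC_atLeast[where F="?F"])
    fix x assume x: "d \<le> x"
    then have "x > 0" using assms by simp
    have "x powr (\<alpha> - 3) * x = x powr (\<alpha> - 2)"
      using powr_mult_base[of x "\<alpha> - 3"] \<open>x > 0\<close> by (simp add: mult.commute)
    moreover have "(?F has_real_derivative ((\<alpha> - 1) * x powr (\<alpha> - 1 - 1) / (\<alpha> - 1)
       - d * ((\<alpha> - 2) * x powr (\<alpha> - 2 - 1) / (\<alpha> - 2)))) (at x)"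
      by (intro DERIV_diff DERIV_cdivide DERIV_cmult has_real_derivative_powr \<open>x > 0\<close>)
    moreover have "(\<alpha> - 1) * x powr (\<alpha> - 1 - 1) / (\<alpha> - 1) - d * ((\<alpha> - 2) * x powr (\<alpha> - 2 - 1) / (\<alpha> - 2))
      = x powr (\<alpha> - 2) - d * x powr (\<alpha> - 3)"
      using assms by simp
    ultimately show "(?F has_real_derivative x powr (\<alpha> - 3) * (x - d)) (at x)"
      by (simp only: right_diff_distrib mult.commute[of "x powr (\<alpha> - 3)" d])
    show "0 \<le> x powr (\<alpha> - 3) * (x - d)" using x by simp
  next
    have "((\<lambda>r::real. r powr (\<alpha> - 1)) \<longlongrightarrow> 0) at_top" "((\<lambda>r::real. r powr (\<alpha> - 2)) \<longlongrightarrow> 0) at_top"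
      using assms by (auto intro!: tendsto_neg_powr filterlim_ident)
    then have "(?F \<longlongrightarrow> 0 / (\<alpha> - 1) - d * (0 / (\<alpha> - 2))) at_top"
      using assms by (intro tendsto_intros) auto
    then show "(?F \<longlongrightarrow> 0) at_top" by simp
  qed measurable
  also have "0 - ?F d = d powr (\<alpha> - 1) / ((1 - \<alpha>) * (2 - \<alpha>))"
  proof -
    have "d * d powr (\<alpha> - 2) = d powr (\<alpha> - 1)"
      using powr_mult_base[of d "\<alpha> - 2"] assms by simp
    then have "0 - ?F d = d powr (\<alpha> - 1) * (1 / (\<alpha> - 2) - 1 / (\<alpha> - 1))"
      by (simp add: algebra_simps)
    also have "1 / (\<alpha> - 2) - 1 / (\<alpha> - 1) = 1 / ((1 - \<alpha>) * (2 - \<alpha>))"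
      using assms by (simp add: field_simps)
    finally show ?thesis by simp
  qed
  finally show ?thesis .
qed

text \<open>Since \<alpha> - 3 = -1 - 2 (1 - \<alpha>/2), this is the weight of the Slobodeckij
  seminorm of order 1 - \<alpha>/2 as a function of the distance.\<close>

definition slob_weight :: "real \<Rightarrow> real \<Rightarrow> real" where
  "slob_weight \<alpha> r = (if 0 < r then r powr (\<alpha> - 3) else 0)"

lemma slob_weight_measurable [measurable]: "slob_weight \<alpha> \<in> borel_measurable borel"
  unfolding slob_weight_def[abs_def] by measurable

lemma nn_integral_slob_window:
  assumes "0 < \<alpha>" "\<alpha> < 1" "a \<noteq> b"
  shows "(\<integral>\<^sup>+r. \<integral>\<^sup>+s. ennreal (slob_weight \<alpha> r * (indicator {s<..<s+r} a * indicator {s<..<s+r} b)) \<partial>lborel \<partial>lborel)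
    = ennreal (\<bar>a - b\<bar> powr (\<alpha> - 1) / ((1 - \<alpha>) * (2 - \<alpha>)))"
proof -
  have "(\<integral>\<^sup>+s. ennreal (slob_weight \<alpha> r * (indicator {s<..<s+r} a * indicator {s<..<s+r} b)) \<partial>lborel)
    = ennreal (r powr (\<alpha> - 3) * (r - \<bar>a - b\<bar>)) * indicator {\<bar>a - b\<bar>..} r" for r
  proof -
    have "(\<integral>\<^sup>+s. ennreal (slob_weight \<alpha> r * (indicator {s<..<s+r} a * indicator {s<..<s+r} b)) \<partial>lborel)
      = (\<integral>\<^sup>+s. ennreal (slob_weight \<alpha> r) * indicator {max a b - r<..<min a b} s \<partial>lborel)"
      by (intro nn_integral_cong) (auto simp: indicator_def)
    also have "\<dots> = ennreal (slob_weight \<alpha> r) * emeasure lborel {max a b - r<..<min a b}"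
      by (subst nn_integral_cmult_indicator) auto
    also have "\<dots> = ennreal (r powr (\<alpha> - 3) * (r - \<bar>a - b\<bar>)) * indicator {\<bar>a - b\<bar>..} r"
    proof (cases "r \<ge> \<bar>a - b\<bar>")
      case True
      then have "max a b - r \<le> min a b" "min a b - (max a b - r) = r - \<bar>a - b\<bar>" "0 < r" using assms(3) by auto
      then have "emeasure lborel {max a b - r<..<min a b} = ennreal (r - \<bar>a - b\<bar>)" by (simp only: emeasure_lborel_Ioo)
      then show ?thesis using True \<open>0 < r\<close> by (simp add: slob_weight_def ennreal_mult)
    next
      case False
      then have "{max a b - r<..<min a b} = {}" by auto
      then show ?thesis using False by simp
    qed
    finally show ?thesis .
  qed
  then show ?thesis using nn_integral_powr_kernel[OF assms(1,2), of "\<bar>a - b\<bar>"] assms(3) by simp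
qed

lemma AE_lborel_pair_neq: "AE q in (lborel :: (real \<times> real) measure). fst q \<noteq> snd q"
  unfolding lborel_prod[symmetric]
proof (rule lborel_pair.AE_pair_measure)
  show "{x \<in> space (lborel \<Otimes>\<^sub>M lborel). fst x \<noteq> snd x} \<in> sets (lborel \<Otimes>\<^sub>M lborel :: (real \<times> real) measure)"
    by measurable
  show "AE x in lborel. AE y in lborel. fst (x, y :: real) \<noteq> snd (x, y)"
  proof (rule AE_I2)
    fix x :: real
    show "AE y in lborel. fst (x, y) \<noteq> snd (x, y)"
      using AE_lborel_singleton[of x] by eventually_elim auto
  qed
qed

lemma (in pair_sigma_finite) integrable_product_pair:
  fixes f g :: "_ \<Rightarrow> real"
  assumes "integrable M1 f" "integrable M2 g"
  shows "integrable (M1 \<Otimes>\<^sub>M M2) (\<lambda>(a, b). f a * g b)"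
proof (rule integrable_pair_nn)
  have [measurable]: "f \<in> borel_measurable M1" "g \<in> borel_measurable M2" using assms by auto
  show "(\<lambda>(a, b). f a * g b) \<in> borel_measurable (M1 \<Otimes>\<^sub>M M2)" by measurable
  have "(\<integral>\<^sup>+x. \<integral>\<^sup>+y. ennreal \<bar>case (x, y) of (a, b) \<Rightarrow> f a * g b\<bar> \<partial>M2 \<partial>M1)
    = (\<integral>\<^sup>+x. ennreal \<bar>f x\<bar> \<partial>M1) * (\<integral>\<^sup>+x. ennreal \<bar>g x\<bar> \<partial>M2)"
    by (simp add: abs_mult ennreal_mult nn_integral_cmult nn_integral_multc)
  then show "(\<integral>\<^sup>+x. \<integral>\<^sup>+y. ennreal \<bar>case (x, y) of (a, b) \<Rightarrow> f a * g b\<bar> \<partial>M2 \<partial>M1) < \<infinity>"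
    using assms[THEN integrable_nn_finite] by (simp add: ennreal_mult_less_top)
qed

text \<open>Both sides are the integral of \<open>r\<^sup>\<alpha>\<^sup>-\<^sup>3 z(a) z(b)\<close> over all \<open>a, b\<close> in windows \<open>(s, s + r)\<close>.\<close>
lemma
  fixes \<alpha> T :: real
  assumes z: "z \<in> L2s T" and \<alpha>: "0 < \<alpha>" "\<alpha> < 1"
  defines "Q \<equiv> (\<integral>t. z t * cv T (pw T \<alpha>) z t \<partial>lborel)"
  shows cv_pw_nonneg: "0 \<le> Q"
    and energy_identity: "(\<integral>\<^sup>+s. \<integral>\<^sup>+r. ennreal (slob_weight \<alpha> r * (\<integral>x. indicator {s<..<s+r} x * z x \<partial>lborel)\<^sup>2) \<partial>lborel \<partial>lborel)
      = ennreal (2 * Gamma \<alpha> / ((1 - \<alpha>) * (2 - \<alpha>)) * Q)"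
proof -
  define \<kappa> where "\<kappa> = 1 / ((1 - \<alpha>) * (2 - \<alpha>))"
  have \<kappa>: "\<kappa> > 0" using \<alpha> by (simp add: \<kappa>_def)
  have G: "Gamma \<alpha> > 0" using \<alpha> by (auto intro: Gamma_real_pos)
  have zL: "z \<in> L1s T" by (rule L2s_L1s[OF z])
  have zI: "integrable lborel z" by (rule L1s_integrable[OF zL])
  have [measurable]: "z \<in> borel_measurable borel" using zL by (rule L1s_measurable)
  let ?p = "pw T \<alpha>"
  have pL: "?p \<in> L1s T" using \<alpha> by (intro pw_L1s)
  define w where "w = slob_weight \<alpha>"
  have w0: "0 \<le> w r" for r by (simp add: w_def slob_weight_def)
  have [measurable]: "w \<in> borel_measurable borel" by (simp add: w_def)
  define \<Phi> :: "(real \<times> real) \<times> (real \<times> real) \<Rightarrow> real" where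
    "\<Phi> = (\<lambda>((a, b), (s, r)). w r * (indicator {s<..<s+r} a * z a * (indicator {s<..<s+r} b * z b)))"
  have ind: "indicator {s<..<s+r} (a::real) = (if s < a \<and> a < s + r then 1 else (0::real))" for s r a
    by (simp add: indicator_def)
  have \<Phi>m: "\<Phi> \<in> borel_measurable ((borel \<Otimes>\<^sub>M borel) \<Otimes>\<^sub>M (borel \<Otimes>\<^sub>M borel))"
    unfolding \<Phi>_def ind case_prod_beta by measurable
  have \<Phi>m': "\<Phi> \<in> borel_measurable (lborel \<Otimes>\<^sub>M lborel)" 
    using \<Phi>m by (simp add: borel_prod lborel_prod)
  have zz: "integrable (lborel \<Otimes>\<^sub>M lborel) (\<lambda>(a, b). z a * ?p (a - b) * z b)"
  proof (rule lborel_pair.integrable_pair_nn)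
    have az: "(\<lambda>t. \<bar>z t\<bar>) \<in> L2s T" using z by (auto simp: L2s_def L1s_def sqi_def)
    have "(\<integral>\<^sup>+a. \<integral>\<^sup>+b. ennreal \<bar>z a * ?p (a - b) * z b\<bar> \<partial>lborel \<partial>lborel)
      = (\<integral>\<^sup>+a. ennreal (\<bar>z a\<bar> * cv T ?p (\<lambda>t. \<bar>z t\<bar>) a) \<partial>lborel)"
      using conv_AE_integrable[OF L1s_integrable[OF pL] L1s_integrable[OF L2s_L1s[OF az]]]
    proof (intro nn_integral_cong_AE, eventually_elim)
      case (elim a)
      have "(\<integral>\<^sup>+b. ennreal \<bar>z a * ?p (a - b) * z b\<bar> \<partial>lborel)
        = (\<integral>\<^sup>+b. ennreal (\<bar>z a\<bar> * (?p (a - b) * \<bar>z b\<bar>)) \<partial>lborel)"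
        using pw_nonneg[OF \<alpha>(1), of T] by (simp add: abs_mult mult.assoc)
      also have "\<dots> = ennreal (\<bar>z a\<bar> * conv ?p (\<lambda>t. \<bar>z t\<bar>) a)"
        using elim pw_nonneg[OF \<alpha>(1), of T] by (subst nn_integral_eq_integral) (auto simp: conv_def)
      also have "\<bar>z a\<bar> * conv ?p (\<lambda>t. \<bar>z t\<bar>) a = \<bar>z a\<bar> * cv T ?p (\<lambda>t. \<bar>z t\<bar>) a"
        using L1s_zero[OF zL, of a] by (auto simp: cv_def)
      finally show ?case .
    qed
    also have "\<dots> \<le> (\<integral>\<^sup>+a. ennreal \<bar>\<bar>z a\<bar> * cv T ?p (\<lambda>t. \<bar>z t\<bar>) a\<bar> \<partial>lborel)"
      by (intro nn_integral_mono ennreal_leI) simp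
    also have "\<dots> < \<infinity>"
      by (rule integrable_nn_finite[OF sqi_mult[OF L2s_sqi[OF az] L2s_sqi[OF cv_L2s[OF pL az]]]])
    finally show "(\<integral>\<^sup>+a. \<integral>\<^sup>+b. ennreal \<bar>case (a, b) of (a, b) \<Rightarrow> z a * ?p (a - b) * z b\<bar> \<partial>lborel \<partial>lborel) < \<infinity>"
      by simp
  qed measurable
  have zz': "integrable (lborel \<Otimes>\<^sub>M lborel) (\<lambda>(a, b). z a * ?p (b - a) * z b)"
    using lborel_pair.integrable_product_swap[OF zz] by (simp add: mult_ac case_prod_unfold)
  have Q1: "(\<integral>q. (case q of (a, b) \<Rightarrow> z a * ?p (a - b) * z b) \<partial>(lborel \<Otimes>\<^sub>M lborel)) = Q"
  proof -
    have "(\<integral>q. (case q of (a, b) \<Rightarrow> z a * ?p (a - b) * z b) \<partial>(lborel \<Otimes>\<^sub>M lborel))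
      = (\<integral>a. \<integral>b. z a * ?p (a - b) * z b \<partial>lborel \<partial>lborel)"
      using lborel_pair.integral_fst'[OF zz] by simp
    also have "\<dots> = Q"
      unfolding Q_def
    proof (intro Bochner_Integration.integral_cong refl)
      fix a
      have "(\<integral>b. z a * ?p (a - b) * z b \<partial>lborel) = z a * conv ?p z a"
        by (simp add: conv_def mult.assoc)
      then show "(\<integral>b. z a * ?p (a - b) * z b \<partial>lborel) = z a * cv T ?p z a"
        using L1s_zero[OF zL, of a] by (auto simp: cv_def)
    qed
    finally show ?thesis .
  qed
  have Q2: "(\<integral>q. (case q of (a, b) \<Rightarrow> z a * ?p (b - a) * z b) \<partial>(lborel \<Otimes>\<^sub>M lborel)) = Q"
    using lborel_pair.integral_product_swap[of "\<lambda>(a, b). z a * ?p (a - b) * z b"] zz Q1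
    by (simp add: mult_ac case_prod_unfold)
  \<comment> \<open>The one-sided kernel \<open>?p\<close> vanishes for arguments that are not
    positive, so the symmetric kernel is a multiple of \<open>?p (a - b)\<close> plus
    \<open>?p (b - a)\<close>. Each summand contributes Q, whence the factor 2.\<close>
  define K where "K = (\<lambda>(a, b). z a * z b * (\<kappa> * \<bar>a - b\<bar> powr (\<alpha> - 1)))"
  have Keq: "K = (\<lambda>q. \<kappa> * Gamma \<alpha> * ((case q of (a, b) \<Rightarrow> z a * ?p (a - b) * z b) + (case q of (a, b) \<Rightarrow> z a * ?p (b - a) * z b)))"
  proof
    fix q :: "real \<times> real"
    obtain a b where q: "q = (a, b)" by force
    have "z a * z b * \<bar>a - b\<bar> powr (\<alpha> - 1) = Gamma \<alpha> * (z a * ?p (a - b) * z b + z a * ?p (b - a) * z b)"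
    proof (cases "a \<in> {0<..<T} \<and> b \<in> {0<..<T}")
      case True
      then show ?thesis using G by (cases a b rule: linorder_cases) (auto simp: pw_def)
    qed (use L1s_zero[OF zL] in auto)
    then show "K q = \<kappa> * Gamma \<alpha> * ((case q of (a, b) \<Rightarrow> z a * ?p (a - b) * z b) + (case q of (a, b) \<Rightarrow> z a * ?p (b - a) * z b))"
      by (simp add: K_def q algebra_simps)
  qed
  have KI: "integrable (lborel \<Otimes>\<^sub>M lborel) K"
    unfolding Keq by (intro integrable_mult_right Bochner_Integration.integrable_add zz zz')
  have Kint: "(\<integral>q. K q \<partial>(lborel \<Otimes>\<^sub>M lborel)) = 2 * \<kappa> * Gamma \<alpha> * Q"
    unfolding Keq using zz zz' Q1 Q2 by simp
  have win: "(\<integral>\<^sup>+p. ennreal (case p of (s, r) \<Rightarrow> w r * (indicator {s<..<s+r} a * indicator {s<..<s+r} b)) \<partial>lborel)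
      = ennreal (\<kappa> * \<bar>a - b\<bar> powr (\<alpha> - 1))" if "a \<noteq> b" for a b :: real
  proof -
    have m: "(\<lambda>p. ennreal (case p of (s, r) \<Rightarrow> w r * (indicator {s<..<s+r} a * indicator {s<..<s+r} b)))
      \<in> borel_measurable (lborel \<Otimes>\<^sub>M lborel)"
      unfolding ind by measurable
    have "(\<integral>\<^sup>+p. ennreal (case p of (s, r) \<Rightarrow> w r * (indicator {s<..<s+r} a * indicator {s<..<s+r} b)) \<partial>lborel)
      = (\<integral>\<^sup>+r. \<integral>\<^sup>+s. ennreal (w r * (indicator {s<..<s+r} a * indicator {s<..<s+r} b)) \<partial>lborel \<partial>lborel)"
      unfolding lborel_prod[symmetric]
      by (subst lborel_pair.nn_integral_snd[symmetric]) (use m in \<open>simp_all add: case_prod_unfold\<close>)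
    then show ?thesis using nn_integral_slob_window[OF \<alpha> that] by (simp add: w_def \<kappa>_def)
  qed
  \<comment> \<open>Tonelli with the windows inside: the integral of |\<Phi>| over all windows is
    |K|. This is integrable because |z| and I^\<alpha> |z| are square integrable.\<close>
  have \<Phi>I: "integrable (lborel \<Otimes>\<^sub>M lborel) \<Phi>"
  proof (rule lborel_pair.integrable_pair_nn[OF \<Phi>m'])
    have "(\<integral>\<^sup>+q. \<integral>\<^sup>+p. ennreal \<bar>\<Phi> (q, p)\<bar> \<partial>lborel \<partial>lborel) = (\<integral>\<^sup>+q. ennreal \<bar>K q\<bar> \<partial>lborel)"
      using AE_lborel_pair_neq
    proof (intro nn_integral_cong_AE, eventually_elim)
      case (elim q)
      obtain a b where q: "q = (a, b)" by force
      have [measurable]: "(\<lambda>p. ennreal (case p of (s, r) \<Rightarrow> w r * (indicator {s<..<s+r} a * indicator {s<..<s+r} b)))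
        \<in> borel_measurable (borel :: (real \<times> real) measure)"
        unfolding ind borel_prod[symmetric] by measurable
      have "(\<integral>\<^sup>+p. ennreal \<bar>\<Phi> (q, p)\<bar> \<partial>lborel) = (\<integral>\<^sup>+p. ennreal \<bar>z a * z b\<bar> *
        ennreal (case p of (s, r) \<Rightarrow> w r * (indicator {s<..<s+r} a * indicator {s<..<s+r} b)) \<partial>lborel)"
        using w0 by (intro nn_integral_cong) (auto simp: q \<Phi>_def ennreal_mult[symmetric] abs_mult mult_ac split: prod.split)
      also have "\<dots> = ennreal \<bar>z a * z b\<bar> * ennreal (\<kappa> * \<bar>a - b\<bar> powr (\<alpha> - 1))"
        using elim win[of a b] by (subst nn_integral_cmult) (auto simp: q)
      also have "\<dots> = ennreal \<bar>K q\<bar>"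
        using \<kappa> by (simp add: K_def q abs_mult ennreal_mult[symmetric])
      finally show ?case .
    qed
    also have "\<dots> < \<infinity>" using integrable_nn_finite[OF KI] by (simp add: lborel_prod)
    finally show "(\<integral>\<^sup>+q. \<integral>\<^sup>+p. ennreal \<bar>\<Phi> (q, p)\<bar> \<partial>lborel \<partial>lborel) < \<infinity>" .
  qed
  have inner_q: "(\<integral>p. \<Phi> (q, p) \<partial>lborel) = K q" if "fst q \<noteq> snd q" for q
  proof -
    obtain a b where q: "q = (a, b)" by force
    have "(\<integral>p. \<Phi> (q, p) \<partial>lborel)
      = (\<integral>p. z a * z b * (case p of (s, r) \<Rightarrow> w r * (indicator {s<..<s+r} a * indicator {s<..<s+r} b)) \<partial>lborel)"
      by (intro Bochner_Integration.integral_cong) (auto simp: q \<Phi>_def mult_ac split: prod.split)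
    also have "\<dots> = z a * z b * (\<integral>p. (case p of (s, r) \<Rightarrow> w r * (indicator {s<..<s+r} a * indicator {s<..<s+r} b)) \<partial>lborel)"
      by (rule integral_mult_right_zero)
    also have "(\<integral>p. (case p of (s, r) \<Rightarrow> w r * (indicator {s<..<s+r} a * indicator {s<..<s+r} b)) \<partial>lborel)
      = \<kappa> * \<bar>a - b\<bar> powr (\<alpha> - 1)"
    proof -
      have m: "(\<lambda>p. (case p of (s, r) \<Rightarrow> w r * (indicator {s<..<s+r} a * indicator {s<..<s+r} b)))
        \<in> borel_measurable (lborel :: (real \<times> real) measure)"
      proof -
        have "(\<lambda>p. (case p of (s, r) \<Rightarrow> w r * (indicator {s<..<s+r} a * indicator {s<..<s+r} b)))
          \<in> borel_measurable (borel :: (real \<times> real) measure)"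
          unfolding ind borel_prod[symmetric] by measurable
        then show ?thesis by simp
      qed
      show ?thesis
        using win[of a b] that w0 \<kappa>
        by (subst integral_eq_nn_integral[OF m]) (auto simp: q split: prod.split)
    qed
    finally show ?thesis by (simp add: K_def q)
  qed
  \<comment> \<open>Over a fixed window the variables a and b separate, so the integrand in (s, r)
    is a weighted square. This is where the positivity of Q comes from.\<close>
  have inner_p: "(\<integral>q. \<Phi> (q, (s, r)) \<partial>lborel) = w r * (\<integral>x. indicator {s<..<s+r} x * z x \<partial>lborel)\<^sup>2" for s r
  proof -
    let ?f = "\<lambda>x. indicator {s<..<s+r} x * z x"
    have fI: "integrable lborel ?f" by (intro integrable_indicator_mult zI) auto
    have "(\<integral>q. \<Phi> (q, (s, r)) \<partial>lborel) = (\<integral>q. w r * (case q of (a, b) \<Rightarrow> ?f a * ?f b) \<partial>(lborel \<Otimes>\<^sub>M lborel))"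
      unfolding lborel_prod by (intro Bochner_Integration.integral_cong) (auto simp: \<Phi>_def)
    also have "\<dots> = w r * (\<integral>q. (case q of (a, b) \<Rightarrow> ?f a * ?f b) \<partial>(lborel \<Otimes>\<^sub>M lborel))"
      by (rule integral_mult_right_zero)
    also have "(\<integral>q. (case q of (a, b) \<Rightarrow> ?f a * ?f b) \<partial>(lborel \<Otimes>\<^sub>M lborel)) = (\<integral>a. \<integral>b. ?f a * ?f b \<partial>lborel \<partial>lborel)"
      using lborel_pair.integral_fst'[OF lborel_pair.integrable_product_pair[OF fI fI]] by simp
    also have "\<dots> = (\<integral>x. ?f x \<partial>lborel)\<^sup>2"
      by (simp add: power2_eq_square)
    finally show ?thesis .
  qed
  let ?P = "\<lambda>p. (case p of (s, r) \<Rightarrow> w r * (\<integral>x. indicator {s<..<s+r} x * z x \<partial>lborel)\<^sup>2)"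
  have swap: "integrable (lborel \<Otimes>\<^sub>M lborel) (\<lambda>(p, q). \<Phi> (q, p))"
    using lborel_pair.integrable_product_swap[OF \<Phi>I] .
  have PI: "integrable lborel ?P"
  proof -
    have "(\<lambda>p. \<integral>q. \<Phi> (q, p) \<partial>lborel) = ?P" by (auto simp: fun_eq_iff inner_p split: prod.split)
    then show ?thesis using lborel_pair.integrable_fst'[OF swap] by simp
  qed
  have "(\<integral>p. ?P p \<partial>lborel) = (\<integral>p. \<integral>q. \<Phi> (q, p) \<partial>lborel \<partial>lborel)"
    using inner_p by (intro Bochner_Integration.integral_cong) auto
  also have "\<dots> = (\<integral>q. \<integral>p. \<Phi> (q, p) \<partial>lborel \<partial>lborel)"
    using lborel_pair.Fubini_integral[of "\<lambda>q p. \<Phi> (q, p)"] \<Phi>I by simp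
  also have "\<dots> = (\<integral>q. K q \<partial>lborel)"
  proof (rule integral_cong_AE)
    show "(\<lambda>q. \<integral>p. \<Phi> (q, p) \<partial>lborel) \<in> borel_measurable lborel"
      using lborel_pair.integrable_fst'[OF \<Phi>I] by simp
    show "K \<in> borel_measurable lborel" using KI by (simp add: lborel_prod)
    show "AE q in lborel. (\<integral>p. \<Phi> (q, p) \<partial>lborel) = K q"
      using AE_lborel_pair_neq by eventually_elim (rule inner_q)
  qed
  finally have eq: "(\<integral>p. ?P p \<partial>lborel) = 2 * \<kappa> * Gamma \<alpha> * Q" using Kint by (simp add: lborel_prod)
  have P0: "0 \<le> ?P p" for p using w0 by (auto split: prod.split)
  have "0 \<le> 2 * \<kappa> * Gamma \<alpha> * Q" using eq P0 by (metis (no_types, lifting) Bochner_Integration.integral_nonneg)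
  then show "0 \<le> Q"
    using mult_pos_neg[of "2 * \<kappa> * Gamma \<alpha>" Q] mult_pos_pos[OF \<kappa> G] by (cases "0 \<le> Q") auto
  have "(\<integral>\<^sup>+p. ennreal (?P p) \<partial>(lborel \<Otimes>\<^sub>M lborel)) = ennreal (2 * \<kappa> * Gamma \<alpha> * Q)"
    unfolding lborel_prod using nn_integral_eq_integral[OF PI] P0 eq by simp
  moreover have "(\<lambda>p. ennreal (?P p)) \<in> borel_measurable (lborel \<Otimes>\<^sub>M lborel)"
    using PI by (simp add: lborel_prod)
  ultimately have "(\<integral>\<^sup>+s. \<integral>\<^sup>+r. ennreal (?P (s, r)) \<partial>lborel \<partial>lborel) = ennreal (2 * \<kappa> * Gamma \<alpha> * Q)"
    by (subst lborel.nn_integral_fst) auto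
  then show "(\<integral>\<^sup>+s. \<integral>\<^sup>+r. ennreal (slob_weight \<alpha> r * (\<integral>x. indicator {s<..<s+r} x * z x \<partial>lborel)\<^sup>2) \<partial>lborel \<partial>lborel)
      = ennreal (2 * Gamma \<alpha> / ((1 - \<alpha>) * (2 - \<alpha>)) * Q)"
    by (simp add: w_def \<kappa>_def mult_ac)
qed

text \<open>For 0 < s < s + r < T the integral of z over the window (s, s + r) is y(s + r) - y(s).
  The pairs with s < t thus form the part of the energy that belongs to windows inside (0, T), and
  dropping the other windows leaves an inequality. Symmetry in t and s doubles the constant.\<close>

lemma slobodeckij_le_energy:
  fixes \<alpha> T :: real
  assumes z: "z \<in> L2s T" and \<alpha>: "0 < \<alpha>" "\<alpha> < 1"
  defines "y \<equiv> cv T (pw T 1) z"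
  shows "(\<integral>\<^sup>+t. \<integral>\<^sup>+s. ennreal (indicator {0<..<T} t * indicator {0<..<T} s *
      ((y t - y s)\<^sup>2 * \<bar>t - s\<bar> powr (\<alpha> - 3))) \<partial>lborel \<partial>lborel)
    \<le> ennreal (4 * Gamma \<alpha> / ((1 - \<alpha>) * (2 - \<alpha>)) * (\<integral>t. z t * cv T (pw T \<alpha>) z t \<partial>lborel))"
proof -
  have zL: "z \<in> L1s T" by (rule L2s_L1s[OF z])
  have [measurable]: "z \<in> borel_measurable borel" using zL by (rule L1s_measurable)
  have [measurable]: "y \<in> borel_measurable borel"
    unfolding y_def by (rule L1s_measurable[OF cv_L1s[OF pw_L1s zL]]) simp
  define f where "f t s = ennreal (indicator {0<..<T} t * indicator {0<..<T} s *
      ((y t - y s)\<^sup>2 * \<bar>t - s\<bar> powr (\<alpha> - 3)))" for t s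
  have [measurable]: "(\<lambda>(t, s). f t s) \<in> borel_measurable (borel \<Otimes>\<^sub>M borel)"
    unfolding f_def by measurable
  have sym: "f t s = f s t" for t s by (simp add: f_def power2_commute abs_minus_commute mult.commute)
  define A where "A = (\<integral>\<^sup>+s. \<integral>\<^sup>+t. f t s * (if s < t then 1 else 0) \<partial>lborel \<partial>lborel)"
  have "(\<integral>\<^sup>+t. \<integral>\<^sup>+s. f t s \<partial>lborel \<partial>lborel)
    = (\<integral>\<^sup>+t. (\<integral>\<^sup>+s. f t s * (if s < t then 1 else 0) \<partial>lborel) + (\<integral>\<^sup>+s. f t s * (if t < s then 1 else 0) \<partial>lborel) \<partial>lborel)"
  proof (intro nn_integral_cong)
    fix t
    have "f t s = f t s * (if s < t then 1 else 0) + f t s * (if t < s then 1 else 0)" for s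
      by (cases s t rule: linorder_cases) (auto simp: f_def)
    then show "(\<integral>\<^sup>+s. f t s \<partial>lborel)
      = (\<integral>\<^sup>+s. f t s * (if s < t then 1 else 0) \<partial>lborel) + (\<integral>\<^sup>+s. f t s * (if t < s then 1 else 0) \<partial>lborel)"
      by (subst nn_integral_add[symmetric]) auto
  qed
  also have "\<dots> = (\<integral>\<^sup>+t. \<integral>\<^sup>+s. f t s * (if s < t then 1 else 0) \<partial>lborel \<partial>lborel)
      + (\<integral>\<^sup>+t. \<integral>\<^sup>+s. f t s * (if t < s then 1 else 0) \<partial>lborel \<partial>lborel)"
    by (rule nn_integral_add) measurable
  also have "(\<integral>\<^sup>+t. \<integral>\<^sup>+s. f t s * (if s < t then 1 else 0) \<partial>lborel \<partial>lborel) = A"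
    unfolding A_def by (rule lborel_pair.Fubini') measurable
  also have "(\<integral>\<^sup>+t. \<integral>\<^sup>+s. f t s * (if t < s then 1 else 0) \<partial>lborel \<partial>lborel) = A"
    unfolding A_def by (subst sym) simp
  also have "A \<le> (\<integral>\<^sup>+s. \<integral>\<^sup>+r. ennreal (slob_weight \<alpha> r * (\<integral>x. indicator {s<..<s+r} x * z x \<partial>lborel)\<^sup>2) \<partial>lborel \<partial>lborel)"
    unfolding A_def
  proof (rule nn_integral_mono)
    fix s
    have "(\<integral>\<^sup>+t. f t s * (if s < t then 1 else 0) \<partial>lborel)
      = (\<integral>\<^sup>+r. f (r + s) s * (if s < r + s then 1 else 0) \<partial>lborel)"
      using nn_integral_shift(1)[of "\<lambda>t. f t s * (if s < t then 1 else 0)" "-s"] by simp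
    also have "\<dots> \<le> (\<integral>\<^sup>+r. ennreal (slob_weight \<alpha> r * (\<integral>x. indicator {s<..<s+r} x * z x \<partial>lborel)\<^sup>2) \<partial>lborel)"
    proof (intro nn_integral_mono)
      fix r
      show "f (r + s) s * (if s < r + s then 1 else 0)
        \<le> ennreal (slob_weight \<alpha> r * (\<integral>x. indicator {s<..<s+r} x * z x \<partial>lborel)\<^sup>2)"
      proof (cases "0 < s \<and> 0 < r \<and> r + s < T")
        case True
        have "y (r + s) - y s = (\<integral>x. indicator {s..<r+s} x * z x \<partial>lborel)"
          unfolding y_def using True by (intro cv_pw_1_diff[OF zL]) auto
        also have "\<dots> = (\<integral>x. indicator {s<..<s+r} x * z x \<partial>lborel)"
          using AE_lborel_singleton[of s]
          by (intro integral_cong_AE) (auto simp: indicator_def add.commute elim!: eventually_mono)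
        finally show ?thesis using True by (simp add: f_def slob_weight_def mult.commute)
      qed (auto simp: f_def)
    qed
    finally show "(\<integral>\<^sup>+t. f t s * (if s < t then 1 else 0) \<partial>lborel)
      \<le> (\<integral>\<^sup>+r. ennreal (slob_weight \<alpha> r * (\<integral>x. indicator {s<..<s+r} x * z x \<partial>lborel)\<^sup>2) \<partial>lborel)" .
  qed
  also have "\<dots> = ennreal (2 * Gamma \<alpha> / ((1 - \<alpha>) * (2 - \<alpha>)) * (\<integral>t. z t * cv T (pw T \<alpha>) z t \<partial>lborel))"
    by (rule energy_identity[OF z \<alpha>])
  finally have "(\<integral>\<^sup>+t. \<integral>\<^sup>+s. f t s \<partial>lborel \<partial>lborel) \<le>
    ennreal (2 * Gamma \<alpha> / ((1 - \<alpha>) * (2 - \<alpha>)) * (\<integral>t. z t * cv T (pw T \<alpha>) z t \<partial>lborel))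
    + ennreal (2 * Gamma \<alpha> / ((1 - \<alpha>) * (2 - \<alpha>)) * (\<integral>t. z t * cv T (pw T \<alpha>) z t \<partial>lborel))"
    by (simp add: add_mono)
  also have "\<dots> = ennreal (4 * Gamma \<alpha> / ((1 - \<alpha>) * (2 - \<alpha>)) * (\<integral>t. z t * cv T (pw T \<alpha>) z t \<partial>lborel))"
  proof -
    have "0 \<le> 2 * Gamma \<alpha> / ((1 - \<alpha>) * (2 - \<alpha>)) * (\<integral>t. z t * cv T (pw T \<alpha>) z t \<partial>lborel)"
      using cv_pw_nonneg[OF z \<alpha>] \<alpha> Gamma_real_pos[OF \<alpha>(1)] by (intro mult_nonneg_nonneg divide_nonneg_pos) auto
    then show ?thesis by (subst ennreal_plus[symmetric]) (auto simp flip: distrib_right add_divide_distrib)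
  qed
  finally show ?thesis by (simp add: f_def)
qed

section \<open>Regularity for the scalar Volterra equation\<close>

lemma cv_cmult: "cv T p (\<lambda>s. c * q s) = (\<lambda>t. c * cv T p q t)"
proof -
  have "conv p (\<lambda>s. c * q s) t = c * conv p q t" for t
  proof -
    have "conv p (\<lambda>s. c * q s) t = (\<integral>s. c * (p (t - s) * q s) \<partial>lborel)"
      unfolding conv_def by (intro Bochner_Integration.integral_cong) (auto simp: mult_ac)
    then show ?thesis by (simp add: conv_def)
  qed
  then show ?thesis by (auto simp: cv_def fun_eq_iff)
qed

lemma cv_pw_pw_AE:
  assumes "0 < a" "0 < b" "q \<in> L1s T"
  shows "AE t in lborel. cv T (pw T a) (cv T (pw T b) q) t = cv T (pw T (a + b)) q t"
  using cv_assoc_AE[OF pw_L1s[OF assms(1)] pw_L1s[OF assms(2)] assms(3)] cv_pw_pw[OF assms(1,2), of T] by simp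

text \<open>Since \<open>2\<alpha> > 1\<close>, inserting the equation once into itself exhibits \<open>u\<close> as the primitive of a
  square integrable \<open>z\<close>, and \<open>z\<close> solves \<open>z + \<mu> I\<^sup>\<alpha> z = k\<close>.\<close>
lemma volterra_regularity:
  fixes \<alpha> T \<mu> :: real
  assumes \<alpha>: "1/2 < \<alpha>" "\<alpha> < 1" and \<mu>: "0 < \<mu>" and u: "u \<in> L2s T" and k: "k \<in> L2s T"
    and eq: "AE t in lborel. u t + \<mu> * cv T (pw T \<alpha>) u t = cv T (pw T 1) k t"
  obtains z where "z \<in> L2s T" "AE t in lborel. u t = cv T (pw T 1) z t"
    "(\<integral>t. (z t)\<^sup>2 \<partial>lborel) \<le> (\<integral>t. (k t)\<^sup>2 \<partial>lborel)"
    "\<mu> * (\<integral>t. z t * cv T (pw T \<alpha>) z t \<partial>lborel) \<le> (\<integral>t. (k t)\<^sup>2 \<partial>lborel)"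
    "\<mu>\<^sup>2 * (\<integral>t. (u t)\<^sup>2 \<partial>lborel) \<le> 4 * (\<integral>t. \<bar>pw T (1 - \<alpha>) t\<bar> \<partial>lborel)\<^sup>2 * (\<integral>t. (k t)\<^sup>2 \<partial>lborel)"
proof -
  note uL = L2s_L1s[OF u] and kL = L2s_L1s[OF k]
  let ?I = "\<lambda>a. cv T (pw T a)"
  have IL: "?I a q \<in> L1s T" if "q \<in> L1s T" "0 < a" for a q using that by (intro cv_L1s pw_L1s)
  have I2: "?I a q \<in> L2s T" if "q \<in> L2s T" "0 < a" for a q using that by (intro cv_L2s pw_L1s)
  have lin: "AE t in lborel. ?I a (\<lambda>s. c * p s + d * q s) t = c * ?I a p t + d * ?I a q t"
    if "0 < a" "p \<in> L1s T" "q \<in> L1s T" for a c d p q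
    using that by (intro cv_linear_AE pw_L1s)
  \<comment> \<open>With the next line, z is the term by term derivative of I^1 k - \<mu> I^(1 +
    \<alpha>) k + \<mu>^2 I^(2 \<alpha>) u.\<close>
  define r where "r s = k s + (- \<mu>) * ?I \<alpha> k s" for s
  define z where "z s = r s + \<mu>\<^sup>2 * ?I (2 * \<alpha> - 1) u s" for s
  have r2: "r \<in> L2s T" unfolding r_def using \<alpha> by (intro L2s_add L2s_cmult I2 k) auto
  have z2: "z \<in> L2s T" unfolding z_def using \<alpha> by (intro L2s_add L2s_cmult I2 r2 u) auto
  note zL = L2s_L1s[OF z2] and rL = L2s_L1s[OF r2]
  define g where "g s = ?I 1 k s + (- \<mu>) * ?I \<alpha> u s" for s
  have gL: "g \<in> L1s T" unfolding g_def using \<alpha> by (intro L1s_add L1s_cmult IL uL kL) auto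
  have ug: "AE t in lborel. u t = g t" using eq by eventually_elim (simp add: g_def)
  have Iug: "?I \<alpha> u = ?I \<alpha> g"
    by (rule cv_cong_AE[OF L1s_measurable[OF uL] L1s_measurable[OF gL] pw_measurable ug])
  have a1: "AE t in lborel. ?I \<alpha> g t = ?I \<alpha> (?I 1 k) t + (- \<mu>) * ?I \<alpha> (?I \<alpha> u) t"
    unfolding g_def using \<alpha> lin[of \<alpha> "?I 1 k" "?I \<alpha> u" 1 "-\<mu>"] IL[OF uL] IL[OF kL] by simp
  have a2: "AE t in lborel. ?I \<alpha> (?I 1 k) t = ?I (\<alpha> + 1) k t" using \<alpha> by (intro cv_pw_pw_AE kL) auto
  have a3: "AE t in lborel. ?I \<alpha> (?I \<alpha> u) t = ?I (\<alpha> + \<alpha>) u t" using \<alpha> by (intro cv_pw_pw_AE uL) auto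
  have b1: "AE t in lborel. ?I 1 z t = ?I 1 r t + \<mu>\<^sup>2 * ?I 1 (?I (2 * \<alpha> - 1) u) t"
    unfolding z_def[abs_def] using \<alpha> lin[of 1 r "?I (2 * \<alpha> - 1) u" 1 "\<mu>\<^sup>2"] rL IL[OF uL] by simp
  have b2: "AE t in lborel. ?I 1 r t = ?I 1 k t + (- \<mu>) * ?I 1 (?I \<alpha> k) t"
    unfolding r_def[abs_def] using \<alpha> lin[of 1 k "?I \<alpha> k" 1 "-\<mu>"] kL IL[OF kL] by simp
  have b3: "AE t in lborel. ?I 1 (?I (2 * \<alpha> - 1) u) t = ?I (\<alpha> + \<alpha>) u t"
    using \<alpha> cv_pw_pw_AE[of 1 "2 * \<alpha> - 1" u T] uL by simp
  have b4: "AE t in lborel. ?I 1 (?I \<alpha> k) t = ?I (\<alpha> + 1) k t"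
    using \<alpha> cv_pw_pw_AE[of 1 \<alpha> k T] kL by (simp add: add.commute)
  have uz: "AE t in lborel. u t = ?I 1 z t"
    using ug a1 a2 a3 b1 b2 b3 b4
  proof eventually_elim
    case (elim t)
    have 1: "u t = ?I 1 k t + (- \<mu>) * ?I \<alpha> u t" using elim(1) by (simp only: g_def)
    have 2: "?I \<alpha> u t = ?I (\<alpha> + 1) k t + (- \<mu>) * ?I (\<alpha> + \<alpha>) u t"
      using elim(2-4) by (simp only: Iug[THEN fun_cong])
    have 3: "?I 1 z t = ?I 1 k t + (- \<mu>) * ?I (\<alpha> + 1) k t + \<mu>\<^sup>2 * ?I (\<alpha> + \<alpha>) u t"
      using elim(5-8) by (simp only:)
    show ?case unfolding 3 1 2 by (simp add: power2_eq_square algebra_simps)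
  qed
  have Iuz: "?I \<alpha> u = ?I \<alpha> (?I 1 z)"
    by (rule cv_cong_AE[OF L1s_measurable[OF uL] L1s_measurable[OF IL[OF zL zero_less_one]] pw_measurable uz])
  have c1: "AE t in lborel. ?I \<alpha> (?I 1 z) t = ?I (\<alpha> + 1) z t" using \<alpha> by (intro cv_pw_pw_AE zL) auto
  have c2: "AE t in lborel. ?I 1 (?I \<alpha> z) t = ?I (\<alpha> + 1) z t"
    using \<alpha> cv_pw_pw_AE[of 1 \<alpha> z T] zL by (simp add: add.commute)
  have c3: "AE t in lborel. ?I 1 (\<lambda>s. z s + \<mu> * ?I \<alpha> z s) t = ?I 1 z t + \<mu> * ?I 1 (?I \<alpha> z) t"
    using \<alpha> lin[of 1 z "?I \<alpha> z" 1 \<mu>] zL IL[OF zL] by simp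
  \<comment> \<open>Since I^1 and I^\<alpha> commute, the equation for u = I^1 z is I^1 applied to
    the equation for z, and I^1 is injective.\<close>
  have "AE t in lborel. ?I 1 (\<lambda>s. z s + \<mu> * ?I \<alpha> z s) t = ?I 1 k t"
    using c1 c2 c3 uz eq by eventually_elim (simp add: Iuz)
  then have zk: "AE t in lborel. z t + \<mu> * ?I \<alpha> z t = k t"
    using \<alpha> by (intro cv_pw_1_injective'[OF _ kL] L1s_add zL L1s_cmult IL) auto
  let ?Q = "\<integral>t. z t * ?I \<alpha> z t \<partial>lborel"
  let ?Z = "\<integral>t. (z t)\<^sup>2 \<partial>lborel" and ?K = "\<integral>t. (k t)\<^sup>2 \<partial>lborel"
  have Q0: "0 \<le> ?Q" using \<alpha> by (intro cv_pw_nonneg z2) auto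
  note sq = L2s_sqi[OF z2] L2s_sqi[OF k] L2s_sqi[OF I2[OF z2, of \<alpha>]]
  \<comment> \<open>The equation for z multiplied by z and integrated. Both terms on the left are
    nonnegative, so each of them is bounded by the right-hand side.\<close>
  have test: "?Z + \<mu> * ?Q = (\<integral>t. k t * z t \<partial>lborel)"
  proof -
    have "?Z + \<mu> * ?Q = (\<integral>t. (z t)\<^sup>2 + \<mu> * (z t * ?I \<alpha> z t) \<partial>lborel)"
      using sq \<alpha> sqi_mult[of z lborel "?I \<alpha> z"] by (subst Bochner_Integration.integral_add) (auto simp: sqi_integrable)
    also have "\<dots> = (\<integral>t. k t * z t \<partial>lborel)"
    proof (rule integral_cong_AE)
      show "AE t in lborel. (z t)\<^sup>2 + \<mu> * (z t * ?I \<alpha> z t) = k t * z t"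
        using zk
      proof eventually_elim
        case (elim t)
        show ?case unfolding elim[symmetric] by (simp add: power2_eq_square algebra_simps)
      qed
    qed (use sq \<alpha> in \<open>auto intro!: borel_measurable_add borel_measurable_times borel_measurable_power dest!: sqi_measurable\<close>)
    finally show ?thesis .
  qed
  have CS: "(\<integral>t. k t * z t \<partial>lborel) \<le> sqrt ?K * sqrt ?Z"
    using sqi_CS[OF sq(2,1)] by simp
  have K0: "0 \<le> ?K" "0 \<le> ?Z" by auto
  have ZK': "sqrt ?Z \<le> sqrt ?K"
  proof (rule ccontr)
    assume *: "\<not> sqrt ?Z \<le> sqrt ?K"
    then have "?K < ?Z" by simp
    moreover from this have "0 < ?Z" using K0 by linarith
    ultimately have "sqrt ?K * sqrt ?Z < sqrt ?Z * sqrt ?Z"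
      by (intro mult_strict_right_mono) auto
    moreover have "?Z \<le> sqrt ?K * sqrt ?Z" using test CS Q0 \<mu> mult_nonneg_nonneg[of \<mu> ?Q] by linarith
    ultimately show False using K0 by simp
  qed
  then have ZK: "?Z \<le> ?K" by simp
  have "\<mu> * ?Q \<le> sqrt ?K * sqrt ?Z" using test CS K0 by linarith
  also have "\<dots> \<le> sqrt ?K * sqrt ?K" using ZK' K0 by (intro mult_left_mono) auto
  finally have QK: "\<mu> * ?Q \<le> ?K" using K0 by simp
  \<comment> \<open>Here \<mu> I^\<alpha> z = k - z has norm at most twice that of k, and u = I^(1 -
    \<alpha>) I^\<alpha> z. Young's inequality for I^(1 - \<alpha>) then bounds \<mu> u by a
    constant free of \<mu>.\<close>
  have muU: "\<mu>\<^sup>2 * (\<integral>t. (u t)\<^sup>2 \<partial>lborel) \<le> 4 * (\<integral>t. \<bar>pw T (1 - \<alpha>) t\<bar> \<partial>lborel)\<^sup>2 * ?K"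
  proof -
    let ?d = "\<lambda>t. k t - z t"
    have d2: "?d \<in> L2s T" by (intro L2s_diff k z2)
    have "AE t in lborel. \<mu> * ?I \<alpha> z t = ?d t" using zk by eventually_elim simp
    then have "?I (1 - \<alpha>) (\<lambda>t. \<mu> * ?I \<alpha> z t) = ?I (1 - \<alpha>) ?d"
      using \<alpha> by (intro cv_cong_AE L1s_measurable[OF L1s_cmult[OF IL[OF zL]]] L1s_measurable[OF L2s_L1s[OF d2]] pw_measurable) auto
    then have e: "\<mu> * ?I (1 - \<alpha>) (?I \<alpha> z) t = ?I (1 - \<alpha>) ?d t" for t
      unfolding cv_cmult by (rule fun_cong)
    have "AE t in lborel. ?I (1 - \<alpha>) (?I \<alpha> z) t = ?I (1 - \<alpha> + \<alpha>) z t" using \<alpha> by (intro cv_pw_pw_AE zL) auto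
    then have ud: "AE t in lborel. \<mu> * u t = ?I (1 - \<alpha>) ?d t"
      using uz by eventually_elim (simp add: e[symmetric])
    have "\<mu>\<^sup>2 * (\<integral>t. (u t)\<^sup>2 \<partial>lborel) = (\<integral>t. (\<mu> * u t)\<^sup>2 \<partial>lborel)" by (simp add: power_mult_distrib)
    also have "\<dots> = (\<integral>t. (?I (1 - \<alpha>) ?d t)\<^sup>2 \<partial>lborel)"
      using ud L1s_measurable[OF uL] L1s_measurable[OF IL[OF L2s_L1s[OF d2]], of "1 - \<alpha>"] \<alpha>
      by (intro integral_cong_AE) (auto elim!: eventually_mono)
    also have "\<dots> \<le> (\<integral>t. \<bar>pw T (1 - \<alpha>) t\<bar> \<partial>lborel)\<^sup>2 * (\<integral>t. (?d t)\<^sup>2 \<partial>lborel)"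
      using \<alpha> by (intro cv_L2_le d2 pw_L1s) auto
    also have "(\<integral>t. (?d t)\<^sup>2 \<partial>lborel) \<le> 4 * ?K"
    proof -
      have "sqrt (\<integral>t. (k t + - z t)\<^sup>2 \<partial>lborel) \<le> sqrt ?K + sqrt (\<integral>t. (- z t)\<^sup>2 \<partial>lborel)"
        by (rule sqi_Minkowski[OF sq(2) sqi_uminus[OF sq(1)]])
      then have "sqrt (\<integral>t. (?d t)\<^sup>2 \<partial>lborel) \<le> sqrt ?K + sqrt ?Z" by simp
      then have "sqrt (\<integral>t. (?d t)\<^sup>2 \<partial>lborel) \<le> 2 * sqrt ?K" using ZK' by linarith
      also have "\<dots> = sqrt (4 * ?K)" by (simp add: real_sqrt_mult)
      finally show ?thesis by simp
    qed
    then have "(\<integral>t. \<bar>pw T (1 - \<alpha>) t\<bar> \<partial>lborel)\<^sup>2 * (\<integral>t. (?d t)\<^sup>2 \<partial>lborel)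
      \<le> (\<integral>t. \<bar>pw T (1 - \<alpha>) t\<bar> \<partial>lborel)\<^sup>2 * (4 * ?K)" by (intro mult_left_mono) auto
    finally show ?thesis by (simp add: mult_ac)
  qed
  show ?thesis using that[OF z2 uz ZK QK muU] .
qed

section \<open>Fractional Hardy inequality\<close>

lemma ennreal_le_plusI: "a \<le> b + c \<Longrightarrow> 0 \<le> b \<Longrightarrow> 0 \<le> c \<Longrightarrow> ennreal a \<le> ennreal b + ennreal c"
  by (metis ennreal_leI ennreal_plus)

lemma nn_integral_split3:
  fixes f h :: "real \<Rightarrow> real \<Rightarrow> ennreal"
  assumes [measurable]: "(\<lambda>(t, s). f t s) \<in> borel_measurable (borel \<Otimes>\<^sub>M borel)"
    "(\<lambda>(t, s). h t s) \<in> borel_measurable (borel \<Otimes>\<^sub>M borel)" "n \<in> borel_measurable borel"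
  shows "(\<integral>\<^sup>+t. (\<integral>\<^sup>+s. C * f t s + h t s \<partial>lborel) + D * n t \<partial>lborel)
    = C * (\<integral>\<^sup>+t. \<integral>\<^sup>+s. f t s \<partial>lborel \<partial>lborel) + (\<integral>\<^sup>+t. \<integral>\<^sup>+s. h t s \<partial>lborel \<partial>lborel) + D * (\<integral>\<^sup>+t. n t \<partial>lborel)"
  by (simp add: nn_integral_add nn_integral_cmult)

definition slob :: "real \<Rightarrow> real \<Rightarrow> (real \<Rightarrow> real) \<Rightarrow> ennreal" where
  "slob T \<gamma> g = (\<integral>\<^sup>+t. \<integral>\<^sup>+s. ennreal (indicator {0<..<T} t * indicator {0<..<T} s *
      ((g t - g s)\<^sup>2 * \<bar>t - s\<bar> powr (- 1 - 2 * \<gamma>))) \<partial>lborel \<partial>lborel)"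

text \<open>The cutoff \<delta> > 0 makes the integral finite for every square integrable g, so that
  it may be absorbed into the left-hand side of an inequality. The case \<delta> = 0 is the Hardy
  integral itself.\<close>

definition hardy_int :: "real \<Rightarrow> real \<Rightarrow> (real \<Rightarrow> real) \<Rightarrow> real \<Rightarrow> ennreal" where
  "hardy_int T \<gamma> g \<delta> = (\<integral>\<^sup>+t. ennreal (indicator {\<delta><..<T} t * ((g t)\<^sup>2 * t powr (- 2 * \<gamma>))) \<partial>lborel)"

text \<open>Compare \<open>g(t)\<close> with its values on \<open>(\<kappa>t, 2\<kappa>t)\<close>; for large \<open>\<kappa>\<close> the averaged values reproduce at
  most half of the left-hand side, because \<open>2\<gamma> < 1\<close>.\<close>
lemma hardy_truncated:
  fixes g :: "real \<Rightarrow> real" and T \<gamma> \<delta> :: real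
  assumes [measurable]: "g \<in> borel_measurable borel" and T: "0 < T" and \<gamma>: "0 < \<gamma>" "\<gamma> < 1/2"
    and fin: "(\<integral>\<^sup>+t. ennreal ((g t)\<^sup>2) \<partial>lborel) < \<infinity>" and \<delta>: "0 < \<delta>"
  defines "\<kappa> \<equiv> 8 powr (1 / (1 - 2 * \<gamma>))"
  shows "hardy_int T \<gamma> g \<delta> \<le> ennreal (2 * (2 / \<kappa> * (2 * \<kappa>) powr (1 + 2 * \<gamma>))) * slob T \<gamma> g
    + ennreal (2 * (T / (2 * \<kappa>)) powr (- 2 * \<gamma>)) * (\<integral>\<^sup>+t. ennreal ((g t)\<^sup>2) \<partial>lborel)"
proof -
  let ?A = "hardy_int T \<gamma> g \<delta>" and ?N = "\<integral>\<^sup>+t. ennreal ((g t)\<^sup>2) \<partial>lborel"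
  have k1: "\<kappa> \<ge> 1" unfolding \<kappa>_def using \<gamma> by (intro ge_one_powr_ge_zero) auto
  \<comment> \<open>The averaged term comes back with the factor 2 * 2^(2 \<gamma>) * \<kappa>^(2
    \<gamma> - 1). As 2^(2 \<gamma>) \<le> 2, the value 1/8 of the last power leaves at most
    1/2.\<close>
  have kp: "\<kappa> powr (2 * \<gamma> - 1) = 1 / 8"
  proof -
    have "\<kappa> powr (2 * \<gamma> - 1) = 8 powr ((1 / (1 - 2 * \<gamma>)) * (2 * \<gamma> - 1))" by (simp add: \<kappa>_def powr_powr)
    also have "(1 / (1 - 2 * \<gamma>)) * (2 * \<gamma> - 1) = -1" using \<gamma> by (simp add: field_simps)
    finally show ?thesis by (simp add: powr_minus_divide)
  qed
  \<comment> \<open>For t < \<tau> the comparison interval (\<kappa> t, 2 \<kappa> t) stays inside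
    (0, T). For t \<ge> \<tau> the weight t^(-2 \<gamma>) is bounded by \<tau>^(-2 \<gamma>), and
    the L2 norm of g suffices.\<close>
  define \<tau> where "\<tau> = T / (2 * \<kappa>)"
  have \<tau>: "0 < \<tau>" "\<tau> \<le> T" using T k1 by (auto simp: \<tau>_def field_simps intro: order_trans[OF _ mult_left_mono])
  define C1 where "C1 = 2 / \<kappa> * (2 * \<kappa>) powr (1 + 2 * \<gamma>)"
  have C1: "C1 \<ge> 0" using k1 by (simp add: C1_def)
  have ind: "indicator {a<..<b} (x::real) = (if a < x \<and> x < b then 1 else (0::real))" for a b x
    by (simp add: indicator_def)
  let ?s = "\<lambda>t s. ennreal (indicator {0<..<T} t * indicator {0<..<T} s * ((g t - g s)\<^sup>2 * \<bar>t - s\<bar> powr (- 1 - 2 * \<gamma>)))"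
  let ?r = "\<lambda>t s. ennreal (indicator {\<delta><..<\<tau>} t * (indicator {\<kappa> * t<..<2 * \<kappa> * t} s * (2 / \<kappa> * t powr (- 1 - 2 * \<gamma>) * (g s)\<^sup>2)))"
  have [measurable]: "(\<lambda>(t, s). ?s t s) \<in> borel_measurable (borel \<Otimes>\<^sub>M borel)" unfolding ind by measurable
  have [measurable]: "(\<lambda>(t, s). ?r t s) \<in> borel_measurable (borel \<Otimes>\<^sub>M borel)" unfolding ind by measurable
  have fin_A: "?A < \<infinity>"
  proof -
    have "?A \<le> (\<integral>\<^sup>+t. ennreal (\<delta> powr (- 2 * \<gamma>)) * ennreal ((g t)\<^sup>2) \<partial>lborel)"
      unfolding hardy_int_def
    proof (rule nn_integral_mono)
      fix t
      have "t powr (- 2 * \<gamma>) \<le> \<delta> powr (- 2 * \<gamma>)" if "\<delta> < t"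
        using that \<delta> \<gamma> by (intro powr_mono2') auto
      then have "indicator {\<delta><..<T} t * ((g t)\<^sup>2 * t powr (- 2 * \<gamma>)) \<le> \<delta> powr (- 2 * \<gamma>) * (g t)\<^sup>2"
        by (auto simp: indicator_def mult.commute intro!: mult_left_mono)
      then show "ennreal (indicator {\<delta><..<T} t * ((g t)\<^sup>2 * t powr (- 2 * \<gamma>))) \<le> ennreal (\<delta> powr (- 2 * \<gamma>)) * ennreal ((g t)\<^sup>2)"
        by (subst ennreal_mult[symmetric]) (auto intro: ennreal_leI)
    qed
    also have "\<dots> = ennreal (\<delta> powr (- 2 * \<gamma>)) * ?N" by (rule nn_integral_cmult) measurable
    also have "\<dots> < \<infinity>" using fin by (simp add: ennreal_mult_less_top)
    finally show ?thesis .
  qed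
  have pt: "ennreal (indicator {\<delta><..<T} t * ((g t)\<^sup>2 * t powr (- 2 * \<gamma>)))
      \<le> (\<integral>\<^sup>+s. ennreal C1 * ?s t s + ?r t s \<partial>lborel) + ennreal (\<tau> powr (- 2 * \<gamma>)) * ennreal ((g t)\<^sup>2)" for t
  proof (cases "\<delta> < t \<and> t < \<tau>")
    case True
    then have t: "0 < t" "t < \<tau>" "\<delta> < t" using \<delta> by auto
    have 2: "2 * \<kappa> * t < T" using t k1 by (simp add: \<tau>_def field_simps)
    \<comment> \<open>The factor \<open>ennreal (\<kappa> * t)\<close> is the length of the
      comparison interval, so the left-hand side becomes an average over s of a quantity that is
      constant in s.\<close>
    have "ennreal (indicator {\<delta><..<T} t * ((g t)\<^sup>2 * t powr (- 2 * \<gamma>)))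
      = ennreal (1 / \<kappa> * t powr (- 1 - 2 * \<gamma>) * (g t)\<^sup>2) * ennreal (\<kappa> * t)"
    proof -
      have "t powr (- 2 * \<gamma>) = t powr (- 1 - 2 * \<gamma>) * t"
        using powr_mult_base[of t "-1 - 2 * \<gamma>"] t by (simp add: mult.commute)
      then show ?thesis using t \<tau> k1 by (simp add: ennreal_mult[symmetric] field_simps)
    qed
    also have "\<dots> = (\<integral>\<^sup>+s. ennreal (1 / \<kappa> * t powr (- 1 - 2 * \<gamma>) * (g t)\<^sup>2) * indicator {\<kappa> * t<..<2 * \<kappa> * t} s \<partial>lborel)"
      using k1 t by (subst nn_integral_cmult_indicator) auto
    also have "\<dots> \<le> (\<integral>\<^sup>+s. ennreal C1 * ?s t s + ?r t s \<partial>lborel)"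
    proof (rule nn_integral_mono)
      fix s
      show "ennreal (1 / \<kappa> * t powr (- 1 - 2 * \<gamma>) * (g t)\<^sup>2) * indicator {\<kappa> * t<..<2 * \<kappa> * t} s \<le> ennreal C1 * ?s t s + ?r t s"
      proof (cases "\<kappa> * t < s \<and> s < 2 * \<kappa> * t")
        case s: True
        have "1 * t \<le> \<kappa> * t" using k1 t by (intro mult_right_mono) auto
        then have ts: "t < s" using s by linarith
        have inU: "0 < s" "s < T" "0 < t" "t < T" using ts t 2 s \<tau> by auto
        have "(2 * \<kappa> * t) powr (- 1 - 2 * \<gamma>) \<le> \<bar>t - s\<bar> powr (- 1 - 2 * \<gamma>)"
          using ts s t \<gamma> by (intro powr_mono2') auto
        then have "(2 * \<kappa>) powr (1 + 2 * \<gamma>) * ((2 * \<kappa>) powr (- 1 - 2 * \<gamma>) * t powr (- 1 - 2 * \<gamma>))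
          \<le> (2 * \<kappa>) powr (1 + 2 * \<gamma>) * \<bar>t - s\<bar> powr (- 1 - 2 * \<gamma>)"
          using k1 t by (intro mult_left_mono) (auto simp: powr_mult)
        moreover have "(2 * \<kappa>) powr (1 + 2 * \<gamma>) * (2 * \<kappa>) powr (- 1 - 2 * \<gamma>) = 1"
          using k1 by (simp add: powr_add[symmetric])
        ultimately have tle: "t powr (- 1 - 2 * \<gamma>) \<le> (2 * \<kappa>) powr (1 + 2 * \<gamma>) * \<bar>t - s\<bar> powr (- 1 - 2 * \<gamma>)"
          by (simp add: mult.assoc[symmetric])
        have sq: "(g t)\<^sup>2 \<le> 2 * (g t - g s)\<^sup>2 + 2 * (g s)\<^sup>2"
          using sum_squares_bound[of "g t - g s" "g s"] by (simp add: power2_eq_square algebra_simps)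
        have "1 / \<kappa> * t powr (- 1 - 2 * \<gamma>) * (g t)\<^sup>2 \<le> 1 / \<kappa> * t powr (- 1 - 2 * \<gamma>) * (2 * (g t - g s)\<^sup>2 + 2 * (g s)\<^sup>2)"
          using k1 by (intro mult_left_mono sq) auto
        also have "\<dots> = 2 / \<kappa> * t powr (- 1 - 2 * \<gamma>) * (g t - g s)\<^sup>2 + 2 / \<kappa> * t powr (- 1 - 2 * \<gamma>) * (g s)\<^sup>2"
          by (simp add: algebra_simps)
        also have "2 / \<kappa> * t powr (- 1 - 2 * \<gamma>) * (g t - g s)\<^sup>2
          \<le> 2 / \<kappa> * ((2 * \<kappa>) powr (1 + 2 * \<gamma>) * \<bar>t - s\<bar> powr (- 1 - 2 * \<gamma>)) * (g t - g s)\<^sup>2"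
          using k1 by (intro mult_right_mono mult_left_mono tle) auto
        also have "\<dots> = C1 * ((g t - g s)\<^sup>2 * \<bar>t - s\<bar> powr (- 1 - 2 * \<gamma>))" by (simp add: C1_def)
        finally have "1 / \<kappa> * t powr (- 1 - 2 * \<gamma>) * (g t)\<^sup>2 \<le> C1 * ((g t - g s)\<^sup>2 * \<bar>t - s\<bar> powr (- 1 - 2 * \<gamma>))
           + 2 / \<kappa> * t powr (- 1 - 2 * \<gamma>) * (g s)\<^sup>2" by simp
        then have "ennreal (1 / \<kappa> * t powr (- 1 - 2 * \<gamma>) * (g t)\<^sup>2) \<le> ennreal (C1 * ((g t - g s)\<^sup>2 * \<bar>t - s\<bar> powr (- 1 - 2 * \<gamma>)))
           + ennreal (2 / \<kappa> * t powr (- 1 - 2 * \<gamma>) * (g s)\<^sup>2)"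
          using C1 k1 by (intro ennreal_le_plusI) auto
        then show ?thesis using s t inU C1 by (simp add: ennreal_mult)
      qed simp
    qed
    finally show ?thesis by (rule order_trans) simp
  next
    case False
    have "indicator {\<delta><..<T} t * ((g t)\<^sup>2 * t powr (- 2 * \<gamma>)) \<le> \<tau> powr (- 2 * \<gamma>) * (g t)\<^sup>2"
    proof (cases "\<delta> < t \<and> t < T")
      case True
      then have "\<tau> \<le> t" using False by auto
      then have "t powr (- 2 * \<gamma>) \<le> \<tau> powr (- 2 * \<gamma>)" using \<tau> \<gamma> by (intro powr_mono2') auto
      then show ?thesis using True by (simp add: mult.commute mult_left_mono)
    qed auto
    then have "ennreal (indicator {\<delta><..<T} t * ((g t)\<^sup>2 * t powr (- 2 * \<gamma>))) \<le> ennreal (\<tau> powr (- 2 * \<gamma>)) * ennreal ((g t)\<^sup>2)"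
      by (subst ennreal_mult[symmetric]) (auto intro: ennreal_leI)
    then show ?thesis by (rule order_trans) simp
  qed
  have "?A \<le> (\<integral>\<^sup>+t. (\<integral>\<^sup>+s. ennreal C1 * ?s t s + ?r t s \<partial>lborel) + ennreal (\<tau> powr (- 2 * \<gamma>)) * ennreal ((g t)\<^sup>2) \<partial>lborel)"
    unfolding hardy_int_def by (rule nn_integral_mono) (rule pt)
  also have "\<dots> = ennreal C1 * slob T \<gamma> g + (\<integral>\<^sup>+t. \<integral>\<^sup>+s. ?r t s \<partial>lborel \<partial>lborel) + ennreal (\<tau> powr (- 2 * \<gamma>)) * ?N"
    unfolding slob_def by (rule nn_integral_split3) measurable
  also have "(\<integral>\<^sup>+t. \<integral>\<^sup>+s. ?r t s \<partial>lborel \<partial>lborel) = (\<integral>\<^sup>+s. \<integral>\<^sup>+t. ?r t s \<partial>lborel \<partial>lborel)"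
    by (rule lborel_pair.Fubini'[symmetric]) measurable
  also have "\<dots> \<le> (\<integral>\<^sup>+s. ennreal (1/2) * ennreal (indicator {\<delta><..<T} s * ((g s)\<^sup>2 * s powr (- 2 * \<gamma>))) \<partial>lborel)"
  proof (rule nn_integral_mono)
    fix s
    show "(\<integral>\<^sup>+t. ?r t s \<partial>lborel) \<le> ennreal (1/2) * ennreal (indicator {\<delta><..<T} s * ((g s)\<^sup>2 * s powr (- 2 * \<gamma>)))"
    proof (cases "\<delta> < s \<and> s < T")
      case True
      then have s: "0 < s" "\<delta> < s" "s < T" using \<delta> by auto
      let ?c = "2 / \<kappa> * (s / (2 * \<kappa>)) powr (- 1 - 2 * \<gamma>) * (g s)\<^sup>2"
      have c0: "0 \<le> ?c" using k1 by simp
      have "(\<integral>\<^sup>+t. ?r t s \<partial>lborel) \<le> (\<integral>\<^sup>+t. ennreal ?c * indicator {s / (2 * \<kappa>)<..<s / \<kappa>} t \<partial>lborel)"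
      proof (rule nn_integral_mono)
        fix t
        show "?r t s \<le> ennreal ?c * indicator {s / (2 * \<kappa>)<..<s / \<kappa>} t"
        proof (cases "\<delta> < t \<and> \<kappa> * t < s \<and> s < 2 * \<kappa> * t")
          case t: True
          then have tt: "s / (2 * \<kappa>) < t" "t < s / \<kappa>" using k1 by (auto simp: field_simps)
          have "t powr (- 1 - 2 * \<gamma>) \<le> (s / (2 * \<kappa>)) powr (- 1 - 2 * \<gamma>)"
            using tt s k1 \<gamma> by (intro powr_mono2') auto
          then have "2 / \<kappa> * t powr (- 1 - 2 * \<gamma>) * (g s)\<^sup>2 \<le> ?c"
            using k1 by (intro mult_right_mono mult_left_mono) auto
          then show ?thesis using tt c0 t by (auto simp: indicator_def intro!: ennreal_leI)
        qed auto
      qed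
      also have "\<dots> = ennreal ?c * ennreal (s / \<kappa> - s / (2 * \<kappa>))"
        using s k1 by (subst nn_integral_cmult_indicator) (auto simp: field_simps)
      also have "\<dots> = ennreal (?c * (s / (2 * \<kappa>)))"
        using c0 s k1 by (subst ennreal_mult[symmetric]) (auto simp: field_simps)
      also have "?c * (s / (2 * \<kappa>)) = (2 powr (2 * \<gamma>) * 2) * \<kappa> powr (2 * \<gamma> - 1) * ((g s)\<^sup>2 * s powr (- 2 * \<gamma>))"
      proof -
        have p1: "(s / (2 * \<kappa>)) powr (- 1 - 2 * \<gamma>) * (s / (2 * \<kappa>)) = (s / (2 * \<kappa>)) powr (- 2 * \<gamma>)"
          using powr_mult_base[of "s / (2 * \<kappa>)" "-1 - 2 * \<gamma>"] s k1 by (simp add: mult.commute)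
        have p2: "(s / (2 * \<kappa>)) powr (- 2 * \<gamma>) = s powr (- 2 * \<gamma>) * (2 powr (2 * \<gamma>) * \<kappa> powr (2 * \<gamma>))"
          using s k1 by (simp add: powr_divide powr_mult powr_minus_divide)
        have p3: "\<kappa> powr (2 * \<gamma>) / \<kappa> = \<kappa> powr (2 * \<gamma> - 1)"
          using k1 by (simp add: powr_diff)
        have "?c * (s / (2 * \<kappa>)) = 2 / \<kappa> * (g s)\<^sup>2 * ((s / (2 * \<kappa>)) powr (- 1 - 2 * \<gamma>) * (s / (2 * \<kappa>)))" by simp
        also have "\<dots> = 2 * (g s)\<^sup>2 * s powr (- 2 * \<gamma>) * 2 powr (2 * \<gamma>) * (\<kappa> powr (2 * \<gamma>) / \<kappa>)"
          unfolding p1 p2 by simp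
        finally show ?thesis unfolding p3 by simp
      qed
      also have "\<dots> \<le> 1 / 2 * ((g s)\<^sup>2 * s powr (- 2 * \<gamma>))"
      proof (rule mult_right_mono)
        have "(2::real) powr (2 * \<gamma>) \<le> 2 powr 1" using \<gamma> by (intro powr_mono) auto
        then show "2 powr (2 * \<gamma>) * 2 * \<kappa> powr (2 * \<gamma> - 1) \<le> 1 / 2" unfolding kp by simp
      qed simp
      finally have "(\<integral>\<^sup>+t. ?r t s \<partial>lborel) \<le> ennreal (1 / 2 * ((g s)\<^sup>2 * s powr (- 2 * \<gamma>)))"
        by (simp only: ennreal_leI)
      also have "\<dots> = ennreal (1/2) * ennreal (indicator {\<delta><..<T} s * ((g s)\<^sup>2 * s powr (- 2 * \<gamma>)))"
        using True by (subst ennreal_mult[symmetric]) auto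
      finally show ?thesis .
    next
      case False
      have "?r t s = 0" for t
      proof (cases "\<delta> < t \<and> t < \<tau> \<and> \<kappa> * t < s \<and> s < 2 * \<kappa> * t")
        case t: True
        have "1 * t \<le> \<kappa> * t" using k1 t \<delta> by (intro mult_right_mono) auto
        moreover have "2 * \<kappa> * t < T" using t k1 by (simp add: \<tau>_def field_simps)
        ultimately show ?thesis using False t by linarith
      qed auto
      then show ?thesis by simp
    qed
  qed
  also have "\<dots> = ennreal (1/2) * ?A"
    unfolding hardy_int_def by (rule nn_integral_cmult) measurable
  finally have "?A \<le> (ennreal C1 * slob T \<gamma> g + ennreal (1/2) * ?A) + ennreal (\<tau> powr (- 2 * \<gamma>)) * ?N"
    by (simp add: add_left_mono add_right_mono)
  \<comment> \<open>Absorption without subtracting in \<open>ennreal\<close>: after doubling, A + A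
    is bounded by A plus the remainder, and the finite A cancels.\<close>
  then have "ennreal 2 * ?A \<le> ennreal 2 * (ennreal (1/2) * ?A + (ennreal C1 * slob T \<gamma> g + ennreal (\<tau> powr (- 2 * \<gamma>)) * ?N))"
    by (intro mult_left_mono) (auto simp: add_ac)
  also have "\<dots> = ?A + (ennreal (2 * C1) * slob T \<gamma> g + ennreal (2 * \<tau> powr (- 2 * \<gamma>)) * ?N)"
  proof -
    have h: "ennreal 2 * ennreal (1/2) = 1" by (subst ennreal_mult[symmetric]) auto
    have "ennreal 2 * (ennreal (1/2) * ?A) = ?A" by (simp only: mult.assoc[symmetric] h mult_1_left)
    then show ?thesis using C1 by (simp add: distrib_left ennreal_mult mult.assoc[symmetric])
  qed
  also have "ennreal 2 * ?A = ?A + ?A" by (simp add: mult_2)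
  finally show ?thesis using fin_A unfolding C1_def \<tau>_def
    by (subst (asm) ennreal_add_left_cancel_le) auto
qed

text \<open>The constants in \<open>hardy_truncated\<close> do not involve the cutoff, so monotone
  convergence removes it.\<close>

lemma hardy_left:
  fixes g :: "real \<Rightarrow> real" and T \<gamma> :: real
  assumes [measurable]: "g \<in> borel_measurable borel" and T: "0 < T" and \<gamma>: "0 < \<gamma>" "\<gamma> < 1/2"
    and fin: "(\<integral>\<^sup>+t. ennreal ((g t)\<^sup>2) \<partial>lborel) < \<infinity>"
  defines "\<kappa> \<equiv> 8 powr (1 / (1 - 2 * \<gamma>))"
  shows "hardy_int T \<gamma> g 0 \<le> ennreal (2 * (2 / \<kappa> * (2 * \<kappa>) powr (1 + 2 * \<gamma>))) * slob T \<gamma> g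
    + ennreal (2 * (T / (2 * \<kappa>)) powr (- 2 * \<gamma>)) * (\<integral>\<^sup>+t. ennreal ((g t)\<^sup>2) \<partial>lborel)" (is "_ \<le> ?R")
proof -
  let ?f = "\<lambda>n t. ennreal (indicator {1 / Suc n<..<T} t * ((g t)\<^sup>2 * t powr (- 2 * \<gamma>)))"
  have "ennreal (indicator {0<..<T} t * ((g t)\<^sup>2 * t powr (- 2 * \<gamma>))) = (SUP n. ?f n t)" for t
  proof (rule antisym)
    show "ennreal (indicator {0<..<T} t * ((g t)\<^sup>2 * t powr (- 2 * \<gamma>))) \<le> (SUP n. ?f n t)"
    proof (cases "0 < t \<and> t < T")
      case True
      then obtain n where "inverse (real (Suc n)) < t" using reals_Archimedean by blast
      then show ?thesis using True by (intro SUP_upper2[of n]) (auto simp: inverse_eq_divide)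
    qed auto
    show "(SUP n. ?f n t) \<le> ennreal (indicator {0<..<T} t * ((g t)\<^sup>2 * t powr (- 2 * \<gamma>)))"
    proof (rule SUP_least)
      fix n
      have "0 < t" if "1 / real (Suc n) < t" using that by (rule less_trans[rotated]) simp
      then show "?f n t \<le> ennreal (indicator {0<..<T} t * ((g t)\<^sup>2 * t powr (- 2 * \<gamma>)))"
        by (intro ennreal_leI) (auto simp: indicator_def simp del: of_nat_Suc)
    qed
  qed
  then have "hardy_int T \<gamma> g 0 = (\<integral>\<^sup>+t. (SUP n. ?f n t) \<partial>lborel)"
    unfolding hardy_int_def by simp
  also have "\<dots> = (SUP n. hardy_int T \<gamma> g (1 / Suc n))"
    unfolding hardy_int_def
  proof (rule nn_integral_monotone_convergence_SUP)
    show "incseq ?f"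
    proof (intro incseq_SucI le_funI ennreal_leI)
      fix n t
      have "1 / real (Suc (Suc n)) \<le> 1 / real (Suc n)" by (simp add: frac_le)
      then show "indicator {1 / Suc n<..<T} t * ((g t)\<^sup>2 * t powr (- 2 * \<gamma>))
        \<le> indicator {1 / Suc (Suc n)<..<T} t * ((g t)\<^sup>2 * t powr (- 2 * \<gamma>))"
        by (auto simp: indicator_def simp del: of_nat_Suc)
    qed
  qed measurable
  also have "\<dots> \<le> ?R"
  proof (rule SUP_least)
    fix n
    show "hardy_int T \<gamma> g (1 / Suc n) \<le> ?R"
      unfolding \<kappa>_def by (rule hardy_truncated[OF assms(1) T \<gamma> fin]) simp
  qed
  finally show ?thesis .
qed

section \<open>The end point T by time reversal, and extension by zero to the line\<close>

lemma slob_reflect: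
  assumes [measurable]: "g \<in> borel_measurable borel"
  shows "slob T \<gamma> (\<lambda>t. g (T - t)) = slob T \<gamma> g"
proof -
  have ind: "indicator {0<..<T} (x::real) = (if 0 < x \<and> x < T then 1 else (0::real))" for x
    by (simp add: indicator_def)
  let ?s = "\<lambda>t s. ennreal (indicator {0<..<T} t * indicator {0<..<T} s * ((g t - g s)\<^sup>2 * \<bar>t - s\<bar> powr (- 1 - 2 * \<gamma>)))"
  have [measurable]: "(\<lambda>(t, s). ?s t s) \<in> borel_measurable (borel \<Otimes>\<^sub>M borel)" unfolding ind by measurable
  have eq: "ennreal (indicator {0<..<T} t * indicator {0<..<T} s * ((g (T - t) - g (T - s))\<^sup>2 * \<bar>t - s\<bar> powr (- 1 - 2 * \<gamma>)))
    = ?s (T - t) (T - s)" for t s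
    by (auto simp: ind abs_minus_commute)
  have "slob T \<gamma> (\<lambda>t. g (T - t)) = (\<integral>\<^sup>+t. \<integral>\<^sup>+s. ?s (T - t) (T - s) \<partial>lborel \<partial>lborel)"
    unfolding slob_def eq ..
  also have "\<dots> = (\<integral>\<^sup>+t. \<integral>\<^sup>+s. ?s (T - t) s \<partial>lborel \<partial>lborel)"
  proof (rule nn_integral_cong)
    fix t
    have "?s (T - t) \<in> borel_measurable borel" unfolding ind by measurable
    from nn_integral_shift(2)[OF this, of T]
    show "(\<integral>\<^sup>+s. ?s (T - t) (T - s) \<partial>lborel) = (\<integral>\<^sup>+s. ?s (T - t) s \<partial>lborel)" .
  qed
  also have "\<dots> = slob T \<gamma> g"
    unfolding slob_def using nn_integral_shift(2)[of "\<lambda>t. \<integral>\<^sup>+s. ?s t s \<partial>lborel" T] by simp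
  finally show ?thesis .
qed

lemma nn_integral_powr_tail:
  assumes "0 < \<gamma>" "0 < a"
  shows "(\<integral>\<^sup>+\<rho>. ennreal (\<rho> powr (- 1 - \<gamma>)) * indicator {a..} \<rho> \<partial>lborel) = ennreal (a powr (- \<gamma>) / \<gamma>)"
proof -
  let ?F = "\<lambda>r. r powr (- \<gamma>) / (- \<gamma>)"
  have "(\<integral>\<^sup>+\<rho>. ennreal (\<rho> powr (- 1 - \<gamma>)) * indicator {a..} \<rho> \<partial>lborel) = ennreal (0 - ?F a)"
  proof (rule nn_integral_FTC_atLeast[where F="?F"])
    fix x assume "a \<le> x"
    then have x: "x > 0" using assms by simp
    have "(?F has_real_derivative ((- \<gamma>) * x powr (- \<gamma> - 1) / (- \<gamma>))) (at x)"
      by (intro DERIV_cdivide has_real_derivative_powr x)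
    moreover have "(- \<gamma>) * x powr (- \<gamma> - 1) / (- \<gamma>) = x powr (- 1 - \<gamma>)"
      using assms by (simp add: minus_diff_commute)
    ultimately show "(?F has_real_derivative x powr (- 1 - \<gamma>)) (at x)" by simp
  next
    have "((\<lambda>r::real. r powr (- \<gamma>)) \<longlongrightarrow> 0) at_top"
      using assms by (auto intro!: tendsto_neg_powr filterlim_ident)
    then have "(?F \<longlongrightarrow> 0 / (- \<gamma>)) at_top" using assms by (intro tendsto_intros) auto
    then show "(?F \<longlongrightarrow> 0) at_top" by simp
  qed auto
  then show ?thesis by simp
qed

text \<open>The Slobodeckij seminorm over the whole line, with pairs parametrised by a positive
  shift, so that each unordered pair of points is counted once.\<close>

definition slob_line :: "real \<Rightarrow> (real \<Rightarrow> real) \<Rightarrow> ennreal" where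
  "slob_line \<gamma> g = (\<integral>\<^sup>+t. \<integral>\<^sup>+\<rho>. ennreal (indicator {0<..} \<rho> * ((g t - g (t - \<rho>))\<^sup>2 * \<rho> powr (- 1 - 2 * \<gamma>))) \<partial>lborel \<partial>lborel)"

text \<open>The summand 1 accounts for the pairs inside (0, T). Each end point adds 1/(2 \<gamma>),
  from the tail integral of \<rho>^(-1 - 2 \<gamma>), times the sum of the two constants of
  \<open>hardy_left\<close>.\<close>

definition hardy_const :: "real \<Rightarrow> real \<Rightarrow> real" where
  "hardy_const T \<gamma> = (let \<kappa> = 8 powr (1 / (1 - 2 * \<gamma>)) in
     1 + (2 * (2 / \<kappa> * (2 * \<kappa>) powr (1 + 2 * \<gamma>)) + 2 * (T / (2 * \<kappa>)) powr (- 2 * \<gamma>)) / \<gamma>)"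

lemma hardy_const_pos: "0 < \<gamma> \<Longrightarrow> 0 < hardy_const T \<gamma>"
  by (auto simp: hardy_const_def Let_def intro!: add_pos_nonneg divide_nonneg_pos)

text \<open>A pair with a single point in (0, T) contributes the square of g at that point.
  Integrating over the other point leaves the weight t^(-2 \<gamma>) or (T - t)^(-2 \<gamma>), which
  the Hardy inequality at 0 and its reflection at T control because \<gamma> < 1/2.\<close>

lemma slob_line_le:
  fixes g :: "real \<Rightarrow> real" and T \<gamma> :: real
  assumes g: "g \<in> L2s T" and T: "0 < T" and \<gamma>: "0 < \<gamma>" "\<gamma> < 1/2"
  shows "slob_line \<gamma> g \<le> ennreal (hardy_const T \<gamma>) * (slob T \<gamma> g + (\<integral>\<^sup>+t. ennreal ((g t)\<^sup>2) \<partial>lborel))"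
proof -
  note gL = L2s_L1s[OF g]
  have [measurable]: "g \<in> borel_measurable borel" using gL by (rule L1s_measurable)
  have g0: "g t = 0" if "\<not> (0 < t \<and> t < T)" for t using L1s_zero[OF gL, of t] that by auto
  have fin: "(\<integral>\<^sup>+t. ennreal ((g t)\<^sup>2) \<partial>lborel) < \<infinity>" using L2s_sqi[OF g] by (simp add: sqi_iff_nn)
  let ?N = "\<integral>\<^sup>+t. ennreal ((g t)\<^sup>2) \<partial>lborel"
  have ind: "indicator {0<..<T} (x::real) = (if 0 < x \<and> x < T then 1 else (0::real))"
    "indicator {0<..} x = (if 0 < x then 1 else (0::real))" for x
    by (simp_all add: indicator_def)
  let ?w = "\<lambda>t s. ennreal (indicator {0<..<T} t * indicator {0<..<T} s * ((g t - g s)\<^sup>2 * \<bar>t - s\<bar> powr (- 1 - 2 * \<gamma>)))"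
  \<comment> \<open>\<open>?a\<close> is for pairs with both points in (0, T), \<open>?b\<close> for
    those with only the later point t inside, and \<open>?c\<close> for those with only the earlier
    point t - \<rho> inside.\<close>
  let ?a = "\<lambda>t \<rho>. ?w t (t - \<rho>)"
  let ?b = "\<lambda>t \<rho>. ennreal (indicator {0<..<T} t * (g t)\<^sup>2) * (ennreal (\<rho> powr (- 1 - 2 * \<gamma>)) * indicator {t..} \<rho>)"
  let ?bb = "\<lambda>s \<rho>. ennreal (indicator {0<..<T} s * (g s)\<^sup>2) * (ennreal (\<rho> powr (- 1 - 2 * \<gamma>)) * indicator {T - s..} \<rho>)"
  let ?c = "\<lambda>t \<rho>. ?bb (t - \<rho>) \<rho>"
  have indc: "indicator {a..} (x::real) = (if a \<le> x then 1 else (0::ennreal))" for a x by (simp add: indicator_def)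
  have [measurable]: "(\<lambda>(t, s). ?w t s) \<in> borel_measurable (borel \<Otimes>\<^sub>M borel)"
    "(\<lambda>(t, \<rho>). ?a t \<rho>) \<in> borel_measurable (borel \<Otimes>\<^sub>M borel)"
    "(\<lambda>(t, \<rho>). ?b t \<rho>) \<in> borel_measurable (borel \<Otimes>\<^sub>M borel)"
    "(\<lambda>(t, \<rho>). ?c t \<rho>) \<in> borel_measurable (borel \<Otimes>\<^sub>M borel)"
    "(\<lambda>(t, \<rho>). ?bb t \<rho>) \<in> borel_measurable (borel \<Otimes>\<^sub>M borel)"
    unfolding ind indc by measurable
  have "slob_line \<gamma> g \<le> (\<integral>\<^sup>+t. \<integral>\<^sup>+\<rho>. ?a t \<rho> + ?b t \<rho> + ?c t \<rho> \<partial>lborel \<partial>lborel)"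
    unfolding slob_line_def
  proof (rule nn_integral_mono, rule nn_integral_mono)
    fix t \<rho>
    show "ennreal (indicator {0<..} \<rho> * ((g t - g (t - \<rho>))\<^sup>2 * \<rho> powr (- 1 - 2 * \<gamma>))) \<le> ?a t \<rho> + ?b t \<rho> + ?c t \<rho>"
    proof (cases "0 < \<rho>")
      case \<rho>: True
      consider "0 < t - \<rho>" "t < T" | "0 < t" "t < T" "t - \<rho> \<le> 0" | "T \<le> t" "0 < t - \<rho>" "t - \<rho> < T"
        | "\<not> (0 < t \<and> t < T)" "\<not> (0 < t - \<rho> \<and> t - \<rho> < T)" using \<rho> by linarith
      then show ?thesis
      proof cases
        case 1
        then have "ennreal (indicator {0<..} \<rho> * ((g t - g (t - \<rho>))\<^sup>2 * \<rho> powr (- 1 - 2 * \<gamma>))) = ?a t \<rho>"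
          using \<rho> by (simp add: ind)
        then show ?thesis by (metis add_increasing2 order_refl zero_le)
      next
        case 2
        then have "ennreal (indicator {0<..} \<rho> * ((g t - g (t - \<rho>))\<^sup>2 * \<rho> powr (- 1 - 2 * \<gamma>))) = ?b t \<rho>"
          using \<rho> g0[of "t - \<rho>"] by (simp add: ind ennreal_mult)
        then show ?thesis by (metis add_increasing add_increasing2 order_refl zero_le)
      next
        case 3
        then have "ennreal (indicator {0<..} \<rho> * ((g t - g (t - \<rho>))\<^sup>2 * \<rho> powr (- 1 - 2 * \<gamma>))) = ?c t \<rho>"
          using \<rho> g0[of t] by (simp add: ind ennreal_mult)
        then show ?thesis by (metis add_increasing order_refl zero_le)
      next
        case 4
        then show ?thesis using g0 by simp
      qed
    qed simp
  qed
  also have "\<dots> = (\<integral>\<^sup>+t. (\<integral>\<^sup>+\<rho>. ?a t \<rho> \<partial>lborel) + (\<integral>\<^sup>+\<rho>. ?b t \<rho> \<partial>lborel) + (\<integral>\<^sup>+\<rho>. ?c t \<rho> \<partial>lborel) \<partial>lborel)"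
    by (intro nn_integral_cong) (simp add: nn_integral_add)
  also have "\<dots> = (\<integral>\<^sup>+t. \<integral>\<^sup>+\<rho>. ?a t \<rho> \<partial>lborel \<partial>lborel) + (\<integral>\<^sup>+t. \<integral>\<^sup>+\<rho>. ?b t \<rho> \<partial>lborel \<partial>lborel) + (\<integral>\<^sup>+t. \<integral>\<^sup>+\<rho>. ?c t \<rho> \<partial>lborel \<partial>lborel)"
    by (simp add: nn_integral_add)
  also have "(\<integral>\<^sup>+t. \<integral>\<^sup>+\<rho>. ?a t \<rho> \<partial>lborel \<partial>lborel) = slob T \<gamma> g"
    unfolding slob_def
  proof (rule nn_integral_cong)
    fix t
    have "?w t \<in> borel_measurable borel" unfolding ind by measurable
    from nn_integral_shift(2)[OF this, of t]
    show "(\<integral>\<^sup>+\<rho>. ?a t \<rho> \<partial>lborel) = (\<integral>\<^sup>+s. ?w t s \<partial>lborel)" .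
  qed
  also have "(\<integral>\<^sup>+t. \<integral>\<^sup>+\<rho>. ?b t \<rho> \<partial>lborel \<partial>lborel) = ennreal (1 / (2 * \<gamma>)) * hardy_int T \<gamma> g 0"
  proof -
    have "(\<integral>\<^sup>+\<rho>. ?b t \<rho> \<partial>lborel) = ennreal (1 / (2 * \<gamma>)) * ennreal (indicator {0<..<T} t * ((g t)\<^sup>2 * t powr (- 2 * \<gamma>)))" for t
    proof (cases "0 < t")
      case True
      then have "(\<integral>\<^sup>+\<rho>. ?b t \<rho> \<partial>lborel) = ennreal (indicator {0<..<T} t * (g t)\<^sup>2) * ennreal (t powr (- (2 * \<gamma>)) / (2 * \<gamma>))"
        using nn_integral_powr_tail[of "2 * \<gamma>" t] \<gamma> by (subst nn_integral_cmult) auto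
      also have "\<dots> = ennreal (1 / (2 * \<gamma>)) * ennreal (indicator {0<..<T} t * ((g t)\<^sup>2 * t powr (- 2 * \<gamma>)))"
        using \<gamma> by (simp add: ennreal_mult[symmetric] mult_ac)
      finally show ?thesis .
    qed simp
    then show ?thesis unfolding hardy_int_def by (simp add: nn_integral_cmult)
  qed
  also have "(\<integral>\<^sup>+t. \<integral>\<^sup>+\<rho>. ?c t \<rho> \<partial>lborel \<partial>lborel) = ennreal (1 / (2 * \<gamma>)) * hardy_int T \<gamma> (\<lambda>t. g (T - t)) 0"
  proof -
    have "(\<integral>\<^sup>+t. \<integral>\<^sup>+\<rho>. ?c t \<rho> \<partial>lborel \<partial>lborel) = (\<integral>\<^sup>+\<rho>. \<integral>\<^sup>+t. ?bb (t - \<rho>) \<rho> \<partial>lborel \<partial>lborel)"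
      by (rule lborel_pair.Fubini'[symmetric]) measurable
    also have "\<dots> = (\<integral>\<^sup>+\<rho>. \<integral>\<^sup>+s. ?bb s \<rho> \<partial>lborel \<partial>lborel)"
    proof (rule nn_integral_cong)
      fix \<rho>
      have "(\<lambda>s. ?bb s \<rho>) \<in> borel_measurable borel" unfolding ind indc by measurable
      from nn_integral_shift(1)[OF this, of \<rho>]
      show "(\<integral>\<^sup>+t. ?bb (t - \<rho>) \<rho> \<partial>lborel) = (\<integral>\<^sup>+s. ?bb s \<rho> \<partial>lborel)" .
    qed
    also have "\<dots> = (\<integral>\<^sup>+s. \<integral>\<^sup>+\<rho>. ?bb s \<rho> \<partial>lborel \<partial>lborel)"
      by (rule lborel_pair.Fubini') measurable
    also have "\<dots> = (\<integral>\<^sup>+s. ennreal (1 / (2 * \<gamma>)) * ennreal (indicator {0<..<T} s * ((g s)\<^sup>2 * (T - s) powr (- 2 * \<gamma>))) \<partial>lborel)"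
    proof (rule nn_integral_cong)
      fix s
      show "(\<integral>\<^sup>+\<rho>. ?bb s \<rho> \<partial>lborel) = ennreal (1 / (2 * \<gamma>)) * ennreal (indicator {0<..<T} s * ((g s)\<^sup>2 * (T - s) powr (- 2 * \<gamma>)))"
      proof (cases "s < T")
        case True
        then have "(\<integral>\<^sup>+\<rho>. ?bb s \<rho> \<partial>lborel) = ennreal (indicator {0<..<T} s * (g s)\<^sup>2) * ennreal ((T - s) powr (- (2 * \<gamma>)) / (2 * \<gamma>))"
          using nn_integral_powr_tail[of "2 * \<gamma>" "T - s"] \<gamma> by (subst nn_integral_cmult) auto
        also have "\<dots> = ennreal (1 / (2 * \<gamma>)) * ennreal (indicator {0<..<T} s * ((g s)\<^sup>2 * (T - s) powr (- 2 * \<gamma>)))"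
          using \<gamma> by (simp add: ennreal_mult[symmetric] mult_ac)
        finally show ?thesis .
      qed simp
    qed
    also have "\<dots> = ennreal (1 / (2 * \<gamma>)) * (\<integral>\<^sup>+s. ennreal (indicator {0<..<T} s * ((g s)\<^sup>2 * (T - s) powr (- 2 * \<gamma>))) \<partial>lborel)"
      by (rule nn_integral_cmult) measurable
    also have "(\<integral>\<^sup>+s. ennreal (indicator {0<..<T} s * ((g s)\<^sup>2 * (T - s) powr (- 2 * \<gamma>))) \<partial>lborel)
      = (\<integral>\<^sup>+t. ennreal (indicator {0<..<T} (T - t) * ((g (T - t))\<^sup>2 * (T - (T - t)) powr (- 2 * \<gamma>))) \<partial>lborel)"
      by (rule nn_integral_shift(2)[symmetric]) measurable
    also have "\<dots> = hardy_int T \<gamma> (\<lambda>t. g (T - t)) 0"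
      unfolding hardy_int_def by (intro nn_integral_cong) (auto simp: ind)
    finally show ?thesis .
  qed
  finally have main: "slob_line \<gamma> g \<le> slob T \<gamma> g + ennreal (1 / (2 * \<gamma>)) * hardy_int T \<gamma> g 0
    + ennreal (1 / (2 * \<gamma>)) * hardy_int T \<gamma> (\<lambda>t. g (T - t)) 0" .
  define \<kappa> :: real where "\<kappa> = 8 powr (1 / (1 - 2 * \<gamma>))"
  define A B where "A = 2 * (2 / \<kappa> * (2 * \<kappa>) powr (1 + 2 * \<gamma>))" and "B = 2 * (T / (2 * \<kappa>)) powr (- 2 * \<gamma>)"
  have AB: "0 \<le> A" "0 \<le> B" by (auto simp: A_def B_def \<kappa>_def)
  have "hardy_int T \<gamma> g 0 \<le> ennreal A * slob T \<gamma> g + ennreal B * ?N"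
    unfolding A_def B_def \<kappa>_def by (rule hardy_left[OF _ T \<gamma> fin]) measurable
  also have "\<dots> \<le> ennreal (A + B) * (slob T \<gamma> g + ?N)"
    using AB by (auto simp: distrib_left ennreal_plus distrib_right intro!: add_mono add_increasing add_increasing2)
  finally have h1: "hardy_int T \<gamma> g 0 \<le> ennreal (A + B) * (slob T \<gamma> g + ?N)" .
  have N': "(\<integral>\<^sup>+t. ennreal ((g (T - t))\<^sup>2) \<partial>lborel) = ?N"
    using nn_integral_shift(2)[of "\<lambda>t. ennreal ((g t)\<^sup>2)" T] by simp
  have "hardy_int T \<gamma> (\<lambda>t. g (T - t)) 0 \<le> ennreal A * slob T \<gamma> (\<lambda>t. g (T - t)) + ennreal B * (\<integral>\<^sup>+t. ennreal ((g (T - t))\<^sup>2) \<partial>lborel)"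
    unfolding A_def B_def \<kappa>_def using fin by (intro hardy_left T \<gamma>) (auto simp: N')
  also have "\<dots> = ennreal A * slob T \<gamma> g + ennreal B * ?N"
    unfolding N' by (simp add: slob_reflect)
  also have "\<dots> \<le> ennreal (A + B) * (slob T \<gamma> g + ?N)"
    using AB by (auto simp: distrib_left ennreal_plus distrib_right intro!: add_mono add_increasing add_increasing2)
  finally have h2: "hardy_int T \<gamma> (\<lambda>t. g (T - t)) 0 \<le> ennreal (A + B) * (slob T \<gamma> g + ?N)" .
  let ?X = "slob T \<gamma> g + ?N"
  have "slob_line \<gamma> g \<le> ?X + ennreal (1 / (2 * \<gamma>)) * (ennreal (A + B) * ?X) + ennreal (1 / (2 * \<gamma>)) * (ennreal (A + B) * ?X)"
    by (rule order_trans[OF main]) (intro add_mono mult_left_mono h1 h2, auto)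
  also have "\<dots> = ennreal (1 + (A + B) / \<gamma>) * ?X"
  proof -
    have "ennreal (1 / (2 * \<gamma>)) * (ennreal (A + B) * ?X) = ennreal ((A + B) / (2 * \<gamma>)) * ?X"
      using \<gamma> AB by (simp add: mult.assoc[symmetric] ennreal_mult[symmetric] del: ennreal_plus)
    moreover have "ennreal (1 + (A + B) / \<gamma>) = 1 + ennreal ((A + B) / (2 * \<gamma>)) + ennreal ((A + B) / (2 * \<gamma>))"
    proof -
      have e1: "1 + (A + B) / \<gamma> = 1 + (A + B) / (2 * \<gamma>) + (A + B) / (2 * \<gamma>)" using \<gamma> by (simp add: field_simps)
      have "ennreal (1 + x + x) = 1 + ennreal x + ennreal x" if "0 \<le> x" for x
        using that by (metis ennreal_1 ennreal_plus add_nonneg_nonneg zero_le_one)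
      then show ?thesis unfolding e1 using \<gamma> AB by (metis add_nonneg_nonneg divide_nonneg_pos mult_pos_pos zero_less_numeral)
    qed
    ultimately show ?thesis by (simp add: distrib_right)
  qed
  also have "1 + (A + B) / \<gamma> = hardy_const T \<gamma>"
    by (simp add: hardy_const_def Let_def A_def B_def \<kappa>_def)
  finally show ?thesis .
qed

section \<open>Square integrable Marchaud derivatives\<close>

text \<open>Expand the square under the product weight k(r) k(r'): the double integral is twice the
  unnormalised variance of a. The identity is stated as a sum because the terms will be integrated
  over t in \<open>ennreal\<close>, where subtraction is of little use.\<close>

lemma variance_identity:
  fixes k a :: "real \<Rightarrow> real"
  assumes k: "integrable lborel k" "\<And>r. 0 \<le> k r" and a[measurable]: "a \<in> borel_measurable borel"
    and ka: "integrable lborel (\<lambda>r. k r * (a r)\<^sup>2)"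
  shows "ennreal (2 * (\<integral>r. a r * k r \<partial>lborel)\<^sup>2) + (\<integral>\<^sup>+r. \<integral>\<^sup>+r'. ennreal (k r * k r' * (a r - a r')\<^sup>2) \<partial>lborel \<partial>lborel)
    = ennreal (2 * ((\<integral>r. k r \<partial>lborel) * (\<integral>r. k r * (a r)\<^sup>2 \<partial>lborel)))"
proof -
  have [measurable]: "k \<in> borel_measurable borel" using k by auto
  have k1: "integrable lborel (\<lambda>r. a r * k r)"
  proof (rule Bochner_Integration.integrable_bound)
    show "integrable lborel (\<lambda>r. k r + k r * (a r)\<^sup>2)" using k ka by simp
    have "\<bar>x\<bar> \<le> 1 + x\<^sup>2" for x :: real
      using sum_squares_bound[of 1 "\<bar>x\<bar>"] by simp
    then have "k r * \<bar>a r\<bar> \<le> k r * (1 + (a r)\<^sup>2)" for r by (intro mult_left_mono k)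
    then show "AE r in lborel. norm (a r * k r) \<le> norm (k r + k r * (a r)\<^sup>2)"
      using k(2) by (intro AE_I2) (simp add: abs_mult algebra_simps)
  qed simp
  let ?P = "\<lambda>f g :: real \<Rightarrow> real. \<lambda>(r, r'). f r * g r'"
  let ?ka = "\<lambda>r. a r * k r" and ?kaa = "\<lambda>r. k r * (a r)\<^sup>2"
  have I: "integrable (lborel \<Otimes>\<^sub>M lborel) (?P f g)" "(\<integral>q. ?P f g q \<partial>(lborel \<Otimes>\<^sub>M lborel)) = (\<integral>r. f r \<partial>lborel) * (\<integral>r. g r \<partial>lborel)"
    if "integrable lborel f" "integrable lborel g" for f g :: "real \<Rightarrow> real"
  proof -
    show 1: "integrable (lborel \<Otimes>\<^sub>M lborel) (?P f g)"
      by (rule lborel_pair.integrable_product_pair[OF that])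
    show "(\<integral>q. ?P f g q \<partial>(lborel \<Otimes>\<^sub>M lborel)) = (\<integral>r. f r \<partial>lborel) * (\<integral>r. g r \<partial>lborel)"
      using lborel_pair.integral_fst'[OF 1] by simp
  qed
  let ?F = "\<lambda>q. ?P ?kaa k q + ?P k ?kaa q - 2 * ?P ?ka ?ka q"
  have FI: "integrable (lborel \<Otimes>\<^sub>M lborel) ?F"
    by (intro Bochner_Integration.integrable_diff Bochner_Integration.integrable_add integrable_mult_right I k1 ka k)
  have F: "?F (r, r') = k r * k r' * (a r - a r')\<^sup>2" for r r'
    by (simp add: power2_eq_square algebra_simps)
  have F0: "0 \<le> ?F q" for q using F k(2) by (cases q) (simp del: split_paired_All)
  have Fint: "(\<integral>q. ?F q \<partial>(lborel \<Otimes>\<^sub>M lborel)) = 2 * ((\<integral>r. k r \<partial>lborel) * (\<integral>r. ?kaa r \<partial>lborel)) - 2 * (\<integral>r. ?ka r \<partial>lborel)\<^sup>2"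
    using I[OF ka k(1)] I[OF k(1) ka] I[OF k1 k1]
    by (simp add: power2_eq_square mult.commute)
  have "(\<integral>\<^sup>+r. \<integral>\<^sup>+r'. ennreal (k r * k r' * (a r - a r')\<^sup>2) \<partial>lborel \<partial>lborel)
    = (\<integral>\<^sup>+q. ennreal (?F q) \<partial>(lborel \<Otimes>\<^sub>M lborel))"
    using FI by (subst lborel.nn_integral_fst[symmetric]) (auto simp: F[simplified])
  also have "\<dots> = ennreal (2 * ((\<integral>r. k r \<partial>lborel) * (\<integral>r. ?kaa r \<partial>lborel)) - 2 * (\<integral>r. ?ka r \<partial>lborel)\<^sup>2)"
    using FI F0 Fint by (subst nn_integral_eq_integral) auto
  finally have e: "(\<integral>\<^sup>+r. \<integral>\<^sup>+r'. ennreal (k r * k r' * (a r - a r')\<^sup>2) \<partial>lborel \<partial>lborel) = \<dots>" .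
  have "0 \<le> 2 * ((\<integral>r. k r \<partial>lborel) * (\<integral>r. ?kaa r \<partial>lborel)) - 2 * (\<integral>r. ?ka r \<partial>lborel)\<^sup>2"
    unfolding Fint[symmetric] by (rule Bochner_Integration.integral_nonneg) (rule F0)
  then show ?thesis unfolding e by (subst ennreal_plus[symmetric]) auto
qed

definition shift_sq :: "(real \<Rightarrow> real) \<Rightarrow> real \<Rightarrow> ennreal" where
  "shift_sq G \<rho> = (\<integral>\<^sup>+t. ennreal ((G t - G (t - \<rho>))\<^sup>2) \<partial>lborel)"

lemma shift_sq_measurable [measurable]:
  assumes [measurable]: "G \<in> borel_measurable borel" shows "shift_sq G \<in> borel_measurable borel"
  unfolding shift_sq_def[abs_def] by measurable

lemma shift_sq_translate:
  assumes [measurable]: "G \<in> borel_measurable borel"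
  shows "(\<integral>\<^sup>+t. ennreal ((G (t - r') - G (t - r))\<^sup>2) \<partial>lborel) = shift_sq G (r - r')"
  unfolding shift_sq_def
  using nn_integral_shift(1)[of "\<lambda>t. ennreal ((G t - G (t - (r - r')))\<^sup>2)" r'] by simp

lemma shift_sq_minus:
  assumes [measurable]: "G \<in> borel_measurable borel" shows "shift_sq G (- \<rho>) = shift_sq G \<rho>"
  using shift_sq_translate[OF assms, of 0 "-\<rho>"] shift_sq_translate[OF assms, of "\<rho>" 0]
  by (simp add: power2_commute shift_sq_def)

lemma shift_sq_0 [simp]: "shift_sq G 0 = 0"
  by (simp add: shift_sq_def)

lemma shift_sq_le:
  assumes [measurable]: "G \<in> borel_measurable borel"
  shows "shift_sq G \<rho> \<le> 4 * (\<integral>\<^sup>+t. ennreal ((G t)\<^sup>2) \<partial>lborel)"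
proof -
  have "shift_sq G \<rho> \<le> (\<integral>\<^sup>+t. 2 * ennreal ((G t)\<^sup>2) + 2 * ennreal ((G (t - \<rho>))\<^sup>2) \<partial>lborel)"
    unfolding shift_sq_def
  proof (rule nn_integral_mono)
    fix t
    have "(G t - G (t - \<rho>))\<^sup>2 \<le> 2 * (G t)\<^sup>2 + 2 * (G (t - \<rho>))\<^sup>2"
      using sum_squares_bound[of "G t" "- G (t - \<rho>)"] by (simp add: power2_eq_square algebra_simps)
    then have "ennreal ((G t - G (t - \<rho>))\<^sup>2) \<le> ennreal (2 * (G t)\<^sup>2) + ennreal (2 * (G (t - \<rho>))\<^sup>2)"
      by (intro ennreal_le_plusI) auto
    then show "ennreal ((G t - G (t - \<rho>))\<^sup>2) \<le> 2 * ennreal ((G t)\<^sup>2) + 2 * ennreal ((G (t - \<rho>))\<^sup>2)"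
      by (simp add: ennreal_mult)
  qed
  also have "\<dots> = 2 * (\<integral>\<^sup>+t. ennreal ((G t)\<^sup>2) \<partial>lborel) + 2 * (\<integral>\<^sup>+t. ennreal ((G t)\<^sup>2) \<partial>lborel)"
    using nn_integral_shift(1)[of "\<lambda>t. ennreal ((G t)\<^sup>2)" \<rho>]
    by (simp add: nn_integral_add nn_integral_cmult)
  also have "\<dots> = 4 * (\<integral>\<^sup>+t. ennreal ((G t)\<^sup>2) \<partial>lborel)"
    by (simp flip: distrib_right)
  finally show ?thesis .
qed

text \<open>The cross terms \<open>(G(t) - G(t - r)) (G(t) - G(t - r'))\<close> are evaluated by the variance identity,
  in which the first-order parts of \<open>\<integral>k(r) \<integral>|G(t) - G(t - r)|\<^sup>2\<close> cancel.\<close>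
lemma marchaud_bound:
  fixes G k :: "real \<Rightarrow> real" and d :: "real \<Rightarrow> real \<Rightarrow> real"
  assumes G: "G \<in> sqi lborel" and k: "integrable lborel k" "\<And>r. 0 \<le> k r" "\<And>r. r \<le> 0 \<Longrightarrow> k r = 0"
    and d: "(\<lambda>(\<rho>, r). d \<rho> r) \<in> borel_measurable (borel \<Otimes>\<^sub>M borel)" "\<And>\<rho> r. 0 \<le> d \<rho> r"
      "\<And>\<rho> r. 0 < \<rho> \<Longrightarrow> 0 < r \<Longrightarrow> k \<rho> \<le> k (r + \<rho>) + d \<rho> r"
  shows "(\<integral>\<^sup>+t. ennreal ((\<integral>r. (G t - G (t - r)) * k r \<partial>lborel)\<^sup>2) \<partial>lborel)
    \<le> (\<integral>\<^sup>+\<rho>. \<integral>\<^sup>+r. (if 0 < \<rho> then shift_sq G \<rho> * ennreal (k r * d \<rho> r) else 0) \<partial>lborel \<partial>lborel)"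
proof -
  have [measurable]: "G \<in> borel_measurable borel" using G by (simp add: sqi_def)
  have [measurable]: "k \<in> borel_measurable borel" using k by auto
  note [measurable] = d(1)
  let ?S = "shift_sq G"
  define N where "N = (\<integral>\<^sup>+t. ennreal ((G t)\<^sup>2) \<partial>lborel)"
  have N: "N < \<infinity>" using G by (simp add: sqi_iff_nn N_def)
  define K where "K = (\<integral>r. k r \<partial>lborel)"
  have Knn: "(\<integral>\<^sup>+r. ennreal (k r) \<partial>lborel) = ennreal K" and K0: "0 \<le> K"
    unfolding K_def using k by (auto intro: nn_integral_eq_integral)
  \<comment> \<open>The variance identity, integrated over t, reads 2 X + V = 2 Z, where V is twice
    Y: by symmetry only r' = r + \<rho> with \<rho> > 0 matters. Z and Y differ in that k(\<rho>) is
    replaced by k(r + \<rho>), and the hypothesis on d bounds this difference by W.\<close>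
  define X where "X = (\<integral>\<^sup>+t. ennreal ((\<integral>r. (G t - G (t - r)) * k r \<partial>lborel)\<^sup>2) \<partial>lborel)"
  define Y where "Y = (\<integral>\<^sup>+r. \<integral>\<^sup>+\<rho>. (if 0 < \<rho> then ennreal (k r * k (\<rho> + r)) * ?S \<rho> else 0) \<partial>lborel \<partial>lborel)"
  define Z where "Z = ennreal K * (\<integral>\<^sup>+r. ennreal (k r) * ?S r \<partial>lborel)"
  define W where "W = (\<integral>\<^sup>+\<rho>. \<integral>\<^sup>+r. (if 0 < \<rho> then ?S \<rho> * ennreal (k r * d \<rho> r) else 0) \<partial>lborel \<partial>lborel)"
  define A where "A t = (\<integral>\<^sup>+r. ennreal (k r * (G t - G (t - r))\<^sup>2) \<partial>lborel)" for t
  define V where "V t = (\<integral>\<^sup>+r. \<integral>\<^sup>+r'. ennreal (k r * k r' * (G (t - r') - G (t - r))\<^sup>2) \<partial>lborel \<partial>lborel)" for t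
  have [measurable]: "A \<in> borel_measurable borel" "V \<in> borel_measurable borel"
    unfolding A_def[abs_def] V_def[abs_def] by measurable
  have Aint: "(\<integral>\<^sup>+t. A t \<partial>lborel) = (\<integral>\<^sup>+r. ennreal (k r) * ?S r \<partial>lborel)"
  proof -
    have "(\<integral>\<^sup>+t. A t \<partial>lborel) = (\<integral>\<^sup>+r. \<integral>\<^sup>+t. ennreal (k r * (G t - G (t - r))\<^sup>2) \<partial>lborel \<partial>lborel)"
      unfolding A_def by (rule lborel_pair.Fubini'[symmetric]) measurable
    also have "\<dots> = (\<integral>\<^sup>+r. ennreal (k r) * ?S r \<partial>lborel)"
      unfolding shift_sq_def using k(2) by (intro nn_integral_cong) (simp add: ennreal_mult nn_integral_cmult)
    finally show ?thesis .
  qed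
  have Afin: "(\<integral>\<^sup>+t. A t \<partial>lborel) < \<infinity>"
  proof -
    have "(\<integral>\<^sup>+r. ennreal (k r) * ?S r \<partial>lborel) \<le> (\<integral>\<^sup>+r. ennreal (k r) * (4 * N) \<partial>lborel)"
      unfolding N_def by (intro nn_integral_mono mult_left_mono shift_sq_le) auto
    also have "\<dots> = ennreal K * (4 * N)" by (simp add: nn_integral_multc Knn)
    also have "\<dots> < \<infinity>" using N by (simp add: ennreal_mult_less_top)
    finally show ?thesis unfolding Aint .
  qed
  have Zfin: "Z < \<infinity>" using Afin unfolding Z_def Aint by (simp add: ennreal_mult_less_top)
  have "AE t in lborel. A t \<noteq> \<infinity>" using Afin by (intro nn_integral_PInf_AE) auto
  then have id: "AE t in lborel. 2 * ennreal ((\<integral>r. (G t - G (t - r)) * k r \<partial>lborel)\<^sup>2) + V t = 2 * (ennreal K * A t)"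
  proof eventually_elim
    case (elim t)
    have i: "integrable lborel (\<lambda>r. k r * (G t - G (t - r))\<^sup>2)"
      using elim k(2) unfolding A_def by (intro integrableI_nonneg) (auto simp: top.not_eq_extremum)
    have "(\<integral>\<^sup>+r. \<integral>\<^sup>+r'. ennreal (k r * k r' * ((G t - G (t - r)) - (G t - G (t - r')))\<^sup>2) \<partial>lborel \<partial>lborel) = V t"
      unfolding V_def by simp
    moreover have "A t = ennreal (\<integral>r. k r * (G t - G (t - r))\<^sup>2 \<partial>lborel)"
      unfolding A_def using i k(2) by (intro nn_integral_eq_integral) auto
    ultimately show ?case
      using variance_identity[OF k(1,2) _ i] K0 k(2) by (simp add: ennreal_mult K_def)
  qed
  have XV: "2 * X + (\<integral>\<^sup>+t. V t \<partial>lborel) = 2 * Z"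
  proof -
    have "2 * X + (\<integral>\<^sup>+t. V t \<partial>lborel) = (\<integral>\<^sup>+t. 2 * ennreal ((\<integral>r. (G t - G (t - r)) * k r \<partial>lborel)\<^sup>2) + V t \<partial>lborel)"
      unfolding X_def by (subst nn_integral_add) (auto simp: nn_integral_cmult)
    also have "\<dots> = (\<integral>\<^sup>+t. 2 * (ennreal K * A t) \<partial>lborel)" by (rule nn_integral_cong_AE[OF id])
    also have "\<dots> = 2 * Z" unfolding Z_def Aint[symmetric] by (simp add: nn_integral_cmult)
    finally show ?thesis .
  qed
  have V1: "(\<integral>\<^sup>+t. V t \<partial>lborel) = (\<integral>\<^sup>+r. \<integral>\<^sup>+r'. ennreal (k r * k r') * ?S (r - r') \<partial>lborel \<partial>lborel)"
  proof -
    have "(\<integral>\<^sup>+t. V t \<partial>lborel) = (\<integral>\<^sup>+r. \<integral>\<^sup>+t. \<integral>\<^sup>+r'. ennreal (k r * k r' * (G (t - r') - G (t - r))\<^sup>2) \<partial>lborel \<partial>lborel \<partial>lborel)"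
      unfolding V_def by (rule lborel_pair.Fubini'[symmetric]) measurable
    also have "\<dots> = (\<integral>\<^sup>+r. \<integral>\<^sup>+r'. \<integral>\<^sup>+t. ennreal (k r * k r' * (G (t - r') - G (t - r))\<^sup>2) \<partial>lborel \<partial>lborel \<partial>lborel)"
      by (intro nn_integral_cong lborel_pair.Fubini'[symmetric]) measurable
    also have "\<dots> = (\<integral>\<^sup>+r. \<integral>\<^sup>+r'. ennreal (k r * k r') * ?S (r - r') \<partial>lborel \<partial>lborel)"
    proof (intro nn_integral_cong)
      fix r r'
      show "(\<integral>\<^sup>+t. ennreal (k r * k r' * (G (t - r') - G (t - r))\<^sup>2) \<partial>lborel) = ennreal (k r * k r') * ?S (r - r')"
        using k(2) by (simp add: shift_sq_translate[symmetric] ennreal_mult nn_integral_cmult)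
    qed
    finally show ?thesis .
  qed
  have V2: "(\<integral>\<^sup>+t. V t \<partial>lborel) = 2 * Y"
  proof -
    let ?f = "\<lambda>r r'. ennreal (k r * k r') * ?S (r - r')"
    have sym: "?f r r' = ?f r' r" for r r'
      using shift_sq_minus[of G "r - r'"] by (simp add: mult.commute)
    define Y' where "Y' = (\<integral>\<^sup>+r. \<integral>\<^sup>+r'. (if r < r' then ?f r r' else 0) \<partial>lborel \<partial>lborel)"
    have "(\<integral>\<^sup>+r. \<integral>\<^sup>+r'. ?f r r' \<partial>lborel \<partial>lborel)
      = (\<integral>\<^sup>+r. (\<integral>\<^sup>+r'. (if r < r' then ?f r r' else 0) \<partial>lborel) + (\<integral>\<^sup>+r'. (if r' < r then ?f r r' else 0) \<partial>lborel) \<partial>lborel)"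
    proof (rule nn_integral_cong)
      fix r
      have "?f r r' = (if r < r' then ?f r r' else 0) + (if r' < r then ?f r r' else 0)" for r'
        by (cases r r' rule: linorder_cases) auto
      then show "(\<integral>\<^sup>+r'. ?f r r' \<partial>lborel) = (\<integral>\<^sup>+r'. (if r < r' then ?f r r' else 0) \<partial>lborel) + (\<integral>\<^sup>+r'. (if r' < r then ?f r r' else 0) \<partial>lborel)"
        by (subst nn_integral_add[symmetric]) (auto intro!: nn_integral_cong)
    qed
    also have "\<dots> = Y' + (\<integral>\<^sup>+r. \<integral>\<^sup>+r'. (if r' < r then ?f r r' else 0) \<partial>lborel \<partial>lborel)"
      unfolding Y'_def by (rule nn_integral_add) measurable
    also have "(\<integral>\<^sup>+r. \<integral>\<^sup>+r'. (if r' < r then ?f r r' else 0) \<partial>lborel \<partial>lborel)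
      = (\<integral>\<^sup>+r'. \<integral>\<^sup>+r. (if r' < r then ?f r r' else 0) \<partial>lborel \<partial>lborel)"
      by (rule lborel_pair.Fubini'[symmetric]) measurable
    also have "\<dots> = Y'" unfolding Y'_def by (intro nn_integral_cong) (simp add: sym)
    also have "Y' = Y"
      unfolding Y'_def Y_def
    proof (rule nn_integral_cong)
      fix r
      have "(\<integral>\<^sup>+r'. (if r < r' then ?f r r' else 0) \<partial>lborel) = (\<integral>\<^sup>+\<rho>. (if r < \<rho> + r then ?f r (\<rho> + r) else 0) \<partial>lborel)"
        by (rule nn_integral_shift(1)[of "\<lambda>r'. (if r < r' then ?f r r' else 0)" "-r", unfolded diff_minus_eq_add, symmetric]) measurable
      then show "(\<integral>\<^sup>+r'. (if r < r' then ?f r r' else 0) \<partial>lborel)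
        = (\<integral>\<^sup>+\<rho>. (if 0 < \<rho> then ennreal (k r * k (\<rho> + r)) * ?S \<rho> else 0) \<partial>lborel)"
        by (simp add: shift_sq_minus cong: if_cong)
    qed
    finally show ?thesis unfolding V1 by (simp add: mult_2)
  qed
  have ZYW: "Z \<le> Y + W"
  proof -
    have "Z = (\<integral>\<^sup>+\<rho>. (\<integral>\<^sup>+r. ennreal (k r) \<partial>lborel) * (ennreal (k \<rho>) * ?S \<rho>) \<partial>lborel)"
      unfolding Z_def Knn by (simp add: nn_integral_cmult)
    also have "\<dots> = (\<integral>\<^sup>+\<rho>. \<integral>\<^sup>+r. ennreal (k r) * (ennreal (k \<rho>) * ?S \<rho>) \<partial>lborel \<partial>lborel)"
      by (simp add: nn_integral_multc)
    also have "\<dots> \<le> (\<integral>\<^sup>+\<rho>. \<integral>\<^sup>+r. (if 0 < \<rho> then ennreal (k r * k (\<rho> + r)) * ?S \<rho> else 0)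
        + (if 0 < \<rho> then ?S \<rho> * ennreal (k r * d \<rho> r) else 0) \<partial>lborel \<partial>lborel)"
    proof (intro nn_integral_mono)
      fix \<rho> r
      show "ennreal (k r) * (ennreal (k \<rho>) * ?S \<rho>) \<le> (if 0 < \<rho> then ennreal (k r * k (\<rho> + r)) * ?S \<rho> else 0)
        + (if 0 < \<rho> then ?S \<rho> * ennreal (k r * d \<rho> r) else 0)"
      proof (cases "0 < \<rho> \<and> 0 < r")
        case True
        have "k r * k \<rho> \<le> k r * (k (r + \<rho>) + d \<rho> r)" using True by (intro mult_left_mono d k) auto
        then have "ennreal (k r * k \<rho>) \<le> ennreal (k r * k (\<rho> + r)) + ennreal (k r * d \<rho> r)"
          using k(2) d(2) by (intro ennreal_le_plusI) (auto simp: algebra_simps)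
        then have "ennreal (k r * k \<rho>) * ?S \<rho> \<le> (ennreal (k r * k (\<rho> + r)) + ennreal (k r * d \<rho> r)) * ?S \<rho>"
          by (rule mult_right_mono) simp
        then show ?thesis using True k(2) by (simp add: ennreal_mult algebra_simps)
      next
        case False
        then have "k r = 0 \<or> k \<rho> = 0" using k(3) by (meson not_less)
        then show ?thesis by auto
      qed
    qed
    also have "\<dots> = (\<integral>\<^sup>+\<rho>. \<integral>\<^sup>+r. (if 0 < \<rho> then ennreal (k r * k (\<rho> + r)) * ?S \<rho> else 0) \<partial>lborel \<partial>lborel) + W"
      unfolding W_def by (simp add: nn_integral_add)
    also have "(\<integral>\<^sup>+\<rho>. \<integral>\<^sup>+r. (if 0 < \<rho> then ennreal (k r * k (\<rho> + r)) * ?S \<rho> else 0) \<partial>lborel \<partial>lborel) = Y"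
      unfolding Y_def by (rule lborel_pair.Fubini') measurable
    finally show ?thesis .
  qed
  have "2 * Y + 2 * X = 2 * Z" using XV unfolding V2 by (simp add: add.commute)
  also have "\<dots> \<le> 2 * (Y + W)" by (intro mult_left_mono ZYW) simp
  also have "\<dots> = 2 * Y + 2 * W" by (simp add: distrib_left)
  finally have le: "2 * Y + 2 * X \<le> 2 * Y + 2 * W" .
  \<comment> \<open>Z is finite because k is integrable and the shift differences of G are bounded
    in L2. Hence Y is finite and may be cancelled.\<close>
  have "2 * Y \<le> 2 * Z" using XV unfolding V2 by (metis add.commute le_iff_add)
  also have "2 * Z < \<infinity>" using Zfin by (simp add: ennreal_mult_less_top)
  finally have "2 * Y < \<infinity>" .
  then have XW: "2 * X \<le> 2 * W" using le by (subst (asm) ennreal_add_left_cancel_le) auto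
  then have "X \<le> W" by (subst (asm) ennreal_mult_le_mult_iff) auto
  then show ?thesis unfolding X_def W_def .
qed

text \<open>The kernel r^(-1 - \<gamma>) of the Marchaud derivative, shifted by \<epsilon> to be
  integrable at 0. The normalising factor \<gamma> / Gamma (1 - \<gamma>) is supplied in
  \<open>fractional_derivative_exists\<close>.\<close>

definition marchaud_kernel :: "real \<Rightarrow> real \<Rightarrow> real \<Rightarrow> real" where
  "marchaud_kernel \<gamma> \<epsilon> r = (if 0 < r then (r + \<epsilon>) powr (- 1 - \<gamma>) else 0)"

lemma marchaud_kernel_measurable [measurable]: "marchaud_kernel \<gamma> \<epsilon> \<in> borel_measurable borel"
  unfolding marchaud_kernel_def[abs_def] by measurable

lemma marchaud_kernel_nonneg: "0 \<le> marchaud_kernel \<gamma> \<epsilon> r"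
  by (simp add: marchaud_kernel_def)

lemma marchaud_kernel_mono:
  assumes "0 < \<gamma>" "0 \<le> \<delta>" "\<delta> \<le> \<epsilon>" shows "marchaud_kernel \<gamma> \<epsilon> r \<le> marchaud_kernel \<gamma> \<delta> r"
  using assms by (auto simp: marchaud_kernel_def intro!: powr_mono2')

lemma
  assumes "0 < \<gamma>" "0 < \<epsilon>"
  shows marchaud_kernel_integrable: "integrable lborel (marchaud_kernel \<gamma> \<epsilon>)"
    and marchaud_kernel_integral: "(\<integral>r. marchaud_kernel \<gamma> \<epsilon> r \<partial>lborel) = \<epsilon> powr (- \<gamma>) / \<gamma>"
proof -
  have "(\<integral>\<^sup>+r. ennreal (marchaud_kernel \<gamma> \<epsilon> r) \<partial>lborel)
    = (\<integral>\<^sup>+r. ennreal ((r - - \<epsilon>) powr (- 1 - \<gamma>)) * indicator {\<epsilon>..} (r - - \<epsilon>) \<partial>lborel)"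
    using AE_lborel_singleton[of 0]
    by (intro nn_integral_cong_AE) (auto simp: marchaud_kernel_def indicator_def elim!: eventually_mono)
  also have "\<dots> = (\<integral>\<^sup>+\<rho>. ennreal (\<rho> powr (- 1 - \<gamma>)) * indicator {\<epsilon>..} \<rho> \<partial>lborel)"
    by (rule nn_integral_shift(1)) measurable
  also have "\<dots> = ennreal (\<epsilon> powr (- \<gamma>) / \<gamma>)" by (rule nn_integral_powr_tail[OF assms])
  finally have e: "(\<integral>\<^sup>+r. ennreal (marchaud_kernel \<gamma> \<epsilon> r) \<partial>lborel) = ennreal (\<epsilon> powr (- \<gamma>) / \<gamma>)" .
  show "integrable lborel (marchaud_kernel \<gamma> \<epsilon>)"
    using e by (intro integrableI_nonneg) (auto simp: marchaud_kernel_nonneg)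
  show "(\<integral>r. marchaud_kernel \<gamma> \<epsilon> r \<partial>lborel) = \<epsilon> powr (- \<gamma>) / \<gamma>"
    using e assms by (subst integral_eq_nn_integral) (auto simp: marchaud_kernel_nonneg)
qed

text \<open>The increment of the singular kernel, used as d in \<open>marchaud_bound\<close>. It
  dominates the increments of all regularised kernels, so the resulting bounds are uniform in
  \<epsilon>.\<close>

definition marchaud_diff :: "real \<Rightarrow> real \<Rightarrow> real \<Rightarrow> real" where
  "marchaud_diff \<gamma> \<rho> r = (if 0 < \<rho> \<and> 0 < r then \<rho> powr (- 1 - \<gamma>) - (\<rho> + r) powr (- 1 - \<gamma>) else 0)"

lemma marchaud_diff_measurable [measurable]:
  "(\<lambda>(\<rho>, r). marchaud_diff \<gamma> \<rho> r) \<in> borel_measurable (borel \<Otimes>\<^sub>M borel)"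
  unfolding marchaud_diff_def[abs_def] by measurable

lemma marchaud_diff_nonneg: "0 < \<gamma> \<Longrightarrow> 0 \<le> marchaud_diff \<gamma> \<rho> r"
  by (auto simp: marchaud_diff_def intro!: powr_mono2')

lemma powr_diff_factor:
  fixes x r a :: real
  assumes "0 < x" "0 < r"
  shows "x powr a - (x + r) powr a = x powr a * (1 - (1 + r / x) powr a)"
proof -
  have "x + r = x * (1 + r / x)" using assms by (simp add: field_simps)
  then have "(x + r) powr a = x powr a * (1 + r / x) powr a"
    using assms by (simp add: powr_mult)
  then show ?thesis by (simp add: algebra_simps)
qed

text \<open>The increment factors as x^(-1 - \<gamma>) times 1 - (1 + r/x)^(-1 - \<gamma>), and both
  nonnegative factors decrease in x.\<close>

lemma powr_diff_antimono:
  fixes x y r \<gamma> :: real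
  assumes "0 < \<gamma>" "0 < x" "x \<le> y" "0 < r"
  shows "y powr (- 1 - \<gamma>) - (y + r) powr (- 1 - \<gamma>) \<le> x powr (- 1 - \<gamma>) - (x + r) powr (- 1 - \<gamma>)"
proof -
  have "y powr (- 1 - \<gamma>) * (1 - (1 + r / y) powr (- 1 - \<gamma>)) \<le> x powr (- 1 - \<gamma>) * (1 - (1 + r / x) powr (- 1 - \<gamma>))"
  proof (rule mult_mono)
    show "y powr (- 1 - \<gamma>) \<le> x powr (- 1 - \<gamma>)" using assms by (intro powr_mono2') auto
    have "r / y \<le> r / x" using assms by (intro divide_left_mono) auto
    then have "(1 + r / x) powr (- 1 - \<gamma>) \<le> (1 + r / y) powr (- 1 - \<gamma>)"
      using assms by (intro powr_mono2') (auto intro: add_pos_nonneg)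
    then show "1 - (1 + r / y) powr (- 1 - \<gamma>) \<le> 1 - (1 + r / x) powr (- 1 - \<gamma>)" by simp
    have "(1 + r / y) powr (- 1 - \<gamma>) \<le> 1 powr (- 1 - \<gamma>)" using assms by (intro powr_mono2') auto
    then show "0 \<le> 1 - (1 + r / y) powr (- 1 - \<gamma>)" by simp
  qed simp
  then show ?thesis using assms by (simp add: powr_diff_factor)
qed

text \<open>The first bound serves for r \<le> \<rho>, where the increment is of first order in r,
  the second for larger r. The first follows from exp y \<ge> 1 + y and ln (1 + x) \<le> x.\<close>

lemma marchaud_diff_le:
  assumes "0 < \<gamma>" "0 < \<rho>" "0 < r"
  shows "marchaud_diff \<gamma> \<rho> r \<le> (1 + \<gamma>) * r * \<rho> powr (- 2 - \<gamma>)" "marchaud_diff \<gamma> \<rho> r \<le> \<rho> powr (- 1 - \<gamma>)"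
proof -
  show "marchaud_diff \<gamma> \<rho> r \<le> \<rho> powr (- 1 - \<gamma>)" using assms by (simp add: marchaud_diff_def)
  have "ln (1 + r / \<rho>) \<le> r / \<rho>" using assms by (intro ln_add_one_self_le_self) auto
  then have "(- 1 - \<gamma>) * (r / \<rho>) \<le> (- 1 - \<gamma>) * ln (1 + r / \<rho>)" using assms by (intro mult_left_mono_neg) auto
  then have "1 + (- 1 - \<gamma>) * (r / \<rho>) \<le> exp ((- 1 - \<gamma>) * ln (1 + r / \<rho>))"
    using exp_ge_add_one_self[of "(- 1 - \<gamma>) * ln (1 + r / \<rho>)"] by linarith
  also have "\<dots> = (1 + r / \<rho>) powr (- 1 - \<gamma>)"
  proof -
    have "0 < 1 + r / \<rho>" using assms by (simp add: add_pos_pos)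
    then show ?thesis by (simp add: powr_def)
  qed
  finally have "1 - (1 + r / \<rho>) powr (- 1 - \<gamma>) \<le> (1 + \<gamma>) * (r / \<rho>)" by (simp add: algebra_simps add_divide_distrib)
  then have "\<rho> powr (- 1 - \<gamma>) * (1 - (1 + r / \<rho>) powr (- 1 - \<gamma>)) \<le> \<rho> powr (- 1 - \<gamma>) * ((1 + \<gamma>) * (r / \<rho>))"
    by (rule mult_left_mono) simp
  also have "\<dots> = (1 + \<gamma>) * r * \<rho> powr (- 2 - \<gamma>)"
  proof -
    have "\<rho> powr (- 2 - \<gamma>) = \<rho> powr (- 1 - \<gamma>) / \<rho>"
    proof -
      have "- 2 - \<gamma> = - 1 - \<gamma> - 1" by simp
      then show ?thesis using assms powr_diff[of \<rho> "- 1 - \<gamma>" 1] by simp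
    qed
    then show ?thesis by simp
  qed
  finally show "marchaud_diff \<gamma> \<rho> r \<le> (1 + \<gamma>) * r * \<rho> powr (- 2 - \<gamma>)"
    using assms by (simp add: marchaud_diff_def powr_diff_factor)
qed

definition marchaud_const :: "real \<Rightarrow> real" where
  "marchaud_const \<gamma> = (1 + \<gamma>) / (1 - \<gamma>) + 1 / \<gamma>"

text \<open>Split at r = \<rho>. Below it the increment supplies a factor r, and r^(-\<gamma>) is
  integrable at 0 since \<gamma> < 1; above it the kernel itself decays. The two ranges give the two
  summands of \<open>marchaud_const\<close>.\<close>

lemma marchaud_diff_integral:
  assumes "0 < \<gamma>" "\<gamma> < 1" "0 < \<rho>"
  shows "(\<integral>\<^sup>+r. ennreal (marchaud_kernel \<gamma> 0 r * marchaud_diff \<gamma> \<rho> r) \<partial>lborel)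
    \<le> ennreal (marchaud_const \<gamma> * \<rho> powr (- 1 - 2 * \<gamma>))"
proof -
  have i1: "(\<integral>\<^sup>+r. ennreal (r powr (- \<gamma>)) * indicator {0..\<rho>} r \<partial>lborel) = ennreal (\<rho> powr (- \<gamma> + 1) / (- \<gamma> + 1))"
    using assms by (intro nn_integral_has_integral_lebesgue' has_integral_powr_from_0) auto
  have "(\<integral>\<^sup>+r. ennreal (marchaud_kernel \<gamma> 0 r * marchaud_diff \<gamma> \<rho> r) \<partial>lborel)
    \<le> (\<integral>\<^sup>+r. ennreal ((1 + \<gamma>) * \<rho> powr (- 2 - \<gamma>)) * (ennreal (r powr (- \<gamma>)) * indicator {0..\<rho>} r)
      + ennreal (\<rho> powr (- 1 - \<gamma>)) * (ennreal (r powr (- 1 - \<gamma>)) * indicator {\<rho>..} r) \<partial>lborel)"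
  proof (rule nn_integral_mono)
    fix r
    consider "r \<le> 0" | "0 < r" "r \<le> \<rho>" | "\<rho> < r" using assms by linarith
    then show "ennreal (marchaud_kernel \<gamma> 0 r * marchaud_diff \<gamma> \<rho> r)
      \<le> ennreal ((1 + \<gamma>) * \<rho> powr (- 2 - \<gamma>)) * (ennreal (r powr (- \<gamma>)) * indicator {0..\<rho>} r)
      + ennreal (\<rho> powr (- 1 - \<gamma>)) * (ennreal (r powr (- 1 - \<gamma>)) * indicator {\<rho>..} r)"
    proof cases
      case 1
      then show ?thesis by (simp add: marchaud_kernel_def)
    next
      case 2
      have "marchaud_kernel \<gamma> 0 r * marchaud_diff \<gamma> \<rho> r \<le> r powr (- 1 - \<gamma>) * ((1 + \<gamma>) * r * \<rho> powr (- 2 - \<gamma>))"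
        using 2 assms marchaud_diff_le(1)[of \<gamma> \<rho> r] by (auto simp: marchaud_kernel_def mult.assoc intro!: mult_left_mono)
      also have "\<dots> = (1 + \<gamma>) * \<rho> powr (- 2 - \<gamma>) * (r * r powr (- 1 - \<gamma>))" by simp
      also have "r * r powr (- 1 - \<gamma>) = r powr (- \<gamma>)"
        using powr_mult_base[of r "- 1 - \<gamma>"] 2 by simp
      finally have "ennreal (marchaud_kernel \<gamma> 0 r * marchaud_diff \<gamma> \<rho> r) \<le> ennreal ((1 + \<gamma>) * \<rho> powr (- 2 - \<gamma>) * r powr (- \<gamma>))"
        by (rule ennreal_leI)
      also have "\<dots> = ennreal ((1 + \<gamma>) * \<rho> powr (- 2 - \<gamma>)) * (ennreal (r powr (- \<gamma>)) * indicator {0..\<rho>} r)"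
        using 2 assms by (simp add: ennreal_mult)
      finally show ?thesis by (rule order_trans) simp
    next
      case 3
      then have "0 < r" using assms by simp
      have "marchaud_kernel \<gamma> 0 r * marchaud_diff \<gamma> \<rho> r \<le> r powr (- 1 - \<gamma>) * \<rho> powr (- 1 - \<gamma>)"
        using \<open>0 < r\<close> assms by (auto simp: marchaud_kernel_def intro!: mult_left_mono marchaud_diff_le)
      then have "ennreal (marchaud_kernel \<gamma> 0 r * marchaud_diff \<gamma> \<rho> r) \<le> ennreal (r powr (- 1 - \<gamma>) * \<rho> powr (- 1 - \<gamma>))"
        by (rule ennreal_leI)
      also have "\<dots> = ennreal (\<rho> powr (- 1 - \<gamma>)) * (ennreal (r powr (- 1 - \<gamma>)) * indicator {\<rho>..} r)"
        using 3 by (simp add: ennreal_mult mult.commute)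
      finally show ?thesis by (rule order_trans) simp
    qed
  qed
  also have "\<dots> = ennreal ((1 + \<gamma>) * \<rho> powr (- 2 - \<gamma>)) * ennreal (\<rho> powr (- \<gamma> + 1) / (- \<gamma> + 1))
      + ennreal (\<rho> powr (- 1 - \<gamma>)) * ennreal (\<rho> powr (- \<gamma>) / \<gamma>)"
    using i1 nn_integral_powr_tail[OF assms(1,3)] by (simp add: nn_integral_add nn_integral_cmult)
  also have "\<dots> = ennreal ((1 + \<gamma>) * \<rho> powr (- 2 - \<gamma>) * (\<rho> powr (- \<gamma> + 1) / (- \<gamma> + 1)) + \<rho> powr (- 1 - \<gamma>) * (\<rho> powr (- \<gamma>) / \<gamma>))"
  proof -
    have "ennreal a * ennreal b + ennreal c * ennreal d = ennreal (a * b + c * d)"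
      if "0 \<le> a" "0 \<le> b" "0 \<le> c" "0 \<le> d" for a b c d
      using that by (simp add: ennreal_mult)
    from this[of "(1 + \<gamma>) * \<rho> powr (- 2 - \<gamma>)" "\<rho> powr (- \<gamma> + 1) / (- \<gamma> + 1)" "\<rho> powr (- 1 - \<gamma>)" "\<rho> powr (- \<gamma>) / \<gamma>"]
    show ?thesis using assms by fastforce
  qed
  also have "(1 + \<gamma>) * \<rho> powr (- 2 - \<gamma>) * (\<rho> powr (- \<gamma> + 1) / (- \<gamma> + 1)) + \<rho> powr (- 1 - \<gamma>) * (\<rho> powr (- \<gamma>) / \<gamma>)
    = marchaud_const \<gamma> * \<rho> powr (- 1 - 2 * \<gamma>)"
  proof -
    have "\<rho> powr (- 2 - \<gamma>) * \<rho> powr (- \<gamma> + 1) = \<rho> powr (- 1 - 2 * \<gamma>)" "\<rho> powr (- 1 - \<gamma>) * \<rho> powr (- \<gamma>) = \<rho> powr (- 1 - 2 * \<gamma>)"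
    proof -
      have "(- 2 - \<gamma>) + (- \<gamma> + 1) = - 1 - 2 * \<gamma>" "(- 1 - \<gamma>) + (- \<gamma>) = - 1 - 2 * \<gamma>" by simp_all
      then show "\<rho> powr (- 2 - \<gamma>) * \<rho> powr (- \<gamma> + 1) = \<rho> powr (- 1 - 2 * \<gamma>)" "\<rho> powr (- 1 - \<gamma>) * \<rho> powr (- \<gamma>) = \<rho> powr (- 1 - 2 * \<gamma>)"
        by (metis powr_add)+
    qed
    then have e: "(1 + \<gamma>) * \<rho> powr (- 2 - \<gamma>) * (\<rho> powr (- \<gamma> + 1) / (- \<gamma> + 1)) = (1 + \<gamma>) / (1 - \<gamma>) * \<rho> powr (- 1 - 2 * \<gamma>)"
      "\<rho> powr (- 1 - \<gamma>) * (\<rho> powr (- \<gamma>) / \<gamma>) = 1 / \<gamma> * \<rho> powr (- 1 - 2 * \<gamma>)"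
      by simp_all
    show ?thesis unfolding e marchaud_const_def by (rule distrib_right[symmetric])
  qed
  finally show ?thesis .
qed

lemma slob_line_shift_sq:
  assumes [measurable]: "G \<in> borel_measurable borel"
  shows "slob_line \<gamma> G = (\<integral>\<^sup>+\<rho>. (if 0 < \<rho> then shift_sq G \<rho> * ennreal (\<rho> powr (- 1 - 2 * \<gamma>)) else 0) \<partial>lborel)"
proof -
  have ind: "indicator {0<..} (x::real) = (if 0 < x then 1 else (0::real))" for x by (simp add: indicator_def)
  have "slob_line \<gamma> G = (\<integral>\<^sup>+\<rho>. \<integral>\<^sup>+t. ennreal (indicator {0<..} \<rho> * ((G t - G (t - \<rho>))\<^sup>2 * \<rho> powr (- 1 - 2 * \<gamma>))) \<partial>lborel \<partial>lborel)"
    unfolding slob_line_def ind by (rule lborel_pair.Fubini'[symmetric]) measurable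
  also have "\<dots> = (\<integral>\<^sup>+\<rho>. (if 0 < \<rho> then shift_sq G \<rho> * ennreal (\<rho> powr (- 1 - 2 * \<gamma>)) else 0) \<partial>lborel)"
    unfolding shift_sq_def by (intro nn_integral_cong) (auto simp: ind ennreal_mult nn_integral_multc)
  finally show ?thesis .
qed

text \<open>One statement for two purposes: \<delta> = 0 means that nothing is subtracted and bounds
  a single regularised derivative, while \<delta> > \<epsilon> bounds the difference of two. The
  right-hand side is free of \<epsilon>.\<close>

lemma marchaud_bound_kernel:
  assumes G: "G \<in> sqi lborel" and \<gamma>: "0 < \<gamma>" and \<epsilon>: "0 < \<epsilon>" and \<delta>: "\<delta> = 0 \<or> \<epsilon> < \<delta>"
  defines "k \<equiv> \<lambda>r. marchaud_kernel \<gamma> \<epsilon> r - (if \<delta> = 0 then 0 else marchaud_kernel \<gamma> \<delta> r)"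
  shows "(\<integral>\<^sup>+t. ennreal ((\<integral>r. (G t - G (t - r)) * k r \<partial>lborel)\<^sup>2) \<partial>lborel)
    \<le> (\<integral>\<^sup>+\<rho>. \<integral>\<^sup>+r. (if 0 < \<rho> then shift_sq G \<rho> * ennreal ((marchaud_kernel \<gamma> 0 r - (if \<delta> = 0 then 0 else marchaud_kernel \<gamma> \<delta> r)) * marchaud_diff \<gamma> \<rho> r) else 0) \<partial>lborel \<partial>lborel)"
    (is "_ \<le> ?R")
proof -
  have kI: "integrable lborel k" unfolding k_def using \<gamma> \<epsilon> \<delta> by (auto intro!: Bochner_Integration.integrable_diff marchaud_kernel_integrable)
  have k0: "0 \<le> k r" for r
    unfolding k_def using \<gamma> \<epsilon> \<delta> marchaud_kernel_mono[of \<gamma> \<epsilon> \<delta> r] by (auto simp: marchaud_kernel_nonneg)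
  have kz: "k r = 0" if "r \<le> 0" for r using that by (simp add: k_def marchaud_kernel_def)
  \<comment> \<open>Only the increment of the \<epsilon>-kernel has to be dominated. The subtracted
    \<delta>-kernel is decreasing, so its increment has the favourable sign.\<close>
  have kd: "k \<rho> \<le> k (r + \<rho>) + marchaud_diff \<gamma> \<rho> r" if "0 < \<rho>" "0 < r" for \<rho> r
  proof -
    have "(\<rho> + \<epsilon>) powr (- 1 - \<gamma>) - (\<rho> + \<epsilon> + r) powr (- 1 - \<gamma>) \<le> \<rho> powr (- 1 - \<gamma>) - (\<rho> + r) powr (- 1 - \<gamma>)"
      using that \<epsilon> \<gamma> by (intro powr_diff_antimono) auto
    moreover have "(\<rho> + \<delta> + r) powr (- 1 - \<gamma>) \<le> (\<rho> + \<delta>) powr (- 1 - \<gamma>)" if "\<delta> \<noteq> 0"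
      using that \<open>0 < \<rho>\<close> \<open>0 < r\<close> \<delta> \<epsilon> \<gamma> by (intro powr_mono2') auto
    ultimately show ?thesis using that by (auto simp: k_def marchaud_kernel_def marchaud_diff_def add_ac)
  qed
  have "(\<integral>\<^sup>+t. ennreal ((\<integral>r. (G t - G (t - r)) * k r \<partial>lborel)\<^sup>2) \<partial>lborel)
    \<le> (\<integral>\<^sup>+\<rho>. \<integral>\<^sup>+r. (if 0 < \<rho> then shift_sq G \<rho> * ennreal (k r * marchaud_diff \<gamma> \<rho> r) else 0) \<partial>lborel \<partial>lborel)"
    by (rule marchaud_bound[OF G kI k0 kz marchaud_diff_measurable marchaud_diff_nonneg[OF \<gamma>] kd])
  also have "\<dots> \<le> ?R"
  proof (intro nn_integral_mono)
    fix \<rho> r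
    have "k r \<le> marchaud_kernel \<gamma> 0 r - (if \<delta> = 0 then 0 else marchaud_kernel \<gamma> \<delta> r)"
      unfolding k_def using marchaud_kernel_mono[OF \<gamma>, of 0 \<epsilon> r] \<epsilon> by auto
    then show "(if 0 < \<rho> then shift_sq G \<rho> * ennreal (k r * marchaud_diff \<gamma> \<rho> r) else 0)
      \<le> (if 0 < \<rho> then shift_sq G \<rho> * ennreal ((marchaud_kernel \<gamma> 0 r - (if \<delta> = 0 then 0 else marchaud_kernel \<gamma> \<delta> r)) * marchaud_diff \<gamma> \<rho> r) else 0)"
      using marchaud_diff_nonneg[OF \<gamma>, of \<rho> r] by (auto intro!: mult_left_mono ennreal_leI mult_right_mono)
  qed
  finally show ?thesis .
qed

lemma marchaud_majorant:
  assumes [measurable]: "G \<in> borel_measurable borel" and \<gamma>: "0 < \<gamma>" "\<gamma> < 1"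
  shows "(\<integral>\<^sup>+\<rho>. \<integral>\<^sup>+r. (if 0 < \<rho> then shift_sq G \<rho> * ennreal (marchaud_kernel \<gamma> 0 r * marchaud_diff \<gamma> \<rho> r) else 0) \<partial>lborel \<partial>lborel)
    \<le> ennreal (marchaud_const \<gamma>) * slob_line \<gamma> G"
proof -
  have [measurable]: "marchaud_diff \<gamma> \<rho> \<in> borel_measurable borel" for \<rho>
    unfolding marchaud_diff_def[abs_def] by measurable
  have C: "0 \<le> marchaud_const \<gamma>" using \<gamma> by (auto simp: marchaud_const_def)
  have "(\<integral>\<^sup>+\<rho>. \<integral>\<^sup>+r. (if 0 < \<rho> then shift_sq G \<rho> * ennreal (marchaud_kernel \<gamma> 0 r * marchaud_diff \<gamma> \<rho> r) else 0) \<partial>lborel \<partial>lborel)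
    \<le> (\<integral>\<^sup>+\<rho>. ennreal (marchaud_const \<gamma>) * (if 0 < \<rho> then shift_sq G \<rho> * ennreal (\<rho> powr (- 1 - 2 * \<gamma>)) else 0) \<partial>lborel)"
  proof (rule nn_integral_mono)
    fix \<rho> :: real
    show "(\<integral>\<^sup>+r. (if 0 < \<rho> then shift_sq G \<rho> * ennreal (marchaud_kernel \<gamma> 0 r * marchaud_diff \<gamma> \<rho> r) else 0) \<partial>lborel)
      \<le> ennreal (marchaud_const \<gamma>) * (if 0 < \<rho> then shift_sq G \<rho> * ennreal (\<rho> powr (- 1 - 2 * \<gamma>)) else 0)"
    proof (cases "0 < \<rho>")
      case True
      have "(\<integral>\<^sup>+r. shift_sq G \<rho> * ennreal (marchaud_kernel \<gamma> 0 r * marchaud_diff \<gamma> \<rho> r) \<partial>lborel)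
        = shift_sq G \<rho> * (\<integral>\<^sup>+r. ennreal (marchaud_kernel \<gamma> 0 r * marchaud_diff \<gamma> \<rho> r) \<partial>lborel)"
        by (rule nn_integral_cmult) measurable
      also have "\<dots> \<le> shift_sq G \<rho> * ennreal (marchaud_const \<gamma> * \<rho> powr (- 1 - 2 * \<gamma>))"
        by (intro mult_left_mono marchaud_diff_integral[OF \<gamma> True]) simp
      finally show ?thesis using True C by (simp add: ennreal_mult mult_ac)
    qed simp
  qed
  also have "\<dots> = ennreal (marchaud_const \<gamma>) * slob_line \<gamma> G"
    by (subst slob_line_shift_sq, measurable, subst nn_integral_cmult) auto
  finally show ?thesis .
qed

text \<open>Dominated convergence with the majorant of \<open>marchaud_majorant\<close>. It makes
  the regularised derivatives a Cauchy sequence.\<close>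

lemma marchaud_majorant_tendsto_0:
  assumes G: "G \<in> sqi lborel" and \<gamma>: "0 < \<gamma>" "\<gamma> < 1" and fin: "slob_line \<gamma> G < \<infinity>"
  shows "(\<lambda>n. \<integral>\<^sup>+\<rho>. \<integral>\<^sup>+r. (if 0 < \<rho> then shift_sq G \<rho> *
      ennreal ((marchaud_kernel \<gamma> 0 r - marchaud_kernel \<gamma> (1 / Suc n) r) * marchaud_diff \<gamma> \<rho> r) else 0) \<partial>lborel \<partial>lborel) \<longlonglongrightarrow> 0"
proof -
  have [measurable]: "G \<in> borel_measurable borel" using G by (simp add: sqi_def)
  let ?f = "\<lambda>n q. case q of (\<rho>, r) \<Rightarrow> (if 0 < \<rho> then shift_sq G \<rho> *
      ennreal ((marchaud_kernel \<gamma> 0 r - marchaud_kernel \<gamma> (1 / Suc n) r) * marchaud_diff \<gamma> \<rho> r) else 0)"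
  let ?w = "\<lambda>q. case q of (\<rho>, r) \<Rightarrow> (if 0 < \<rho> then shift_sq G \<rho> *
      ennreal (marchaud_kernel \<gamma> 0 r * marchaud_diff \<gamma> \<rho> r) else 0)"
  have [measurable]: "?f n \<in> borel_measurable (borel \<Otimes>\<^sub>M borel)" "?w \<in> borel_measurable (borel \<Otimes>\<^sub>M borel)" for n
    by measurable
  have pos: "0 < 1 / real (Suc n)" for n by simp
  have "(\<lambda>n. \<integral>\<^sup>+q. ?f n q \<partial>(lborel \<Otimes>\<^sub>M lborel)) \<longlonglongrightarrow> (\<integral>\<^sup>+q. 0 \<partial>(lborel \<Otimes>\<^sub>M lborel :: (real \<times> real) measure))"
  proof (rule nn_integral_dominated_convergence[where w="?w" and u'="\<lambda>q. 0" and u="?f"])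
    show "AE q in lborel \<Otimes>\<^sub>M lborel. ?f n q \<le> ?w q" for n
    proof (rule AE_I2)
      fix q :: "real \<times> real"
      obtain \<rho> r where q: "q = (\<rho>, r)" by force
      show "?f n q \<le> ?w q" unfolding q
        using marchaud_diff_nonneg[OF \<gamma>(1), of \<rho> r] marchaud_kernel_nonneg[of \<gamma> "1 / Suc n" r]
        by (auto intro!: mult_left_mono ennreal_leI mult_right_mono simp del: of_nat_Suc)
    qed
    have "(\<integral>\<^sup>+q. ?w q \<partial>(lborel \<Otimes>\<^sub>M lborel)) \<le> ennreal (marchaud_const \<gamma>) * slob_line \<gamma> G"
      using marchaud_majorant[OF _ \<gamma>, of G] by (subst lborel.nn_integral_fst[symmetric]) auto
    also have "\<dots> < \<infinity>" using fin by (simp add: ennreal_mult_less_top)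
    finally show "(\<integral>\<^sup>+q. ?w q \<partial>(lborel \<Otimes>\<^sub>M lborel)) < \<infinity>" .
    show "AE q in lborel \<Otimes>\<^sub>M lborel. (\<lambda>n. ?f n q) \<longlonglongrightarrow> 0"
    proof (rule AE_I2)
      fix q :: "real \<times> real"
      obtain \<rho> r where q: "q = (\<rho>, r)" by force
      show "(\<lambda>n. ?f n q) \<longlonglongrightarrow> 0"
      proof (cases "0 < \<rho> \<and> 0 < r")
        case True
        have "(\<lambda>n. (r + 1 / Suc n) powr (- 1 - \<gamma>)) \<longlonglongrightarrow> (r + 0) powr (- 1 - \<gamma>)"
          using True by (intro tendsto_intros LIMSEQ_Suc[OF lim_1_over_n]) auto
        then have "(\<lambda>n. (marchaud_kernel \<gamma> 0 r - marchaud_kernel \<gamma> (1 / Suc n) r) * marchaud_diff \<gamma> \<rho> r)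
          \<longlonglongrightarrow> (marchaud_kernel \<gamma> 0 r - marchaud_kernel \<gamma> 0 r) * marchaud_diff \<gamma> \<rho> r"
          using True by (intro tendsto_intros) (simp add: marchaud_kernel_def)
        then have "(\<lambda>n. ennreal ((marchaud_kernel \<gamma> 0 r - marchaud_kernel \<gamma> (1 / Suc n) r) * marchaud_diff \<gamma> \<rho> r)) \<longlonglongrightarrow> ennreal 0"
          by (intro tendsto_ennrealI) simp
        moreover have "shift_sq G \<rho> \<noteq> \<infinity>"
          using shift_sq_le[of G \<rho>] G by (auto simp: sqi_iff_nn ennreal_mult_less_top top.not_eq_extremum intro: le_less_trans)
        ultimately have "(\<lambda>n. shift_sq G \<rho> * ennreal ((marchaud_kernel \<gamma> 0 r - marchaud_kernel \<gamma> (1 / Suc n) r) * marchaud_diff \<gamma> \<rho> r)) \<longlonglongrightarrow> shift_sq G \<rho> * 0"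
          by (intro ennreal_tendsto_cmult) (auto simp: top.not_eq_extremum)
        then show ?thesis using True by (simp add: q)
      qed (auto simp: q marchaud_diff_def cong: if_cong)
    qed
  qed measurable
  then show ?thesis by (subst (asm) lborel.nn_integral_fst[symmetric]) auto
qed

lemma cv_pw_1_shifted_power:
  assumes "0 < \<gamma>" "0 < \<epsilon>" "0 < t" "t < T" and q: "(\<lambda>t. if 0 < t \<and> t < T then (t + \<epsilon>) powr (- 1 - \<gamma>) else 0) \<in> L1s T"
  shows "cv T (pw T 1) (\<lambda>t. if 0 < t \<and> t < T then (t + \<epsilon>) powr (- 1 - \<gamma>) else 0) t = (\<epsilon> powr (- \<gamma>) - (t + \<epsilon>) powr (- \<gamma>)) / \<gamma>"
proof -
  let ?F = "\<lambda>s. (s + \<epsilon>) powr (- \<gamma>) / (- \<gamma>)"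
  have "cv T (pw T 1) (\<lambda>t. if 0 < t \<and> t < T then (t + \<epsilon>) powr (- 1 - \<gamma>) else 0) t
    = (\<integral>s. indicator {..<t} s * (if 0 < s \<and> s < T then (s + \<epsilon>) powr (- 1 - \<gamma>) else 0) \<partial>lborel)"
    using assms conv_pw_1[OF q, of t] by (simp add: cv_def)
  also have "\<dots> = (\<integral>s. indicator {0..t} s *\<^sub>R (s + \<epsilon>) powr (- 1 - \<gamma>) \<partial>lborel)"
  proof (rule integral_cong_AE)
    show "AE s in lborel. indicator {..<t} s * (if 0 < s \<and> s < T then (s + \<epsilon>) powr (- 1 - \<gamma>) else 0)
      = indicator {0..t} s *\<^sub>R (s + \<epsilon>) powr (- 1 - \<gamma>)"
      using AE_lborel_singleton[of 0] AE_lborel_singleton[of t]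
      by eventually_elim (use assms in \<open>auto simp: indicator_def\<close>)
  qed measurable
  also have "\<dots> = ?F t - ?F 0"
  proof (rule integral_FTC_atLeastAtMost)
    fix s assume s: "0 \<le> s" "s \<le> t"
    then have "0 < s + \<epsilon>" using assms by simp
    have "((\<lambda>x. x powr (- \<gamma>)) has_real_derivative (- \<gamma>) * (s + \<epsilon>) powr (- \<gamma> - 1)) (at (s + \<epsilon>))"
      using \<open>0 < s + \<epsilon>\<close> by (rule has_real_derivative_powr)
    then have "((\<lambda>x. (x + \<epsilon>) powr (- \<gamma>)) has_real_derivative (- \<gamma>) * (s + \<epsilon>) powr (- \<gamma> - 1)) (at s)"
      by (simp add: DERIV_shift)
    then have "(?F has_real_derivative (- \<gamma>) * (s + \<epsilon>) powr (- \<gamma> - 1) / (- \<gamma>)) (at s)"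
      by (rule DERIV_cdivide)
    moreover have "(- \<gamma>) * (s + \<epsilon>) powr (- \<gamma> - 1) / (- \<gamma>) = (s + \<epsilon>) powr (- 1 - \<gamma>)"
      using assms by (simp add: minus_diff_commute)
    ultimately show "(?F has_vector_derivative (s + \<epsilon>) powr (- 1 - \<gamma>)) (at s within {0..t})"
      by (simp add: has_real_derivative_iff_has_vector_derivative[symmetric] has_field_derivative_at_within)
  qed (use assms in \<open>auto intro!: continuous_intros\<close>)
  finally show ?thesis using assms by (simp add: diff_divide_distrib)
qed

definition frac_const :: "real \<Rightarrow> real \<Rightarrow> real" where
  "frac_const T \<gamma> = (\<gamma> / Gamma (1 - \<gamma>))\<^sup>2 * (marchaud_const \<gamma> * hardy_const T \<gamma>)"

lemma frac_const_nonneg: "0 < \<gamma> \<Longrightarrow> \<gamma> < 1 \<Longrightarrow> 0 \<le> frac_const T \<gamma>"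
  using hardy_const_pos[of \<gamma> T] by (simp add: frac_const_def marchaud_const_def)

text \<open>The derivative is the limit of \<open>c \<integral>(g(t) - g(t - r)) (r + \<epsilon>)\<^sup>-\<^sup>1\<^sup>-\<^sup>\<gamma> dr\<close>, the exact derivative of
  the convolution of \<open>g\<close> with \<open>(t + \<epsilon>)\<^sup>-\<^sup>\<gamma> / \<Gamma>(1 - \<gamma>)\<close>.\<close>
lemma fractional_derivative_exists:
  fixes T \<gamma> :: real
  assumes T: "0 < T" and \<gamma>: "0 < \<gamma>" "\<gamma> < 1/2" and g: "g \<in> L2s T" and fin: "slob T \<gamma> g < \<infinity>"
  obtains h where "h \<in> L2s T" "AE t in lborel. cv T (pw T 1) h t = cv T (pw T (1 - \<gamma>)) g t"
    "ennreal (\<integral>t. (h t)\<^sup>2 \<partial>lborel) \<le> ennreal (frac_const T \<gamma>) * (slob T \<gamma> g + (\<integral>\<^sup>+t. ennreal ((g t)\<^sup>2) \<partial>lborel))"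
proof -
  note gL = L2s_L1s[OF g] and gI = L1s_integrable[OF L2s_L1s[OF g]] and gq = L2s_sqi[OF g]
  have [measurable]: "g \<in> borel_measurable borel" using gL by (rule L1s_measurable)
  have g0: "g t = 0" if "\<not> (0 < t \<and> t < T)" for t using L1s_zero[OF gL, of t] that by auto
  have \<gamma>1: "\<gamma> < 1" using \<gamma> by simp
  have Gp: "Gamma (1 - \<gamma>) > 0" using \<gamma>1 by (intro Gamma_real_pos) simp
  define c where "c = \<gamma> / Gamma (1 - \<gamma>)"
  have c: "c > 0" using \<gamma> Gp by (simp add: c_def)
  define \<epsilon> where "\<epsilon> n = 1 / real (Suc n)" for n
  have \<epsilon>: "\<epsilon> n > 0" for n by (simp add: \<epsilon>_def)
  have \<epsilon>mono: "\<epsilon> m < \<epsilon> n" if "n < m" for m n using that by (simp add: \<epsilon>_def frac_less2)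
  let ?mk = "\<lambda>n. marchaud_kernel \<gamma> (\<epsilon> n)"
  have mkI: "integrable lborel (?mk n)" for n by (rule marchaud_kernel_integrable[OF \<gamma>(1) \<epsilon>])
  define q where "q n t = (if 0 < t \<and> t < T then (t + \<epsilon> n) powr (- 1 - \<gamma>) else 0)" for n t
  have qL: "q n \<in> L1s T" for n
  proof -
    have "integrable lborel (\<lambda>t. indicator {0<..<T} t * ?mk n t)"
      by (rule integrable_indicator_mult[OF mkI]) simp
    moreover have "(\<lambda>t. indicator {0<..<T} t * ?mk n t) = q n"
      by (auto simp: fun_eq_iff q_def marchaud_kernel_def)
    ultimately show ?thesis by (simp add: L1s_def q_def)
  qed
  \<comment> \<open>The regularised kernel has mass \<epsilon>^(-\<gamma>) / \<gamma>. Multiplying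
    out the Marchaud integral \<open>D n\<close> gives this multiple of g minus a convolution, so
    that \<open>h n\<close> is c times \<open>D n\<close> almost everywhere in (0, T) and vanishes
    outside.\<close>
  define h where "h n t = \<epsilon> n powr (- \<gamma>) / Gamma (1 - \<gamma>) * g t + (- c) * cv T (q n) g t" for n t
  have hL: "h n \<in> L2s T" for n
    unfolding h_def by (intro L2s_add L2s_cmult cv_L2s g qL)
  have [measurable]: "h n \<in> borel_measurable borel" for n using L1s_measurable[OF L2s_L1s[OF hL]] .
  have h0: "h n t = 0" if "\<not> (0 < t \<and> t < T)" for n t using L1s_zero[OF L2s_L1s[OF hL], of t] that by auto
  define D where "D n t = (\<integral>r. (g t - g (t - r)) * ?mk n r \<partial>lborel)" for n t
  have hD: "AE t in lborel. 0 < t \<and> t < T \<longrightarrow> integrable lborel (\<lambda>r. (g t - g (t - r)) * ?mk n r) \<and> h n t = c * D n t" for n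
    using conv_AE_integrable[OF gI mkI[of n]]
  proof eventually_elim
    case (elim t)
    show ?case
    proof (intro impI)
      assume t: "0 < t \<and> t < T"
      have eq: "(\<lambda>r. (g t - g (t - r)) * ?mk n r) = (\<lambda>r. g t * ?mk n r - g (t - r) * ?mk n r)"
        by (simp add: fun_eq_iff left_diff_distrib)
      have I: "integrable lborel (\<lambda>r. (g t - g (t - r)) * ?mk n r)"
        unfolding eq using elim mkI by (intro Bochner_Integration.integrable_diff integrable_mult_right) auto
      have "D n t = g t * (\<epsilon> n powr (- \<gamma>) / \<gamma>) - conv g (?mk n) t"
        unfolding D_def eq conv_def using elim mkI marchaud_kernel_integral[OF \<gamma>(1) \<epsilon>, of n]
        by (subst Bochner_Integration.integral_diff) auto
      also have "conv g (?mk n) t = conv (?mk n) g t" by (rule conv_commute)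
      also have "\<dots> = conv (q n) g t"
        unfolding conv_def
      proof (intro Bochner_Integration.integral_cong refl)
        fix s
        show "?mk n (t - s) * g s = q n (t - s) * g s"
          using g0[of s] t by (cases "0 < s") (auto simp: q_def marchaud_kernel_def)
      qed
      finally have "c * D n t = c * (g t * (\<epsilon> n powr (- \<gamma>) / \<gamma>)) - c * conv (q n) g t"
        by (simp add: right_diff_distrib)
      also have "c * (g t * (\<epsilon> n powr (- \<gamma>) / \<gamma>)) = \<epsilon> n powr (- \<gamma>) / Gamma (1 - \<gamma>) * g t"
        using \<gamma> by (simp add: c_def)
      finally have "h n t = c * D n t" using t by (simp add: h_def cv_def)
      with I show "integrable lborel (\<lambda>r. (g t - g (t - r)) * ?mk n r) \<and> h n t = c * D n t" by simp
    qed
  qed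
  define \<omega> where "\<omega> n = (\<integral>\<^sup>+\<rho>. \<integral>\<^sup>+r. (if 0 < \<rho> then shift_sq g \<rho> *
      ennreal ((marchaud_kernel \<gamma> 0 r - ?mk n r) * marchaud_diff \<gamma> \<rho> r) else 0) \<partial>lborel \<partial>lborel)" for n
  have line: "slob_line \<gamma> g \<le> ennreal (hardy_const T \<gamma>) * (slob T \<gamma> g + (\<integral>\<^sup>+t. ennreal ((g t)\<^sup>2) \<partial>lborel))"
    by (rule slob_line_le[OF g T \<gamma>])
  have "slob_line \<gamma> g < \<infinity>"
    using line fin gq by (auto simp: sqi_iff_nn ennreal_mult_less_top intro: le_less_trans)
  then have \<omega>0: "\<omega> \<longlonglongrightarrow> 0"
    unfolding \<omega>_def \<epsilon>_def by (rule marchaud_majorant_tendsto_0[OF gq \<gamma>(1) \<gamma>1])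
  have diff: "ennreal (\<integral>t. (h m t - h n t)\<^sup>2 \<partial>lborel) \<le> ennreal (c\<^sup>2) * \<omega> n" if mn: "n < m" for m n
  proof -
    have "ennreal (\<integral>t. (h m t - h n t)\<^sup>2 \<partial>lborel) = (\<integral>\<^sup>+t. ennreal ((h m t - h n t)\<^sup>2) \<partial>lborel)"
      by (rule sqi_nn_integral[symmetric, OF sqi_diff[OF L2s_sqi[OF hL] L2s_sqi[OF hL]]])
    also have "\<dots> \<le> (\<integral>\<^sup>+t. ennreal (c\<^sup>2) * ennreal ((\<integral>r. (g t - g (t - r)) * (?mk m r - (if \<epsilon> n = 0 then 0 else ?mk n r)) \<partial>lborel)\<^sup>2) \<partial>lborel)"
      using hD[of m] hD[of n]
    proof (intro nn_integral_mono_AE, eventually_elim)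
      case (elim t)
      show ?case
      proof (cases "0 < t \<and> t < T")
        case True
        then have "h m t - h n t = c * (D m t - D n t)" using elim by (simp add: right_diff_distrib)
        also have "D m t - D n t = (\<integral>r. (g t - g (t - r)) * ?mk m r - (g t - g (t - r)) * ?mk n r \<partial>lborel)"
          unfolding D_def using elim True by (intro Bochner_Integration.integral_diff[symmetric]) auto
        also have "\<dots> = (\<integral>r. (g t - g (t - r)) * (?mk m r - (if \<epsilon> n = 0 then 0 else ?mk n r)) \<partial>lborel)"
          using \<epsilon>[of n] by (simp add: right_diff_distrib)
        finally show ?thesis by (simp add: power_mult_distrib ennreal_mult)
      qed (simp add: h0)
    qed
    also have "\<dots> = ennreal (c\<^sup>2) * (\<integral>\<^sup>+t. ennreal ((\<integral>r. (g t - g (t - r)) * (?mk m r - (if \<epsilon> n = 0 then 0 else ?mk n r)) \<partial>lborel)\<^sup>2) \<partial>lborel)"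
      by (rule nn_integral_cmult) measurable
    also have "\<dots> \<le> ennreal (c\<^sup>2) * \<omega> n"
    proof (rule mult_left_mono)
      have ne: "(\<epsilon> n = 0) = False" using \<epsilon>[of n] by simp
      show "(\<integral>\<^sup>+t. ennreal ((\<integral>r. (g t - g (t - r)) * (?mk m r - (if \<epsilon> n = 0 then 0 else ?mk n r)) \<partial>lborel)\<^sup>2) \<partial>lborel) \<le> \<omega> n"
        using marchaud_bound_kernel[OF gq \<gamma>(1) \<epsilon>[of m], of "\<epsilon> n"] \<epsilon>mono[OF mn]
        unfolding \<omega>_def ne if_False by blast
    qed simp
    finally show ?thesis .
  qed
  have norm: "ennreal (\<integral>t. (h n t)\<^sup>2 \<partial>lborel) \<le> ennreal (c\<^sup>2) * (ennreal (marchaud_const \<gamma>) * slob_line \<gamma> g)" for n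
  proof -
    have "ennreal (\<integral>t. (h n t)\<^sup>2 \<partial>lborel) = (\<integral>\<^sup>+t. ennreal ((h n t)\<^sup>2) \<partial>lborel)"
      by (rule sqi_nn_integral[symmetric, OF L2s_sqi[OF hL]])
    also have "\<dots> \<le> (\<integral>\<^sup>+t. ennreal (c\<^sup>2) * ennreal ((D n t)\<^sup>2) \<partial>lborel)"
      using hD[of n]
    proof (intro nn_integral_mono_AE, eventually_elim)
      case (elim t)
      then show ?case
        by (cases "0 < t \<and> t < T") (simp_all add: h0 power_mult_distrib ennreal_mult)
    qed
    also have "\<dots> = ennreal (c\<^sup>2) * (\<integral>\<^sup>+t. ennreal ((D n t)\<^sup>2) \<partial>lborel)"
      unfolding D_def by (rule nn_integral_cmult) measurable
    also have "(\<integral>\<^sup>+t. ennreal ((D n t)\<^sup>2) \<partial>lborel) \<le> (\<integral>\<^sup>+\<rho>. \<integral>\<^sup>+r. (if 0 < \<rho> then shift_sq g \<rho> * ennreal (marchaud_kernel \<gamma> 0 r * marchaud_diff \<gamma> \<rho> r) else 0) \<partial>lborel \<partial>lborel)"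
      using marchaud_bound_kernel[OF gq \<gamma>(1) \<epsilon>[of n], of 0] unfolding D_def by (simp cong: if_cong)
    also have "\<dots> \<le> ennreal (marchaud_const \<gamma>) * slob_line \<gamma> g"
      by (rule marchaud_majorant) (use \<gamma> \<gamma>1 in auto)
    finally show ?thesis by (simp add: mult_left_mono)
  qed
  have "\<exists>N. \<forall>m\<ge>N. \<forall>n\<ge>N. (\<integral>t. (h m t - h n t)\<^sup>2 \<partial>lborel) < e" if "e > 0" for e
  proof -
    have "(\<lambda>n. ennreal (c\<^sup>2) * \<omega> n) \<longlonglongrightarrow> ennreal (c\<^sup>2) * 0"
      by (intro ennreal_tendsto_cmult \<omega>0) simp
    then have "\<forall>\<^sub>F n in sequentially. ennreal (c\<^sup>2) * \<omega> n < ennreal e"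
      using that by (intro order_tendstoD(2)) auto
    then obtain N where N: "\<And>n. n \<ge> N \<Longrightarrow> ennreal (c\<^sup>2) * \<omega> n < ennreal e"
      by (auto simp: eventually_sequentially)
    have lt: "(\<integral>t. (h m t - h n t)\<^sup>2 \<partial>lborel) < e" if "N \<le> n" "n < m" for m n
    proof -
      have "ennreal (\<integral>t. (h m t - h n t)\<^sup>2 \<partial>lborel) < ennreal e"
        using diff[OF that(2)] N[OF that(1)] by (rule le_less_trans)
      then show ?thesis by (subst (asm) ennreal_less_iff) auto
    qed
    have "(\<integral>t. (h m t - h n t)\<^sup>2 \<partial>lborel) < e" if "N \<le> n" "N \<le> m" for m n
    proof (cases m n rule: linorder_cases)
      case less
      then show ?thesis using lt[of m n] that by (simp add: power2_commute)
    next
      case equal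
      then show ?thesis using \<open>e > 0\<close> by simp
    next
      case greater
      then show ?thesis using lt[of n m] that by simp
    qed
    then show ?thesis by auto
  qed
  with sqi_complete[of h lborel] L2s_sqi[OF hL]
  obtain H where H: "H \<in> sqi lborel" "(\<lambda>n. \<integral>t. (h n t - H t)\<^sup>2 \<partial>lborel) \<longlonglongrightarrow> 0" by blast
  \<comment> \<open>All \<open>h n\<close> vanish outside (0, T), so resetting the limit to zero
    there can only decrease its distance to them.\<close>
  define H' where "H' t = (if 0 < t \<and> t < T then H t else 0)" for t
  have [measurable]: "H \<in> borel_measurable borel" using sqi_measurable[OF H(1)] by simp
  have H'q: "H' \<in> sqi lborel"
  proof -
    have "(\<integral>\<^sup>+t. ennreal ((H' t)\<^sup>2) \<partial>lborel) \<le> (\<integral>\<^sup>+t. ennreal ((H t)\<^sup>2) \<partial>lborel)"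
      by (intro nn_integral_mono) (auto simp: H'_def)
    then show ?thesis using H(1) unfolding H'_def[abs_def] sqi_iff_nn by (auto intro: le_less_trans)
  qed
  have H'L: "H' \<in> L2s T" by (rule L2s_I[OF H'q]) (auto simp: H'_def)
  have lim: "(\<lambda>n. \<integral>t. (h n t - H' t)\<^sup>2 \<partial>lborel) \<longlonglongrightarrow> 0"
  proof (rule Lim_null_comparison[OF _ H(2)], intro always_eventually allI)
    fix n
    have "(\<integral>t. (h n t - H' t)\<^sup>2 \<partial>lborel) \<le> (\<integral>t. (h n t - H t)\<^sup>2 \<partial>lborel)"
      using sqi_integrable[OF sqi_diff[OF L2s_sqi[OF hL] H'q]] sqi_integrable[OF sqi_diff[OF L2s_sqi[OF hL] H(1)]]
      by (intro integral_mono) (auto simp: H'_def h0)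
    then show "norm (\<integral>t. (h n t - H' t)\<^sup>2 \<partial>lborel) \<le> (\<integral>t. (h n t - H t)\<^sup>2 \<partial>lborel)" by simp
  qed
  have bound: "ennreal (\<integral>t. (H' t)\<^sup>2 \<partial>lborel) \<le> ennreal (frac_const T \<gamma>) * (slob T \<gamma> g + (\<integral>\<^sup>+t. ennreal ((g t)\<^sup>2) \<partial>lborel))"
  proof -
    have "(\<lambda>n. ennreal (\<integral>t. (h n t)\<^sup>2 \<partial>lborel)) \<longlonglongrightarrow> ennreal (\<integral>t. (H' t)\<^sup>2 \<partial>lborel)"
      by (intro tendsto_ennrealI sqi_tendsto_norm[OF L2s_sqi[OF hL] H'q lim])
    then have "ennreal (\<integral>t. (H' t)\<^sup>2 \<partial>lborel) \<le> ennreal (c\<^sup>2) * (ennreal (marchaud_const \<gamma>) * slob_line \<gamma> g)"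
      by (rule LIMSEQ_le_const2) (use norm in auto)
    also have "\<dots> \<le> ennreal (c\<^sup>2) * (ennreal (marchaud_const \<gamma>) * (ennreal (hardy_const T \<gamma>) * (slob T \<gamma> g + (\<integral>\<^sup>+t. ennreal ((g t)\<^sup>2) \<partial>lborel))))"
      by (intro mult_left_mono line) auto
    also have "\<dots> = ennreal (frac_const T \<gamma>) * (slob T \<gamma> g + (\<integral>\<^sup>+t. ennreal ((g t)\<^sup>2) \<partial>lborel))"
      using hardy_const_pos[OF \<gamma>(1), of T] \<gamma> \<gamma>1
      by (simp add: frac_const_def c_def ennreal_mult mult.assoc marchaud_const_def del: ennreal_plus)
    finally show ?thesis .
  qed
  \<comment> \<open>The kernel of I^(1 - \<gamma>) shifted by \<epsilon>. Its derivative is -c times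
    \<open>q n\<close> and its value at 0 is the factor of g in \<open>h n\<close>, hence I^1 (h n)
    is exactly the convolution of \<open>j n\<close> with g.\<close>
  define j where "j n t = (if 0 < t \<and> t < T then (t + \<epsilon> n) powr (- \<gamma>) / Gamma (1 - \<gamma>) else 0)" for n t
  have [measurable]: "j n \<in> borel_measurable borel" for n unfolding j_def[abs_def] by measurable
  let ?p = "pw T (1 - \<gamma>)"
  have pL: "?p \<in> L1s T" using \<gamma>1 by (intro pw_L1s) simp
  have jp: "0 \<le> j n t" "j n t \<le> ?p t" for n t
  proof -
    show "0 \<le> j n t" using Gp by (simp add: j_def)
    have "(t + \<epsilon> n) powr (- \<gamma>) \<le> t powr (- \<gamma>)" if "0 < t"
      using that \<epsilon>[of n] \<gamma> by (intro powr_mono2') auto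
    then show "j n t \<le> ?p t" using Gp by (auto simp: j_def pw_def divide_right_mono)
  qed
  have jL: "j n \<in> L1s T" for n
  proof -
    have "integrable lborel (j n)"
      by (rule Bochner_Integration.integrable_bound[OF L1s_integrable[OF pL]])
         (use jp pw_nonneg[of "1 - \<gamma>" T] \<gamma>1 in auto)
    then show ?thesis by (simp add: L1s_def j_def)
  qed
  have Ih: "AE t in lborel. cv T (pw T 1) (h n) t = cv T (j n) g t" for n
  proof -
    have a1: "AE t in lborel. cv T (pw T 1) (h n) t = \<epsilon> n powr (- \<gamma>) / Gamma (1 - \<gamma>) * cv T (pw T 1) g t
        + (- c) * cv T (pw T 1) (cv T (q n) g) t"
      unfolding h_def[abs_def] by (intro cv_linear_AE pw_L1s gL cv_L1s qL) simp
    have a2: "AE t in lborel. cv T (pw T 1) (cv T (q n) g) t = cv T (cv T (pw T 1) (q n)) g t"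
      by (intro cv_assoc_AE pw_L1s qL gL) simp
    have jeq: "j n = (\<lambda>t. \<epsilon> n powr (- \<gamma>) / Gamma (1 - \<gamma>) * pw T 1 t + (- c) * cv T (pw T 1) (q n) t)"
    proof
      fix t
      show "j n t = \<epsilon> n powr (- \<gamma>) / Gamma (1 - \<gamma>) * pw T 1 t + (- c) * cv T (pw T 1) (q n) t"
      proof (cases "0 < t \<and> t < T")
        case True
        have "cv T (pw T 1) (q n) t = (\<epsilon> n powr (- \<gamma>) - (t + \<epsilon> n) powr (- \<gamma>)) / \<gamma>"
          unfolding q_def[abs_def] using True qL[of n]
          by (intro cv_pw_1_shifted_power \<gamma> \<epsilon>) (auto simp: q_def[abs_def])
        then have "(t + \<epsilon> n) powr (- \<gamma>) = \<epsilon> n powr (- \<gamma>) - \<gamma> * cv T (pw T 1) (q n) t" using \<gamma> by simp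
        then show ?thesis using True by (simp add: j_def pw_def c_def diff_divide_distrib)
      qed (auto simp: j_def pw_def cv_def)
    qed
    have a3: "AE t in lborel. cv T (j n) g t = \<epsilon> n powr (- \<gamma>) / Gamma (1 - \<gamma>) * cv T (pw T 1) g t
        + (- c) * cv T (cv T (pw T 1) (q n)) g t"
      unfolding jeq cv_commute[of T _ g]
      by (intro cv_linear_AE gL pw_L1s cv_L1s qL) simp_all
    show ?thesis using a1 a2 a3 by eventually_elim simp
  qed
  have L1: "(\<lambda>n. (\<integral>t. \<bar>j n t - ?p t\<bar> \<partial>lborel)\<^sup>2 * (\<integral>t. (g t)\<^sup>2 \<partial>lborel)) \<longlonglongrightarrow> 0"
  proof -
    have "(\<lambda>n. \<integral>t. \<bar>j n t - ?p t\<bar> \<partial>lborel) \<longlonglongrightarrow> (\<integral>t. 0 \<partial>(lborel :: real measure))"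
    proof (rule integral_dominated_convergence[where w="?p"])
      show "AE t in lborel. (\<lambda>n. \<bar>j n t - ?p t\<bar>) \<longlonglongrightarrow> 0"
      proof (rule AE_I2)
        fix t
        show "(\<lambda>n. \<bar>j n t - ?p t\<bar>) \<longlonglongrightarrow> 0"
        proof (cases "0 < t \<and> t < T")
          case True
          have "(\<lambda>n. (t + \<epsilon> n) powr (- \<gamma>) / Gamma (1 - \<gamma>)) \<longlonglongrightarrow> (t + 0) powr (- \<gamma>) / Gamma (1 - \<gamma>)"
            unfolding \<epsilon>_def using True Gp by (intro tendsto_intros LIMSEQ_Suc[OF lim_1_over_n]) auto
          then have "(\<lambda>n. j n t - ?p t) \<longlonglongrightarrow> ?p t - ?p t"
            using True by (intro tendsto_intros) (simp add: j_def pw_def)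
          then show ?thesis using tendsto_rabs_zero by force
        qed (auto simp: j_def pw_def)
      qed
      show "AE t in lborel. norm \<bar>j n t - ?p t\<bar> \<le> ?p t" for n
        using jp[of n] by (auto intro!: AE_I2 simp: abs_le_iff diff_le_eq add_increasing)
    qed (use L1s_integrable[OF pL] in auto)
    then have "(\<lambda>n. (\<integral>t. \<bar>j n t - ?p t\<bar> \<partial>lborel)\<^sup>2 * (\<integral>t. (g t)\<^sup>2 \<partial>lborel)) \<longlonglongrightarrow> 0\<^sup>2 * (\<integral>t. (g t)\<^sup>2 \<partial>lborel)"
      by (intro tendsto_intros) simp
    then show ?thesis by simp
  qed
  let ?A = "\<lambda>t. cv T (pw T 1) H' t - cv T ?p g t"
  have A2: "cv T (pw T 1) H' \<in> L2s T" "cv T ?p g \<in> L2s T"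
    using cv_L2s[OF pw_L1s[of 1 T] H'L] cv_L2s[OF pL g] by simp_all
  define P1 where "P1 = (\<integral>t. \<bar>pw T 1 t\<bar> \<partial>lborel)\<^sup>2"
  \<comment> \<open>The identity for \<open>h n\<close> passes to the limit in L2: I^1 (h n)
    approaches I^1 H' because I^1 is bounded, and the convolutions with g converge because
    \<open>j n\<close> tends to \<open>?p\<close> in L1. Both bounds are instances of Young's
    inequality.\<close>
  have le: "(\<integral>t. (?A t)\<^sup>2 \<partial>lborel) \<le> 2 * (P1 * (\<integral>t. (h n t - H' t)\<^sup>2 \<partial>lborel))
      + 2 * ((\<integral>t. \<bar>j n t - ?p t\<bar> \<partial>lborel)\<^sup>2 * (\<integral>t. (g t)\<^sup>2 \<partial>lborel))" for n
  proof -
    let ?u = "cv T (pw T 1) (\<lambda>t. h n t - H' t)" and ?v = "cv T (\<lambda>t. j n t - ?p t) g"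
    have d1: "(\<lambda>t. h n t - H' t) \<in> L2s T" by (intro L2s_diff hL H'L)
    have d2: "(\<lambda>t. j n t - ?p t) \<in> L1s T" by (intro L1s_diff jL pL)
    have u2: "?u \<in> L2s T" by (intro cv_L2s pw_L1s d1) simp
    have v2: "?v \<in> L2s T" by (intro cv_L2s d2 g)
    have b1: "AE t in lborel. cv T (pw T 1) (\<lambda>t. 1 * h n t + (- 1) * H' t) t = 1 * cv T (pw T 1) (h n) t + (- 1) * cv T (pw T 1) H' t"
      by (intro cv_linear_AE pw_L1s L2s_L1s[OF hL] L2s_L1s[OF H'L]) simp
    have b2: "AE t in lborel. cv T g (\<lambda>t. 1 * j n t + (- 1) * ?p t) t = 1 * cv T g (j n) t + (- 1) * cv T g ?p t"
      by (intro cv_linear_AE gL jL pL)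
    have "AE t in lborel. ?A t = (-1) * ?u t + ?v t"
      using b1 b2 Ih[of n] by eventually_elim (simp add: cv_commute[of T g])
    then have "(\<integral>t. (?A t)\<^sup>2 \<partial>lborel) = (\<integral>t. ((-1) * ?u t + ?v t)\<^sup>2 \<partial>lborel)"
      using L1s_measurable[OF L2s_L1s[OF A2(1)]] L1s_measurable[OF L2s_L1s[OF A2(2)]]
        L1s_measurable[OF L2s_L1s[OF u2]] L1s_measurable[OF L2s_L1s[OF v2]]
      by (intro integral_cong_AE) (auto elim!: eventually_mono)
    also have "\<dots> \<le> (\<integral>t. 2 * (?u t)\<^sup>2 + 2 * (?v t)\<^sup>2 \<partial>lborel)"
    proof (rule integral_mono)
      show "integrable lborel (\<lambda>t. ((-1) * ?u t + ?v t)\<^sup>2)"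
        by (rule sqi_integrable[OF sqi_add[OF sqi_cmult[OF L2s_sqi[OF u2]] L2s_sqi[OF v2]]])
      show "integrable lborel (\<lambda>t. 2 * (?u t)\<^sup>2 + 2 * (?v t)\<^sup>2)"
        using sqi_integrable[OF L2s_sqi[OF u2]] sqi_integrable[OF L2s_sqi[OF v2]] by auto
      fix t
      show "((-1) * ?u t + ?v t)\<^sup>2 \<le> 2 * (?u t)\<^sup>2 + 2 * (?v t)\<^sup>2"
        using sum_squares_bound[of "- ?u t" "?v t"] by (simp add: power2_eq_square algebra_simps)
    qed
    also have "\<dots> = 2 * (\<integral>t. (?u t)\<^sup>2 \<partial>lborel) + 2 * (\<integral>t. (?v t)\<^sup>2 \<partial>lborel)"
      using sqi_integrable[OF L2s_sqi[OF u2]] sqi_integrable[OF L2s_sqi[OF v2]] by simp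
    also have "(\<integral>t. (?u t)\<^sup>2 \<partial>lborel) \<le> P1 * (\<integral>t. (h n t - H' t)\<^sup>2 \<partial>lborel)"
      unfolding P1_def by (intro cv_L2_le d1 pw_L1s) simp
    also have "(\<integral>t. (?v t)\<^sup>2 \<partial>lborel) \<le> (\<integral>t. \<bar>j n t - ?p t\<bar> \<partial>lborel)\<^sup>2 * (\<integral>t. (g t)\<^sup>2 \<partial>lborel)"
      by (intro cv_L2_le d2 g)
    finally show ?thesis by simp
  qed
  have "(\<lambda>n. 2 * (P1 * (\<integral>t. (h n t - H' t)\<^sup>2 \<partial>lborel))
      + 2 * ((\<integral>t. \<bar>j n t - ?p t\<bar> \<partial>lborel)\<^sup>2 * (\<integral>t. (g t)\<^sup>2 \<partial>lborel))) \<longlonglongrightarrow> 2 * (P1 * 0) + 2 * 0"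
    by (intro tendsto_intros lim L1)
  then have "(\<lambda>n. 2 * (P1 * (\<integral>t. (h n t - H' t)\<^sup>2 \<partial>lborel))
      + 2 * ((\<integral>t. \<bar>j n t - ?p t\<bar> \<partial>lborel)\<^sup>2 * (\<integral>t. (g t)\<^sup>2 \<partial>lborel))) \<longlonglongrightarrow> 0" by simp
  then have "(\<integral>t. (?A t)\<^sup>2 \<partial>lborel) \<le> 0"
    by (rule LIMSEQ_le_const) (use le in auto)
  then have "AE t in lborel. cv T (pw T 1) H' t = cv T ?p g t"
    by (rule sqi_eq_AE[OF L2s_sqi[OF A2(1)] L2s_sqi[OF A2(2)]])
  then show ?thesis using that H'L bound by blast
qed

section \<open>Weak gradients and the Dirichlet eigenbasis\<close>

lemma has_weak_partial_sqi: "has_weak_partial U b w g \<Longrightarrow> g \<in> sqi (leb U)"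
  by (simp add: has_weak_partial_def L2_eq_sqi)

lemma has_weak_partial_unique:
  fixes U :: "'a::euclidean_space set"
  assumes U: "open U" and g: "has_weak_partial U b w g" and g': "has_weak_partial U b w g'"
  shows "AE x in leb U. g x = g' x"
proof -
  note gs = has_weak_partial_sqi[OF g] and gs' = has_weak_partial_sqi[OF g']
  have "AE x in leb U. g x - g' x = 0"
  proof (rule AE_zero_if_orthogonal_to_test_functions[OF U sqi_diff[OF gs gs']])
    fix \<psi> :: "'a \<Rightarrow> real" assume \<psi>: "\<psi> \<in> test_functions U"
    have "(\<integral>x. (g x - g' x) * \<psi> x \<partial>leb U) = (\<integral>x. g x * \<psi> x \<partial>leb U) - (\<integral>x. g' x * \<psi> x \<partial>leb U)"
      using sqi_mult[OF gs test_functions_sqi(1)[OF \<psi> U]] sqi_mult[OF gs' test_functions_sqi(1)[OF \<psi> U]]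
      by (simp add: left_diff_distrib)
    then show "(\<integral>x. (g x - g' x) * \<psi> x \<partial>leb U) = 0"
      using g g' \<psi> by (simp add: has_weak_partial_def)
  qed
  then show ?thesis by simp
qed

lemma has_weak_partial_weak_partial:
  "has_weak_partial U b w g \<Longrightarrow> has_weak_partial U b w (weak_partial U b w)"
  using someI[of "has_weak_partial U b w" g] by (simp add: weak_partial_def)

text \<open>Up to null sets, the choice made in \<open>weak_partial\<close> agrees with any witness
  at hand.\<close>

lemma weak_partial_AE:
  assumes "open U" "has_weak_partial U b w g"
  shows "AE x in leb U. weak_partial U b w x = g x"
  using has_weak_partial_unique[OF assms(1) has_weak_partial_weak_partial[OF assms(2)] assms(2)] .

lemma has_weak_partial_cmult:
  assumes "has_weak_partial U b w g"
  shows "has_weak_partial U b (\<lambda>x. c * w x) (\<lambda>x. c * g x)"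
  using assms sqi_cmult[OF has_weak_partial_sqi[OF assms]]
  by (simp add: has_weak_partial_def L2_eq_sqi mult.assoc)

lemma has_weak_partial_sum:
  fixes U :: "'a::euclidean_space set"
  assumes U: "open U" and b: "b \<in> Basis" and w: "\<And>i. i \<in> I \<Longrightarrow> w i \<in> sqi (leb U)" and g: "\<And>i. i \<in> I \<Longrightarrow> has_weak_partial U b (w i) (g i)"
  shows "has_weak_partial U b (\<lambda>x. \<Sum>i\<in>I. w i x) (\<lambda>x. \<Sum>i\<in>I. g i x)"
  unfolding has_weak_partial_def L2_eq_sqi
proof (intro conjI ballI)
  show "(\<lambda>x. \<Sum>i\<in>I. g i x) \<in> sqi (leb U)" using has_weak_partial_sqi[OF g] by auto
  fix \<psi> assume \<psi>: "\<psi> \<in> test_functions U"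
  have "(\<integral>x. (\<Sum>i\<in>I. w i x) * partial b \<psi> x \<partial>leb U) = (\<Sum>i\<in>I. \<integral>x. w i x * partial b \<psi> x \<partial>leb U)"
    unfolding sum_distrib_right by (intro Bochner_Integration.integral_sum sqi_mult w test_functions_sqi(2)[OF \<psi> U b])
  also have "\<dots> = - (\<Sum>i\<in>I. \<integral>x. g i x * \<psi> x \<partial>leb U)"
    using g \<psi> by (simp add: has_weak_partial_def sum_negf)
  also have "(\<Sum>i\<in>I. \<integral>x. g i x * \<psi> x \<partial>leb U) = (\<integral>x. (\<Sum>i\<in>I. g i x) * \<psi> x \<partial>leb U)"
    unfolding sum_distrib_right
    by (intro Bochner_Integration.integral_sum[symmetric] sqi_mult has_weak_partial_sqi[OF g] test_functions_sqi(1)[OF \<psi> U])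
  finally show "(\<integral>x. (\<Sum>i\<in>I. w i x) * partial b \<psi> x \<partial>leb U) = - (\<integral>x. (\<Sum>i\<in>I. g i x) * \<psi> x \<partial>leb U)" .
qed

text \<open>Weak differentiation is a closed operator: both sides of the defining identity are
  continuous with respect to L2 convergence.\<close>

lemma has_weak_partial_limit:
  fixes U :: "'a::euclidean_space set"
  assumes U: "open U" and b: "b \<in> Basis" and w: "\<And>n. w n \<in> sqi (leb U)" "w' \<in> sqi (leb U)" "L2_tendsto U w w'"
    and g: "\<And>n::nat. has_weak_partial U b (w n) (g n)" "g' \<in> sqi (leb U)" "L2_tendsto U g g'"
  shows "has_weak_partial U b w' g'"
  unfolding has_weak_partial_def L2_eq_sqi
proof (intro conjI ballI g)
  fix \<psi> assume \<psi>: "\<psi> \<in> test_functions U"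
  have 1: "(\<lambda>n. \<integral>x. w n x * partial b \<psi> x \<partial>leb U) \<longlonglongrightarrow> (\<integral>x. w' x * partial b \<psi> x \<partial>leb U)"
    using w unfolding L2_tendsto_def by (intro sqi_tendsto_inner test_functions_sqi(2)[OF \<psi> U b])
  have 2: "(\<lambda>n. - (\<integral>x. g n x * \<psi> x \<partial>leb U)) \<longlonglongrightarrow> - (\<integral>x. g' x * \<psi> x \<partial>leb U)"
    using g unfolding L2_tendsto_def
    by (intro tendsto_minus sqi_tendsto_inner test_functions_sqi(1)[OF \<psi> U] has_weak_partial_sqi[OF g(1)])
  have 3: "(\<lambda>n. \<integral>x. w n x * partial b \<psi> x \<partial>leb U) = (\<lambda>n. - (\<integral>x. g n x * \<psi> x \<partial>leb U))"
    using g(1) \<psi> by (simp add: has_weak_partial_def fun_eq_iff)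
  show "(\<integral>x. w' x * partial b \<psi> x \<partial>leb U) = - (\<integral>x. g' x * \<psi> x \<partial>leb U)"
    by (rule LIMSEQ_unique[OF 1[unfolded 3] 2])
qed

section \<open>Orthonormal expansions and the Dirichlet form\<close>

locale onb =
  fixes U :: "'a::euclidean_space set" and \<phi> :: "nat \<Rightarrow> 'a \<Rightarrow> real"
  assumes open_U: "open U" and basis: "orthonormal_basis_L2 U \<phi>"
begin

lemma \<phi>_sqi: "\<phi> i \<in> sqi (leb U)"
  using basis by (simp add: orthonormal_basis_L2_def L2_eq_sqi)

lemma \<phi>_orth: "(\<integral>x. \<phi> i x * \<phi> j x \<partial>leb U) = (if i = j then 1 else 0)"
  using basis by (simp add: orthonormal_basis_L2_def L2_inner_def)

lemma expansion:
  "v \<in> sqi (leb U) \<Longrightarrow> (\<lambda>n. \<integral>x. ((\<Sum>i<n. L2_inner U v (\<phi> i) * \<phi> i x) - v x)\<^sup>2 \<partial>leb U) \<longlonglongrightarrow> 0"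
  using basis by (simp add: orthonormal_basis_L2_def L2_eq_sqi L2_tendsto_def)

lemma coeff_linear:
  assumes "v \<in> sqi (leb U)" "w \<in> sqi (leb U)"
  shows "L2_inner U (\<lambda>x. v x - w x) (\<phi> i) = L2_inner U v (\<phi> i) - L2_inner U w (\<phi> i)"
  using sqi_mult[OF assms(1) \<phi>_sqi] sqi_mult[OF assms(2) \<phi>_sqi]
  by (simp add: L2_inner_def left_diff_distrib)

lemma partial_sum_norm:
  fixes a :: "nat \<Rightarrow> real"
  assumes "finite I" shows "(\<integral>x. (\<Sum>i\<in>I. a i * \<phi> i x)\<^sup>2 \<partial>leb U) = (\<Sum>i\<in>I. (a i)\<^sup>2)"
proof -
  have I: "integrable (leb U) (\<lambda>x. (a i * \<phi> i x) * (a j * \<phi> j x))" for i j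
    by (intro sqi_mult sqi_cmult \<phi>_sqi)
  have e: "(\<integral>x. (a i * \<phi> i x) * (a j * \<phi> j x) \<partial>leb U) = (if i = j then a i * a j else 0)" for i j
  proof -
    have "(\<integral>x. (a i * \<phi> i x) * (a j * \<phi> j x) \<partial>leb U) = (\<integral>x. (a i * a j) * (\<phi> i x * \<phi> j x) \<partial>leb U)"
      by (simp add: mult_ac)
    then show ?thesis by (simp add: \<phi>_orth)
  qed
  have "(\<integral>x. (\<Sum>i\<in>I. a i * \<phi> i x)\<^sup>2 \<partial>leb U) = (\<integral>x. (\<Sum>i\<in>I. \<Sum>j\<in>I. (a i * \<phi> i x) * (a j * \<phi> j x)) \<partial>leb U)"
    by (simp add: power2_eq_square sum_product)
  also have "\<dots> = (\<Sum>i\<in>I. \<Sum>j\<in>I. if i = j then a i * a j else 0)"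
    by (simp add: Bochner_Integration.integral_sum I e)
  also have "\<dots> = (\<Sum>i\<in>I. (a i)\<^sup>2)"
    using assms by (simp add: power2_eq_square sum.delta)
  finally show ?thesis .
qed

lemma parseval:
  assumes v: "v \<in> sqi (leb U)"
  shows "(\<lambda>i. (L2_inner U v (\<phi> i))\<^sup>2) sums (\<integral>x. (v x)\<^sup>2 \<partial>leb U)"
proof -
  have "(\<lambda>n. \<integral>x. (\<Sum>i<n. L2_inner U v (\<phi> i) * \<phi> i x)\<^sup>2 \<partial>leb U) \<longlonglongrightarrow> (\<integral>x. (v x)\<^sup>2 \<partial>leb U)"
    by (intro sqi_tendsto_norm sqi_sum sqi_cmult \<phi>_sqi v expansion)
  then show ?thesis by (simp add: partial_sum_norm sums_def)
qed

end

locale eigenbasis =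
  fixes U :: "'a::euclidean_space set" and \<phi> :: "nat \<Rightarrow> 'a \<Rightarrow> real" and lam :: "nat \<Rightarrow> real"
  assumes open_U: "open U" and eig: "dirichlet_eigenbasis U \<phi> lam"
begin

sublocale onb U \<phi>
  using open_U eig by unfold_locales (auto simp: dirichlet_eigenbasis_def)

lemma lam_pos: "0 < lam i"
  using eig by (simp add: dirichlet_eigenbasis_def)

abbreviation "G b i \<equiv> weak_partial U b (\<phi> i)"

lemma G_partial: "b \<in> Basis \<Longrightarrow> has_weak_partial U b (\<phi> i) (G b i)"
  using eig unfolding dirichlet_eigenbasis_def H2_def H1_def by (blast intro: has_weak_partial_weak_partial)

lemma G_sqi: "b \<in> Basis \<Longrightarrow> G b i \<in> sqi (leb U)"
  using has_weak_partial_sqi[OF G_partial] .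

lemma G_partial2: "b \<in> Basis \<Longrightarrow> has_weak_partial U b (G b i) (weak_partial U b (G b i))"
  using eig unfolding dirichlet_eigenbasis_def H2_def H1_def by (blast intro: has_weak_partial_weak_partial)

lemma weak_form_test:
  assumes s: "s \<in> test_functions U"
  shows "(\<Sum>b\<in>Basis. \<integral>x. G b k x * partial b s x \<partial>leb U) = lam k * (\<integral>x. \<phi> k x * s x \<partial>leb U)"
proof -
  note sS = test_functions_sqi(1)[OF s open_U]
  have "(\<Sum>b\<in>Basis. \<integral>x. G b k x * partial b s x \<partial>leb U) = - (\<Sum>b\<in>Basis. \<integral>x. weak_partial U b (G b k) x * s x \<partial>leb U)"
    using G_partial2 s by (simp add: has_weak_partial_def sum_negf)
  also have "(\<Sum>b\<in>Basis. \<integral>x. weak_partial U b (G b k) x * s x \<partial>leb U) = (\<integral>x. weak_laplacian U (\<phi> k) x * s x \<partial>leb U)"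
    unfolding weak_laplacian_def sum_distrib_right
    by (intro Bochner_Integration.integral_sum[symmetric] sqi_mult has_weak_partial_sqi[OF G_partial2] sS)
  also have "- \<dots> = (\<integral>x. - weak_laplacian U (\<phi> k) x * s x \<partial>leb U)" by simp
  also have "\<dots> = (\<integral>x. lam k * (\<phi> k x * s x) \<partial>leb U)"
  proof (rule integral_cong_AE)
    have "weak_laplacian U (\<phi> k) \<in> borel_measurable (leb U)"
      unfolding weak_laplacian_def[abs_def] by (intro borel_measurable_sum sqi_measurable has_weak_partial_sqi[OF G_partial2])
    then show "(\<lambda>x. - weak_laplacian U (\<phi> k) x * s x) \<in> borel_measurable (leb U)"
      using sqi_measurable[OF sS] by simp
    show "(\<lambda>x. lam k * (\<phi> k x * s x)) \<in> borel_measurable (leb U)"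
      using sqi_measurable[OF sS] sqi_measurable[OF \<phi>_sqi] by simp
    have "AE x in leb U. - weak_laplacian U (\<phi> k) x = lam k * \<phi> k x"
      using eig by (simp add: dirichlet_eigenbasis_def)
    then show "AE x in leb U. - weak_laplacian U (\<phi> k) x * s x = lam k * (\<phi> k x * s x)"
      by eventually_elim simp
  qed
  finally show ?thesis by simp
qed

text \<open>The weak form of the eigenvalue equation extends from test functions to \<phi>_j along
  the approximating sequence contained in \<open>H10\<close>. The Dirichlet boundary condition
  enters here.\<close>

lemma grad_orth:
  "(\<Sum>b\<in>Basis. \<integral>x. G b j x * G b k x \<partial>leb U) = (if j = k then lam k else 0)"
proof -
  have "\<phi> j \<in> H10 U" using eig by (simp add: dirichlet_eigenbasis_def)
  then obtain s where s: "\<And>n. s n \<in> test_functions U" "L2_tendsto U s (\<phi> j)"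
    "\<And>b. b \<in> Basis \<Longrightarrow> L2_tendsto U (\<lambda>n. partial b (s n)) (G b j)"
    unfolding H10_def by blast
  have 1: "(\<lambda>n. \<Sum>b\<in>Basis. \<integral>x. partial b (s n) x * G b k x \<partial>leb U) \<longlonglongrightarrow> (\<Sum>b\<in>Basis. \<integral>x. G b j x * G b k x \<partial>leb U)"
    using s(3) unfolding L2_tendsto_def
    by (intro tendsto_sum sqi_tendsto_inner G_sqi test_functions_sqi(2)[OF s(1) open_U])
  have 2: "(\<lambda>n. lam k * (\<integral>x. s n x * \<phi> k x \<partial>leb U)) \<longlonglongrightarrow> lam k * (\<integral>x. \<phi> j x * \<phi> k x \<partial>leb U)"
    using s(2) unfolding L2_tendsto_def
    by (intro tendsto_mult_left sqi_tendsto_inner \<phi>_sqi test_functions_sqi(1)[OF s(1) open_U])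
  have 3: "(\<lambda>n. \<Sum>b\<in>Basis. \<integral>x. partial b (s n) x * G b k x \<partial>leb U) = (\<lambda>n. lam k * (\<integral>x. s n x * \<phi> k x \<partial>leb U))"
    using weak_form_test[OF s(1)] by (simp add: fun_eq_iff mult.commute)
  have "(\<Sum>b\<in>Basis. \<integral>x. G b j x * G b k x \<partial>leb U) = lam k * (\<integral>x. \<phi> j x * \<phi> k x \<partial>leb U)"
    by (rule LIMSEQ_unique[OF 1[unfolded 3] 2])
  then show ?thesis by (simp add: \<phi>_orth)
qed

lemma grad_partial_sum_norm:
  fixes a :: "nat \<Rightarrow> real"
  assumes "finite I"
  shows "(\<Sum>b\<in>Basis. \<integral>x. (\<Sum>j\<in>I. a j * G b j x)\<^sup>2 \<partial>leb U) = (\<Sum>j\<in>I. lam j * (a j)\<^sup>2)"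
proof -
  have I: "integrable (leb U) (\<lambda>x. a i * a j * (G b i x * G b j x))" if "b \<in> Basis" for i j b
    using that by (intro integrable_mult_right sqi_mult G_sqi)
  have "(\<Sum>b\<in>Basis. \<integral>x. (\<Sum>j\<in>I. a j * G b j x)\<^sup>2 \<partial>leb U)
    = (\<Sum>b\<in>Basis. \<integral>x. (\<Sum>i\<in>I. \<Sum>j\<in>I. a i * a j * (G b i x * G b j x)) \<partial>leb U)"
    by (simp add: power2_eq_square sum_product mult_ac)
  also have "\<dots> = (\<Sum>b\<in>Basis. \<Sum>i\<in>I. \<Sum>j\<in>I. a i * a j * (\<integral>x. G b i x * G b j x \<partial>leb U))"
  proof (rule sum.cong[OF refl])
    fix b :: 'a assume b: "b \<in> Basis"
    show "(\<integral>x. (\<Sum>i\<in>I. \<Sum>j\<in>I. a i * a j * (G b i x * G b j x)) \<partial>leb U)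
      = (\<Sum>i\<in>I. \<Sum>j\<in>I. a i * a j * (\<integral>x. G b i x * G b j x \<partial>leb U))"
    proof -
      have "(\<integral>x. (\<Sum>i\<in>I. \<Sum>j\<in>I. a i * a j * (G b i x * G b j x)) \<partial>leb U)
        = (\<Sum>i\<in>I. \<Sum>j\<in>I. \<integral>x. a i * a j * (G b i x * G b j x) \<partial>leb U)"
        using I[OF b] by (subst Bochner_Integration.integral_sum, intro Bochner_Integration.integrable_sum, assumption)
          (intro sum.cong refl Bochner_Integration.integral_sum, assumption)
      then show ?thesis by simp
    qed
  qed
  also have "\<dots> = (\<Sum>i\<in>I. \<Sum>j\<in>I. \<Sum>b\<in>Basis. a i * a j * (\<integral>x. G b i x * G b j x \<partial>leb U))"
    by (subst sum.swap, intro sum.cong refl, rule sum.swap)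
  also have "\<dots> = (\<Sum>i\<in>I. \<Sum>j\<in>I. if i = j then a i * a j * lam j else 0)"
    by (simp add: sum_distrib_left[symmetric] grad_orth if_distrib cong: if_cong)
  also have "\<dots> = (\<Sum>j\<in>I. lam j * (a j)\<^sup>2)"
    using assms by (simp add: power2_eq_square mult_ac)
  finally show ?thesis .
qed

text \<open>The squared distance of the gradients of two partial sums is bounded by a block of the
  given series, by orthogonality. They thus converge, and closedness of the weak derivative
  identifies the limit. It links the spectrally defined space with the weak gradients in the weak
  formulation.\<close>

lemma hdot1_gradient:
  assumes u: "u \<in> sqi (leb U)" and s: "summable (\<lambda>j. lam j * (L2_inner U u (\<phi> j))\<^sup>2)"
  obtains g where "\<And>b. b \<in> Basis \<Longrightarrow> has_weak_partial U b u (g b)"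
    "\<And>i. (\<Sum>b\<in>Basis. \<integral>x. g b x * G b i x \<partial>leb U) = lam i * L2_inner U u (\<phi> i)"
proof -
  define a where "a j = L2_inner U u (\<phi> j)" for j
  define P where "P n x = (\<Sum>j<n. a j * \<phi> j x)" for n x
  define D where "D b n x = (\<Sum>j<n. a j * G b j x)" for b n x
  have PD: "has_weak_partial U b (P n) (D b n)" if "b \<in> Basis" for b n
    unfolding P_def[abs_def] D_def[abs_def]
    by (intro has_weak_partial_sum open_U that sqi_cmult \<phi>_sqi has_weak_partial_cmult G_partial)
  have Dq: "D b n \<in> sqi (leb U)" if "b \<in> Basis" for b n using has_weak_partial_sqi[OF PD[OF that]] .
  have Pq: "P n \<in> sqi (leb U)" for n unfolding P_def[abs_def] by (intro sqi_sum sqi_cmult \<phi>_sqi)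
  have diff: "(\<integral>x. (D b m x - D b n x)\<^sup>2 \<partial>leb U) \<le> (\<Sum>j=n..<m. lam j * (a j)\<^sup>2)" if b: "b \<in> Basis" and nm: "n \<le> m" for b n m
  proof -
    have "D b' m x - D b' n x = (\<Sum>j=n..<m. a j * G b' j x)" for b' x
      unfolding D_def lessThan_atLeast0 using nm by (simp add: sum_diff_nat_ivl)
    then have "(\<integral>x. (D b m x - D b n x)\<^sup>2 \<partial>leb U) = (\<integral>x. (\<Sum>j=n..<m. a j * G b j x)\<^sup>2 \<partial>leb U)" by simp
    also have "\<dots> \<le> (\<Sum>b\<in>Basis. \<integral>x. (\<Sum>j=n..<m. a j * G b j x)\<^sup>2 \<partial>leb U)"
      by (rule member_le_sum[OF b]) auto
    also have "\<dots> = (\<Sum>j=n..<m. lam j * (a j)\<^sup>2)" by (rule grad_partial_sum_norm) simp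
    finally show ?thesis .
  qed
  have "\<exists>g. g \<in> sqi (leb U) \<and> L2_tendsto U (D b) g" if b: "b \<in> Basis" for b
  proof -
    have "\<exists>N. \<forall>m\<ge>N. \<forall>n\<ge>N. (\<integral>x. (D b m x - D b n x)\<^sup>2 \<partial>leb U) < e" if e: "e > 0" for e
    proof -
      have "Cauchy (\<lambda>n. \<Sum>j<n. lam j * (a j)\<^sup>2)"
        using s unfolding a_def summable_iff_convergent by (rule convergent_Cauchy)
      then obtain N where N: "\<And>m n. N \<le> m \<Longrightarrow> N \<le> n \<Longrightarrow> \<bar>(\<Sum>j<m. lam j * (a j)\<^sup>2) - (\<Sum>j<n. lam j * (a j)\<^sup>2)\<bar> < e"
        using e unfolding Cauchy_def dist_real_def by blast
      have lt: "(\<integral>x. (D b m x - D b n x)\<^sup>2 \<partial>leb U) < e" if "N \<le> n" "n \<le> m" for m n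
      proof -
        have "(\<Sum>j=n..<m. lam j * (a j)\<^sup>2) = (\<Sum>j<m. lam j * (a j)\<^sup>2) - (\<Sum>j<n. lam j * (a j)\<^sup>2)"
          unfolding lessThan_atLeast0 using that by (simp add: sum_diff_nat_ivl)
        then show ?thesis using diff[OF b that(2)] N[of m n] that by simp
      qed
      have "(\<integral>x. (D b m x - D b n x)\<^sup>2 \<partial>leb U) < e" if "N \<le> n" "N \<le> m" for m n
        using lt[of n m] lt[of m n] that by (cases "n \<le> m") (auto simp: power2_commute)
      then show ?thesis by blast
    qed
    then obtain g where "g \<in> sqi (leb U)" "(\<lambda>n. \<integral>x. (D b n x - g x)\<^sup>2 \<partial>leb U) \<longlonglongrightarrow> 0"
      using sqi_complete[of "D b" "leb U"] Dq[OF b] by blast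
    then show ?thesis unfolding L2_tendsto_def by blast
  qed
  then obtain g where g: "\<And>b. b \<in> Basis \<Longrightarrow> g b \<in> sqi (leb U)" "\<And>b. b \<in> Basis \<Longrightarrow> L2_tendsto U (D b) (g b)"
    by metis
  have 1: "has_weak_partial U b u (g b)" if "b \<in> Basis" for b
  proof (rule has_weak_partial_limit[OF open_U that Pq u _ PD[OF that] g(1)[OF that] g(2)[OF that]])
    show "L2_tendsto U P u" using expansion[OF u] by (simp add: L2_tendsto_def P_def a_def)
  qed
  have 2: "(\<Sum>b\<in>Basis. \<integral>x. g b x * G b i x \<partial>leb U) = lam i * L2_inner U u (\<phi> i)" for i
  proof -
    have 1: "(\<lambda>n. \<Sum>b\<in>Basis. \<integral>x. D b n x * G b i x \<partial>leb U) \<longlonglongrightarrow> (\<Sum>b\<in>Basis. \<integral>x. g b x * G b i x \<partial>leb U)"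
      using g(2) unfolding L2_tendsto_def by (intro tendsto_sum sqi_tendsto_inner Dq g(1) G_sqi)
    have "\<forall>\<^sub>F n in sequentially. (\<Sum>b\<in>Basis. \<integral>x. D b n x * G b i x \<partial>leb U) = lam i * a i"
      using eventually_gt_at_top[of i]
    proof eventually_elim
      case (elim n)
      have "(\<Sum>b\<in>Basis. \<integral>x. D b n x * G b i x \<partial>leb U) = (\<Sum>b\<in>Basis. \<Sum>j<n. a j * (\<integral>x. G b j x * G b i x \<partial>leb U))"
      proof (rule sum.cong[OF refl])
        fix b :: 'a assume b: "b \<in> Basis"
        have "(\<integral>x. D b n x * G b i x \<partial>leb U) = (\<integral>x. (\<Sum>j<n. a j * (G b j x * G b i x)) \<partial>leb U)"
          by (simp add: D_def sum_distrib_right mult.assoc)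
        also have "\<dots> = (\<Sum>j<n. a j * (\<integral>x. G b j x * G b i x \<partial>leb U))"
          using sqi_mult[OF G_sqi[OF b] G_sqi[OF b]] by (simp add: Bochner_Integration.integral_sum)
        finally show "(\<integral>x. D b n x * G b i x \<partial>leb U) = (\<Sum>j<n. a j * (\<integral>x. G b j x * G b i x \<partial>leb U))" .
      qed
      also have "\<dots> = (\<Sum>j<n. a j * (\<Sum>b\<in>Basis. \<integral>x. G b j x * G b i x \<partial>leb U))"
        by (subst sum.swap) (simp add: sum_distrib_left)
      also have "\<dots> = (\<Sum>j<n. if j = i then a j * lam i else 0)"
        by (simp add: grad_orth if_distrib cong: if_cong)
      also have "\<dots> = lam i * a i" using elim by simp
      finally show ?case .
    qed
    then have "(\<lambda>n. \<Sum>b\<in>Basis. \<integral>x. D b n x * G b i x \<partial>leb U) \<longlonglongrightarrow> lam i * a i"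
      by (rule tendsto_eventually)
    from LIMSEQ_unique[OF 1 this] show ?thesis by (simp add: a_def)
  qed
  show ?thesis by (rule that[OF 1 2])
qed

lemma grad_inner_mode:
  assumes u: "u \<in> sqi (leb U)" and s: "summable (\<lambda>j. lam j * (L2_inner U u (\<phi> j))\<^sup>2)"
  shows "grad_inner U u (\<lambda>x. c * \<phi> i x) = c * (lam i * L2_inner U u (\<phi> i))"
proof -
  obtain g where g: "\<And>b. b \<in> Basis \<Longrightarrow> has_weak_partial U b u (g b)"
    "(\<Sum>b\<in>Basis. \<integral>x. g b x * G b i x \<partial>leb U) = lam i * L2_inner U u (\<phi> i)"
    using hdot1_gradient[OF u s, of thesis] by blast
  have I: "integrable (leb U) (\<lambda>x. weak_partial U b u x * weak_partial U b (\<lambda>x. c * \<phi> i x) x)" if "b \<in> Basis" for b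
    by (rule sqi_mult[OF has_weak_partial_sqi[OF has_weak_partial_weak_partial[OF g(1)[OF that]]]
      has_weak_partial_sqi[OF has_weak_partial_weak_partial[OF has_weak_partial_cmult[OF G_partial[OF that]]]]])
  have "grad_inner U u (\<lambda>x. c * \<phi> i x) = (\<Sum>b\<in>Basis. \<integral>x. weak_partial U b u x * weak_partial U b (\<lambda>x. c * \<phi> i x) x \<partial>leb U)"
    unfolding grad_inner_def using I by (intro Bochner_Integration.integral_sum)
  also have "\<dots> = (\<Sum>b\<in>Basis. c * (\<integral>x. g b x * G b i x \<partial>leb U))"
  proof (rule sum.cong[OF refl])
    fix b :: 'a assume b: "b \<in> Basis"
    note cp = has_weak_partial_cmult[OF G_partial[OF b], of c i]
    have "(\<integral>x. weak_partial U b u x * weak_partial U b (\<lambda>x. c * \<phi> i x) x \<partial>leb U) = (\<integral>x. c * (g b x * G b i x) \<partial>leb U)"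
    proof (rule integral_cong_AE)
      show "(\<lambda>x. weak_partial U b u x * weak_partial U b (\<lambda>x. c * \<phi> i x) x) \<in> borel_measurable (leb U)" using I[OF b] by simp
      show "(\<lambda>x. c * (g b x * G b i x)) \<in> borel_measurable (leb U)"
        using sqi_mult[OF has_weak_partial_sqi[OF g(1)[OF b]] G_sqi[OF b]] by simp
      show "AE x in leb U. weak_partial U b u x * weak_partial U b (\<lambda>x. c * \<phi> i x) x = c * (g b x * G b i x)"
        using weak_partial_AE[OF open_U g(1)[OF b]] weak_partial_AE[OF open_U cp] by eventually_elim simp
    qed
    then show "(\<integral>x. weak_partial U b u x * weak_partial U b (\<lambda>x. c * \<phi> i x) x \<partial>leb U) = c * (\<integral>x. g b x * G b i x \<partial>leb U)"
      by simp
  qed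
  finally show ?thesis using g(2) by (simp add: sum_distrib_left[symmetric])
qed

end

section \<open>Time dependent fields and their coefficients\<close>

lemma test_function_real:
  fixes \<psi> :: "real \<Rightarrow> real"
  assumes \<psi>: "\<psi> \<in> test_functions U"
  shows "(\<psi> has_real_derivative deriv \<psi> t) (at t)" "continuous_on UNIV (deriv \<psi>)" "deriv \<psi> = partial 1 \<psi>"
proof -
  have C: "C_k (Suc 0) \<psi>" using \<psi> unfolding test_functions_def by blast
  then have d: "\<psi> differentiable (at t)" for t by simp
  then show 1: "(\<psi> has_real_derivative deriv \<psi> t) (at t)" for t
    using DERIV_deriv_iff_real_differentiable by blast
  show e: "deriv \<psi> = partial 1 \<psi>"
  proof
    fix t
    have "(\<psi> has_derivative (\<lambda>h. deriv \<psi> t * h)) (at t)" using 1[of t] by (simp add: has_field_derivative_def)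
    from frechet_derivative_at[OF this] show "deriv \<psi> t = partial 1 \<psi> t"
      unfolding partial_def by (metis mult.right_neutral)
  qed
  show "continuous_on UNIV (deriv \<psi>)" unfolding e using C by simp
qed

lemma leb_interval_integral:
  fixes f :: "real \<Rightarrow> real" and T :: real
  shows "(\<integral>t. f t \<partial>leb {0<..<T}) = (\<integral>t. indicator {0<..<T} t * f t \<partial>lborel)"
  by (subst integral_restrict_space) auto

lemma leb_interval_nn_integral:
  fixes T :: real
  shows "(\<integral>\<^sup>+t. f t \<partial>leb {0<..<T}) = (\<integral>\<^sup>+t. f t * indicator {0<..<T} t \<partial>lborel)"
  by (subst nn_integral_restrict_space) auto

text \<open>Fubini over the triangle s < t: integrating \<psi>' over (s, T) gives -\<psi>(s),
  because \<psi> vanishes at T.\<close>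

lemma primitive_by_parts:
  assumes h: "h \<in> L1s T" and T: "0 < T" and \<psi>: "\<psi> \<in> test_functions {0<..<T}"
  shows "(\<integral>t. cv T (pw T 1) h t * deriv \<psi> t \<partial>leb {0<..<T}) = - (\<integral>t. h t * \<psi> t \<partial>leb {0<..<T})"
proof -
  note d = test_function_real[OF \<psi>]
  have [measurable]: "h \<in> borel_measurable borel" using h by (rule L1s_measurable)
  have [measurable]: "deriv \<psi> \<in> borel_measurable borel" using d(2) by (rule borel_measurable_continuous_onI)
  have hI: "integrable lborel h" by (rule L1s_integrable[OF h])
  have h0: "h s = 0" if "\<not> (0 < s \<and> s < T)" for s using L1s_zero[OF h, of s] that by auto
  have \<psi>T: "\<psi> T = 0"
  proof -
    obtain K where "K \<subseteq> {0<..<T}" "\<forall>x. x \<notin> K \<longrightarrow> \<psi> x = 0" using \<psi> unfolding test_functions_def by blast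
    then show ?thesis by (meson greaterThanLessThan_iff less_irrefl subsetD)
  qed
  obtain B where B: "\<And>t. t \<in> {0..T} \<Longrightarrow> \<bar>deriv \<psi> t\<bar> \<le> B"
  proof -
    have "compact (deriv \<psi> ` {0..T})" by (intro compact_continuous_image continuous_on_subset[OF d(2)]) auto
    then have "bounded (deriv \<psi> ` {0..T})" by (rule compact_imp_bounded)
    then obtain B where "\<And>x. x \<in> deriv \<psi> ` {0..T} \<Longrightarrow> \<bar>x\<bar> \<le> B" unfolding bounded_real by blast
    then show ?thesis using that by blast
  qed
  let ?F = "\<lambda>(t, s). (if 0 < t \<and> t < T \<and> s < t then h s * deriv \<psi> t else 0)"
  have F: "integrable (lborel \<Otimes>\<^sub>M lborel) ?F"
  proof (rule Bochner_Integration.integrable_bound)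
    show "integrable (lborel \<Otimes>\<^sub>M lborel) (\<lambda>(t, s). (B * indicator {0<..<T} t) * h s)"
      by (intro lborel_pair.integrable_product_pair hI integrable_mult_right integrable_real_indicator)
         (auto simp: emeasure_lborel_Ioo T less_imp_le)
    show "?F \<in> borel_measurable (lborel \<Otimes>\<^sub>M lborel)" by measurable
    show "AE q in lborel \<Otimes>\<^sub>M lborel. norm (?F q) \<le> norm (case q of (t, s) \<Rightarrow> (B * indicator {0<..<T} t) * h s)"
    proof (rule AE_I2)
      fix q :: "real \<times> real"
      obtain t s where q: "q = (t, s)" by force
      show "norm (?F q) \<le> norm (case q of (t, s) \<Rightarrow> (B * indicator {0<..<T} t) * h s)"
      proof (cases "0 < t \<and> t < T")
        case True
        then have "\<bar>h s * deriv \<psi> t\<bar> \<le> \<bar>h s * B\<bar>"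
          using B[of t] unfolding abs_mult by (intro mult_left_mono) auto
        then show ?thesis using True by (auto simp: q mult.commute)
      qed (auto simp: q)
    qed
  qed
  have "(\<integral>t. cv T (pw T 1) h t * deriv \<psi> t \<partial>leb {0<..<T}) = (\<integral>t. \<integral>s. ?F (t, s) \<partial>lborel \<partial>lborel)"
    unfolding leb_interval_integral
  proof (intro Bochner_Integration.integral_cong refl)
    fix t
    show "indicator {0<..<T} t * (cv T (pw T 1) h t * deriv \<psi> t) = (\<integral>s. ?F (t, s) \<partial>lborel)"
    proof (cases "0 < t \<and> t < T")
      case True
      have "(\<integral>s. ?F (t, s) \<partial>lborel) = (\<integral>s. (indicator {..<t} s * h s) * deriv \<psi> t \<partial>lborel)"
        using True by (intro Bochner_Integration.integral_cong) (auto simp: indicator_def)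
      also have "\<dots> = (\<integral>s. indicator {..<t} s * h s \<partial>lborel) * deriv \<psi> t" by (rule integral_mult_left_zero)
      finally show ?thesis using True by (simp add: cv_def conv_pw_1[OF h])
    qed auto
  qed
  also have "\<dots> = (\<integral>s. \<integral>t. ?F (t, s) \<partial>lborel \<partial>lborel)"
    using lborel_pair.Fubini_integral[of "\<lambda>t s. ?F (t, s)"] F by simp
  also have "\<dots> = (\<integral>s. - (indicator {0<..<T} s * (h s * \<psi> s)) \<partial>lborel)"
  proof (intro Bochner_Integration.integral_cong refl)
    fix s
    show "(\<integral>t. ?F (t, s) \<partial>lborel) = - (indicator {0<..<T} s * (h s * \<psi> s))"
    proof (cases "0 < s \<and> s < T")
      case True
      have "(\<integral>t. ?F (t, s) \<partial>lborel) = (\<integral>t. h s * (indicator {s..T} t *\<^sub>R deriv \<psi> t) \<partial>lborel)"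
      proof (rule integral_cong_AE)
        show "AE t in lborel. ?F (t, s) = h s * (indicator {s..T} t *\<^sub>R deriv \<psi> t)"
          using AE_lborel_singleton[of s] AE_lborel_singleton[of T]
          by eventually_elim (use True in \<open>auto simp: indicator_def\<close>)
      qed (simp only: prod.case, measurable)+
      also have "\<dots> = h s * (\<integral>t. indicator {s..T} t *\<^sub>R deriv \<psi> t \<partial>lborel)" by (rule integral_mult_right_zero)
      also have "(\<integral>t. indicator {s..T} t *\<^sub>R deriv \<psi> t \<partial>lborel) = \<psi> T - \<psi> s"
        using True d(1) continuous_on_subset[OF d(2)]
        by (intro integral_FTC_atLeastAtMost)
           (auto simp: has_real_derivative_iff_has_vector_derivative[symmetric] has_field_derivative_at_within)
      finally show ?thesis using True \<psi>T by simp
    next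
      case False
      then have "(\<lambda>t. ?F (t, s)) = (\<lambda>t. 0)" using h0[of s] by auto
      then show ?thesis using False by auto
    qed
  qed
  finally show ?thesis unfolding leb_interval_integral by simp
qed

text \<open>Only countably many test functions may be used, because the exceptional set of points x
  in \<open>has_time_deriv\<close> depends on the test function and is common only to countably
  many. Boxes with arbitrary end points are exhausted from inside by rational ones.\<close>

lemma has_time_deriv_unique_1d:
  fixes d :: "real \<Rightarrow> real"
  assumes d: "d \<in> sqi (leb {0<..<T})"
    and z: "\<And>a c n. a \<in> \<rat> \<Longrightarrow> c \<in> \<rat> \<Longrightarrow> cbox a c \<subseteq> {0<..<T} \<Longrightarrow> (\<integral>t. d t * box_bump (1 / Suc n) a c t \<partial>leb {0<..<T}) = 0"
  shows "AE t in leb {0<..<T}. d t = 0"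
proof -
  let ?U = "{0<..<T}"
  have U: "open ?U" by simp
  have rat: "(\<integral>x. indicator (box a c) x * d x \<partial>lborel) = 0" if "a \<in> \<rat>" "c \<in> \<rat>" and ac: "cbox a c \<subseteq> ?U" for a c
  proof -
    have B: "box a c \<subseteq> ?U" using ac box_subset_cbox by blast
    have "(\<lambda>n. \<integral>x. d x * box_bump (1 / Suc n) a c x \<partial>leb ?U) \<longlonglongrightarrow> 0"
      using z[OF that] by simp
    from LIMSEQ_unique[OF box_bump_integral_tendsto[OF U d, of a c] this]
    show ?thesis using leb_indicator_integral[OF U B] by simp
  qed
  have dm: "(\<lambda>x. indicator ?U x * d x) \<in> borel_measurable lborel"
    using sqi_measurable[OF d] by (subst (asm) borel_measurable_restrict_space_iff) auto
  have "AE x in lborel. x \<in> ?U \<longrightarrow> d x = 0"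
  proof (rule AE_zero_if_local_box_integrals_zero[OF U])
    fix a c :: real assume ac: "cbox a c \<subseteq> ?U"
    then have B: "box a c \<subseteq> ?U" using box_subset_cbox by blast
    show I: "integrable lborel (\<lambda>x. indicator (box a c) x * d x)"
      using sqi_mult[OF sqi_indicator_box[OF U] d] leb_indicator_integral[OF U B] by auto
    show "(\<integral>x. indicator (box a c) x * d x \<partial>lborel) = 0"
    proof (cases "a < c")
      case True
      define m where "m = (a + c) / 2"
      have "\<exists>f. \<forall>n. f n \<in> \<rat> \<and> a < f n \<and> f n < min m (a + 1 / Suc n)"
      proof (intro choice allI)
        fix n
        have "a < min m (a + 1 / Suc n)" using True by (simp add: m_def)
        from Rats_dense_in_real[OF this] show "\<exists>y. y \<in> \<rat> \<and> a < y \<and> y < min m (a + 1 / Suc n)" by blast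
      qed
      then obtain f where f: "\<And>n::nat. f n \<in> \<rat>" "\<And>n. a < f n" "\<And>n. f n < min m (a + 1 / Suc n)" by blast
      have "\<exists>g. \<forall>n. g n \<in> \<rat> \<and> max m (c - 1 / Suc n) < g n \<and> g n < c"
      proof (intro choice allI)
        fix n
        have "max m (c - 1 / Suc n) < c" using True by (simp add: m_def)
        from Rats_dense_in_real[OF this] show "\<exists>y. y \<in> \<rat> \<and> max m (c - 1 / Suc n) < y \<and> y < c" by blast
      qed
      then obtain g where g: "\<And>n::nat. g n \<in> \<rat>" "\<And>n. max m (c - 1 / Suc n) < g n" "\<And>n. g n < c" by blast
      have sub: "cbox (f n) (g n) \<subseteq> cbox a c" for n using f(2)[of n] g(3)[of n] by auto
      have ac': "{a..c} \<subseteq> ?U" using ac by simp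
      have "(\<lambda>n. \<integral>x. indicator (box (f n) (g n)) x * d x \<partial>lborel) \<longlonglongrightarrow> (\<integral>x. indicator (box a c) x * d x \<partial>lborel)"
      proof (rule integral_dominated_convergence[where w="\<lambda>x. \<bar>indicator (box a c) x * d x\<bar>"])
        have e: "indicator (box p q) x * d x = indicator (box p q) x * (indicator ?U x * d x)" if "box p q \<subseteq> ?U" for p q x
          using that by (auto simp: indicator_def)
        show "(\<lambda>x. indicator (box a c) x * d x) \<in> borel_measurable lborel" using I by simp
        have bs: "box (f n) (g n) \<subseteq> ?U" for n using sub[of n] ac box_subset_cbox by blast
        show "(\<lambda>x. indicator (box (f n) (g n)) x * d x) \<in> borel_measurable lborel" for n
          by (subst e[OF bs], rule borel_measurable_times[OF _ dm]) simp
        show "integrable lborel (\<lambda>x. \<bar>indicator (box a c) x * d x\<bar>)" using I by simp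
        show "AE x in lborel. norm (indicator (box (f n) (g n)) x * d x) \<le> \<bar>indicator (box a c) x * d x\<bar>" for n
          using f(2)[of n] g(3)[of n] by (intro AE_I2) (auto simp: indicator_def)
        show "AE x in lborel. (\<lambda>n. indicator (box (f n) (g n)) x * d x) \<longlonglongrightarrow> indicator (box a c) x * d x"
        proof (rule AE_I2)
          fix x
          show "(\<lambda>n. indicator (box (f n) (g n)) x * d x) \<longlonglongrightarrow> indicator (box a c) x * d x"
          proof (cases "a < x \<and> x < c")
            case True
            have "f \<longlonglongrightarrow> a"
            proof (rule real_tendsto_sandwich[OF _ _ tendsto_const])
              show "(\<lambda>n. a + 1 / Suc n) \<longlonglongrightarrow> a"
                using tendsto_add[OF tendsto_const LIMSEQ_Suc[OF lim_1_over_n], of a] by simp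
              show "\<forall>\<^sub>F n in sequentially. a \<le> f n" by (intro always_eventually allI less_imp_le f(2))
              show "\<forall>\<^sub>F n in sequentially. f n \<le> a + 1 / Suc n"
                by (intro always_eventually allI) (use f(3) in \<open>auto intro: less_imp_le simp del: of_nat_Suc\<close>)
            qed
            then have 1: "\<forall>\<^sub>F n in sequentially. f n < x" using order_tendstoD(2)[of f a sequentially x] True by auto
            have "g \<longlonglongrightarrow> c"
            proof (rule real_tendsto_sandwich[OF _ _ _ tendsto_const])
              show "(\<lambda>n. c - 1 / Suc n) \<longlonglongrightarrow> c"
                using tendsto_diff[OF tendsto_const LIMSEQ_Suc[OF lim_1_over_n], of c] by simp
              show "\<forall>\<^sub>F n in sequentially. g n \<le> c" by (intro always_eventually allI less_imp_le g(3))
              show "\<forall>\<^sub>F n in sequentially. c - 1 / Suc n \<le> g n"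
                by (intro always_eventually allI) (use g(2) in \<open>auto intro: less_imp_le simp del: of_nat_Suc\<close>)
            qed
            then have "\<forall>\<^sub>F n in sequentially. x < g n" using order_tendstoD(1)[of g c sequentially x] True by auto
            then have "\<forall>\<^sub>F n in sequentially. indicator (box (f n) (g n)) x * d x = indicator (box a c) x * d x"
              using 1 by eventually_elim (use True in \<open>auto simp: indicator_def\<close>)
            then show ?thesis by (rule tendsto_eventually)
          next
            case False
            then have "x \<notin> box (f n) (g n)" for n using f(2)[of n] g(3)[of n] by auto
            then show ?thesis using False by auto
          qed
        qed
      qed
      moreover have "(\<integral>x. indicator (box (f n) (g n)) x * d x \<partial>lborel) = 0" for n
        by (rule rat[OF f(1) g(1)]) (use sub[of n] ac in blast)
      ultimately show ?thesis using LIMSEQ_unique[OF _ tendsto_const] by auto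
    qed (simp add: box_eq_empty)
  qed
  then show ?thesis by (subst AE_restrict_space_iff) auto
qed

section \<open>Fields as functions on the product of the time axis and the domain\<close>

definition ext :: "real \<Rightarrow> (real \<Rightarrow> 'a \<Rightarrow> real) \<Rightarrow> real \<Rightarrow> 'a \<Rightarrow> real" where
  "ext T u t x = (if 0 < t \<and> t < T then u t x else 0)"

locale onb_time = onb U \<phi> for U :: "'a::euclidean_space set" and \<phi> +
  fixes T :: real assumes T_pos: "0 < T"
begin

abbreviation "MT \<equiv> (lborel :: real measure) \<Otimes>\<^sub>M leb U"

sublocale MU: sigma_finite_measure "leb U"
  by (rule sigma_finite_measure_restrict_space[OF lborel.sigma_finite_measure_axioms]) (simp add: open_U)

sublocale P: pair_sigma_finite "lborel :: real measure" "leb U" ..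

sublocale PS: pair_sigma_finite "leb U" "lborel :: real measure" ..

lemma ext_measurable:
  assumes u: "u \<in> fields T U" shows "case_prod (ext T u) \<in> borel_measurable MT"
proof -
  have S: "{q \<in> space MT. 0 < fst q \<and> fst q < T} \<in> sets MT" by measurable
  let ?R = "restrict_space MT {q. 0 < fst q \<and> fst q < T}"
  have "(\<lambda>q. (fst q, snd q)) \<in> measurable ?R (leb {0<..<T} \<Otimes>\<^sub>M leb U)"
  proof (rule measurable_Pair)
    show "fst \<in> measurable ?R (leb {0<..<T})"
      by (rule measurable_restrict_space2) (auto simp: space_restrict_space intro: measurable_restrict_space1)
    show "snd \<in> measurable ?R (leb U)" by (intro measurable_restrict_space1) measurable
  qed
  then have id: "(\<lambda>q. q) \<in> measurable ?R (leb {0<..<T} \<Otimes>\<^sub>M leb U)" by simp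
  have "case_prod u \<in> borel_measurable (leb {0<..<T} \<Otimes>\<^sub>M leb U)" using u by (simp add: fields_def)
  from measurable_compose[OF id this] have "case_prod u \<in> borel_measurable ?R" .
  then have "(\<lambda>q. if 0 < fst q \<and> fst q < T then case_prod u q else 0) \<in> borel_measurable MT"
    using S by (subst measurable_If_restrict_space_iff) auto
  moreover have "(\<lambda>q. if 0 < fst q \<and> fst q < T then case_prod u q else 0) = case_prod (ext T u)"
    by (auto simp: ext_def fun_eq_iff)
  ultimately show ?thesis by simp
qed

lemma fields_I:
  assumes "case_prod g \<in> borel_measurable MT" shows "g \<in> fields T U"
proof -
  have "fst \<in> measurable (leb {0<..<T} \<Otimes>\<^sub>M leb U) lborel"
    by (rule measurable_compose[OF measurable_fst]) (auto intro: measurable_restrict_space1)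
  then have "(\<lambda>q. (fst q, snd q)) \<in> measurable (leb {0<..<T} \<Otimes>\<^sub>M leb U) MT"
    by (intro measurable_Pair) auto
  from measurable_compose[OF this assms] show ?thesis by (simp add: fields_def case_prod_unfold)
qed

lemma L2_sq_nn:
  assumes "v \<in> borel_measurable (leb U)"
  shows "L2_sq U v = (\<integral>\<^sup>+x. ennreal ((v x)\<^sup>2) \<partial>leb U)"
proof (cases "v \<in> sqi (leb U)")
  case True
  then show ?thesis by (simp add: L2_sq_def L2_eq_sqi L2_inner_def sqi_nn_integral flip: power2_eq_square)
next
  case False
  then have "\<not> (\<integral>\<^sup>+x. ennreal ((v x)\<^sup>2) \<partial>leb U) < \<infinity>" using assms by (simp add: sqi_iff_nn)
  then have "(\<integral>\<^sup>+x. ennreal ((v x)\<^sup>2) \<partial>leb U) = \<infinity>" by (metis infinity_ennreal_def top.not_eq_extremum)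
  then show ?thesis using False by (simp add: L2_sq_def L2_eq_sqi)
qed

lemma section_measurable: "case_prod g \<in> borel_measurable MT \<Longrightarrow> g t \<in> borel_measurable (leb U)"
  using measurable_Pair2[of "case_prod g" "lborel :: real measure" "leb U" borel t] by simp

lemma L2t_sq_nn:
  assumes u: "u \<in> fields T U"
  shows "L2t_sq T (L2_sq U) u = (\<integral>\<^sup>+q. ennreal ((case_prod (ext T u) q)\<^sup>2) \<partial>MT)"
proof -
  note m = ext_measurable[OF u]
  have "L2t_sq T (L2_sq U) u = (\<integral>\<^sup>+t. L2_sq U (u t) * indicator {0<..<T} t \<partial>lborel)"
    unfolding L2t_sq_def by (rule leb_interval_nn_integral)
  also have "\<dots> = (\<integral>\<^sup>+t. \<integral>\<^sup>+x. ennreal ((ext T u t x)\<^sup>2) \<partial>leb U \<partial>lborel)"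
  proof (rule nn_integral_cong)
    fix t
    show "L2_sq U (u t) * indicator {0<..<T} t = (\<integral>\<^sup>+x. ennreal ((ext T u t x)\<^sup>2) \<partial>leb U)"
    proof (cases "0 < t \<and> t < T")
      case True
      then have "u t = ext T u t" by (auto simp: ext_def)
      then show ?thesis using True L2_sq_nn[OF section_measurable[OF m], of t] by simp
    qed (auto simp: ext_def)
  qed
  also have "\<dots> = (\<integral>\<^sup>+q. ennreal ((case_prod (ext T u) q)\<^sup>2) \<partial>MT)"
    using m by (subst MU.nn_integral_fst[symmetric]) auto
  finally show ?thesis .
qed

text \<open>The zero values outside (0, T) are required identically, so that slices at fixed x and
  coefficients in time lie in \<open>L2s\<close> and the scalar theory on the line applies.\<close>

definition F2 :: "(real \<Rightarrow> 'a \<Rightarrow> real) set" where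
  "F2 = {g. case_prod g \<in> sqi MT \<and> (\<forall>t x. \<not> (0 < t \<and> t < T) \<longrightarrow> g t x = 0)}"

lemma F2_sqi: "g \<in> F2 \<Longrightarrow> case_prod g \<in> sqi MT"
  and F2_zero: "g \<in> F2 \<Longrightarrow> \<not> (0 < t \<and> t < T) \<Longrightarrow> g t x = 0"
  by (auto simp: F2_def)

lemma F2_measurable: "g \<in> F2 \<Longrightarrow> case_prod g \<in> borel_measurable MT"
  by (rule sqi_measurable[OF F2_sqi])

lemma ext_F2: "g \<in> F2 \<Longrightarrow> ext T g = g"
  using F2_zero by (auto simp: ext_def fun_eq_iff)

lemma F2_ext:
  assumes "u \<in> fields T U" "L2t_sq T (L2_sq U) u < \<infinity>" shows "ext T u \<in> F2"
  using assms ext_measurable[OF assms(1)] by (auto simp: F2_def sqi_iff_nn L2t_sq_nn ext_def[of T u])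

lemma F2_L2t:
  assumes "g \<in> F2" shows "g \<in> L2t T U (L2_sq U)" "L2t_sq T (L2_sq U) g = ennreal (\<integral>q. (case_prod g q)\<^sup>2 \<partial>MT)"
proof -
  have f: "g \<in> fields T U" by (rule fields_I[OF F2_measurable[OF assms]])
  show e: "L2t_sq T (L2_sq U) g = ennreal (\<integral>q. (case_prod g q)\<^sup>2 \<partial>MT)"
    using L2t_sq_nn[OF f] sqi_nn_integral[OF F2_sqi[OF assms]] by (simp add: ext_F2[OF assms])
  show "g \<in> L2t T U (L2_sq U)" using f by (simp add: L2t_def e)
qed

lemma F2_section: "g \<in> F2 \<Longrightarrow> AE t in lborel. g t \<in> sqi (leb U)"
  using P.AE_integrable_fst'[OF sqi_integrable[OF F2_sqi], of g] section_measurable[OF F2_measurable, of g]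
  by (auto simp: sqi_def elim!: eventually_mono)

lemma F2_section_x:
  assumes g: "g \<in> F2" shows "AE x in leb U. (\<lambda>t. g t x) \<in> L2s T"
proof -
  have "integrable (leb U \<Otimes>\<^sub>M lborel) (\<lambda>(x, t). (case_prod g (t, x))\<^sup>2)"
    using P.integrable_product_swap[OF sqi_integrable[OF F2_sqi[OF g]]] .
  from PS.AE_integrable_fst'[OF this]
  have "AE x in leb U. integrable lborel (\<lambda>t. (g t x)\<^sup>2)" by simp
  moreover have "(\<lambda>t. g t x) \<in> borel_measurable lborel" if "x \<in> space (leb U)" for x
    using measurable_Pair1[OF F2_measurable[OF g] that] by simp
  ultimately have "AE x in leb U. (\<lambda>t. g t x) \<in> sqi lborel"
    using AE_space by (auto simp: sqi_def elim!: AE_mp)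
  then show ?thesis
    by eventually_elim (rule L2s_I, use F2_zero[OF g] in auto)
qed

lemma F2_iterated:
  assumes g: "g \<in> F2"
  shows "(\<integral>q. (case_prod g q)\<^sup>2 \<partial>MT) = (\<integral>t. \<integral>x. (g t x)\<^sup>2 \<partial>leb U \<partial>lborel)"
    "integrable lborel (\<lambda>t. \<integral>x. (g t x)\<^sup>2 \<partial>leb U)"
  using P.integral_fst'[OF sqi_integrable[OF F2_sqi[OF g]]] P.integrable_fst'[OF sqi_integrable[OF F2_sqi[OF g]]]
  by simp_all

lemma F2_diff:
  assumes "g \<in> F2" "h \<in> F2" shows "(\<lambda>t x. g t x - h t x) \<in> F2"
  using sqi_diff[OF F2_sqi[OF assms(1)] F2_sqi[OF assms(2)]] F2_zero[OF assms(1)] F2_zero[OF assms(2)]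
  by (auto simp: F2_def case_prod_unfold)

lemma coeff_measurable:
  assumes g: "case_prod g \<in> borel_measurable MT" and w: "w \<in> borel_measurable (leb U)"
  shows "(\<lambda>t. L2_inner U (g t) w) \<in> borel_measurable borel"
proof -
  have "(\<lambda>q. case_prod g q * w (snd q)) \<in> borel_measurable MT"
    using g w by measurable
  then have "(\<lambda>t. \<integral>x. g t x * w x \<partial>leb U) \<in> borel_measurable lborel"
    by (intro MU.borel_measurable_lebesgue_integral) (simp add: case_prod_unfold)
  then show ?thesis by (simp add: L2_inner_def)
qed

lemma
  assumes g: "g \<in> F2" and w: "w \<in> sqi (leb U)"
  shows coeff_L2s: "(\<lambda>t. L2_inner U (g t) w) \<in> L2s T"
    and coeff_le: "(\<integral>t. (L2_inner U (g t) w)\<^sup>2 \<partial>lborel) \<le> (\<integral>q. (case_prod g q)\<^sup>2 \<partial>MT) * (\<integral>x. (w x)\<^sup>2 \<partial>leb U)"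
proof -
  have m[measurable]: "(\<lambda>t. L2_inner U (g t) w) \<in> borel_measurable borel"
    by (rule coeff_measurable[OF F2_measurable[OF g] sqi_measurable[OF w]])
  have le: "AE t in lborel. (L2_inner U (g t) w)\<^sup>2 \<le> (\<integral>x. (g t x)\<^sup>2 \<partial>leb U) * (\<integral>x. (w x)\<^sup>2 \<partial>leb U)"
    using F2_section[OF g] by eventually_elim (simp add: L2_inner_def sqi_CS_sq[OF _ w])
  have I: "integrable lborel (\<lambda>t. (\<integral>x. (g t x)\<^sup>2 \<partial>leb U) * (\<integral>x. (w x)\<^sup>2 \<partial>leb U))"
    by (intro integrable_mult_left F2_iterated(2)[OF g])
  have Ic: "integrable lborel (\<lambda>t. (L2_inner U (g t) w)\<^sup>2)"
    by (rule Bochner_Integration.integrable_bound[OF I]) (use le in \<open>auto elim!: eventually_mono\<close>)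
  then have "(\<lambda>t. L2_inner U (g t) w) \<in> sqi lborel" by (simp add: sqi_def m)
  then show "(\<lambda>t. L2_inner U (g t) w) \<in> L2s T"
    by (rule L2s_I) (auto simp: L2_inner_def F2_zero[OF g])
  have "(\<integral>t. (L2_inner U (g t) w)\<^sup>2 \<partial>lborel) \<le> (\<integral>t. (\<integral>x. (g t x)\<^sup>2 \<partial>leb U) * (\<integral>x. (w x)\<^sup>2 \<partial>leb U) \<partial>lborel)"
    by (rule integral_mono_AE[OF Ic I le])
  then show "(\<integral>t. (L2_inner U (g t) w)\<^sup>2 \<partial>lborel) \<le> (\<integral>q. (case_prod g q)\<^sup>2 \<partial>MT) * (\<integral>x. (w x)\<^sup>2 \<partial>leb U)"
    unfolding F2_iterated(1)[OF g] by simp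
qed

abbreviation cf :: "(real \<Rightarrow> 'a \<Rightarrow> real) \<Rightarrow> nat \<Rightarrow> real \<Rightarrow> real" where
  "cf g i t \<equiv> L2_inner U (g t) (\<phi> i)"

lemma parseval_ennreal:
  assumes "v \<in> sqi (leb U)"
  shows "(\<Sum>i. ennreal ((L2_inner U v (\<phi> i))\<^sup>2)) = ennreal (\<integral>x. (v x)\<^sup>2 \<partial>leb U)"
  using parseval[OF assms] by (intro suminf_ennreal_eq) auto

lemma parseval_time:
  assumes g: "g \<in> F2"
  shows "(\<Sum>i. ennreal (\<integral>t. (cf g i t)\<^sup>2 \<partial>lborel)) = ennreal (\<integral>q. (case_prod g q)\<^sup>2 \<partial>MT)"
proof -
  have [measurable]: "cf g i \<in> borel_measurable borel" for i
    by (rule coeff_measurable[OF F2_measurable[OF g] sqi_measurable[OF \<phi>_sqi]])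
  have "(\<Sum>i. ennreal (\<integral>t. (cf g i t)\<^sup>2 \<partial>lborel)) = (\<Sum>i. \<integral>\<^sup>+t. ennreal ((cf g i t)\<^sup>2) \<partial>lborel)"
    using sqi_nn_integral[OF L2s_sqi[OF coeff_L2s[OF g \<phi>_sqi]]] by simp
  also have "\<dots> = (\<integral>\<^sup>+t. (\<Sum>i. ennreal ((cf g i t)\<^sup>2)) \<partial>lborel)"
    by (rule nn_integral_suminf[symmetric]) measurable
  also have "\<dots> = (\<integral>\<^sup>+t. ennreal (\<integral>x. (g t x)\<^sup>2 \<partial>leb U) \<partial>lborel)"
    using F2_section[OF g] by (intro nn_integral_cong_AE, eventually_elim) (rule parseval_ennreal)
  also have "\<dots> = ennreal (\<integral>t. \<integral>x. (g t x)\<^sup>2 \<partial>leb U \<partial>lborel)"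
    by (intro nn_integral_eq_integral F2_iterated(2)[OF g]) auto
  finally show ?thesis by (simp add: F2_iterated(1)[OF g])
qed

text \<open>Parseval for the difference. It lifts identities between scalar coefficients to
  identities between fields.\<close>

lemma F2_eq_by_coeff:
  assumes g: "g \<in> F2" and h: "h \<in> F2" and e: "\<And>i. AE t in lborel. cf g i t = cf h i t"
  shows "AE q in MT. case_prod g q = case_prod h q"
proof (rule sqi_eq_AE[OF F2_sqi[OF g] F2_sqi[OF h]])
  note d = F2_diff[OF g h]
  have "AE t in lborel. cf (\<lambda>t x. g t x - h t x) i t = 0" for i
    using F2_section[OF g] F2_section[OF h] e[of i] by eventually_elim (simp add: coeff_linear)
  then have "(\<integral>t. (cf (\<lambda>t x. g t x - h t x) i t)\<^sup>2 \<partial>lborel) = 0" for i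
    by (intro integral_eq_zero_AE) (auto elim!: eventually_mono)
  then have "ennreal (\<integral>q. (case_prod (\<lambda>t x. g t x - h t x) q)\<^sup>2 \<partial>MT) = 0"
    unfolding parseval_time[OF d, symmetric] by simp
  then show "(\<integral>q. (case_prod g q - case_prod h q)\<^sup>2 \<partial>MT) \<le> 0"
    by (simp add: case_prod_unfold ennreal_eq_0_iff)
qed

lemma product_sqi:
  assumes z: "z \<in> sqi lborel" and w: "w \<in> sqi (leb U)"
  shows "(\<lambda>q. z (fst q) * w (snd q)) \<in> sqi MT"
proof -
  have [measurable]: "z \<in> borel_measurable borel" "w \<in> borel_measurable (leb U)"
    using z w by (auto simp: sqi_def)
  have "integrable MT (\<lambda>(t, x). (z t)\<^sup>2 * (w x)\<^sup>2)"
    by (rule P.integrable_product_pair[OF sqi_integrable[OF z] sqi_integrable[OF w]])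
  then show ?thesis by (simp add: sqi_def power_mult_distrib case_prod_unfold)
qed

lemma synthesis_norm:
  assumes z: "\<And>i. z i \<in> L2s T" and I: "finite I"
  shows "(\<integral>q. (\<Sum>i\<in>I. z i (fst q) * \<phi> i (snd q))\<^sup>2 \<partial>MT) = (\<Sum>i\<in>I. \<integral>t. (z i t)\<^sup>2 \<partial>lborel)"
proof -
  have q: "(\<lambda>q. \<Sum>i\<in>I. z i (fst q) * \<phi> i (snd q)) \<in> sqi MT"
    by (intro sqi_sum product_sqi L2s_sqi[OF z] \<phi>_sqi)
  have "(\<integral>q. (\<Sum>i\<in>I. z i (fst q) * \<phi> i (snd q))\<^sup>2 \<partial>MT) = (\<integral>t. \<integral>x. (\<Sum>i\<in>I. z i t * \<phi> i x)\<^sup>2 \<partial>leb U \<partial>lborel)"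
    using P.integral_fst'[OF sqi_integrable[OF q]] by simp
  also have "\<dots> = (\<integral>t. (\<Sum>i\<in>I. (z i t)\<^sup>2) \<partial>lborel)"
    by (simp add: partial_sum_norm[OF I])
  also have "\<dots> = (\<Sum>i\<in>I. \<integral>t. (z i t)\<^sup>2 \<partial>lborel)"
    by (intro Bochner_Integration.integral_sum sqi_integrable L2s_sqi[OF z])
  finally show ?thesis .
qed

text \<open>The theorem of Riesz and Fischer. The scalar theory yields derivatives mode by mode,
  whereas \<open>has_time_deriv\<close> requires a single jointly measurable field with these
  coefficients.\<close>

lemma synthesis:
  assumes z: "\<And>i. z i \<in> L2s T" and s: "summable (\<lambda>i. \<integral>t. (z i t)\<^sup>2 \<partial>lborel)"
  obtains g where "g \<in> F2" "\<And>i. AE t in lborel. cf g i t = z i t"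
proof -
  define Q where "Q n q = (\<Sum>i<n. z i (fst q) * \<phi> i (snd q))" for n q
  have Qs: "Q n \<in> sqi MT" for n
    unfolding Q_def[abs_def] by (intro sqi_sum product_sqi L2s_sqi[OF z] \<phi>_sqi)
  define N where "N n = (\<Sum>i<n. \<integral>t. (z i t)\<^sup>2 \<partial>lborel)" for n
  have d: "(\<integral>q. (Q m q - Q n q)\<^sup>2 \<partial>MT) = N m - N n" if "n \<le> m" for m n
  proof -
    have "Q m q - Q n q = (\<Sum>i=n..<m. z i (fst q) * \<phi> i (snd q))" for q
      unfolding Q_def lessThan_atLeast0 using that by (simp add: sum_diff_nat_ivl)
    then have "(\<integral>q. (Q m q - Q n q)\<^sup>2 \<partial>MT) = (\<Sum>i=n..<m. \<integral>t. (z i t)\<^sup>2 \<partial>lborel)"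
      by (simp add: synthesis_norm[OF z])
    then show ?thesis unfolding N_def lessThan_atLeast0 using that by (simp add: sum_diff_nat_ivl)
  qed
  have "\<exists>k. \<forall>m\<ge>k. \<forall>n\<ge>k. (\<integral>q. (Q m q - Q n q)\<^sup>2 \<partial>MT) < e" if e: "e > 0" for e
  proof -
    have "Cauchy N" using s unfolding N_def summable_iff_convergent by (rule convergent_Cauchy)
    then obtain k where k: "\<And>m n. k \<le> m \<Longrightarrow> k \<le> n \<Longrightarrow> \<bar>N m - N n\<bar> < e"
      using e unfolding Cauchy_def dist_real_def by blast
    have lt: "(\<integral>q. (Q m q - Q n q)\<^sup>2 \<partial>MT) < e" if "k \<le> n" "n \<le> m" for m n
      using d[OF that(2)] k[of m n] that by simp
    have "(\<integral>q. (Q m q - Q n q)\<^sup>2 \<partial>MT) < e" if "k \<le> n" "k \<le> m" for m n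
      using lt[of n m] lt[of m n] that by (cases "n \<le> m") (auto simp: power2_commute)
    then show ?thesis by blast
  qed
  with sqi_complete[of Q MT] Qs obtain h where h: "h \<in> sqi MT" "(\<lambda>n. \<integral>q. (Q n q - h q)\<^sup>2 \<partial>MT) \<longlonglongrightarrow> 0" by blast
  define g where "g t x = (if 0 < t \<and> t < T then h (t, x) else 0)" for t x
  have hm[measurable]: "h \<in> borel_measurable MT" by (rule sqi_measurable[OF h(1)])
  have geq: "case_prod g = (\<lambda>q. if 0 < fst q \<and> fst q < T then h q else 0)" by (auto simp: g_def fun_eq_iff)
  have gm: "case_prod g \<in> borel_measurable MT" unfolding geq by measurable
  have "(\<integral>\<^sup>+q. ennreal ((case_prod g q)\<^sup>2) \<partial>MT) \<le> (\<integral>\<^sup>+q. ennreal ((h q)\<^sup>2) \<partial>MT)"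
    unfolding geq by (intro nn_integral_mono) auto
  also have "\<dots> < \<infinity>" using h(1) by (simp add: sqi_iff_nn)
  finally have gs: "case_prod g \<in> sqi MT" using gm by (simp add: sqi_iff_nn)
  moreover have "\<forall>t x. \<not> (0 < t \<and> t < T) \<longrightarrow> g t x = 0" by (auto simp: g_def)
  ultimately have gF: "g \<in> F2" unfolding F2_def by blast
  have lim: "(\<lambda>n. \<integral>q. (Q n q - case_prod g q)\<^sup>2 \<partial>MT) \<longlonglongrightarrow> 0"
  proof (rule Lim_null_comparison[OF _ h(2)], intro always_eventually allI)
    fix n
    have "Q n q = 0" if "\<not> (0 < fst q \<and> fst q < T)" for q
      unfolding Q_def using L1s_zero[OF L2s_L1s[OF z], of "fst q"] that by (auto intro!: sum.neutral)
    then have "(\<integral>q. (Q n q - case_prod g q)\<^sup>2 \<partial>MT) \<le> (\<integral>q. (Q n q - h q)\<^sup>2 \<partial>MT)"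
      using sqi_integrable[OF sqi_diff[OF Qs gs]] sqi_integrable[OF sqi_diff[OF Qs h(1)]]
      by (intro integral_mono) (auto simp: geq)
    then show "norm (\<integral>q. (Q n q - case_prod g q)\<^sup>2 \<partial>MT) \<le> (\<integral>q. (Q n q - h q)\<^sup>2 \<partial>MT)" by simp
  qed
  have "AE t in lborel. cf g i t = z i t" for i
  proof (rule sqi_eq_AE[OF L2s_sqi[OF coeff_L2s[OF gF \<phi>_sqi]] L2s_sqi[OF z]])
    \<comment> \<open>Once n exceeds i, the i-th coefficient of g minus the partial sum is
      \<open>cf g i\<close> minus \<open>z i\<close>, and a coefficient is no larger in L2 than the
      field.\<close>
    have "\<forall>\<^sub>F n in sequentially. (\<integral>t. (cf g i t - z i t)\<^sup>2 \<partial>lborel) \<le> (\<integral>q. (Q n q - case_prod g q)\<^sup>2 \<partial>MT)"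
      using eventually_gt_at_top[of i]
    proof eventually_elim
      case (elim n)
      note n = elim
      define R where "R t x = g t x - (\<Sum>j<n. z j t * \<phi> j x)" for t x
      have Req: "case_prod R q = case_prod g q - Q n q" for q by (simp add: R_def Q_def case_prod_unfold)
      have RF: "R \<in> F2"
        using sqi_diff[OF gs Qs[of n]] L1s_zero[OF L2s_L1s[OF z]] F2_zero[OF gF]
        by (auto simp: F2_def R_def Q_def[abs_def] case_prod_unfold intro!: sum.neutral)
      have "AE t in lborel. cf R i t = cf g i t - z i t"
        using F2_section[OF gF]
      proof eventually_elim
        case (elim t)
        have S: "(\<lambda>x. \<Sum>j<n. z j t * \<phi> j x) \<in> sqi (leb U)" by (intro sqi_sum sqi_cmult \<phi>_sqi)
        have "L2_inner U (\<lambda>x. \<Sum>j<n. z j t * \<phi> j x) (\<phi> i) = (\<Sum>j<n. z j t * (\<integral>x. \<phi> j x * \<phi> i x \<partial>leb U))"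
          unfolding L2_inner_def sum_distrib_right mult.assoc
          using sqi_mult[OF \<phi>_sqi \<phi>_sqi] by (simp add: Bochner_Integration.integral_sum)
        also have "\<dots> = (\<Sum>j<n. if j = i then z j t else 0)" by (intro sum.cong) (auto simp: \<phi>_orth)
        also have "\<dots> = z i t" using n by simp
        finally show ?case unfolding R_def[abs_def] using coeff_linear[OF elim S] by simp
      qed
      then have "(\<integral>t. (cf g i t - z i t)\<^sup>2 \<partial>lborel) = (\<integral>t. (cf R i t)\<^sup>2 \<partial>lborel)"
        using L1s_measurable[OF L2s_L1s[OF coeff_L2s[OF gF \<phi>_sqi[of i]]]] L1s_measurable[OF L2s_L1s[OF coeff_L2s[OF RF \<phi>_sqi[of i]]]]
          L1s_measurable[OF L2s_L1s[OF z[of i]]]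
        by (intro integral_cong_AE) (auto elim!: eventually_mono)
      also have "\<dots> \<le> (\<integral>q. (case_prod R q)\<^sup>2 \<partial>MT) * (\<integral>x. (\<phi> i x)\<^sup>2 \<partial>leb U)" by (rule coeff_le[OF RF \<phi>_sqi])
      also have "(\<integral>x. (\<phi> i x)\<^sup>2 \<partial>leb U) = 1" using \<phi>_orth[of i i] by (simp add: power2_eq_square)
      finally show ?case by (simp only: Req power2_commute[of "case_prod g _"] mult_1_right)
    qed
    then show "(\<integral>t. (cf g i t - z i t)\<^sup>2 \<partial>lborel) \<le> 0"
      by (intro tendsto_lowerbound[OF lim]) auto
  qed
  with gF show ?thesis using that by blast
qed

section \<open>Convolution in time of fields, and their time derivatives\<close>

definition cvf :: "(real \<Rightarrow> real) \<Rightarrow> (real \<Rightarrow> 'a \<Rightarrow> real) \<Rightarrow> real \<Rightarrow> 'a \<Rightarrow> real" where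
  "cvf p g t x = cv T p (\<lambda>s. g s x) t"

text \<open>Young's inequality holds for almost every fixed x and is integrated over x. The
  coefficient formula is Fubini in (s, x), justified for almost every t by the convolution of |p|
  with the inner products of |g(s)| and |w|.\<close>

lemma
  assumes p: "p \<in> L1s T" and g: "g \<in> F2"
  shows cvf_F2: "cvf p g \<in> F2"
    and coeff_cvf: "w \<in> sqi (leb U) \<Longrightarrow> AE t in lborel. L2_inner U (cvf p g t) w = cv T p (\<lambda>s. L2_inner U (g s) w) t"
proof -
  have [measurable]: "p \<in> borel_measurable borel" using p by (rule L1s_measurable)
  note [measurable] = F2_measurable[OF g]
  have "(\<lambda>q. \<integral>s. p (fst q - s) * case_prod g (s, snd q) \<partial>lborel) \<in> borel_measurable MT"
    by (rule lborel.borel_measurable_lebesgue_integral) measurable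
  then have c: "(\<lambda>q. \<integral>s. p (fst q - s) * g s (snd q) \<partial>lborel) \<in> borel_measurable MT" by simp
  have eq: "case_prod (cvf p g) = (\<lambda>q. if 0 < fst q \<and> fst q < T then \<integral>s. p (fst q - s) * g s (snd q) \<partial>lborel else 0)"
    by (auto simp: cvf_def cv_def conv_def fun_eq_iff)
  have m[measurable]: "case_prod (cvf p g) \<in> borel_measurable MT" unfolding eq using c by measurable
  let ?C = "ennreal ((\<integral>t. \<bar>p t\<bar> \<partial>lborel)\<^sup>2)"
  have "(\<integral>\<^sup>+q. ennreal ((case_prod (cvf p g) q)\<^sup>2) \<partial>MT) = (\<integral>\<^sup>+x. \<integral>\<^sup>+t. ennreal ((cvf p g t x)\<^sup>2) \<partial>lborel \<partial>leb U)"
    by (subst P.nn_integral_snd[symmetric]) auto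
  also have "\<dots> \<le> (\<integral>\<^sup>+x. ?C * (\<integral>\<^sup>+t. ennreal ((g t x)\<^sup>2) \<partial>lborel) \<partial>leb U)"
    using F2_section_x[OF g]
  proof (intro nn_integral_mono_AE, eventually_elim)
    case (elim x)
    show ?case unfolding cvf_def by (rule cv_L2_nn[OF p L2s_L1s[OF elim(2)]])
  qed
  also have "\<dots> = ?C * (\<integral>\<^sup>+x. \<integral>\<^sup>+t. ennreal ((case_prod g (t, x))\<^sup>2) \<partial>lborel \<partial>leb U)"
    by (subst nn_integral_cmult) auto
  also have "(\<integral>\<^sup>+x. \<integral>\<^sup>+t. ennreal ((case_prod g (t, x))\<^sup>2) \<partial>lborel \<partial>leb U) = (\<integral>\<^sup>+q. ennreal ((case_prod g q)\<^sup>2) \<partial>MT)"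
    by (rule P.nn_integral_snd) measurable
  also have "?C * \<dots> < \<infinity>" using F2_sqi[OF g] by (simp add: sqi_iff_nn ennreal_mult_less_top)
  finally have "case_prod (cvf p g) \<in> sqi MT" using m by (simp add: sqi_iff_nn)
  moreover have "\<forall>t x. \<not> (0 < t \<and> t < T) \<longrightarrow> cvf p g t x = 0" by (auto simp: cvf_def cv_def)
  ultimately show "cvf p g \<in> F2" unfolding F2_def by blast
  assume w: "w \<in> sqi (leb U)"
  have [measurable]: "w \<in> borel_measurable (leb U)" by (rule sqi_measurable[OF w])
  define ag where "ag t x = \<bar>g t x\<bar>" for t x
  have agF: "ag \<in> F2" using F2_sqi[OF g] F2_zero[OF g] by (auto simp: F2_def ag_def sqi_def case_prod_unfold)
  have aw: "(\<lambda>x. \<bar>w x\<bar>) \<in> sqi (leb U)" using w by (auto simp: sqi_def)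
  let ?H = "\<lambda>s. L2_inner U (ag s) (\<lambda>x. \<bar>w x\<bar>)"
  have H: "integrable lborel ?H" by (rule L1s_integrable[OF L2s_L1s[OF coeff_L2s[OF agF aw]]])
  have "AE t in lborel. integrable lborel (\<lambda>s. \<bar>p (t - s)\<bar> * ?H s)"
    using conv_AE_integrable[OF integrable_abs[OF L1s_integrable[OF p]] H] .
  then show "AE t in lborel. L2_inner U (cvf p g t) w = cv T p (\<lambda>s. L2_inner U (g s) w) t"
  proof eventually_elim
    case (elim t)
    let ?F = "\<lambda>q. p (t - fst q) * (case_prod g q * w (snd q))"
    have FI: "integrable MT ?F"
    proof (rule P.integrable_pair_nn)
      have "(\<integral>\<^sup>+s. \<integral>\<^sup>+x. ennreal \<bar>?F (s, x)\<bar> \<partial>leb U \<partial>lborel) = (\<integral>\<^sup>+s. ennreal (\<bar>p (t - s)\<bar> * ?H s) \<partial>lborel)"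
        using F2_section[OF agF]
      proof (intro nn_integral_cong_AE, eventually_elim)
        case (elim s)
        have "(\<integral>\<^sup>+x. ennreal \<bar>?F (s, x)\<bar> \<partial>leb U) = (\<integral>\<^sup>+x. ennreal (\<bar>p (t - s)\<bar> * (ag s x * \<bar>w x\<bar>)) \<partial>leb U)"
          by (simp add: ag_def abs_mult)
        also have "\<dots> = ennreal (\<integral>x. \<bar>p (t - s)\<bar> * (ag s x * \<bar>w x\<bar>) \<partial>leb U)"
          using sqi_mult[OF elim(2) aw] by (intro nn_integral_eq_integral integrable_mult_right) (auto simp: ag_def)
        finally show ?case by (simp add: L2_inner_def)
      qed
      also have "\<dots> = ennreal (\<integral>s. \<bar>p (t - s)\<bar> * ?H s \<partial>lborel)"
        using elim by (intro nn_integral_eq_integral)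
          (auto simp: L2_inner_def ag_def intro!: AE_I2 mult_nonneg_nonneg Bochner_Integration.integral_nonneg)
      finally show "(\<integral>\<^sup>+s. \<integral>\<^sup>+x. ennreal \<bar>?F (s, x)\<bar> \<partial>leb U \<partial>lborel) < \<infinity>" by simp
    qed measurable
    show ?case
    proof (cases "0 < t \<and> t < T")
      case True
      have "L2_inner U (cvf p g t) w = (\<integral>x. \<integral>s. ?F (s, x) \<partial>lborel \<partial>leb U)"
        unfolding L2_inner_def
      proof (intro Bochner_Integration.integral_cong refl)
        fix x
        have "(\<integral>s. ?F (s, x) \<partial>lborel) = (\<integral>s. (p (t - s) * g s x) * w x \<partial>lborel)" by (simp add: mult.assoc)
        also have "\<dots> = (\<integral>s. p (t - s) * g s x \<partial>lborel) * w x" by (rule integral_mult_left_zero)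
        finally show "cvf p g t x * w x = (\<integral>s. ?F (s, x) \<partial>lborel)"
          using True by (simp add: cvf_def cv_def conv_def)
      qed
      also have "\<dots> = (\<integral>s. \<integral>x. ?F (s, x) \<partial>leb U \<partial>lborel)"
        using P.Fubini_integral[of "\<lambda>s x. ?F (s, x)"] FI by (simp add: case_prod_unfold)
      also have "\<dots> = cv T p (\<lambda>s. L2_inner U (g s) w) t"
        using True by (simp add: cv_def conv_def L2_inner_def)
      finally show ?thesis .
    next
      case False
      then have "cvf p g t = (\<lambda>x. 0)" "cv T p (\<lambda>s. L2_inner U (g s) w) t = 0"
        by (auto simp: cvf_def cv_def)
      then show ?thesis by (simp add: L2_inner_def)
    qed
  qed
qed

lemma AE_swap_F2:
  fixes f g :: "real \<Rightarrow> 'a \<Rightarrow> real"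
  assumes f: "case_prod f \<in> borel_measurable MT" and g: "case_prod g \<in> borel_measurable MT"
  shows "(AE q in MT. case_prod f q = case_prod g q) \<longleftrightarrow> (AE x in leb U. AE t in lborel. f t x = g t x)"
proof -
  have S: "{q \<in> space MT. f (fst q) (snd q) = g (fst q) (snd q)} \<in> sets MT"
    by (rule borel_measurable_eq[OF f[unfolded case_prod_unfold] g[unfolded case_prod_unfold]])
  show ?thesis
    using P.AE_pair_iff[OF S] P.AE_commute[OF S] by (simp add: case_prod_unfold)
qed

text \<open>For almost every x the slice of u agrees almost everywhere with the primitive of a
  square integrable function, so integration by parts applies slice by slice.\<close>

lemma has_time_deriv_primitive:
  assumes u: "u \<in> fields T U" and g: "g \<in> F2"
    and eq: "AE q in MT. case_prod (ext T u) q = case_prod (cvf (pw T 1) g) q"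
  shows "has_time_deriv T U u g"
  unfolding has_time_deriv_def
proof (intro conjI ballI)
  show "g \<in> L2t T U (L2_sq U)" by (rule F2_L2t(1)[OF g])
  fix \<psi> :: "real \<Rightarrow> real" assume \<psi>: "\<psi> \<in> test_functions {0<..<T}"
  have [measurable]: "deriv \<psi> \<in> borel_measurable borel"
    using test_function_real(2)[OF \<psi>] by (rule borel_measurable_continuous_onI)
  have p1: "pw T 1 \<in> L1s T" by (rule pw_L1s) simp
  note c = F2_measurable[OF cvf_F2[OF p1 g]]
  have "AE x in leb U. AE t in lborel. ext T u t x = cvf (pw T 1) g t x"
    using eq AE_swap_F2[OF ext_measurable[OF u] c] by blast
  then show "AE x in leb U. (\<integral>t. u t x * deriv \<psi> t \<partial>leb {0<..<T}) = - (\<integral>t. g t x * \<psi> t \<partial>leb {0<..<T})"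
    using F2_section_x[OF g] AE_space
  proof eventually_elim
    case (elim x)
    have [measurable]: "(\<lambda>t. ext T u t x) \<in> borel_measurable borel" "(\<lambda>t. cvf (pw T 1) g t x) \<in> borel_measurable borel"
      using measurable_Pair1[OF ext_measurable[OF u] elim(3)] measurable_Pair1[OF c elim(3)] by simp_all
    have "(\<integral>t. u t x * deriv \<psi> t \<partial>leb {0<..<T}) = (\<integral>t. indicator {0<..<T} t * (ext T u t x * deriv \<psi> t) \<partial>lborel)"
      unfolding leb_interval_integral
      by (intro Bochner_Integration.integral_cong) (auto simp: ext_def indicator_def)
    also have "\<dots> = (\<integral>t. indicator {0<..<T} t * (cvf (pw T 1) g t x * deriv \<psi> t) \<partial>lborel)"
      using elim(1) by (intro integral_cong_AE) (auto elim!: eventually_mono)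
    also have "\<dots> = (\<integral>t. cv T (pw T 1) (\<lambda>s. g s x) t * deriv \<psi> t \<partial>leb {0<..<T})"
      unfolding leb_interval_integral cvf_def ..
    also have "\<dots> = - (\<integral>t. g t x * \<psi> t \<partial>leb {0<..<T})"
      by (rule primitive_by_parts[OF L2s_L1s[OF elim(2)] T_pos \<psi>])
    finally show ?case .
  qed
qed

lemma sqi_interval:
  assumes "h \<in> L2s T" shows "h \<in> sqi (leb {0<..<T})"
proof -
  have "integrable lborel (\<lambda>t. indicator {0<..<T} t * (h t)\<^sup>2)"
    by (rule integrable_indicator_mult[OF sqi_integrable[OF L2s_sqi[OF assms]]]) simp
  then have "integrable (leb {0<..<T}) (\<lambda>t. (h t)\<^sup>2)" by (subst integrable_restrict_space) auto
  moreover have "h \<in> borel_measurable (leb {0<..<T})"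
    using L1s_measurable[OF L2s_L1s[OF assms]] by (intro measurable_restrict_space1) simp
  ultimately show ?thesis by (simp add: sqi_def)
qed

lemma has_time_deriv_unique:
  assumes g: "has_time_deriv T U u g" and h: "has_time_deriv T U u h"
  shows "ext T g \<in> F2" "AE q in MT. case_prod (ext T g) q = case_prod (ext T h) q"
proof -
  have gF: "ext T g \<in> F2" and hF: "ext T h \<in> F2"
    using g h by (auto simp: has_time_deriv_def L2t_def intro: F2_ext)
  show "ext T g \<in> F2" by (rule gF)
  let ?A = "{(a, c). a \<in> \<rat> \<and> c \<in> \<rat> \<and> cbox a c \<subseteq> {0<..<T}} :: (real \<times> real) set"
  have cA: "countable ?A"
    by (rule countable_subset[of _ "\<rat> \<times> \<rat>"]) (auto intro: countable_SIGMA countable_rat)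
  let ?b = "\<lambda>p n. box_bump (1 / real (Suc n)) (fst p) (snd p)"
  have "AE x in leb U. \<forall>p\<in>?A. \<forall>n. (\<integral>t. g t x * ?b p n t \<partial>leb {0<..<T}) = (\<integral>t. h t x * ?b p n t \<partial>leb {0<..<T})"
    unfolding AE_ball_countable[OF cA] AE_all_countable
  proof (intro ballI allI)
    fix p n assume "p \<in> ?A"
    then have \<psi>: "?b p n \<in> test_functions {0<..<T}" by (intro box_bump_test) auto
    have "AE x in leb U. (\<integral>t. u t x * deriv (?b p n) t \<partial>leb {0<..<T}) = - (\<integral>t. g t x * ?b p n t \<partial>leb {0<..<T})"
      "AE x in leb U. (\<integral>t. u t x * deriv (?b p n) t \<partial>leb {0<..<T}) = - (\<integral>t. h t x * ?b p n t \<partial>leb {0<..<T})"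
      using g h \<psi> unfolding has_time_deriv_def by blast+
    then show "AE x in leb U. (\<integral>t. g t x * ?b p n t \<partial>leb {0<..<T}) = (\<integral>t. h t x * ?b p n t \<partial>leb {0<..<T})"
      by eventually_elim linarith
  qed
  then have "AE x in leb U. AE t in lborel. ext T g t x = ext T h t x"
    using F2_section_x[OF gF] F2_section_x[OF hF]
  proof eventually_elim
    case (elim x)
    note gq = sqi_interval[OF elim(2)] and hq = sqi_interval[OF elim(3)]
    have "AE t in leb {0<..<T}. ext T g t x - ext T h t x = 0"
    proof (rule has_time_deriv_unique_1d[OF sqi_diff[OF gq hq]])
      fix a c :: real and n :: nat
      assume ac: "a \<in> \<rat>" "c \<in> \<rat>" "cbox a c \<subseteq> {0<..<T}"
      have bs: "box_bump (1 / Suc n) a c \<in> sqi (leb {0<..<T})"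
        using ac(3) by (intro test_functions_sqi(1) box_bump_test) auto
      have "(\<integral>t. g t x * ?b (a, c) n t \<partial>leb {0<..<T}) = (\<integral>t. h t x * ?b (a, c) n t \<partial>leb {0<..<T})"
        using elim(1) ac by blast
      moreover have "(\<integral>t. f t x * ?b (a, c) n t \<partial>leb {0<..<T}) = (\<integral>t. ext T f t x * box_bump (1 / Suc n) a c t \<partial>leb {0<..<T})" for f
        by (intro Bochner_Integration.integral_cong) (auto simp: ext_def space_restrict_space)
      ultimately show "(\<integral>t. (ext T g t x - ext T h t x) * box_bump (1 / Suc n) a c t \<partial>leb {0<..<T}) = 0"
        using sqi_mult[OF gq bs] sqi_mult[OF hq bs] by (simp add: left_diff_distrib)
    qed
    then have "AE t in lborel. t \<in> {0<..<T} \<longrightarrow> ext T g t x - ext T h t x = 0"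
      by (subst (asm) AE_restrict_space_iff) auto
    then show ?case by eventually_elim (auto simp: ext_def)
  qed
  then show "AE q in MT. case_prod (ext T g) q = case_prod (ext T h) q"
    using AE_swap_F2[OF F2_measurable[OF gF] F2_measurable[OF hF]] by blast
qed

text \<open>Any known witness determines the chosen one almost everywhere in (0, T). Outside this
  interval the choice is unconstrained, hence the extension by zero.\<close>

lemma time_deriv_AE:
  assumes g: "g \<in> F2" and h: "has_time_deriv T U u g"
  shows "has_time_deriv T U u (time_deriv T U u)" "ext T (time_deriv T U u) \<in> F2"
    "AE q in MT. case_prod (ext T (time_deriv T U u)) q = case_prod g q"
proof -
  show 1: "has_time_deriv T U u (time_deriv T U u)"
    unfolding time_deriv_def using h by (rule someI[of "has_time_deriv T U u"])
  show "ext T (time_deriv T U u) \<in> F2" "AE q in MT. case_prod (ext T (time_deriv T U u)) q = case_prod g q"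
    using has_time_deriv_unique[OF 1 h] by (simp_all add: ext_F2[OF g])
qed

end

section \<open>Norms in terms of coefficients\<close>

context onb_time
begin

text \<open>Squared norms that are diagonal in \<phi>: weights 1 give L2, powers of the eigenvalues
  give the spectral spaces. One reduction to coefficients then serves all norms.\<close>

abbreviation "diag_norm N c \<equiv> (\<forall>v\<in>sqi (leb U). N v = (\<Sum>i. ennreal (c i * (L2_inner U v (\<phi> i))\<^sup>2)))"

lemma diag_L2: "diag_norm (L2_sq U) (\<lambda>i. 1)"
proof
  fix v assume v: "v \<in> sqi (leb U)"
  then have "L2_sq U v = ennreal (\<integral>x. (v x)\<^sup>2 \<partial>leb U)"
    by (simp add: L2_sq_def L2_eq_sqi L2_inner_def power2_eq_square)
  then show "L2_sq U v = (\<Sum>i. ennreal (1 * (L2_inner U v (\<phi> i))\<^sup>2))"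
    unfolding mult_1 parseval_ennreal[OF v] .
qed

lemma diag_hdot: "diag_norm (hdot_sq U \<phi> lam \<gamma>) (\<lambda>i. lam i powr \<gamma>)"
  by (simp add: hdot_sq_def L2_eq_sqi)

lemma cf_measurable: "g \<in> F2 \<Longrightarrow> cf g i \<in> borel_measurable borel"
  by (rule coeff_measurable[OF F2_measurable sqi_measurable[OF \<phi>_sqi]])

lemma cf_outside: "g \<in> F2 \<Longrightarrow> \<not> (0 < t \<and> t < T) \<Longrightarrow> cf g i t = 0"
  using F2_zero[of g t] by (simp add: L2_inner_def)

lemma L2t_sq_coeff:
  assumes u: "ext T u \<in> F2" and N: "diag_norm N c" and c: "\<And>i. 0 \<le> c i"
  shows "L2t_sq T N u = (\<Sum>i. ennreal (c i) * (\<integral>\<^sup>+t. ennreal ((cf (ext T u) i t)\<^sup>2) \<partial>lborel))"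
proof -
  note [measurable] = cf_measurable[OF u]
  have "L2t_sq T N u = (\<integral>\<^sup>+t. N (u t) * indicator {0<..<T} t \<partial>lborel)"
    unfolding L2t_sq_def by (rule leb_interval_nn_integral)
  also have "\<dots> = (\<integral>\<^sup>+t. (\<Sum>i. ennreal (c i * (cf (ext T u) i t)\<^sup>2)) \<partial>lborel)"
    using F2_section[OF u]
  proof (intro nn_integral_cong_AE, eventually_elim)
    case (elim t)
    show ?case
    proof (cases "0 < t \<and> t < T")
      case True
      then have "u t = ext T u t" by (auto simp: ext_def)
      then show ?thesis using True N elim(2) by simp
    next
      case False
      then show ?thesis by (simp add: cf_outside[OF u False])
    qed
  qed
  also have "\<dots> = (\<Sum>i. \<integral>\<^sup>+t. ennreal (c i * (cf (ext T u) i t)\<^sup>2) \<partial>lborel)"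
    by (rule nn_integral_suminf) measurable
  also have "\<dots> = (\<Sum>i. ennreal (c i) * (\<integral>\<^sup>+t. ennreal ((cf (ext T u) i t)\<^sup>2) \<partial>lborel))"
    using c by (simp add: ennreal_mult nn_integral_cmult)
  finally show ?thesis .
qed

text \<open>For almost all t and s both sections are square integrable, so \<open>N\<close> of their
  difference is a series in the differences of coefficients. Tonelli then exchanges the series with
  the double time integral.\<close>

lemma Hgt_sq_coeff:
  assumes u: "ext T u \<in> F2" and N: "diag_norm N c" and c: "\<And>i. 0 \<le> c i"
  shows "Hgt_sq \<gamma> T N u = (\<Sum>i. ennreal (c i) * ((\<integral>\<^sup>+t. ennreal ((cf (ext T u) i t)\<^sup>2) \<partial>lborel) + slob T \<gamma> (cf (ext T u) i)))"
proof -
  note [measurable] = cf_measurable[OF u]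
  let ?e = "\<lambda>i. cf (ext T u) i"
  let ?s = "\<lambda>i t s. ennreal (c i) * ennreal (indicator {0<..<T} t * indicator {0<..<T} s *
      ((?e i t - ?e i s)\<^sup>2 * \<bar>t - s\<bar> powr (- 1 - 2 * \<gamma>)))"
  let ?w = "\<lambda>t s. ennreal (\<bar>t - s\<bar> powr (- 1 - 2 * \<gamma>))"
  have ind: "indicator {0<..<T} (x::real) = (if 0 < x \<and> x < T then 1 else (0::real))" for x
    by (simp add: indicator_def)
  have m[measurable]: "(\<lambda>(t, s). ?s i t s) \<in> borel_measurable (borel \<Otimes>\<^sub>M borel)" for i
    unfolding ind by measurable
  have "(\<integral>\<^sup>+t. (\<integral>\<^sup>+s. N (\<lambda>x. u t x - u s x) * ?w t s \<partial>leb {0<..<T}) \<partial>leb {0<..<T})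
    = (\<integral>\<^sup>+t. (\<integral>\<^sup>+s. N (\<lambda>x. u t x - u s x) * ?w t s * indicator {0<..<T} s \<partial>lborel) * indicator {0<..<T} t \<partial>lborel)"
    by (simp add: leb_interval_nn_integral)
  also have "\<dots> = (\<integral>\<^sup>+t. \<integral>\<^sup>+s. (\<Sum>i. ?s i t s) \<partial>lborel \<partial>lborel)"
    using F2_section[OF u]
  proof (intro nn_integral_cong_AE, eventually_elim)
    case (elim t)
    note t = elim(2)
    show ?case
    proof (cases "0 < t \<and> t < T")
      case True
      have "(\<integral>\<^sup>+s. N (\<lambda>x. u t x - u s x) * ?w t s * indicator {0<..<T} s \<partial>lborel) = (\<integral>\<^sup>+s. (\<Sum>i. ?s i t s) \<partial>lborel)"
        using F2_section[OF u]
      proof (intro nn_integral_cong_AE, eventually_elim)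
        case (elim s)
        show ?case
        proof (cases "0 < s \<and> s < T")
          case s: True
          have d: "(\<lambda>x. u t x - u s x) = (\<lambda>x. ext T u t x - ext T u s x)" using True s by (simp add: ext_def)
          have "N (\<lambda>x. u t x - u s x) = (\<Sum>i. ennreal (c i * (L2_inner U (\<lambda>x. u t x - u s x) (\<phi> i))\<^sup>2))"
            using N sqi_diff[OF t elim(2)] unfolding d by blast
          also have "\<dots> = (\<Sum>i. ennreal (c i * (?e i t - ?e i s)\<^sup>2))"
            unfolding d coeff_linear[OF t elim(2)] ..
          finally have "N (\<lambda>x. u t x - u s x) * ?w t s = (\<Sum>i. ennreal (c i * (?e i t - ?e i s)\<^sup>2) * ?w t s)"
            by (simp add: ennreal_suminf_multc)
          also have "\<dots> = (\<Sum>i. ?s i t s)"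
            using True s c by (simp add: ennreal_mult[symmetric] mult.assoc)
          finally show ?thesis using s by simp
        next
          case False
          then have "indicator {0<..<T} s = (0::real)" "indicator {0<..<T} s = (0::ennreal)" by auto
          then show ?thesis by simp
        qed
      qed
      then show ?thesis using True by simp
    next
      case False
      then have "indicator {0<..<T} t = (0::real)" "indicator {0<..<T} t = (0::ennreal)" by auto
      then show ?thesis by simp
    qed
  qed
  also have "\<dots> = (\<integral>\<^sup>+t. (\<Sum>i. \<integral>\<^sup>+s. ?s i t s \<partial>lborel) \<partial>lborel)"
    by (intro nn_integral_cong nn_integral_suminf) measurable
  also have "\<dots> = (\<Sum>i. \<integral>\<^sup>+t. \<integral>\<^sup>+s. ?s i t s \<partial>lborel \<partial>lborel)"
    by (rule nn_integral_suminf) measurable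
  also have "\<dots> = (\<Sum>i. ennreal (c i) * slob T \<gamma> (?e i))"
  proof (rule suminf_cong)
    fix i
    have [measurable]: "(\<lambda>(t, s). ennreal (indicator {0<..<T} t * indicator {0<..<T} s *
      ((?e i t - ?e i s)\<^sup>2 * \<bar>t - s\<bar> powr (- 1 - 2 * \<gamma>)))) \<in> borel_measurable (borel \<Otimes>\<^sub>M borel)"
      unfolding ind by measurable
    show "(\<integral>\<^sup>+t. \<integral>\<^sup>+s. ?s i t s \<partial>lborel \<partial>lborel) = ennreal (c i) * slob T \<gamma> (?e i)"
      unfolding slob_def by (simp add: nn_integral_cmult)
  qed
  finally have 2: "(\<integral>\<^sup>+t. (\<integral>\<^sup>+s. N (\<lambda>x. u t x - u s x) * ?w t s \<partial>leb {0<..<T}) \<partial>leb {0<..<T})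
    = (\<Sum>i. ennreal (c i) * slob T \<gamma> (?e i))" .
  show ?thesis
    unfolding Hgt_sq_def 2 L2t_sq_coeff[OF u N c]
    by (subst suminf_add) (auto simp: distrib_left)
qed

section \<open>Fractional derivatives of fields\<close>

lemma frac_int_left_eq:
  assumes "0 < t" "t < T"
  shows "frac_int_left 0 \<gamma> (\<lambda>s. u s x) t = cvf (pw T \<gamma>) (ext T u) t x"
proof -
  have "(LINT s:{0<..<t}|lborel. (t - s) powr (\<gamma> - 1) * u s x) = (\<integral>s. Gamma \<gamma> * (pw T \<gamma> (t - s) * ext T u s x) \<partial>lborel)" if "Gamma \<gamma> \<noteq> 0"
    unfolding set_lebesgue_integral_def
    using assms that by (intro Bochner_Integration.integral_cong) (auto simp: indicator_def pw_def ext_def)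
  moreover have "cvf (pw T \<gamma>) (ext T u) t x = (\<integral>s. pw T \<gamma> (t - s) * ext T u s x \<partial>lborel)"
    using assms by (simp add: cvf_def cv_def conv_def)
  \<comment> \<open>Gamma takes the value 0 at its poles by convention, and then division by zero
    makes both sides vanish.\<close>
  ultimately show ?thesis
    by (cases "Gamma \<gamma> = 0") (simp_all add: frac_int_left_def pw_def[abs_def] if_distrib[of "\<lambda>x. x * _"] cong: if_cong)
qed

lemma fields_cong:
  assumes "g \<in> fields T U" "\<And>t x. 0 < t \<Longrightarrow> t < T \<Longrightarrow> u t x = g t x"
  shows "u \<in> fields T U"
proof -
  have "case_prod u \<in> borel_measurable (leb {0<..<T} \<Otimes>\<^sub>M leb U) \<longleftrightarrow> case_prod g \<in> borel_measurable (leb {0<..<T} \<Otimes>\<^sub>M leb U)"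
    by (rule measurable_cong) (use assms(2) in \<open>auto simp: space_pair_measure space_restrict_space\<close>)
  then show ?thesis using assms(1) by (simp add: fields_def)
qed

text \<open>The scalar derivatives have norms bounded by the summands of \<open>Hgt_sq\<close>, so
  they can be assembled into one field h. By comparison of coefficients I^1 h is the fractional
  integral of u; this witness is what ties the value of \<open>frac_deriv_left\<close> to u.\<close>

lemma frac_deriv_left_exists:
  assumes u: "u \<in> fields T U" "ext T u \<in> F2" and \<gamma>: "0 < \<gamma>" "\<gamma> < 1/2" and fin: "Hgt_sq \<gamma> T (L2_sq U) u < \<infinity>"
  obtains h where "h \<in> F2" "\<And>i. AE t in lborel. cv T (pw T 1) (cf h i) t = cv T (pw T (1 - \<gamma>)) (cf (ext T u) i) t"
    "ext T (frac_deriv_left T U \<gamma> u) \<in> F2" "AE q in MT. case_prod (ext T (frac_deriv_left T U \<gamma> u)) q = case_prod h q"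
proof -
  let ?u = "\<lambda>i. cf (ext T u) i"
  have uL: "?u i \<in> L2s T" for i by (rule coeff_L2s[OF u(2) \<phi>_sqi])
  have S: "(\<Sum>i. (\<integral>\<^sup>+t. ennreal ((?u i t)\<^sup>2) \<partial>lborel) + slob T \<gamma> (?u i)) < \<infinity>" (is "(\<Sum>i. ?S i) < _")
    using fin unfolding Hgt_sq_coeff[OF u(2) diag_L2, of \<gamma>, simplified] by simp
  have Sfin: "slob T \<gamma> (?u i) < \<infinity>" for i
  proof -
    have "slob T \<gamma> (?u i) \<le> ?S i" by simp
    also have "\<dots> \<le> (\<Sum>i. ?S i)" using sum_le_suminf[of ?S "{i}"] by simp
    finally show ?thesis using S by (rule le_less_trans)
  qed
  define Q where "Q i h \<longleftrightarrow> h \<in> L2s T \<and> (AE t in lborel. cv T (pw T 1) h t = cv T (pw T (1 - \<gamma>)) (?u i) t) \<and>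
    ennreal (\<integral>t. (h t)\<^sup>2 \<partial>lborel) \<le> ennreal (frac_const T \<gamma>) * ?S i" for i h
  have "\<exists>h. Q i h" for i
    unfolding Q_def by (rule fractional_derivative_exists[OF T_pos \<gamma> uL Sfin, of i]) (auto simp: add.commute)
  then obtain h where "\<And>i. Q i (h i)" by metis
  then have h: "\<And>i. h i \<in> L2s T" "\<And>i. AE t in lborel. cv T (pw T 1) (h i) t = cv T (pw T (1 - \<gamma>)) (?u i) t"
    "\<And>i. ennreal (\<integral>t. (h i t)\<^sup>2 \<partial>lborel) \<le> ennreal (frac_const T \<gamma>) * ?S i"
    unfolding Q_def by auto
  have "(\<Sum>i. ennreal (\<integral>t. (h i t)\<^sup>2 \<partial>lborel)) \<le> (\<Sum>i. ennreal (frac_const T \<gamma>) * ?S i)"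
    by (rule suminf_le[OF h(3)]) (rule summableI)+
  also have "\<dots> = ennreal (frac_const T \<gamma>) * (\<Sum>i. ?S i)" by (rule ennreal_suminf_cmult)
  also have "\<dots> < \<infinity>" using S by (simp add: ennreal_mult_less_top)
  finally have "summable (\<lambda>i. \<integral>t. (h i t)\<^sup>2 \<partial>lborel)"
    by (intro summable_suminf_not_top) (simp_all add: less_top)
  then obtain H where H: "H \<in> F2" "\<And>i. AE t in lborel. cf H i t = h i t"
    by (rule synthesis[OF h(1)]) blast+
  have p1: "pw T 1 \<in> L1s T" and pg: "pw T (1 - \<gamma>) \<in> L1s T" using \<gamma> by (auto intro: pw_L1s)
  have ch: "cv T (pw T 1) (cf H i) = cv T (pw T 1) (h i)" for i
    by (rule cv_cong_AE[OF cf_measurable[OF H(1)] L1s_measurable[OF L2s_L1s[OF h(1)]] pw_measurable H(2)])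
  have 1: "AE t in lborel. cv T (pw T 1) (cf H i) t = cv T (pw T (1 - \<gamma>)) (?u i) t" for i
    using h(2)[of i] unfolding ch .
  let ?w = "\<lambda>t x. frac_int_left 0 (1 - \<gamma>) (\<lambda>s. u s x) t"
  have wf: "?w \<in> fields T U"
    by (rule fields_cong[OF fields_I[OF F2_measurable[OF cvf_F2[OF pg u(2)]]]]) (rule frac_int_left_eq)
  have we: "ext T ?w = cvf (pw T (1 - \<gamma>)) (ext T u)"
    by (auto simp: fun_eq_iff ext_def[of T ?w] frac_int_left_eq) (auto simp: cvf_def cv_def)
  have "AE q in MT. case_prod (ext T ?w) q = case_prod (cvf (pw T 1) H) q"
    unfolding we
  proof (rule F2_eq_by_coeff[OF cvf_F2[OF pg u(2)] cvf_F2[OF p1 H(1)]])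
    fix i
    show "AE t in lborel. cf (cvf (pw T (1 - \<gamma>)) (ext T u)) i t = cf (cvf (pw T 1) H) i t"
      using coeff_cvf[OF pg u(2) \<phi>_sqi[of i]] coeff_cvf[OF p1 H(1) \<phi>_sqi[of i]] 1[of i] by eventually_elim simp
  qed
  from has_time_deriv_primitive[OF wf H(1) this] have "has_time_deriv T U ?w H" .
  from time_deriv_AE[OF H(1) this]
  show ?thesis by (intro that[OF H(1) 1]) (simp_all add: frac_deriv_left_def)
qed

lemma separable_F2:
  assumes "z \<in> L2s T" "w \<in> sqi (leb U)" shows "(\<lambda>t x. z t * w x) \<in> F2"
  using product_sqi[OF L2s_sqi[OF assms(1)] assms(2)] L1s_zero[OF L2s_L1s[OF assms(1)]]
  by (auto simp: F2_def case_prod_unfold)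

text \<open>The constant \<open>K0\<close> is present because the right-sided fractional integral of
  the test function does not vanish at t = 0. It drops out since \<psi>' has integral zero.\<close>

lemma has_time_deriv_separable:
  assumes k: "k \<in> L2s T" and w: "w \<in> sqi (leb U)"
    and u: "\<And>t x. 0 < t \<Longrightarrow> t < T \<Longrightarrow> u t x = (K0 + cv T (pw T 1) k t) * w x"
  shows "has_time_deriv T U u (\<lambda>t x. k t * w x)"
proof -
  show ?thesis
    unfolding has_time_deriv_def
  proof (intro conjI ballI)
    show "(\<lambda>t x. k t * w x) \<in> L2t T U (L2_sq U)" by (rule F2_L2t(1)[OF separable_F2[OF k w]])
    fix \<psi> :: "real \<Rightarrow> real" assume \<psi>: "\<psi> \<in> test_functions {0<..<T}"
    note d = test_function_real[OF \<psi>]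
    let ?c = "cv T (pw T 1) k"
    have c2: "?c \<in> sqi (leb {0<..<T})" by (intro sqi_interval cv_L2s pw_L1s k) simp
    have d2: "deriv \<psi> \<in> sqi (leb {0<..<T})" unfolding d(3) by (rule test_functions_sqi(2)[OF \<psi>]) auto
    have dI: "integrable (leb {0<..<T}) (deriv \<psi>)"
    proof -
      have "(\<lambda>t. 1) \<in> sqi (leb {0<..<T})"
      proof -
        have "integrable lborel (\<lambda>t. indicator {0<..<T} t :: real)"
          using sqi_integrable[OF indicator_sqi[of 0 T]] by (simp add: power2_eq_square flip: indicator_inter_arith)
        then have "integrable (leb {0<..<T}) (\<lambda>t. 1 :: real)" by (subst integrable_restrict_space) auto
        then show ?thesis by (simp add: sqi_def)
      qed
      from sqi_mult[OF this d2] show ?thesis by simp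
    qed
    have z: "(\<integral>t. deriv \<psi> t \<partial>leb {0<..<T}) = 0"
    proof -
      obtain C where C: "C \<subseteq> {0<..<T}" "\<forall>x. x \<notin> C \<longrightarrow> \<psi> x = 0" using \<psi> unfolding test_functions_def by blast
      then have e: "\<psi> 0 = 0" "\<psi> T = 0" by (meson greaterThanLessThan_iff less_irrefl subsetD)+
      have [measurable]: "deriv \<psi> \<in> borel_measurable borel" using d(2) by (rule borel_measurable_continuous_onI)
      have "(\<integral>t. deriv \<psi> t \<partial>leb {0<..<T}) = (\<integral>t. indicator {0..T} t *\<^sub>R deriv \<psi> t \<partial>lborel)"
        unfolding leb_interval_integral
      proof (rule integral_cong_AE)
        show "AE t in lborel. indicator {0<..<T} t * deriv \<psi> t = indicator {0..T} t *\<^sub>R deriv \<psi> t"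
          using AE_lborel_singleton[of 0] AE_lborel_singleton[of T]
          by eventually_elim (auto simp: indicator_def)
      qed measurable
      also have "\<dots> = \<psi> T - \<psi> 0"
        using T_pos d(1) continuous_on_subset[OF d(2)]
        by (intro integral_FTC_atLeastAtMost)
           (auto simp: has_real_derivative_iff_has_vector_derivative[symmetric] has_field_derivative_at_within)
      finally show ?thesis using e by simp
    qed
    have "(\<integral>t. (K0 + ?c t) * deriv \<psi> t \<partial>leb {0<..<T}) = K0 * (\<integral>t. deriv \<psi> t \<partial>leb {0<..<T}) + (\<integral>t. ?c t * deriv \<psi> t \<partial>leb {0<..<T})"
      using dI sqi_mult[OF c2 d2] by (simp add: distrib_right)
    also have "\<dots> = - (\<integral>t. k t * \<psi> t \<partial>leb {0<..<T})"
      using z primitive_by_parts[OF L2s_L1s[OF k] T_pos \<psi>] by simp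
    finally have e: "(\<integral>t. (K0 + ?c t) * deriv \<psi> t \<partial>leb {0<..<T}) = - (\<integral>t. k t * \<psi> t \<partial>leb {0<..<T})" .
    show "AE x in leb U. (\<integral>t. u t x * deriv \<psi> t \<partial>leb {0<..<T}) = - (\<integral>t. k t * w x * \<psi> t \<partial>leb {0<..<T})"
    proof (rule AE_I2)
      fix x
      have "(\<integral>t. u t x * deriv \<psi> t \<partial>leb {0<..<T}) = (\<integral>t. w x * ((K0 + ?c t) * deriv \<psi> t) \<partial>leb {0<..<T})"
        by (intro Bochner_Integration.integral_cong) (auto simp: u space_restrict_space)
      also have "\<dots> = - (w x * (\<integral>t. k t * \<psi> t \<partial>leb {0<..<T}))" using e by simp
      also have "w x * (\<integral>t. k t * \<psi> t \<partial>leb {0<..<T}) = (\<integral>t. w x * (k t * \<psi> t) \<partial>leb {0<..<T})" by simp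
      also have "\<dots> = (\<integral>t. k t * w x * \<psi> t \<partial>leb {0<..<T})" by (intro Bochner_Integration.integral_cong) auto
      finally show "(\<integral>t. u t x * deriv \<psi> t \<partial>leb {0<..<T}) = - (\<integral>t. k t * w x * \<psi> t \<partial>leb {0<..<T})" .
    qed
  qed
qed

end

section \<open>Testing with separated functions\<close>

text \<open>\<open>(c - t)\<^sub>+\<^sup>1\<^sup>+\<^sup>\<beta>\<close>, a multiple of the right-sided integral \<open>I\<^sup>\<beta>\<^bsub>T-\<^esub>\<close> of \<open>(c - t)\<^sub>+\<close>.\<close>
definition ramp :: "real \<Rightarrow> real \<Rightarrow> real \<Rightarrow> real" where
  "ramp \<beta> c t = (max 0 (c - t)) powr (1 + \<beta>)"

lemma ramp_measurable [measurable]: "ramp \<beta> c \<in> borel_measurable borel"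
  unfolding ramp_def[abs_def] by measurable

text \<open>The ramp is, up to a factor, the kernel of I^(2 + \<beta>) reflected at c. Testing with
  it therefore evaluates a fractional integral at time c, and varying c recovers a function of
  time.\<close>

lemma integral_ramp:
  assumes \<beta>: "0 < \<beta>" and c: "0 < c" "c < T" and q: "q \<in> L1s T"
  shows "(\<integral>t. ramp \<beta> c t * q t \<partial>lborel) = Gamma (2 + \<beta>) * cv T (pw T (2 + \<beta>)) q c"
proof -
  have "0 < Gamma (2 + \<beta>)" using \<beta> by (intro Gamma_real_pos) simp
  then have G: "Gamma (2 + \<beta>) \<noteq> 0" by simp
  have "(\<integral>t. ramp \<beta> c t * q t \<partial>lborel) = (\<integral>t. Gamma (2 + \<beta>) * (pw T (2 + \<beta>) (c - t) * q t) \<partial>lborel)"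
  proof (intro Bochner_Integration.integral_cong refl)
    fix t
    show "ramp \<beta> c t * q t = Gamma (2 + \<beta>) * (pw T (2 + \<beta>) (c - t) * q t)"
    proof (cases "0 < t \<and> t < T")
      case True
      then have "c - t < T" using c by simp
      then show ?thesis using G \<beta> by (auto simp: ramp_def pw_def max_def)
    qed (use L1s_zero[OF q, of t] in auto)
  qed
  also have "\<dots> = Gamma (2 + \<beta>) * cv T (pw T (2 + \<beta>)) q c" using c by (simp add: cv_def conv_def)
  finally show ?thesis .
qed

lemma ramp_Lipschitz:
  assumes \<beta>: "0 < \<beta>" and c: "0 < c" "c < T" and t: "0 < t" "0 < s"
  shows "\<bar>ramp \<beta> c t - ramp \<beta> c s\<bar> \<le> (1 + \<beta>) * T powr \<beta> * \<bar>t - s\<bar>"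
proof -
  let ?x = "max 0 (c - t)" and ?y = "max 0 (c - s)"
  have key: "y powr (1 + \<beta>) - x powr (1 + \<beta>) \<le> (1 + \<beta>) * T powr \<beta> * (y - x)" if xy: "0 \<le> x" "x \<le> y" "y \<le> T" for x y
  proof (cases "x < y")
    case True
    have "continuous_on {x..y} (\<lambda>z. z powr (1 + \<beta>))"
      using xy \<beta> by (intro continuous_on_powr' continuous_intros) auto
    moreover have "((\<lambda>z. z powr (1 + \<beta>)) has_real_derivative (1 + \<beta>) * z powr (1 + \<beta> - 1)) (at z)" if "x < z" "z < y" for z
      using that xy by (intro has_real_derivative_powr) auto
    ultimately obtain l z where z: "x < z" "z < y" "((\<lambda>z. z powr (1 + \<beta>)) has_real_derivative l) (at z)"
      "y powr (1 + \<beta>) - x powr (1 + \<beta>) = (y - x) * l"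
      using MVT[OF True, of "\<lambda>z. z powr (1 + \<beta>)"] by (metis real_differentiable_def)
    have "l = (1 + \<beta>) * z powr (1 + \<beta> - 1)"
      using z(1,3) xy by (intro DERIV_unique[OF z(3)] has_real_derivative_powr) auto
    then have l: "l = (1 + \<beta>) * z powr \<beta>" by simp
    have "z powr \<beta> \<le> T powr \<beta>" using z xy \<beta> by (intro powr_mono2) auto
    then have "(y - x) * ((1 + \<beta>) * z powr \<beta>) \<le> (y - x) * ((1 + \<beta>) * T powr \<beta>)"
      using True \<beta> by (intro mult_left_mono) auto
    then show ?thesis unfolding z(4) l by (simp add: mult_ac)
  qed (use xy in auto)
  have mono: "x powr (1 + \<beta>) \<le> y powr (1 + \<beta>)" if "0 \<le> x" "x \<le> y" for x y
    using that \<beta> by (intro powr_mono2) auto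
  have b: "0 \<le> ?x" "?x \<le> T" "0 \<le> ?y" "?y \<le> T" using c t by auto
  have C: "0 \<le> (1 + \<beta>) * T powr \<beta>" using \<beta> by simp
  have le: "\<bar>?x - ?y\<bar> \<le> \<bar>t - s\<bar>" by (auto simp: max_def)
  have "\<bar>ramp \<beta> c t - ramp \<beta> c s\<bar> \<le> (1 + \<beta>) * T powr \<beta> * \<bar>?x - ?y\<bar>"
  proof (cases "?x \<le> ?y")
    case True
    then show ?thesis using key[of ?x ?y] mono[of ?x ?y] b by (simp add: ramp_def abs_minus_commute[of "?x powr _"] abs_minus_commute[of ?x] del: max.bounded_iff)
  next
    case False
    then show ?thesis using key[of ?y ?x] mono[of ?y ?x] b unfolding ramp_def by linarith
  qed
  also have "\<dots> \<le> (1 + \<beta>) * T powr \<beta> * \<bar>t - s\<bar>" by (rule mult_left_mono[OF le C])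
  finally show ?thesis .
qed

text \<open>The Lipschitz bound turns the weight into |t - s|^(1 - 2 \<beta>), which is bounded on
  (0, T) as 2 \<beta> < 1.\<close>

lemma slob_ramp_finite:
  assumes \<beta>: "0 < \<beta>" "\<beta> < 1/2" and c: "0 < c" "c < T"
  shows "slob T \<beta> (ramp \<beta> c) < \<infinity>"
proof -
  have T: "0 < T" using c by simp
  define L where "L = ((1 + \<beta>) * T powr \<beta>)\<^sup>2 * T powr (1 - 2 * \<beta>)"
  have "slob T \<beta> (ramp \<beta> c) \<le> (\<integral>\<^sup>+t. \<integral>\<^sup>+s. ennreal L * (indicator {0<..<T} t * indicator {0<..<T} s) \<partial>lborel \<partial>lborel)"
    unfolding slob_def
  proof (rule nn_integral_mono, rule nn_integral_mono)
    fix t s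
    show "ennreal (indicator {0<..<T} t * indicator {0<..<T} s * ((ramp \<beta> c t - ramp \<beta> c s)\<^sup>2 * \<bar>t - s\<bar> powr (- 1 - 2 * \<beta>)))
      \<le> ennreal L * (indicator {0<..<T} t * indicator {0<..<T} s)"
    proof (cases "0 < t \<and> t < T \<and> 0 < s \<and> s < T \<and> t \<noteq> s")
      case True
      then have r: "0 < \<bar>t - s\<bar>" "\<bar>t - s\<bar> \<le> T" by auto
      have "(ramp \<beta> c t - ramp \<beta> c s)\<^sup>2 \<le> ((1 + \<beta>) * T powr \<beta> * \<bar>t - s\<bar>)\<^sup>2"
        using ramp_Lipschitz[OF \<beta>(1) c, of t s] True by (metis abs_ge_zero power2_abs power_mono)
      then have "(ramp \<beta> c t - ramp \<beta> c s)\<^sup>2 * \<bar>t - s\<bar> powr (- 1 - 2 * \<beta>) \<le> ((1 + \<beta>) * T powr \<beta> * \<bar>t - s\<bar>)\<^sup>2 * \<bar>t - s\<bar> powr (- 1 - 2 * \<beta>)"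
        by (rule mult_right_mono) simp
      also have "\<dots> = ((1 + \<beta>) * T powr \<beta>)\<^sup>2 * (\<bar>t - s\<bar> powr 2 * \<bar>t - s\<bar> powr (- 1 - 2 * \<beta>))"
        using powr_realpow[OF r(1), of 2] by (simp add: power_mult_distrib)
      also have "\<bar>t - s\<bar> powr 2 * \<bar>t - s\<bar> powr (- 1 - 2 * \<beta>) = \<bar>t - s\<bar> powr (1 - 2 * \<beta>)"
        unfolding powr_add[symmetric] by simp
      also have "((1 + \<beta>) * T powr \<beta>)\<^sup>2 * \<bar>t - s\<bar> powr (1 - 2 * \<beta>) \<le> L"
        unfolding L_def using r \<beta> by (intro mult_left_mono powr_mono2) auto
      finally show ?thesis using True by (simp add: ennreal_leI)
    qed (auto simp: indicator_def)
  qed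
  also have "\<dots> = ennreal L * (ennreal T * ennreal T)"
    using T by (simp add: nn_integral_cmult nn_integral_multc)
  also have "\<dots> < \<infinity>" by (simp add: ennreal_mult_less_top)
  finally show ?thesis .
qed

text \<open>Reflected semigroup law: the orders 2 + \<beta> and 1 - \<beta> add up to 3, and the
  kernel of order 3 is a square over Gamma 3 = 2. The function v agrees with the ramp only almost
  everywhere, to admit a cutoff on a null set.\<close>

lemma frac_int_right_ramp:
  assumes \<beta>: "0 < \<beta>" "\<beta> < 1" and c: "0 < c" "c < T" and t: "0 < t" "t < T"
    and v: "AE s in lborel. 0 < s \<and> s < T \<longrightarrow> v s = ramp \<beta> c s" and vm: "v \<in> borel_measurable borel"
  shows "frac_int_right T (1 - \<beta>) (\<lambda>s. v s * y) t = Gamma (2 + \<beta>) / 2 * (max 0 (c - t))\<^sup>2 * y"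
proof -
  have "0 < Gamma (2 + \<beta>)" "0 < Gamma (1 - \<beta>)" using \<beta> by (auto intro!: Gamma_real_pos)
  then have G: "Gamma (2 + \<beta>) \<noteq> 0" "Gamma (1 - \<beta>) \<noteq> 0" by auto
  have "(LINT s:{t<..<T}|lborel. (s - t) powr (1 - \<beta> - 1) * (v s * y))
    = (\<integral>s. (Gamma (1 - \<beta>) * Gamma (2 + \<beta>) * y) * (pw T (1 - \<beta>) (s - t) * pw T (2 + \<beta>) (c - s)) \<partial>lborel)"
    unfolding set_lebesgue_integral_def
  proof (rule integral_cong_AE)
    show "AE s in lborel. indicator {t<..<T} s *\<^sub>R ((s - t) powr (1 - \<beta> - 1) * (v s * y))
      = (Gamma (1 - \<beta>) * Gamma (2 + \<beta>) * y) * (pw T (1 - \<beta>) (s - t) * pw T (2 + \<beta>) (c - s))"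
      using v
    proof eventually_elim
      case (elim s)
      show ?case
      proof (cases "t < s \<and> s < T")
        case True
        then have "v s = ramp \<beta> c s" "s - t < T" "c - s < T" using elim t c by auto
        then show ?thesis using True G \<beta> by (auto simp: ramp_def pw_def max_def)
      next
        case False
        have "pw T (1 - \<beta>) (s - t) * pw T (2 + \<beta>) (c - s) = 0" using False c by (auto simp: pw_def)
        then show ?thesis using False by auto
      qed
    qed
  qed (use vm in measurable)
  also have "\<dots> = (Gamma (1 - \<beta>) * Gamma (2 + \<beta>) * y) * (\<integral>s. pw T (1 - \<beta>) (s - t) * pw T (2 + \<beta>) (c - s) \<partial>lborel)"
    by (rule integral_mult_right_zero)
  also have "(\<integral>s. pw T (1 - \<beta>) (s - t) * pw T (2 + \<beta>) (c - s) \<partial>lborel) = conv (pw T (2 + \<beta>)) (pw T (1 - \<beta>)) (c - t)"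
    using integral_shift(1)[of "\<lambda>r. pw T (1 - \<beta>) r * pw T (2 + \<beta>) (c - t - r)" t]
    by (simp add: conv_def mult.commute algebra_simps)
  also have "\<dots> = (max 0 (c - t))\<^sup>2 / 2"
  proof (cases "t < c")
    case True
    then have ct: "0 < c - t" "c - t < T" using t c by auto
    then have "conv (pw T (2 + \<beta>)) (pw T (1 - \<beta>)) (c - t) = cv T (pw T (2 + \<beta>)) (pw T (1 - \<beta>)) (c - t)" by (simp add: cv_def)
    also have "\<dots> = pw T (2 + \<beta> + (1 - \<beta>)) (c - t)" using \<beta> by (subst cv_pw_pw) auto
    also have "\<dots> = (c - t)\<^sup>2 / 2"
    proof -
      have "Gamma (3::real) = 2" using Gamma_fact[of 2, where 'a=real] by simp
      then show ?thesis using ct powr_realpow[of "c - t" 2] by (simp add: pw_def)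
    qed
    finally show ?thesis using True by simp
  next
    case False
    have "(\<lambda>s. pw T (2 + \<beta>) (c - t - s) * pw T (1 - \<beta>) s) = (\<lambda>s. 0)" using False by (auto simp: pw_def)
    then show ?thesis using False unfolding conv_def by simp
  qed
  finally show ?thesis using G by (simp add: frac_int_right_def)
qed

text \<open>It writes A/2 times the square of the positive part of c - t as its value at 0 plus a
  primitive, the form that \<open>has_time_deriv_separable\<close> expects.\<close>

lemma cv_pw_1_linear_ramp:
  assumes c: "0 < c" "c < T" and t: "0 < t" "t < T"
    and k: "k = (\<lambda>s. if 0 < s \<and> s < T then - A * max 0 (c - s) else 0)" and kL: "k \<in> L1s T"
  shows "cv T (pw T 1) k t = A / 2 * (max 0 (c - t))\<^sup>2 - A / 2 * c\<^sup>2"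
proof -
  let ?m = "min t c"
  let ?F = "\<lambda>s. - A * (c * s - s\<^sup>2 / 2)"
  have "cv T (pw T 1) k t = (\<integral>s. indicator {..<t} s * k s \<partial>lborel)"
    using t conv_pw_1[OF kL, of t] by (simp add: cv_def)
  also have "\<dots> = (\<integral>s. indicator {0..?m} s *\<^sub>R (- A * (c - s)) \<partial>lborel)"
  proof (rule integral_cong_AE)
    show "AE s in lborel. indicator {..<t} s * k s = indicator {0..?m} s *\<^sub>R (- A * (c - s))"
      using AE_lborel_singleton[of 0] AE_lborel_singleton[of t]
      by eventually_elim (use t c in \<open>auto simp: indicator_def k max_def min_def\<close>)
    show "(\<lambda>s. indicator {..<t} s * k s) \<in> borel_measurable lborel" using L1s_measurable[OF kL] by measurable
  qed measurable
  also have "\<dots> = ?F ?m - ?F 0"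
  proof (rule integral_FTC_atLeastAtMost)
    show "0 \<le> ?m" using t c by simp
    fix s :: real
    have "(?F has_real_derivative - A * (c - s)) (at s)"
      by (auto intro!: derivative_eq_intros simp: field_simps)
    then show "(?F has_vector_derivative - A * (c - s)) (at s within {0..?m})"
      by (simp add: has_real_derivative_iff_has_vector_derivative[symmetric] has_field_derivative_at_within)
  qed (auto intro!: continuous_intros)
  also have "\<dots> = A / 2 * (max 0 (c - t))\<^sup>2 - A / 2 * c\<^sup>2"
    by (auto simp: min_def max_def power2_eq_square field_simps)
  finally show ?thesis .
qed

lemma slob_cong_AE:
  assumes e: "AE t in lborel. 0 < t \<and> t < T \<longrightarrow> f t = g t"
  shows "slob T \<gamma> f = slob T \<gamma> g"
  unfolding slob_def using e
proof (intro nn_integral_cong_AE, eventually_elim)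
  case (elim t)
  note t = elim(2)
  show ?case using e
  proof (intro nn_integral_cong_AE, eventually_elim)
    case (elim s)
    show ?case using t elim(2) by (cases "0 < t \<and> t < T \<and> 0 < s \<and> s < T") auto
  qed
qed

lemma ramp_L2s:
  assumes c: "0 < c" "c < T" and \<beta>: "0 < \<beta>" and B: "B \<in> sets borel" "B \<subseteq> {0<..<T}"
  shows "(\<lambda>t. indicator B t * ramp \<beta> c t) \<in> L2s T"
proof (rule L2s_I)
  note [measurable] = B(1)
  have "integrable lborel (\<lambda>t. (T powr (1 + \<beta>) * indicator {0<..<T} t)\<^sup>2)"
    using sqi_integrable[OF sqi_cmult[OF indicator_sqi]] .
  then have "integrable lborel (\<lambda>t. (indicator B t * ramp \<beta> c t)\<^sup>2)"
  proof (rule Bochner_Integration.integrable_bound)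
    show "AE t in lborel. norm ((indicator B t * ramp \<beta> c t)\<^sup>2) \<le> norm ((T powr (1 + \<beta>) * indicator {0<..<T} t)\<^sup>2)"
    proof (rule AE_I2)
      fix t
      show "norm ((indicator B t * ramp \<beta> c t)\<^sup>2) \<le> norm ((T powr (1 + \<beta>) * indicator {0<..<T} t)\<^sup>2)"
      proof (cases "t \<in> B")
        case True
        then have t: "0 < t" "t < T" using B(2) by auto
        have "ramp \<beta> c t \<le> T powr (1 + \<beta>)" unfolding ramp_def using c t \<beta> by (intro powr_mono2) auto
        then have "(ramp \<beta> c t)\<^sup>2 \<le> (T powr (1 + \<beta>))\<^sup>2" by (intro power_mono) (auto simp: ramp_def)
        then show ?thesis using True t by simp
      qed simp
    qed
  qed measurable
  then show "(\<lambda>t. indicator B t * ramp \<beta> c t) \<in> sqi lborel" by (simp add: sqi_def)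
  show "indicator B t * ramp \<beta> c t = 0" if "t \<notin> {0<..<T}" for t using that B(2) by (auto simp: indicator_def)
qed

text \<open>No regularity of w is assumed: the weak gradient of the zero function vanishes almost
  everywhere and annihilates whatever \<open>weak_partial\<close> returns for w.\<close>

lemma grad_inner_zero:
  assumes "open U" shows "grad_inner U w (\<lambda>x. 0) = 0"
proof -
  have z: "AE x in leb U. weak_partial U b (\<lambda>x. 0) x = 0" for b
    by (rule weak_partial_AE[OF assms]) (simp add: has_weak_partial_def L2_eq_sqi sqi_zero)
  have "AE x in leb U. \<forall>b\<in>Basis. weak_partial U b (\<lambda>x. 0) x = 0"
    using z by (simp add: AE_finite_all)
  then have "AE x in leb U. (\<Sum>b\<in>Basis. weak_partial U b w x * weak_partial U b (\<lambda>x. 0) x) = 0"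
    by eventually_elim simp
  then show ?thesis unfolding grad_inner_def by (rule integral_eq_zero_AE)
qed

lemma sqi_indicator_max:
  assumes "0 < c" "c < T"
  shows "(\<lambda>s. if 0 < s \<and> s < T then - A * max 0 (c - s) else 0) \<in> L2s T"
proof (rule L2s_I)
  have "integrable lborel (\<lambda>t. (A * T * indicator {0<..<T} t)\<^sup>2)"
    using sqi_integrable[OF sqi_cmult[OF indicator_sqi]] .
  then have "integrable lborel (\<lambda>s. (if 0 < s \<and> s < T then - A * max 0 (c - s) else 0)\<^sup>2)"
  proof (rule Bochner_Integration.integrable_bound)
    show "AE s in lborel. norm ((if 0 < s \<and> s < T then - A * max 0 (c - s) else 0)\<^sup>2) \<le> norm ((A * T * indicator {0<..<T} s)\<^sup>2)"
    proof (rule AE_I2)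
      fix s :: real
      have "(max 0 (c - s))\<^sup>2 \<le> T\<^sup>2" if "0 < s" using assms that by (intro power_mono) auto
      then show "norm ((if 0 < s \<and> s < T then - A * max 0 (c - s) else 0)\<^sup>2) \<le> norm ((A * T * indicator {0<..<T} s)\<^sup>2)"
        by (auto simp: power_mult_distrib mult_left_mono)
    qed
  qed measurable
  then show "(\<lambda>s. if 0 < s \<and> s < T then - A * max 0 (c - s) else 0) \<in> sqi lborel" by (simp add: sqi_def)
qed auto

context onb_time
begin

lemma L2_inner_integral_cong:
  assumes f: "case_prod f \<in> borel_measurable MT" "case_prod f' \<in> borel_measurable MT"
    and g: "case_prod g \<in> borel_measurable MT" "case_prod g' \<in> borel_measurable MT"
    and e: "AE q in MT. case_prod f q = case_prod f' q" "AE q in MT. case_prod g q = case_prod g' q"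
  shows "(\<integral>t. L2_inner U (f t) (g t) \<partial>lborel) = (\<integral>t. L2_inner U (f' t) (g' t) \<partial>lborel)"
proof -
  have m: "(\<lambda>t. L2_inner U (a t) (b t)) \<in> borel_measurable lborel"
    if [measurable]: "case_prod a \<in> borel_measurable MT" "case_prod b \<in> borel_measurable MT" for a b :: "real \<Rightarrow> 'a \<Rightarrow> real"
    unfolding L2_inner_def by (rule MU.borel_measurable_lebesgue_integral) (simp add: case_prod_unfold, measurable)
  note s = section_measurable
  show ?thesis
    using P.AE_pair[OF e(1)] P.AE_pair[OF e(2)]
  proof (intro integral_cong_AE m f g, eventually_elim)
    case (elim t)
    show ?case unfolding L2_inner_def
    proof (rule integral_cong_AE)
      show "(\<lambda>x. f t x * g t x) \<in> borel_measurable (leb U)" using s[OF f(1), of t] s[OF g(1), of t] by simp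
      show "(\<lambda>x. f' t x * g' t x) \<in> borel_measurable (leb U)" using s[OF f(2), of t] s[OF g(2), of t] by simp
      show "AE x in leb U. f t x * g t x = f' t x * g' t x" using elim(3,4) by eventually_elim simp
    qed
  qed
qed

lemma cf_separable: "cf (\<lambda>t x. z t * \<phi> i x) j t = (if i = j then z t else 0)"
  by (simp add: L2_inner_def mult.assoc \<phi>_orth)

end

text \<open>Finiteness of Y matters, since \<open>enn2real\<close> maps infinity to 0.\<close>

lemma sqrt_enn2real_le:
  assumes "X \<le> ennreal K * Y" "Y < \<infinity>" "0 \<le> K"
  shows "sqrt (enn2real X) \<le> sqrt K * sqrt (enn2real Y)"
proof -
  have "enn2real X \<le> enn2real (ennreal K * Y)"
    using assms by (intro enn2real_mono) (simp_all add: ennreal_mult_less_top)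
  then have "enn2real X \<le> K * enn2real Y" using assms(3) by (simp add: enn2real_mult)
  then show ?thesis by (simp add: real_sqrt_mult[symmetric])
qed

section \<open>Regularity of the weak solution\<close>

locale diffusion = eigenbasis U \<phi> lam + onb_time U \<phi> T
  for U :: "'a::euclidean_space set" and \<phi> lam T
begin

lemma diag_hdot1: "diag_norm (hdot_sq U \<phi> lam 1) lam"
proof -
  have "lam i powr 1 = lam i" for i using lam_pos[of i] by simp
  then show ?thesis using diag_hdot[of lam 1] by presburger
qed

lemma W_space_F2:
  assumes "u \<in> W_space \<alpha> T U \<phi> lam"
  shows "u \<in> fields T U" "ext T u \<in> F2"
proof -
  show f: "u \<in> fields T U" using assms by (simp add: W_space_def Hgt_def)
  have "L2t_sq T (L2_sq U) u \<le> Hgt_sq (\<alpha>/2) T (L2_sq U) u" unfolding Hgt_sq_def by simp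
  also have "\<dots> < \<infinity>" using assms by (simp add: W_space_def Hgt_def)
  finally show "ext T u \<in> F2" by (rule F2_ext[OF f])
qed

text \<open>The time integral of the weighted series is a finite squared norm, so the series
  converges at almost every time. At such times \<open>grad_inner_mode\<close> evaluates the
  Dirichlet form.\<close>

lemma W_space_regular:
  assumes u: "u \<in> W_space \<alpha> T U \<phi> lam"
  shows "AE t in lborel. ext T u t \<in> sqi (leb U) \<and> summable (\<lambda>j. lam j * (cf (ext T u) j t)\<^sup>2)"
proof -
  note F = W_space_F2(2)[OF u]
  note [measurable] = cf_measurable[OF F]
  have l: "0 \<le> lam j" for j using lam_pos[of j] by simp
  have "(\<integral>\<^sup>+t. (\<Sum>j. ennreal (lam j) * ennreal ((cf (ext T u) j t)\<^sup>2)) \<partial>lborel)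
    = (\<Sum>j. \<integral>\<^sup>+t. ennreal (lam j) * ennreal ((cf (ext T u) j t)\<^sup>2) \<partial>lborel)"
    by (rule nn_integral_suminf) measurable
  also have "\<dots> = (\<Sum>j. ennreal (lam j) * (\<integral>\<^sup>+t. ennreal ((cf (ext T u) j t)\<^sup>2) \<partial>lborel))"
    by (rule suminf_cong, rule nn_integral_cmult) measurable
  also have "\<dots> = L2t_sq T (hdot_sq U \<phi> lam 1) u" by (rule L2t_sq_coeff[OF F diag_hdot1 l, symmetric])
  also have "\<dots> \<noteq> \<infinity>" using u by (auto simp: W_space_def L2t_def)
  finally have "AE t in lborel. (\<Sum>j. ennreal (lam j) * ennreal ((cf (ext T u) j t)\<^sup>2)) \<noteq> \<infinity>"
    by (intro nn_integral_PInf_AE) measurable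
  then show ?thesis using F2_section[OF F]
  proof eventually_elim
    case (elim t)
    have "summable (\<lambda>j. lam j * (cf (ext T u) j t)\<^sup>2)"
      using elim(1) l by (intro summable_suminf_not_top) (simp_all add: ennreal_mult)
    then show ?case using elim(2) by simp
  qed
qed

lemma separable_W:
  assumes z: "z \<in> L2s T" and s: "slob T (\<alpha> / 2) z < \<infinity>"
  shows "(\<lambda>t x. z t * \<phi> i x) \<in> W_space \<alpha> T U \<phi> lam"
proof -
  let ?v = "\<lambda>t x. z t * \<phi> i x"
  note F = separable_F2[OF z \<phi>_sqi[of i]]
  note e = ext_F2[OF F]
  have F': "ext T ?v \<in> F2" unfolding e by (rule F)
  have vf: "?v \<in> fields T U" by (rule fields_I[OF F2_measurable[OF F]])
  have zn: "(\<integral>\<^sup>+t. ennreal ((z t)\<^sup>2) \<partial>lborel) < \<infinity>" using L2s_sqi[OF z] by (simp add: sqi_iff_nn)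
  have l: "0 \<le> lam j" for j using lam_pos[of j] by simp
  have one: "(\<Sum>j. ennreal (c j) * (if i = j then r else 0)) < \<infinity>" if "r < \<infinity>" for c and r :: ennreal
  proof -
    have "(\<Sum>j. ennreal (c j) * (if i = j then r else 0)) = (\<Sum>j\<in>{i}. ennreal (c j) * (if i = j then r else 0))"
      by (rule suminf_finite) auto
    also have "\<dots> < \<infinity>" using that by (simp add: ennreal_mult_less_top)
    finally show ?thesis .
  qed
  let ?Z = "\<integral>\<^sup>+t. ennreal ((z t)\<^sup>2) \<partial>lborel"
  have Z0: "(\<integral>\<^sup>+t. ennreal ((if i = j then z t else 0)\<^sup>2) \<partial>lborel) = (if i = j then ?Z else 0)" for j
    by simp
  have s0: "(if i = j then ?Z else 0) + slob T (\<alpha> / 2) (\<lambda>t. if i = j then z t else 0) = (if i = j then ?Z + slob T (\<alpha> / 2) z else 0)" for j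
    by (simp add: slob_def)
  have "?Z + slob T (\<alpha> / 2) z < \<infinity>" using zn s by simp
  from one[OF this, of "\<lambda>j. 1"] have "Hgt_sq (\<alpha> / 2) T (L2_sq U) ?v < \<infinity>"
    unfolding Hgt_sq_coeff[OF F' diag_L2 zero_le_one] e cf_separable Z0 s0 .
  moreover have "L2t_sq T (hdot_sq U \<phi> lam 1) ?v < \<infinity>"
    using one[OF zn, of lam] unfolding L2t_sq_coeff[OF F' diag_hdot1 l] e cf_separable Z0 .
  ultimately show ?thesis
    unfolding W_space_def Hgt_def L2t_def using vf by (intro IntI CollectI conjI)
qed

lemma frac_deriv_right_ramp:
  fixes i :: nat
  assumes \<beta>: "0 < \<beta>" "\<beta> < 1" and c: "0 < c" "c < T" and B: "B \<in> sets borel"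
    and full: "AE t in lborel. 0 < t \<and> t < T \<longrightarrow> t \<in> B"
  defines "D \<equiv> frac_deriv_right T U \<beta> (\<lambda>t x. indicator B t * ramp \<beta> c t * \<phi> i x)"
  shows "case_prod (ext T D) \<in> borel_measurable MT"
    "AE q in MT. case_prod (ext T D) q = case_prod (\<lambda>t x. (if 0 < t \<and> t < T then Gamma (2 + \<beta>) * max 0 (c - t) else 0) * \<phi> i x) q"
proof -
  note [measurable] = B
  let ?A = "Gamma (2 + \<beta>)"
  define k where "k = (\<lambda>s. if 0 < s \<and> s < T then - ?A * max 0 (c - s) else 0)"
  have kL: "k \<in> L2s T" unfolding k_def by (rule sqi_indicator_max[OF c])
  let ?w = "\<lambda>t x. frac_int_right T (1 - \<beta>) (\<lambda>s. indicator B s * ramp \<beta> c s * \<phi> i x) t"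
  \<comment> \<open>The constant is the value at t = 0 of the fractional integral of the ramp, and k
    is the derivative of this integral.\<close>
  have w: "?w t x = (?A / 2 * c\<^sup>2 + cv T (pw T 1) k t) * \<phi> i x" if t: "0 < t" "t < T" for t x
  proof -
    have "?w t x = ?A / 2 * (max 0 (c - t))\<^sup>2 * \<phi> i x"
    proof (rule frac_int_right_ramp[OF \<beta> c t])
      show "AE s in lborel. 0 < s \<and> s < T \<longrightarrow> indicator B s * ramp \<beta> c s = ramp \<beta> c s"
        using full by eventually_elim auto
    qed measurable
    then show ?thesis unfolding cv_pw_1_linear_ramp[OF c t k_def L2s_L1s[OF kL]] by (simp add: algebra_simps)
  qed
  have d: "has_time_deriv T U ?w (\<lambda>t x. k t * \<phi> i x)"
    by (rule has_time_deriv_separable[OF kL \<phi>_sqi], erule w, assumption)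
  note e = time_deriv_AE[OF separable_F2[OF kL \<phi>_sqi] d]
  have eq: "ext T D = (\<lambda>t x. - ext T (time_deriv T U ?w) t x)"
    by (auto simp: D_def frac_deriv_right_def ext_def fun_eq_iff)
  show "case_prod (ext T D) \<in> borel_measurable MT"
    using F2_measurable[OF e(2)] by (simp add: eq case_prod_unfold)
  show "AE q in MT. case_prod (ext T D) q = case_prod (\<lambda>t x. (if 0 < t \<and> t < T then ?A * max 0 (c - t) else 0) * \<phi> i x) q"
    using e(3) by eventually_elim (auto simp: eq k_def case_prod_unfold)
qed

text \<open>At a null set of times \<open>u t\<close> need not lie in the form domain, and \<open>grad_inner\<close> is then a
  junk value. Cutting the test function off by \<open>indicator B\<close>, with a Borel set \<open>B\<close> of good times of
  full measure, makes the integrand vanish there.\<close>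
lemma weak_solution_mode:
  assumes w: "weak_solution \<alpha> T U \<phi> lam f u" and \<alpha>: "0 < \<alpha>" "\<alpha> < 1" and f: "ext T f \<in> F2"
    and h: "h \<in> F2" "case_prod (ext T (frac_deriv_left T U (\<alpha> / 2) u)) \<in> borel_measurable MT"
      "AE q in MT. case_prod (ext T (frac_deriv_left T U (\<alpha> / 2) u)) q = case_prod h q"
    and c: "0 < c" "c < T"
  shows "cv T (pw T 2) (cf h i) c + lam i * cv T (pw T (2 + \<alpha> / 2)) (cf (ext T u) i) c
    = cv T (pw T (2 + \<alpha> / 2)) (cf (ext T f) i) c"
proof -
  define \<beta> where "\<beta> = \<alpha> / 2"
  have \<beta>: "0 < \<beta>" "\<beta> < 1/2" "\<beta> < 1" using \<alpha> by (auto simp: \<beta>_def)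
  have "0 < Gamma (2 + \<beta>)" using \<beta> by (intro Gamma_real_pos) simp
  then have G: "Gamma (2 + \<beta>) \<noteq> 0" by simp
  have uW: "u \<in> W_space \<alpha> T U \<phi> lam" using w by (simp add: weak_solution_def)
  note uF = W_space_F2(2)[OF uW]
  have uL: "cf (ext T u) i \<in> L2s T" and fL: "cf (ext T f) i \<in> L2s T" and hL: "cf h i \<in> L2s T"
    using coeff_L2s[OF uF \<phi>_sqi] coeff_L2s[OF f \<phi>_sqi] coeff_L2s[OF h(1) \<phi>_sqi] by auto
  note [measurable] = cf_measurable[OF uF] cf_measurable[OF f] cf_measurable[OF h(1)]
  from AE_E[OF W_space_regular[OF uW]] obtain N where N: "{t. \<not> (ext T u t \<in> sqi (leb U) \<and> summable (\<lambda>j. lam j * (cf (ext T u) j t)\<^sup>2))} \<subseteq> N"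
    "emeasure lborel N = 0" "N \<in> sets lborel" by auto
  define B where "B = {0<..<T} - N"
  have B: "B \<in> sets borel" "B \<subseteq> {0<..<T}" using N(3) by (auto simp: B_def)
  note [measurable] = B(1)
  have reg: "ext T u t \<in> sqi (leb U)" "summable (\<lambda>j. lam j * (cf (ext T u) j t)\<^sup>2)" if "t \<in> B" for t
    using N(1) that by (auto simp: B_def)
  have "AE t in lborel. t \<notin> N" by (rule AE_not_in) (use N in \<open>simp add: null_sets_def\<close>)
  then have full: "AE t in lborel. 0 < t \<and> t < T \<longrightarrow> t \<in> B"
    by eventually_elim (simp add: B_def)
  define z where "z t = indicator B t * ramp \<beta> c t" for t
  have [measurable]: "z \<in> borel_measurable borel" unfolding z_def[abs_def] by measurable
  have zL: "z \<in> L2s T" unfolding z_def[abs_def] by (rule ramp_L2s[OF c \<beta>(1) B])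
  have z_AE: "AE t in lborel. 0 < t \<and> t < T \<longrightarrow> z t = ramp \<beta> c t"
    using full by eventually_elim (auto simp: z_def)
  have z_int: "(\<integral>t. z t * q t \<partial>lborel) = Gamma (2 + \<beta>) * cv T (pw T (2 + \<beta>)) q c" if q: "q \<in> L1s T" for q
  proof -
    have [measurable]: "q \<in> borel_measurable borel" using q by (rule L1s_measurable)
    have "(\<integral>t. z t * q t \<partial>lborel) = (\<integral>t. ramp \<beta> c t * q t \<partial>lborel)"
    proof (rule integral_cong_AE)
      show "AE t in lborel. z t * q t = ramp \<beta> c t * q t"
        using z_AE
      proof eventually_elim
        case (elim t)
        then show ?case using L1s_zero[OF q, of t] by (cases "0 < t \<and> t < T") auto
      qed
    qed measurable
    then show ?thesis using integral_ramp[OF \<beta>(1) c q] by simp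
  qed
  let ?v = "\<lambda>t x. z t * \<phi> i x"
  have vW: "?v \<in> W_space \<alpha> T U \<phi> lam"
    by (rule separable_W[OF zL]) (use slob_cong_AE[OF z_AE] slob_ramp_finite[OF \<beta>(1,2) c] in \<open>simp add: \<beta>_def\<close>)
  let ?l = "frac_deriv_left T U \<beta> u" and ?r = "frac_deriv_right T U \<beta> ?v"
  have eq: "(\<integral>t. L2_inner U (?l t) (?r t) \<partial>leb {0<..<T}) + (\<integral>t. grad_inner U (u t) (?v t) \<partial>leb {0<..<T})
    = (\<integral>t. L2_inner U (f t) (?v t) \<partial>leb {0<..<T})"
    using w vW unfolding weak_solution_def \<beta>_def by blast
  let ?k = "\<lambda>t. if 0 < t \<and> t < T then Gamma (2 + \<beta>) * max 0 (c - t) else 0"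
  have kL: "?k \<in> L2s T" using sqi_indicator_max[OF c, of "- Gamma (2 + \<beta>)"] unfolding minus_minus .
  note r = frac_deriv_right_ramp[OF \<beta>(1,3) c B(1) full, of i, folded z_def]
  note h = h[folded \<beta>_def]
  have "(\<integral>t. L2_inner U (?l t) (?r t) \<partial>leb {0<..<T}) = (\<integral>t. L2_inner U (ext T ?l t) (ext T ?r t) \<partial>lborel)"
    unfolding leb_interval_integral
  proof (intro Bochner_Integration.integral_cong refl)
    fix t
    show "indicator {0<..<T} t * L2_inner U (?l t) (?r t) = L2_inner U (ext T ?l t) (ext T ?r t)"
      by (cases "0 < t \<and> t < T") (auto simp: ext_def[abs_def] L2_inner_def)
  qed
  also have "\<dots> = (\<integral>t. L2_inner U (h t) ((\<lambda>t x. ?k t * \<phi> i x) t) \<partial>lborel)"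
    by (rule L2_inner_integral_cong[OF h(2) F2_measurable[OF h(1)] r(1) F2_measurable[OF separable_F2[OF kL \<phi>_sqi]] h(3) r(2)])
  also have "\<dots> = (\<integral>t. Gamma (2 + \<beta>) * (pw T 2 (c - t) * cf h i t) \<partial>lborel)"
  proof (intro Bochner_Integration.integral_cong refl)
    fix t
    have "L2_inner U (h t) (\<lambda>x. ?k t * \<phi> i x) = ?k t * cf h i t"
      unfolding L2_inner_def by (simp only: mult.left_commute[of "h t _"] integral_mult_right_zero)
    also have "\<dots> = Gamma (2 + \<beta>) * (pw T 2 (c - t) * cf h i t)"
    proof (cases "0 < t \<and> t < T")
      case True
      have "Gamma 2 = (1::real)" using Gamma_fact[of 1, where 'a=real] by simp
      then have "max 0 (c - t) = pw T 2 (c - t)" using c True by (auto simp: pw_def max_def)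
      then show ?thesis using True by (simp only: simp_thms if_True mult.assoc)
    next
      case False
      then show ?thesis using cf_outside[OF h(1) False, of i] by (simp only: mult_zero_right)
    qed
    finally show "L2_inner U (h t) (\<lambda>x. ?k t * \<phi> i x) = Gamma (2 + \<beta>) * (pw T 2 (c - t) * cf h i t)" .
  qed
  also have "\<dots> = Gamma (2 + \<beta>) * cv T (pw T 2) (cf h i) c" using c by (simp only: cv_def conv_def integral_mult_right_zero if_True simp_thms)
  finally have 1: "(\<integral>t. L2_inner U (?l t) (?r t) \<partial>leb {0<..<T}) = Gamma (2 + \<beta>) * cv T (pw T 2) (cf h i) c" .
  have "(\<integral>t. grad_inner U (u t) (?v t) \<partial>leb {0<..<T}) = (\<integral>t. lam i * (z t * cf (ext T u) i t) \<partial>lborel)"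
    unfolding leb_interval_integral
  proof (intro Bochner_Integration.integral_cong refl)
    fix t
    show "indicator {0<..<T} t * grad_inner U (u t) (?v t) = lam i * (z t * cf (ext T u) i t)"
    proof (cases "t \<in> B")
      case True
      then have t: "0 < t" "t < T" using B(2) by auto
      then have "ext T u t = u t" by (simp add: ext_def fun_eq_iff)
      then show ?thesis using grad_inner_mode[of "u t" "z t" i] reg[OF True] t by (simp add: mult_ac)
    next
      case False
      then have "z t = 0" by (simp add: z_def)
      then show ?thesis using grad_inner_zero[OF open_U] by simp
    qed
  qed
  also have "\<dots> = lam i * (Gamma (2 + \<beta>) * cv T (pw T (2 + \<beta>)) (cf (ext T u) i) c)"
    using z_int[OF L2s_L1s[OF uL]] by simp
  finally have 2: "(\<integral>t. grad_inner U (u t) (?v t) \<partial>leb {0<..<T}) = lam i * (Gamma (2 + \<beta>) * cv T (pw T (2 + \<beta>)) (cf (ext T u) i) c)" .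
  have "(\<integral>t. L2_inner U (f t) (?v t) \<partial>leb {0<..<T}) = (\<integral>t. z t * cf (ext T f) i t \<partial>lborel)"
    unfolding leb_interval_integral
  proof (intro Bochner_Integration.integral_cong refl)
    fix t
    show "indicator {0<..<T} t * L2_inner U (f t) (?v t) = z t * cf (ext T f) i t"
    proof (cases "t \<in> B")
      case True
      then have t: "0 < t" "t < T" using B(2) by auto
      then have "ext T f t = f t" by (simp add: ext_def fun_eq_iff)
      then show ?thesis using t unfolding L2_inner_def
        by (simp only: mult.left_commute[of "f t _"] integral_mult_right_zero) simp
    next
      case False
      then have "z t = 0" by (simp add: z_def)
      then show ?thesis by (simp add: L2_inner_def)
    qed
  qed
  also have "\<dots> = Gamma (2 + \<beta>) * cv T (pw T (2 + \<beta>)) (cf (ext T f) i) c" by (rule z_int[OF L2s_L1s[OF fL]])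
  finally have "Gamma (2 + \<beta>) * (cv T (pw T 2) (cf h i) c + lam i * cv T (pw T (2 + \<beta>)) (cf (ext T u) i) c)
    = Gamma (2 + \<beta>) * cv T (pw T (2 + \<beta>)) (cf (ext T f) i) c"
    using eq unfolding 1 2 by (simp add: algebra_simps)
  then show ?thesis using G by (simp add: \<beta>_def)
qed

text \<open>\<open>weak_solution_mode\<close> is the mode equation integrated \<open>2 - \<alpha>/2\<close> times; integrating it up to the
  integer order \<open>2\<close> allows to undo the integration.\<close>
lemma mode_equation:
  assumes w: "weak_solution \<alpha> T U \<phi> lam f u" and \<alpha>: "0 < \<alpha>" "\<alpha> < 1" and f: "ext T f \<in> F2"
  shows "AE t in lborel. cf (ext T u) i t + lam i * cv T (pw T \<alpha>) (cf (ext T u) i) t = cv T (pw T \<alpha>) (cf (ext T f) i) t"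
proof -
  define \<beta> where "\<beta> = \<alpha> / 2"
  have \<beta>: "0 < \<beta>" "\<beta> < 1/2" using \<alpha> by (auto simp: \<beta>_def)
  have uW: "u \<in> W_space \<alpha> T U \<phi> lam" using w by (simp add: weak_solution_def)
  note uF = W_space_F2[OF uW]
  have "Hgt_sq \<beta> T (L2_sq U) u < \<infinity>" using uW by (simp add: W_space_def Hgt_def \<beta>_def)
  from frac_deriv_left_exists[OF uF \<beta> this]
  obtain h where h: "h \<in> F2" "\<And>i. AE t in lborel. cv T (pw T 1) (cf h i) t = cv T (pw T (1 - \<beta>)) (cf (ext T u) i) t"
    "ext T (frac_deriv_left T U \<beta> u) \<in> F2" "AE q in MT. case_prod (ext T (frac_deriv_left T U \<beta> u)) q = case_prod h q"
    by blast
  define a where "a = cf h i"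
  define b where "b = cf (ext T u) i"
  define g where "g = cf (ext T f) i"
  let ?I = "\<lambda>r. cv T (pw T r)"
  have aL: "a \<in> L1s T" and bL: "b \<in> L1s T" and gL: "g \<in> L1s T"
    unfolding a_def b_def g_def using coeff_L2s[OF h(1) \<phi>_sqi] coeff_L2s[OF uF(2) \<phi>_sqi] coeff_L2s[OF f \<phi>_sqi]
    by (auto intro: L2s_L1s)
  have IL: "?I r q \<in> L1s T" if "0 < r" "q \<in> L1s T" for r q using that by (intro cv_L1s pw_L1s)
  have cong: "?I r p = ?I r q" if "p \<in> L1s T" "q \<in> L1s T" "AE t in lborel. p t = q t" for r p q
    by (rule cv_cong_AE[OF L1s_measurable[OF that(1)] L1s_measurable[OF that(2)] pw_measurable that(3)])
  have comb: "(\<lambda>t. p t + lam i * q t) \<in> L1s T" if "p \<in> L1s T" "q \<in> L1s T" for p q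
    by (intro L1s_add L1s_cmult that)
  have lin: "AE t in lborel. ?I r (\<lambda>s. p s + lam i * q s) t = ?I r p t + lam i * ?I r q t"
    if "0 < r" "p \<in> L1s T" "q \<in> L1s T" for r p q
    using cv_linear_AE[OF pw_L1s[OF that(1)] that(2,3), of 1 "lam i"] by simp
  \<comment> \<open>Outside (0, T) all terms are truncated to 0, so the equation holds for every t
    and can be convolved further.\<close>
  have mode: "?I 2 a t + lam i * ?I (2 + \<beta>) b t = ?I (2 + \<beta>) g t" for t
  proof (cases "0 < t \<and> t < T")
    case True
    then show ?thesis
      using weak_solution_mode[OF w \<alpha> f h(1) F2_measurable[OF h(3)[unfolded \<beta>_def]] h(4)[unfolded \<beta>_def], of t i]
      by (simp add: a_def b_def g_def \<beta>_def)
  qed (auto simp: cv_def)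
  \<comment> \<open>Since I^1 of the derivative h is I^(1 - \<beta>) u, the term I^2 a becomes I^(2
    - \<beta>) b and the derivative is eliminated.\<close>
  have 1: "?I 1 (?I 1 a) = ?I 1 (?I (1 - \<beta>) b)"
    using \<beta> by (intro cong IL aL bL) (use h(2)[of i] in \<open>simp_all add: a_def b_def\<close>)
  have "AE t in lborel. ?I 1 (?I 1 a) t = ?I 2 a t"
    using cv_pw_pw_AE[of 1 1 a T] aL by simp
  moreover have "AE t in lborel. ?I 1 (?I (1 - \<beta>) b) t = ?I (2 - \<beta>) b t"
    using cv_pw_pw_AE[of 1 "1 - \<beta>" b T] bL \<beta> by simp
  ultimately have 2: "AE t in lborel. ?I (2 - \<beta>) b t + lam i * ?I (2 + \<beta>) b t = ?I (2 + \<beta>) g t"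
    unfolding 1 using mode by (auto elim!: eventually_elim2)
  \<comment> \<open>Applying I^\<beta> raises the orders 2 - \<beta> and 2 + \<beta> to 2 and 2 +
    \<alpha>. The result is I^2 of the mode equation, and I^1 is cancelled twice.\<close>
  have 3: "?I \<beta> (\<lambda>t. ?I (2 - \<beta>) b t + lam i * ?I (2 + \<beta>) b t) = ?I \<beta> (?I (2 + \<beta>) g)"
    using \<beta> by (intro cong comb IL bL gL 2) auto
  let ?r = "\<lambda>s. b s + lam i * ?I \<alpha> b s"
  have rL: "?r \<in> L1s T" using \<alpha> by (intro comb IL bL)
  have s: "\<beta> + (2 - \<beta>) = 2" "\<beta> + (2 + \<beta>) = 2 + \<alpha>" by (auto simp: \<beta>_def)
  have "AE t in lborel. ?I \<beta> (\<lambda>t. ?I (2 - \<beta>) b t + lam i * ?I (2 + \<beta>) b t) t = ?I \<beta> (?I (2 - \<beta>) b) t + lam i * ?I \<beta> (?I (2 + \<beta>) b) t"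
    using \<beta> by (intro lin IL bL) auto
  moreover have "AE t in lborel. ?I \<beta> (?I (2 - \<beta>) b) t = ?I 2 b t"
    using cv_pw_pw_AE[of \<beta> "2 - \<beta>" b T] bL \<beta> unfolding s by simp
  moreover have "AE t in lborel. ?I \<beta> (?I (2 + \<beta>) b) t = ?I (2 + \<alpha>) b t"
    using cv_pw_pw_AE[of \<beta> "2 + \<beta>" b T] bL \<beta> unfolding s by simp
  moreover have "AE t in lborel. ?I \<beta> (?I (2 + \<beta>) g) t = ?I (2 + \<alpha>) g t"
    using cv_pw_pw_AE[of \<beta> "2 + \<beta>" g T] gL \<beta> unfolding s by simp
  moreover have "AE t in lborel. ?I 2 ?r t = ?I 2 b t + lam i * ?I 2 (?I \<alpha> b) t"
    using \<alpha> by (intro lin IL bL) auto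
  moreover have "AE t in lborel. ?I 2 (?I \<alpha> b) t = ?I (2 + \<alpha>) b t"
    using cv_pw_pw_AE[of 2 \<alpha> b T] bL \<alpha> by simp
  moreover have "AE t in lborel. ?I 2 (?I \<alpha> g) t = ?I (2 + \<alpha>) g t"
    using cv_pw_pw_AE[of 2 \<alpha> g T] gL \<alpha> by simp
  moreover have "AE t in lborel. ?I 1 (?I 1 ?r) t = ?I 2 ?r t"
    using cv_pw_pw_AE[of 1 1 ?r T] rL by simp
  moreover have "AE t in lborel. ?I 1 (?I 1 (?I \<alpha> g)) t = ?I 2 (?I \<alpha> g) t"
    using cv_pw_pw_AE[of 1 1 "?I \<alpha> g" T] IL[OF \<alpha>(1) gL] by simp
  ultimately have "AE t in lborel. ?I 1 (?I 1 ?r) t = ?I 1 (?I 1 (?I \<alpha> g)) t"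
    unfolding 3 by eventually_elim simp
  then have "AE t in lborel. ?I 1 ?r t = ?I 1 (?I \<alpha> g) t"
    by (rule cv_pw_1_injective'[OF IL[OF zero_less_one rL] IL[OF zero_less_one IL[OF \<alpha>(1) gL]]])
  then have "AE t in lborel. ?r t = ?I \<alpha> g t"
    by (rule cv_pw_1_injective'[OF rL IL[OF \<alpha>(1) gL]])
  then show ?thesis by (simp add: b_def g_def)
qed

section \<open>Estimates for one mode and their summation\<close>

lemma diag_hdot2: "diag_norm (hdot_sq U \<phi> lam 2) (\<lambda>i. (lam i)\<^sup>2)"
proof -
  have "lam i powr 2 = (lam i)\<^sup>2" for i using powr_realpow[OF lam_pos, of i 2] by simp
  then show ?thesis using diag_hdot[of lam 2] by presburger
qed

text \<open>The number e is the squared norm of the derivative of order 1 - \<alpha> of the i-th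
  coefficient of f. All bounds for the mode are multiples of e by constants free of i, so one
  summable majorant serves every norm.\<close>

lemma mode_estimate:
  assumes w: "weak_solution \<alpha> T U \<phi> lam f u" and \<alpha>: "1/2 < \<alpha>" "\<alpha> < 1"
    and f: "ext T f \<in> F2" and s: "slob T (1 - \<alpha>) (cf (ext T f) i) < \<infinity>"
  obtains e z where "z \<in> L2s T" "AE t in lborel. cf (ext T u) i t = cv T (pw T 1) z t"
    "(\<integral>t. (z t)\<^sup>2 \<partial>lborel) \<le> e"
    "lam i * (\<integral>t. z t * cv T (pw T \<alpha>) z t \<partial>lborel) \<le> e"
    "(lam i)\<^sup>2 * (\<integral>t. (cf (ext T u) i t)\<^sup>2 \<partial>lborel) \<le> 4 * (\<integral>t. \<bar>pw T (1 - \<alpha>) t\<bar> \<partial>lborel)\<^sup>2 * e"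
    "ennreal e \<le> ennreal (frac_const T (1 - \<alpha>)) * ((\<integral>\<^sup>+t. ennreal ((cf (ext T f) i t)\<^sup>2) \<partial>lborel) + slob T (1 - \<alpha>) (cf (ext T f) i))"
proof -
  have uW: "u \<in> W_space \<alpha> T U \<phi> lam" using w by (simp add: weak_solution_def)
  note uL = coeff_L2s[OF W_space_F2(2)[OF uW] \<phi>_sqi[of i]] and fL = coeff_L2s[OF f \<phi>_sqi[of i]]
  have g: "0 < 1 - \<alpha>" "1 - \<alpha> < 1/2" and \<alpha>0: "0 < \<alpha>" using \<alpha> by auto
  obtain k where k: "k \<in> L2s T" "AE t in lborel. cv T (pw T 1) k t = cv T (pw T (1 - (1 - \<alpha>))) (cf (ext T f) i) t"
    "ennreal (\<integral>t. (k t)\<^sup>2 \<partial>lborel) \<le> ennreal (frac_const T (1 - \<alpha>)) * (slob T (1 - \<alpha>) (cf (ext T f) i) + (\<integral>\<^sup>+t. ennreal ((cf (ext T f) i t)\<^sup>2) \<partial>lborel))"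
    by (rule fractional_derivative_exists[OF T_pos g fL s])
  have "AE t in lborel. cf (ext T u) i t + lam i * cv T (pw T \<alpha>) (cf (ext T u) i) t = cv T (pw T 1) k t"
    using mode_equation[OF w \<alpha>0 \<alpha>(2) f, of i] k(2) by eventually_elim simp
  from volterra_regularity[OF \<alpha> lam_pos uL k(1) this] obtain z where z: "z \<in> L2s T" "AE t in lborel. cf (ext T u) i t = cv T (pw T 1) z t"
    "(\<integral>t. (z t)\<^sup>2 \<partial>lborel) \<le> (\<integral>t. (k t)\<^sup>2 \<partial>lborel)"
    "lam i * (\<integral>t. z t * cv T (pw T \<alpha>) z t \<partial>lborel) \<le> (\<integral>t. (k t)\<^sup>2 \<partial>lborel)"
    "(lam i)\<^sup>2 * (\<integral>t. (cf (ext T u) i t)\<^sup>2 \<partial>lborel) \<le> 4 * (\<integral>t. \<bar>pw T (1 - \<alpha>) t\<bar> \<partial>lborel)\<^sup>2 * (\<integral>t. (k t)\<^sup>2 \<partial>lborel)"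
    by blast
  show ?thesis by (rule that[OF z k(3)[unfolded add.commute[of "slob _ _ _"]]])
qed

text \<open>\<open>c1\<close> is the Young constant of u_i = I^1 z_i, \<open>c2\<close> that of
  \<open>volterra_regularity\<close> and \<open>c3\<close> that of
  \<open>slobodeckij_le_energy\<close>. The norm of order 1 in space collects all three: its L2 part
  carries the weight \<lambda>, and \<lambda> \<le> 1 + \<lambda>^2 reduces it to the weights 1 and
  \<lambda>^2.\<close>

lemma regularity_estimate:
  assumes \<alpha>: "1/2 < \<alpha>" "\<alpha> < 1" and f: "f \<in> Hgt (1 - \<alpha>) T U (L2_sq U)" and w: "weak_solution \<alpha> T U \<phi> lam f u"
  defines "c1 \<equiv> (\<integral>t. \<bar>pw T 1 t\<bar> \<partial>lborel)\<^sup>2" and "c2 \<equiv> 4 * (\<integral>t. \<bar>pw T (1 - \<alpha>) t\<bar> \<partial>lborel)\<^sup>2"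
    and "c3 \<equiv> 4 * Gamma \<alpha> / ((1 - \<alpha>) * (2 - \<alpha>))"
    and "Y \<equiv> ennreal (frac_const T (1 - \<alpha>)) * Hgt_sq (1 - \<alpha>) T (L2_sq U) f"
  shows "u \<in> fields T U" "\<exists>g. has_time_deriv T U u g" "time_deriv T U u \<in> L2t T U (L2_sq U)"
    "L2t_sq T (L2_sq U) u \<le> ennreal c1 * Y"
    "L2t_sq T (L2_sq U) (time_deriv T U u) \<le> Y"
    "L2t_sq T (hdot_sq U \<phi> lam 2) u \<le> ennreal c2 * Y"
    "Hgt_sq (1 - \<alpha>/2) T (hdot_sq U \<phi> lam 1) u \<le> ennreal (c1 + c2 + c3) * Y"
proof -
  have c0: "0 \<le> c1" "0 \<le> c2" by (auto simp: c1_def c2_def)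
  have "0 < Gamma \<alpha>" using \<alpha> by (intro Gamma_real_pos) simp
  then have c3: "0 \<le> c3" using \<alpha> unfolding c3_def by simp
  have \<alpha>0: "0 < \<alpha>" using \<alpha> by simp
  have p1: "pw T 1 \<in> L1s T" by (rule pw_L1s) simp
  have ff: "f \<in> fields T U" and fH: "Hgt_sq (1 - \<alpha>) T (L2_sq U) f < \<infinity>" using f by (auto simp: Hgt_def)
  have "L2t_sq T (L2_sq U) f \<le> Hgt_sq (1 - \<alpha>) T (L2_sq U) f" unfolding Hgt_sq_def by simp
  from F2_ext[OF ff le_less_trans[OF this fH]] have fF: "ext T f \<in> F2" .
  have uW: "u \<in> W_space \<alpha> T U \<phi> lam" using w by (simp add: weak_solution_def)
  note uF = W_space_F2(2)[OF uW]
  show uf: "u \<in> fields T U" by (rule W_space_F2(1)[OF uW])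
  let ?u = "\<lambda>i. cf (ext T u) i"
  have uL: "?u i \<in> L2s T" for i by (rule coeff_L2s[OF uF \<phi>_sqi])
  define S where "S i = (\<integral>\<^sup>+t. ennreal ((cf (ext T f) i t)\<^sup>2) \<partial>lborel) + slob T (1 - \<alpha>) (cf (ext T f) i)" for i
  have S: "(\<Sum>i. S i) = Hgt_sq (1 - \<alpha>) T (L2_sq U) f"
    unfolding Hgt_sq_coeff[OF fF diag_L2 zero_le_one] S_def by simp
  have Sfin: "slob T (1 - \<alpha>) (cf (ext T f) i) < \<infinity>" for i
  proof -
    have "slob T (1 - \<alpha>) (cf (ext T f) i) \<le> S i" by (simp add: S_def)
    also have "\<dots> \<le> (\<Sum>i. S i)" using sum_le_suminf[of S "{i}"] by simp
    finally show ?thesis using fH unfolding S by (rule le_less_trans)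
  qed
  define Q where "Q i e z \<longleftrightarrow> z \<in> L2s T \<and> (AE t in lborel. ?u i t = cv T (pw T 1) z t) \<and>
    (\<integral>t. (z t)\<^sup>2 \<partial>lborel) \<le> e \<and> lam i * (\<integral>t. z t * cv T (pw T \<alpha>) z t \<partial>lborel) \<le> e \<and>
    (lam i)\<^sup>2 * (\<integral>t. (?u i t)\<^sup>2 \<partial>lborel) \<le> c2 * e \<and>
    ennreal e \<le> ennreal (frac_const T (1 - \<alpha>)) * S i" for i e z
  have "\<exists>e z. Q i e z" for i
    unfolding Q_def c2_def S_def by (rule mode_estimate[OF w \<alpha> fF Sfin, of i]) blast
  then obtain e z where Q: "\<And>i. Q i (e i) (z i)" by metis
  have z: "\<And>i. z i \<in> L2s T" "\<And>i. AE t in lborel. ?u i t = cv T (pw T 1) (z i) t"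
    and ze: "\<And>i. (\<integral>t. (z i t)\<^sup>2 \<partial>lborel) \<le> e i" "\<And>i. lam i * (\<integral>t. z i t * cv T (pw T \<alpha>) (z i) t \<partial>lborel) \<le> e i"
    "\<And>i. (lam i)\<^sup>2 * (\<integral>t. (?u i t)\<^sup>2 \<partial>lborel) \<le> c2 * e i"
    "\<And>i. ennreal (e i) \<le> ennreal (frac_const T (1 - \<alpha>)) * S i"
    using Q unfolding Q_def by auto
  have e0: "0 \<le> e i" for i using ze(1)[of i] by (rule order_trans[rotated]) (simp add: integral_nonneg_AE)
  have sum_le: "(\<Sum>i. A i) \<le> ennreal C * Y" if "\<And>i. A i \<le> ennreal (C * e i)" "0 \<le> C" for A C
  proof -
    have "(\<Sum>i. A i) \<le> (\<Sum>i. (ennreal C * ennreal (frac_const T (1 - \<alpha>))) * S i)"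
    proof (rule suminf_le)
      fix i
      have "A i \<le> ennreal C * ennreal (e i)" using that(1)[of i] unfolding ennreal_mult[OF that(2) e0] .
      also have "\<dots> \<le> ennreal C * (ennreal (frac_const T (1 - \<alpha>)) * S i)" by (rule mult_left_mono[OF ze(4)]) simp
      finally show "A i \<le> (ennreal C * ennreal (frac_const T (1 - \<alpha>))) * S i" by (simp add: mult.assoc)
    qed (rule summableI)+
    also have "\<dots> = ennreal C * Y" unfolding ennreal_suminf_cmult S Y_def by (simp add: mult.assoc)
    finally show ?thesis .
  qed
  have u_nn: "(\<integral>\<^sup>+t. ennreal ((?u i t)\<^sup>2) \<partial>lborel) = ennreal (\<integral>t. (?u i t)\<^sup>2 \<partial>lborel)" for i
    by (rule sqi_nn_integral[OF L2s_sqi[OF uL]])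
  have u_le: "(\<integral>t. (?u i t)\<^sup>2 \<partial>lborel) \<le> c1 * e i" for i
  proof -
    have "(\<integral>t. (?u i t)\<^sup>2 \<partial>lborel) = (\<integral>t. (cv T (pw T 1) (z i) t)\<^sup>2 \<partial>lborel)"
    proof (rule integral_cong_AE)
      show "(\<lambda>t. (?u i t)\<^sup>2) \<in> borel_measurable lborel" "(\<lambda>t. (cv T (pw T 1) (z i) t)\<^sup>2) \<in> borel_measurable lborel"
        using L1s_measurable[OF L2s_L1s[OF uL[of i]]] L1s_measurable[OF cv_L1s[OF p1 L2s_L1s[OF z(1)[of i]]]] by auto
      show "AE t in lborel. (?u i t)\<^sup>2 = (cv T (pw T 1) (z i) t)\<^sup>2" using z(2)[of i] by eventually_elim simp
    qed
    also have "\<dots> \<le> c1 * (\<integral>t. (z i t)\<^sup>2 \<partial>lborel)" unfolding c1_def by (rule cv_L2_le[OF p1 z(1)])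
    also have "\<dots> \<le> c1 * e i" by (rule mult_left_mono[OF ze(1) c0(1)])
    finally show ?thesis .
  qed
  have l: "0 \<le> lam i" "0 \<le> (lam i)\<^sup>2" for i using lam_pos[of i] by auto
  have ul_le: "lam i * (\<integral>t. (?u i t)\<^sup>2 \<partial>lborel) \<le> (c1 + c2) * e i" for i
  proof -
    let ?J = "\<integral>t. (?u i t)\<^sup>2 \<partial>lborel"
    have J: "0 \<le> ?J" by simp
    \<comment> \<open>From (\<lambda> - 1)^2 \<ge> 0 one gets 2 \<lambda> \<le> 1 + \<lambda>^2, and
      \<lambda> \<ge> 0.\<close>
    have "lam i \<le> 1 + (lam i)\<^sup>2" using sum_power2_ge_zero[of "lam i - 1" 0] l[of i] by (simp add: power2_eq_square algebra_simps)
    then have "lam i * ?J \<le> (1 + (lam i)\<^sup>2) * ?J" by (rule mult_right_mono[OF _ J])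
    then show ?thesis using u_le[of i] ze(3)[of i] by (simp add: distrib_right)
  qed
  show "L2t_sq T (L2_sq U) u \<le> ennreal c1 * Y"
    unfolding L2t_sq_coeff[OF uF diag_L2 zero_le_one] u_nn
    by (rule sum_le[OF _ c0(1)]) (simp add: u_le ennreal_leI)
  show "L2t_sq T (hdot_sq U \<phi> lam 2) u \<le> ennreal c2 * Y"
    unfolding L2t_sq_coeff[OF uF diag_hdot2 l(2)] u_nn
    by (rule sum_le[OF _ c0(2)]) (simp add: ze(3) ennreal_leI l flip: ennreal_mult')
  show "Hgt_sq (1 - \<alpha>/2) T (hdot_sq U \<phi> lam 1) u \<le> ennreal (c1 + c2 + c3) * Y"
    unfolding Hgt_sq_coeff[OF uF diag_hdot1 l(1)] u_nn
  proof (rule sum_le)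
    fix i
    let ?E = "\<integral>t. z i t * cv T (pw T \<alpha>) (z i) t \<partial>lborel"
    have "slob T (1 - \<alpha>/2) (?u i) = slob T (1 - \<alpha>/2) (cv T (pw T 1) (z i))"
      by (rule slob_cong_AE) (use z(2)[of i] in \<open>auto elim!: eventually_mono\<close>)
    also have "\<dots> \<le> ennreal (c3 * ?E)"
    proof -
      have "- 1 - 2 * (1 - \<alpha>/2) = \<alpha> - 3" by (simp add: field_simps)
      then show ?thesis using slobodeckij_le_energy[OF z(1) \<alpha>0 \<alpha>(2), of i] by (simp only: slob_def c3_def)
    qed
    finally have "ennreal (lam i) * (ennreal (\<integral>t. (?u i t)\<^sup>2 \<partial>lborel) + slob T (1 - \<alpha>/2) (?u i))
      \<le> ennreal (lam i) * (ennreal (\<integral>t. (?u i t)\<^sup>2 \<partial>lborel) + ennreal (c3 * ?E))"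
      by (intro mult_left_mono add_left_mono) simp_all
    also have "\<dots> = ennreal (lam i * (\<integral>t. (?u i t)\<^sup>2 \<partial>lborel) + c3 * (lam i * ?E))"
    proof -
      have J: "0 \<le> (\<integral>t. (?u i t)\<^sup>2 \<partial>lborel)" and E: "0 \<le> c3 * ?E"
        using c3 cv_pw_nonneg[OF z(1) \<alpha>0 \<alpha>(2), of i] by simp_all
      show ?thesis
        unfolding ennreal_plus[OF J E, symmetric] ennreal_mult[OF l(1) add_nonneg_nonneg[OF J E], symmetric]
        by (simp add: distrib_left mult.left_commute)
    qed
    also have "\<dots> \<le> ennreal ((c1 + c2 + c3) * e i)"
      using ul_le[of i] mult_left_mono[OF ze(2)[of i] c3] by (intro ennreal_leI) (simp add: distrib_right)
    finally show "ennreal (lam i) * (ennreal (\<integral>t. (?u i t)\<^sup>2 \<partial>lborel) + slob T (1 - \<alpha>/2) (?u i)) \<le> ennreal ((c1 + c2 + c3) * e i)" .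
  qed (use c0 c3 in simp)
  have "(\<Sum>i. ennreal (\<integral>t. (z i t)\<^sup>2 \<partial>lborel)) \<le> ennreal 1 * Y"
    by (rule sum_le) (simp_all add: ze(1) ennreal_leI)
  then have zs: "(\<Sum>i. ennreal (\<integral>t. (z i t)\<^sup>2 \<partial>lborel)) \<le> Y" unfolding ennreal_1 mult_1 .
  also have "\<dots> < \<infinity>" using fH by (simp add: Y_def ennreal_mult_less_top)
  finally have "summable (\<lambda>i. \<integral>t. (z i t)\<^sup>2 \<partial>lborel)"
    by (intro summable_suminf_not_top) (simp_all add: less_top)
  then obtain g where g: "g \<in> F2" "\<And>i. AE t in lborel. cf g i t = z i t"
    by (rule synthesis[OF z(1)]) blast+
  have "AE q in MT. case_prod (ext T u) q = case_prod (cvf (pw T 1) g) q"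
  proof (rule F2_eq_by_coeff[OF uF cvf_F2[OF p1 g(1)]])
    fix i
    have c: "cv T (pw T 1) (cf g i) = cv T (pw T 1) (z i)"
      by (rule cv_cong_AE[OF cf_measurable[OF g(1)] L1s_measurable[OF L2s_L1s[OF z(1)]] pw_measurable g(2)])
    show "AE t in lborel. ?u i t = cf (cvf (pw T 1) g) i t"
      using coeff_cvf[OF p1 g(1) \<phi>_sqi[of i]] z(2)[of i] by eventually_elim (simp add: c)
  qed
  from has_time_deriv_primitive[OF uf g(1) this] have d: "has_time_deriv T U u g" .
  then show "\<exists>g. has_time_deriv T U u g" by blast
  note td = time_deriv_AE[OF g(1) d]
  from td(1) show tdL: "time_deriv T U u \<in> L2t T U (L2_sq U)" by (simp add: has_time_deriv_def)
  then have tdf: "time_deriv T U u \<in> fields T U" by (simp add: L2t_def)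
  have "L2t_sq T (L2_sq U) (time_deriv T U u) = (\<integral>\<^sup>+q. ennreal ((case_prod g q)\<^sup>2) \<partial>MT)"
    unfolding L2t_sq_nn[OF tdf] using td(3) by (intro nn_integral_cong_AE) (auto elim!: eventually_mono)
  also have "\<dots> = ennreal (\<integral>q. (case_prod g q)\<^sup>2 \<partial>MT)" by (rule sqi_nn_integral[OF F2_sqi[OF g(1)]])
  also have "\<dots> = (\<Sum>i. ennreal (\<integral>t. (cf g i t)\<^sup>2 \<partial>lborel))" by (rule parseval_time[OF g(1), symmetric])
  also have "\<dots> = (\<Sum>i. ennreal (\<integral>t. (z i t)\<^sup>2 \<partial>lborel))"
  proof (rule suminf_cong)
    fix i
    have "(\<integral>t. (cf g i t)\<^sup>2 \<partial>lborel) = (\<integral>t. (z i t)\<^sup>2 \<partial>lborel)"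
    proof (rule integral_cong_AE)
      show "(\<lambda>t. (cf g i t)\<^sup>2) \<in> borel_measurable lborel" "(\<lambda>t. (z i t)\<^sup>2) \<in> borel_measurable lborel"
        using cf_measurable[OF g(1), of i] L1s_measurable[OF L2s_L1s[OF z(1)[of i]]] by auto
      show "AE t in lborel. (cf g i t)\<^sup>2 = (z i t)\<^sup>2" using g(2)[of i] by eventually_elim simp
    qed
    then show "ennreal (\<integral>t. (cf g i t)\<^sup>2 \<partial>lborel) = ennreal (\<integral>t. (z i t)\<^sup>2 \<partial>lborel)" by simp
  qed
  also note zs
  finally show "L2t_sq T (L2_sq U) (time_deriv T U u) \<le> Y" .
qed

end

theorem theorem3p3:
  fixes \<Omega> :: "'a::euclidean_space set" and T \<alpha> :: real
  assumes "DIM('a) \<in> {1, 2, 3}"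
    and "convex_polytopal_domain \<Omega>"
    and "0 < T"
    and "1/2 < \<alpha>" and "\<alpha> < 1"
  shows "\<exists>C>0. \<forall>\<phi> lam f u.
    dirichlet_eigenbasis \<Omega> \<phi> lam \<longrightarrow>
    f \<in> Hgt (1 - \<alpha>) T \<Omega> (L2_sq \<Omega>) \<longrightarrow>
    weak_solution \<alpha> T \<Omega> \<phi> lam f u \<longrightarrow>
      u \<in> H1t T \<Omega> (L2_sq \<Omega>) \<and>
      u \<in> Hgt (1 - \<alpha>/2) T \<Omega> (hdot_sq \<Omega> \<phi> lam 1) \<and>
      u \<in> L2t T \<Omega> (hdot_sq \<Omega> \<phi> lam 2) \<and>
      H1t_norm T \<Omega> (L2_sq \<Omega>) u
        + Hgt_norm (1 - \<alpha>/2) T (hdot_sq \<Omega> \<phi> lam 1) u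
        + L2t_norm T (hdot_sq \<Omega> \<phi> lam 2) u
      \<le> C * Hgt_norm (1 - \<alpha>) T (L2_sq \<Omega>) f"
proof -
  define c1 where "c1 = (\<integral>t. \<bar>pw T 1 t\<bar> \<partial>lborel)\<^sup>2"
  define c2 where "c2 = 4 * (\<integral>t. \<bar>pw T (1 - \<alpha>) t\<bar> \<partial>lborel)\<^sup>2"
  define c3 where "c3 = 4 * Gamma \<alpha> / ((1 - \<alpha>) * (2 - \<alpha>))"
  define c where "c = frac_const T (1 - \<alpha>)"
  have "0 < Gamma \<alpha>" using assms(4) by (intro Gamma_real_pos) simp
  then have p: "0 \<le> c1" "0 \<le> c2" "0 \<le> c3" using assms(5) by (auto simp: c1_def c2_def c3_def)
  have c: "0 \<le> c" unfolding c_def using assms(4,5) by (intro frac_const_nonneg) auto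
  \<comment> \<open>One square root for each norm on the left, whose square is bounded by that
    multiple of the squared norm of the data; the summand 1 gives C > 0. The constant is fixed
    before the eigenbasis, the data and the solution.\<close>
  define C where "C = 1 + sqrt ((c1 + 1) * c) + sqrt ((c1 + c2 + c3) * c) + sqrt (c2 * c)"
  have "open \<Omega>" using assms(2) by (auto simp: convex_polytopal_domain_def)
  show ?thesis
  proof (intro exI[of _ C] conjI allI impI)
    show "0 < C" unfolding C_def using p c by (simp add: add_pos_nonneg)
  next
    fix \<phi> lam f u
    assume eig: "dirichlet_eigenbasis \<Omega> \<phi> lam" and f: "f \<in> Hgt (1 - \<alpha>) T \<Omega> (L2_sq \<Omega>)" and w: "weak_solution \<alpha> T \<Omega> \<phi> lam f u"
    interpret diffusion \<Omega> \<phi> lam T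
      using \<open>open \<Omega>\<close> eig assms(3) by unfold_locales (auto simp: dirichlet_eigenbasis_def)
    let ?F = "Hgt_sq (1 - \<alpha>) T (L2_sq \<Omega>) f"
    note r = regularity_estimate[OF assms(4,5) f w, folded c1_def c2_def c3_def c_def]
    have F: "?F < \<infinity>" using f by (simp add: Hgt_def)
    have m: "ennreal a * (ennreal c * ?F) = ennreal (a * c) * ?F" if "0 \<le> a" for a
      using that c by (simp add: ennreal_mult mult.assoc)
    have fin: "ennreal a * ?F < \<infinity>" for a using F by (simp add: ennreal_mult_less_top)
    have 2: "L2t_sq T (hdot_sq \<Omega> \<phi> lam 2) u \<le> ennreal (c2 * c) * ?F" using r(6) m[OF p(2)] by simp
    have 3: "Hgt_sq (1 - \<alpha>/2) T (hdot_sq \<Omega> \<phi> lam 1) u \<le> ennreal ((c1 + c2 + c3) * c) * ?F"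
      using r(7) m[of "c1 + c2 + c3"] p by simp
    have "L2t_sq T (L2_sq \<Omega>) u + L2t_sq T (L2_sq \<Omega>) (time_deriv T \<Omega> u) \<le> ennreal c1 * (ennreal c * ?F) + ennreal 1 * (ennreal c * ?F)"
      using r(4,5) by (intro add_mono) simp_all
    also have "\<dots> = ennreal (c1 + 1) * (ennreal c * ?F)" using p(1) by (simp add: ennreal_plus distrib_right)
    also have "\<dots> = ennreal ((c1 + 1) * c) * ?F" using p(1) by (intro m) simp
    finally have 1: "L2t_sq T (L2_sq \<Omega>) u + L2t_sq T (L2_sq \<Omega>) (time_deriv T \<Omega> u) \<le> ennreal ((c1 + 1) * c) * ?F" .
    have "L2t_sq T (L2_sq \<Omega>) u < \<infinity>" by (rule le_less_trans[OF r(4)[unfolded m[OF p(1)]] fin])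
    then show "u \<in> H1t T \<Omega> (L2_sq \<Omega>)" using r(1,2,3) by (simp add: H1t_def L2t_def)
    show "u \<in> Hgt (1 - \<alpha>/2) T \<Omega> (hdot_sq \<Omega> \<phi> lam 1)" using r(1) le_less_trans[OF 3 fin] by (simp add: Hgt_def)
    show "u \<in> L2t T \<Omega> (hdot_sq \<Omega> \<phi> lam 2)" using r(1) le_less_trans[OF 2 fin] by (simp add: L2t_def)
    have n: "0 \<le> Hgt_norm (1 - \<alpha>) T (L2_sq \<Omega>) f" by (simp add: Hgt_norm_def)
    have "H1t_norm T \<Omega> (L2_sq \<Omega>) u \<le> sqrt ((c1 + 1) * c) * Hgt_norm (1 - \<alpha>) T (L2_sq \<Omega>) f"
      unfolding H1t_norm_def Hgt_norm_def using p c by (intro sqrt_enn2real_le[OF 1 F]) simp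
    moreover have "Hgt_norm (1 - \<alpha>/2) T (hdot_sq \<Omega> \<phi> lam 1) u \<le> sqrt ((c1 + c2 + c3) * c) * Hgt_norm (1 - \<alpha>) T (L2_sq \<Omega>) f"
      unfolding Hgt_norm_def using p c by (intro sqrt_enn2real_le[OF 3 F]) simp
    moreover have "L2t_norm T (hdot_sq \<Omega> \<phi> lam 2) u \<le> sqrt (c2 * c) * Hgt_norm (1 - \<alpha>) T (L2_sq \<Omega>) f"
      unfolding L2t_norm_def Hgt_norm_def using p c by (intro sqrt_enn2real_le[OF 2 F]) simp
    ultimately show "H1t_norm T \<Omega> (L2_sq \<Omega>) u + Hgt_norm (1 - \<alpha>/2) T (hdot_sq \<Omega> \<phi> lam 1) u + L2t_norm T (hdot_sq \<Omega> \<phi> lam 2) u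
      \<le> C * Hgt_norm (1 - \<alpha>) T (L2_sq \<Omega>) f"
      using n by (simp add: C_def distrib_right)
  qed
qed

end
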